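(* Let $A$ be a stably finite C*-algebra and let $\alpha$ be an action of a finite group $G$ on $A$ with the Rokhlin property. Let $i\colon A^\alpha\to A$ be the inclusion map of the fixed point algebra. (i) The map $\mathrm V(i)\colon\mathrm V(A^\alpha)\to\mathrm V(A)$ is an order embedding and $$\mathrm{Im}(\mathrm V(i))=\mathrm{Im}\Big(\sum_{g\in G}\mathrm V(\alpha_g)\Big)=\{x\in\mathrm V(A)\colon\mathrm V(\alpha_g)(x)=x\ \ \forall g\in G\}.$$ (ii) If $A$ has an approximate identity consisting of projections, then $\mathrm K_0(i)\colon\mathrm K_0(A^\alpha)\to\mathrm K_0(A)$ is an order embedding and $$\mathrm{Im}(\mathrm K_0(i))=\mathrm{Im}\Big(\sum_{g\in G}\mathrm K_0(\alpha_g)\Big)=\{x\in\mathrm K_0(A)\colon\mathrm K_0(\alpha_g)(x)=x\ \ \forall g\in G\}.$$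
   Context: Rokhlin property: an action $\alpha\colon G\to\mathrm{Aut}(A)$ of a finite group $G$ on a (not necessarily unital) C*-algebra $A$ has the Rokhlin property if for every $\varepsilon>0$ and every finite $F\subseteq A$ there exist mutually orthogonal positive contractions $r_g\in A$, $g\in G$, with $\|\alpha_g(r_h)-r_{gh}\|<\varepsilon$ for all $g,h\in G$; $\|r_ga-ar_g\|<\varepsilon$ for all $a\in F$, $g\in G$; and $\|(\sum_{g\in G}r_g)a-a\|<\varepsilon$ for all $a\in F$. A unital C*-algebra is finite if its unit is a finite projection (not Murray–von Neumann equivalent to a proper subprojection) and stably finite if $\mathrm M_n(A)$ is finite for all $n$; a non-unital $A$ is stably finite if its unitization is. $\mathrm V(A)$ is the semigroup of Murray–von Neumann equivalence classes of projections in $A\otimes\mathcal K$ ($\mathcal K$ the compact operators on a separable Hilbert space), ordered by Murray–von Neumann subequivalence ($[p]\le[q]$ iff $p$ is equivalent to a subprojection of $q$). $\mathrm K_0(A)$ carries the order determined by the image of $\mathrm V(A)$. A homomorphism $\varphi$ is an order embedding if $\varphi(s)\le\varphi(s')$ implies $s\le s'$. *)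

theory Defs
  imports "HOL-Analysis.Analysis" "HOL-Algebra.FiniteProduct"
begin

section \<open>C*-algebras\<close>

text \<open>A C*-algebra is a type of the following class; it need not be unital.  The complex scalar
  multiplication \<open>cscale\<close> extends the library's real one.  C*-subalgebras, such as fixed point
  algebras, are subsets of such a type.\<close>

class cstar_algebra = banach + real_normed_algebra +
  fixes cscale :: "complex \<Rightarrow> 'a \<Rightarrow> 'a"
    and star :: "'a \<Rightarrow> 'a"
  assumes cscale_add_right: "cscale c (x + y) = cscale c x + cscale c y"
    and cscale_add_left: "cscale (c + d) x = cscale c x + cscale d x"
    and cscale_cscale: "cscale c (cscale d x) = cscale (c * d) x"
    and cscale_of_real: "cscale (complex_of_real r) x = r *\<^sub>R x"
    and cscale_mult_left: "cscale c x * y = cscale c (x * y)"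
    and cscale_mult_right: "x * cscale c y = cscale c (x * y)"
    and norm_cscale: "norm (cscale c x) = cmod c * norm x"
    and star_add: "star (x + y) = star x + star y"
    and star_cscale: "star (cscale c x) = cscale (cnj c) (star x)"
    and star_mult: "star (x * y) = star y * star x"
    and star_star: "star (star x) = x"
    and cstar_identity: "norm (star x * x) = (norm x)\<^sup>2"

instantiation complex :: cstar_algebra
begin
definition cscale_complex :: "complex \<Rightarrow> complex \<Rightarrow> complex" where "cscale_complex = (*)"
definition star_complex :: "complex \<Rightarrow> complex" where "star_complex = cnj"
instance
  by standard
    (auto simp: cscale_complex_def star_complex_def algebra_simps norm_mult power2_eq_square
      scaleR_conv_of_real)
end

definition star_homomorphism :: "('a::cstar_algebra \<Rightarrow> 'b::cstar_algebra) \<Rightarrow> bool" where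
  "star_homomorphism f \<longleftrightarrow>
     (\<forall>x y. f (x + y) = f x + f y) \<and> (\<forall>c x. f (cscale c x) = cscale c (f x)) \<and>
     (\<forall>x y. f (x * y) = f x * f y) \<and> (\<forall>x. f (star x) = star (f x))"

definition cstar_Aut :: "('a::cstar_algebra \<Rightarrow> 'a) monoid" where
  "cstar_Aut = \<lparr>carrier = {f. star_homomorphism f \<and> bij f}, mult = (\<circ>), one = id\<rparr>"

definition positive :: "'a::cstar_algebra \<Rightarrow> bool" where
  "positive a \<longleftrightarrow> (\<exists>b. a = star b * b)"

definition projection :: "'a::cstar_algebra \<Rightarrow> bool" where
  "projection p \<longleftrightarrow> star p = p \<and> p * p = p"

definition fixed_point_algebra ::
    "('g, 'm) monoid_scheme \<Rightarrow> ('g \<Rightarrow> 'a::cstar_algebra \<Rightarrow> 'a) \<Rightarrow> 'a set" where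
  "fixed_point_algebra G \<alpha> = {a. \<forall>g\<in>carrier G. \<alpha> g a = a}"

definition rokhlin_property ::
    "('g, 'm) monoid_scheme \<Rightarrow> ('g \<Rightarrow> 'a::cstar_algebra \<Rightarrow> 'a) \<Rightarrow> bool" where
  "rokhlin_property G \<alpha> \<longleftrightarrow>
     (\<forall>\<epsilon>>0. \<forall>F. finite F \<longrightarrow>
       (\<exists>r. (\<forall>g\<in>carrier G. positive (r g) \<and> norm (r g) \<le> 1) \<and>
            (\<forall>g\<in>carrier G. \<forall>h\<in>carrier G. g \<noteq> h \<longrightarrow> r g * r h = 0) \<and>
            (\<forall>g\<in>carrier G. \<forall>h\<in>carrier G. norm (\<alpha> g (r h) - r (g \<otimes>\<^bsub>G\<^esub> h)) < \<epsilon>) \<and>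
            (\<forall>a\<in>F. \<forall>g\<in>carrier G. norm (r g * a - a * r g) < \<epsilon>) \<and>
            (\<forall>a\<in>F. norm ((\<Sum>g\<in>carrier G. r g) * a - a) < \<epsilon>)))"

text \<open>Nets are represented by filters: a net of projections induces the filter of its tails on the
  algebra, and every proper filter arises from a net.  The net is not required to be increasing.\<close>

definition has_approximate_identity_of_projections :: "'a::cstar_algebra itself \<Rightarrow> bool" where
  "has_approximate_identity_of_projections _ \<longleftrightarrow>
     (\<exists>\<E> :: 'a filter. \<E> \<noteq> bot \<and> eventually projection \<E> \<and>
        (\<forall>a. ((\<lambda>e. e * a) \<longlongrightarrow> a) \<E> \<and> ((\<lambda>e. a * e) \<longlongrightarrow> a) \<E>))"


section \<open>The unitization\<close>

lemma cscale_zero_left [simp]: "cscale 0 x = (0::'a::cstar_algebra)"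
  using cscale_of_real[of 0 x] by simp

lemma cscale_zero_right [simp]: "cscale c 0 = (0::'a::cstar_algebra)"
  using cscale_add_right[of c 0 "0::'a"] by simp

lemma cscale_one [simp]: "cscale 1 x = (x::'a::cstar_algebra)"
  using cscale_of_real[of 1 x] by simp

lemma cscale_minus_left: "cscale (- c) x = - cscale c (x::'a::cstar_algebra)"
  using cscale_add_left[of c "-c" x] by (simp add: eq_neg_iff_add_eq_0 add.commute)

lemma cscale_minus_right: "cscale c (- x) = - cscale c (x::'a::cstar_algebra)"
  using cscale_add_right[of c x "-x"] by (simp add: eq_neg_iff_add_eq_0 add.commute)

lemma cscale_scaleR_left: "cscale (r *\<^sub>R c) x = r *\<^sub>R cscale c (x::'a::cstar_algebra)"
  by (metis cscale_cscale cscale_of_real scaleR_conv_of_real)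

lemma cscale_scaleR_right: "cscale c (r *\<^sub>R x) = r *\<^sub>R cscale c (x::'a::cstar_algebra)"
  by (metis cscale_cscale cscale_of_real mult.commute)

lemma norm_star [simp]: "norm (star x) = norm (x::'a::cstar_algebra)"
proof -
  have le: "norm y \<le> norm (star y)" for y :: 'a
  proof (cases "norm y = 0")
    case False
    have "norm y * norm y \<le> norm (star y) * norm y"
      using norm_mult_ineq[of "star y" y] cstar_identity[of y] by (simp add: power2_eq_square)
    with False show ?thesis by simp
  qed simp
  show ?thesis using le[of x] le[of "star x"] by (simp add: star_star)
qed

text \<open>The unitization of \<open>A\<close> is \<open>A \<oplus> \<complex>\<close>; a unit is adjoined even if \<open>A\<close> already has one.
  The element \<open>Adjoin a c\<close> stands for \<open>a + c1\<close>.\<close>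

datatype 'a unitization = Adjoin (alg_part: 'a) (scalar_part: complex)

definition lmul :: "'a::cstar_algebra unitization \<Rightarrow> 'a \<Rightarrow> 'a" where
  "lmul x b = alg_part x * b + cscale (scalar_part x) b"

lemma bounded_linear_cscale: "bounded_linear (cscale c :: 'a::cstar_algebra \<Rightarrow> 'a)"
  by (rule bounded_linear_intro[where K = "cmod c"])
    (auto simp: cscale_add_right cscale_scaleR_right norm_cscale mult.commute)

lemma bounded_linear_lmul: "bounded_linear (lmul x)"
  unfolding lmul_def by (intro bounded_linear_add bounded_linear_mult_right bounded_linear_cscale)

text \<open>The C*-norm is the operator norm of the left multiplication on \<open>A\<close>.  For unital \<open>A\<close> that
  is only a seminorm on \<open>A \<oplus> \<complex>\<close>, and the maximum with the modulus of the scalar part, i.e. of the image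
  in \<open>A \<oplus> \<complex> / A\<close>, is needed; for non-unital \<open>A\<close> the maximum changes nothing.\<close>

instantiation unitization :: (cstar_algebra) real_normed_algebra
begin

definition "0 = Adjoin (0::'a) 0"
definition "x + y = Adjoin (alg_part x + alg_part y :: 'a) (scalar_part x + scalar_part y)"
definition "x - y = Adjoin (alg_part x - alg_part y :: 'a) (scalar_part x - scalar_part y)"
definition "- x = Adjoin (- alg_part x :: 'a) (- scalar_part x)"
definition "r *\<^sub>R x = Adjoin (r *\<^sub>R alg_part x :: 'a) (r *\<^sub>R scalar_part x)"
definition "x * y =
  Adjoin (alg_part x * alg_part y + cscale (scalar_part x) (alg_part y) +
          cscale (scalar_part y) (alg_part x) :: 'a)
         (scalar_part x * scalar_part y)"
definition "norm (x :: 'a unitization) = max (cmod (scalar_part x)) (onorm (lmul x))"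
definition "sgn (x :: 'a unitization) = inverse (norm x) *\<^sub>R x"
definition "dist (x :: 'a unitization) y = norm (x - y)"
definition "(uniformity :: ('a unitization \<times> 'a unitization) filter) =
  (INF e\<in>{0<..}. principal {(x, y). dist x y < e})"
definition "open (U :: 'a unitization set) \<longleftrightarrow>
  (\<forall>x\<in>U. eventually (\<lambda>(x', y). x' = x \<longrightarrow> y \<in> U) uniformity)"

lemmas unitization_defs = zero_unitization_def plus_unitization_def minus_unitization_def
  uminus_unitization_def scaleR_unitization_def times_unitization_def

lemma norm_le_lmul: "norm (lmul x b) \<le> onorm (lmul x) * norm b"
  by (rule onorm[OF bounded_linear_lmul])

lemma lmul_nonneg: "0 \<le> onorm (lmul x)"
  by (rule onorm_pos_le[OF bounded_linear_lmul])

lemma lmul_add: "lmul (x + y) = (\<lambda>b. lmul x b + lmul y b)"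
  by (auto simp: lmul_def plus_unitization_def algebra_simps cscale_add_left)

lemma lmul_scaleR: "lmul (r *\<^sub>R x) = (\<lambda>b. r *\<^sub>R lmul x b)"
  by (auto simp: lmul_def scaleR_unitization_def algebra_simps cscale_scaleR_left)

lemma lmul_mult: "lmul (x * y) = lmul x \<circ> lmul y"
  by (auto simp: lmul_def times_unitization_def algebra_simps cscale_add_left cscale_add_right
      cscale_cscale cscale_mult_left cscale_mult_right)

lemma norm_alg_part_le: "norm (alg_part x) \<le> onorm (lmul x) + cmod (scalar_part x)"
proof (cases "alg_part x = 0")
  case True
  then show ?thesis using lmul_nonneg[of x] by simp
next
  case False
  let ?a = "alg_part x" and ?c = "scalar_part x"
  have "norm ?a * norm ?a = norm (?a * star ?a)"
    using cstar_identity[of "star ?a"] by (simp add: star_star power2_eq_square)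
  also have "\<dots> = norm (lmul x (star ?a) - cscale ?c (star ?a))"
    by (simp add: lmul_def)
  also have "\<dots> \<le> norm (lmul x (star ?a)) + norm (cscale ?c (star ?a))"
    by (rule norm_triangle_ineq4)
  also have "\<dots> \<le> (onorm (lmul x) + cmod ?c) * norm ?a"
    using norm_le_lmul[of x "star ?a"] by (simp add: norm_cscale algebra_simps)
  finally show ?thesis using False by simp
qed

lemma norm_unitization_upper: "norm (x :: 'a unitization) \<le> norm (alg_part x) + cmod (scalar_part x)"
proof -
  have "onorm (lmul x) \<le> norm (alg_part x) + cmod (scalar_part x)"
  proof (rule onorm_bound)
    fix b
    show "norm (lmul x b) \<le> (norm (alg_part x) + cmod (scalar_part x)) * norm b"
      using norm_triangle_ineq[of "alg_part x * b" "cscale (scalar_part x) b"]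
        norm_mult_ineq[of "alg_part x" b]
      by (simp add: lmul_def norm_cscale algebra_simps)
  qed simp
  then show ?thesis by (simp add: norm_unitization_def)
qed

lemma norm_unitization_lower:
  "norm (alg_part x) \<le> 2 * norm (x :: 'a unitization)" "cmod (scalar_part x) \<le> norm x"
  using norm_alg_part_le[of x] by (auto simp: norm_unitization_def)

lemma onorm_lmul_mult: "onorm (lmul (x * y)) \<le> onorm (lmul x) * onorm (lmul y)"
  unfolding lmul_mult by (rule onorm_compose[OF bounded_linear_lmul bounded_linear_lmul])

instance
proof
  fix x y z :: "'a unitization" and r s :: real
  show "x + y + z = x + (y + z)" "x + y = y + x" "0 + x = x" "- x + x = 0" "x - y = x + - y"
    by (simp_all add: unitization_defs)
  show "r *\<^sub>R (x + y) = r *\<^sub>R x + r *\<^sub>R y" "(r + s) *\<^sub>R x = r *\<^sub>R x + s *\<^sub>R x"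
    "r *\<^sub>R s *\<^sub>R x = (r * s) *\<^sub>R x" "1 *\<^sub>R x = x"
    by (simp_all add: unitization_defs algebra_simps)
  show "x * y * z = x * (y * z)" "(x + y) * z = x * z + y * z" "x * (y + z) = x * y + x * z"
    by (simp_all add: unitization_defs algebra_simps cscale_add_left cscale_add_right cscale_cscale
        cscale_mult_left cscale_mult_right)
  show "r *\<^sub>R x * y = r *\<^sub>R (x * y)" "x * r *\<^sub>R y = r *\<^sub>R (x * y)"
    by (simp_all add: unitization_defs algebra_simps cscale_scaleR_left cscale_scaleR_right)
  show "sgn x = inverse (norm x) *\<^sub>R x" "dist x y = norm (x - y)"
    by (simp_all add: sgn_unitization_def dist_unitization_def)
  show "uniformity = (INF e\<in>{0<..}. principal {(x, y). dist x (y :: 'a unitization) < e})"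
    by (fact uniformity_unitization_def)
  show "open U \<longleftrightarrow> (\<forall>x\<in>U. eventually (\<lambda>(x', y). x' = x \<longrightarrow> y \<in> U) uniformity)"
    for U :: "'a unitization set"
    by (fact open_unitization_def)
  show "norm x = 0 \<longleftrightarrow> x = 0"
  proof
    assume "norm x = 0"
    then show "x = 0"
      using norm_unitization_lower[of x] by (cases x) (simp add: zero_unitization_def)
  next
    assume "x = 0"
    then show "norm x = 0"
      using norm_unitization_upper[of x] norm_unitization_lower[of x]
      by (simp add: zero_unitization_def)
  qed
  show "norm (x + y) \<le> norm x + norm y"
  proof -
    have "onorm (lmul (x + y)) \<le> onorm (lmul x) + onorm (lmul y)"
      unfolding lmul_add by (rule onorm_triangle[OF bounded_linear_lmul bounded_linear_lmul])
    moreover have "cmod (scalar_part (x + y)) \<le> cmod (scalar_part x) + cmod (scalar_part y)"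
      by (simp add: plus_unitization_def norm_triangle_ineq)
    ultimately show ?thesis by (auto simp: norm_unitization_def max_def)
  qed
  show "norm (r *\<^sub>R x) = \<bar>r\<bar> * norm x"
    by (simp add: norm_unitization_def lmul_scaleR onorm_scaleR[OF bounded_linear_lmul]
        max_mult_distrib_left) (simp add: scaleR_unitization_def)
  show "norm (x * y) \<le> norm x * norm y"
  proof -
    have "cmod (scalar_part (x * y)) \<le> norm x * norm y"
      by (simp add: times_unitization_def norm_mult norm_unitization_def mult_mono lmul_nonneg le_max_iff_disj)
    moreover have "onorm (lmul (x * y)) \<le> norm x * norm y"
      by (rule order_trans[OF onorm_lmul_mult])
        (simp add: norm_unitization_def mult_mono lmul_nonneg le_max_iff_disj)
    ultimately show ?thesis by (simp add: norm_unitization_def[of "x * y"])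
  qed
qed

end

instantiation unitization :: (cstar_algebra) cstar_algebra
begin

definition "cscale c x = Adjoin (cscale c (alg_part x) :: 'a) (c * scalar_part x)"
definition "star x = Adjoin (star (alg_part x) :: 'a) (cnj (scalar_part x))"

lemma lmul_cscale: "lmul (cscale c x) b = cscale c (lmul x b)"
  by (auto simp: lmul_def cscale_unitization_def cscale_mult_left cscale_add_right cscale_cscale)

lemma star_lmul: "star (lmul x b) * d = star b * lmul (star x) d"
  by (auto simp: lmul_def star_unitization_def star_add star_mult star_cscale algebra_simps
      cscale_mult_left cscale_mult_right)

lemma onorm_lmul_star_le: "(onorm (lmul x))\<^sup>2 \<le> onorm (lmul (star x * x))"
proof -
  let ?s = "onorm (lmul (star x * x))"
  have "onorm (lmul x) \<le> sqrt ?s"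
  proof (rule onorm_bound)
    fix b
    have "(norm (lmul x b))\<^sup>2 = norm (star b * lmul (star x * x) b)"
      by (simp add: cstar_identity[symmetric] star_lmul lmul_mult)
    also have "\<dots> \<le> norm b * (?s * norm b)"
      by (intro order_trans[OF norm_mult_ineq])
        (simp add: mult_left_mono norm_le_lmul)
    also have "\<dots> = (sqrt ?s * norm b)\<^sup>2"
      using lmul_nonneg[of "star x * x"] by (simp add: power2_eq_square algebra_simps)
    finally show "norm (lmul x b) \<le> sqrt ?s * norm b"
      by (rule power2_le_imp_le) (simp add: lmul_nonneg)
  qed (simp add: lmul_nonneg)
  then show ?thesis
    using lmul_nonneg[of x] lmul_nonneg[of "star x * x"]
    by (metis power_mono real_sqrt_pow2)
qed

lemma star_star_unitization: "star (star x) = (x :: 'a unitization)"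
  by (simp add: star_unitization_def star_star)

lemma onorm_lmul_cstar: "onorm (lmul (star x * x)) = (onorm (lmul x))\<^sup>2"
proof -
  have le: "onorm (lmul y) \<le> onorm (lmul (star y))" for y :: "'a unitization"
  proof (cases "onorm (lmul y) = 0")
    case True
    then show ?thesis by (simp add: lmul_nonneg)
  next
    case False
    have "onorm (lmul y) * onorm (lmul y) \<le> onorm (lmul (star y)) * onorm (lmul y)"
      using onorm_lmul_star_le[of y] onorm_lmul_mult[of "star y" y] by (simp add: power2_eq_square)
    with False lmul_nonneg[of y] show ?thesis by simp
  qed
  have "onorm (lmul (star x)) = onorm (lmul x)"
    using le[of x] le[of "star x"] by (simp add: star_star_unitization)
  then show ?thesis
    using onorm_lmul_star_le[of x] onorm_lmul_mult[of "star x" x] by (simp add: power2_eq_square)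
qed

instance
proof
  fix X :: "nat \<Rightarrow> 'a unitization"
  assume C: "Cauchy X"
  have dist_eq: "dist u v = norm (u - v)" for u v :: "'a unitization"
    by (rule dist_unitization_def)
  have "Cauchy (\<lambda>n. alg_part (X n))"
  proof (rule metric_CauchyI)
    fix e :: real assume "0 < e"
    then obtain N where N: "\<And>m n. m \<ge> N \<Longrightarrow> n \<ge> N \<Longrightarrow> dist (X m) (X n) < e / 2"
      using C unfolding Cauchy_def by (meson half_gt_zero)
    have "dist (alg_part (X m)) (alg_part (X n)) < e" if "m \<ge> N" "n \<ge> N" for m n
      using N[OF that] norm_unitization_lower(1)[of "X m - X n"]
      by (simp add: dist_eq dist_norm minus_unitization_def)
    then show "\<exists>M. \<forall>m\<ge>M. \<forall>n\<ge>M. dist (alg_part (X m)) (alg_part (X n)) < e" by blast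
  qed
  then obtain a where a: "(\<lambda>n. alg_part (X n)) \<longlonglongrightarrow> a"
    using Cauchy_convergent_iff convergent_def by blast
  have "Cauchy (\<lambda>n. scalar_part (X n))"
  proof (rule metric_CauchyI)
    fix e :: real assume "0 < e"
    then obtain N where N: "\<And>m n. m \<ge> N \<Longrightarrow> n \<ge> N \<Longrightarrow> dist (X m) (X n) < e"
      using C unfolding Cauchy_def by meson
    have "dist (scalar_part (X m)) (scalar_part (X n)) < e" if "m \<ge> N" "n \<ge> N" for m n
      using N[OF that] norm_unitization_lower(2)[of "X m - X n"]
      by (simp add: dist_eq dist_norm minus_unitization_def)
    then show "\<exists>M. \<forall>m\<ge>M. \<forall>n\<ge>M. dist (scalar_part (X m)) (scalar_part (X n)) < e" by blast
  qed
  then obtain c where c: "(\<lambda>n. scalar_part (X n)) \<longlonglongrightarrow> c"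
    using Cauchy_convergent_iff convergent_def by blast
  have "(\<lambda>n. norm (alg_part (X n) - a) + cmod (scalar_part (X n) - c)) \<longlonglongrightarrow> 0 + 0"
    using a c by (intro tendsto_add) (simp_all add: LIM_zero_iff tendsto_norm_zero_iff)
  then have lim: "(\<lambda>n. norm (alg_part (X n) - a) + cmod (scalar_part (X n) - c)) \<longlonglongrightarrow> 0" by simp
  have "X \<longlonglongrightarrow> Adjoin a c"
  proof (rule metric_LIMSEQ_I)
    fix e :: real assume "0 < e"
    then obtain N where
      N: "\<And>n. n \<ge> N \<Longrightarrow> norm (alg_part (X n) - a) + cmod (scalar_part (X n) - c) < e"
      using LIMSEQ_D[OF lim] by fastforce
    have "dist (X n) (Adjoin a c) < e" if "n \<ge> N" for n
      using N[OF that] norm_unitization_upper[of "X n - Adjoin a c"]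
      by (simp add: dist_eq minus_unitization_def)
    then show "\<exists>N. \<forall>n\<ge>N. dist (X n) (Adjoin a c) < e" by blast
  qed
  then show "convergent X" by (auto simp: convergent_def)
next
  fix x y :: "'a unitization" and r :: real and c d :: complex
  show "cscale c (x + y) = cscale c x + cscale c y" "cscale (c + d) x = cscale c x + cscale d x"
    "cscale c (cscale d x) = cscale (c * d) x" "cscale (complex_of_real r) x = r *\<^sub>R x"
    by (simp_all add: unitization_defs cscale_unitization_def star_unitization_def algebra_simps cscale_add_left cscale_add_right cscale_cscale
        cscale_of_real scaleR_conv_of_real)
  show "cscale c x * y = cscale c (x * y)" "x * cscale c y = cscale c (x * y)"
    by (simp_all add: unitization_defs cscale_unitization_def star_unitization_def algebra_simps cscale_add_right cscale_cscale
        cscale_mult_left cscale_mult_right)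
  show "star (x + y) = star x + star y" "star (cscale c x) = cscale (cnj c) (star x)"
    "star (x * y) = star y * star x" "star (star x) = x"
    by (simp_all add: unitization_defs cscale_unitization_def star_unitization_def star_add star_cscale star_mult star_star algebra_simps)
  show "norm (cscale c x) = cmod c * norm x"
  proof -
    have "onorm (lmul (cscale c x)) = cmod c * onorm (lmul x)"
    proof (cases "c = 0")
      case True
      then have "lmul (cscale c x) = (\<lambda>_. 0)" by (simp add: fun_eq_iff lmul_cscale)
      with True show ?thesis by (simp add: onorm_zero)
    next
      case False
      have le: "onorm (lmul (cscale k w)) \<le> cmod k * onorm (lmul w)" for k and w :: "'a unitization"
      proof (rule onorm_bound)
        fix b
        show "norm (lmul (cscale k w) b) \<le> cmod k * onorm (lmul w) * norm b"
          using mult_left_mono[OF norm_le_lmul[of w b], of "cmod k"]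
          by (simp add: lmul_cscale norm_cscale mult.assoc)
      qed (simp add: lmul_nonneg)
      have "cscale (inverse c) (cscale c x) = x"
        using False by (cases x) (simp add: cscale_unitization_def cscale_cscale)
      then have "onorm (lmul x) \<le> inverse (cmod c) * onorm (lmul (cscale c x))"
        using le[of "inverse c" "cscale c x"] by (simp add: norm_inverse)
      then have "cmod c * onorm (lmul x) \<le> onorm (lmul (cscale c x))"
        using False by (simp add: field_simps)
      then show ?thesis using le[of c x] by simp
    qed
    then show ?thesis
      by (simp add: norm_unitization_def cscale_unitization_def norm_mult max_mult_distrib_left)
  qed
  show "norm (star x * x) = (norm x)\<^sup>2"
  proof -
    have "cmod (scalar_part (star x * x)) = (cmod (scalar_part x))\<^sup>2"
      by (simp add: unitization_defs star_unitization_def norm_mult power2_eq_square)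
    moreover have "max (u\<^sup>2) (v\<^sup>2) = (max u v)\<^sup>2" if "0 \<le> u" "0 \<le> v" for u v :: real
      using that by (auto simp: max_def power_mono dest: power2_le_imp_le)
    ultimately show ?thesis
      by (simp add: norm_unitization_def onorm_lmul_cstar lmul_nonneg)
  qed
qed

end

text \<open>The unitization of a C*-subalgebra \<open>S\<close>, as a subset of that of the ambient algebra.\<close>

definition unitize :: "'a::cstar_algebra set \<Rightarrow> 'a unitization set" where
  "unitize S = {x. alg_part x \<in> S}"

definition unitize_map :: "('a::cstar_algebra \<Rightarrow> 'b::cstar_algebra) \<Rightarrow> 'a unitization \<Rightarrow> 'b unitization" where
  "unitize_map f x = Adjoin (f (alg_part x)) (scalar_part x)"


section \<open>Matrix algebras and the stabilization\<close>

text \<open>Elements of \<open>M\<^sub>n(A)\<close> and of \<open>A \<otimes> K\<close> are infinite matrices over \<open>A\<close>.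
  \<open>M\<^sub>n(A)\<close> sits in the upper left corner.\<close>

type_synonym 'a imat = "nat \<Rightarrow> nat \<Rightarrow> 'a"

definition imat_add :: "'a::cstar_algebra imat \<Rightarrow> 'a imat \<Rightarrow> 'a imat" where
  "imat_add x y = (\<lambda>i j. x i j + y i j)"

definition imat_star :: "'a::cstar_algebra imat \<Rightarrow> 'a imat" where
  "imat_star x = (\<lambda>i j. star (x j i))"

text \<open>The series converges in norm for \<open>x\<close> and \<open>y\<close> in the stabilization, and is a finite sum for
  \<open>x\<close> and \<open>y\<close> in a matrix algebra.\<close>

definition imat_mult :: "'a::cstar_algebra imat \<Rightarrow> 'a imat \<Rightarrow> 'a imat" where
  "imat_mult x y = (\<lambda>i j. \<Sum>k. x i k * y k j)"

definition imat_map :: "('a \<Rightarrow> 'b) \<Rightarrow> 'a imat \<Rightarrow> 'b imat" where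
  "imat_map f x = (\<lambda>i j. f (x i j))"

definition matrix_algebra :: "nat \<Rightarrow> 'a::cstar_algebra set \<Rightarrow> 'a imat set" where
  "matrix_algebra n S = {x. (\<forall>i j. x i j \<in> S) \<and> (\<forall>i j. \<not> (i < n \<and> j < n) \<longrightarrow> x i j = 0)}"

text \<open>The C*-norm of \<open>M\<^sub>n(A)\<close> is the operator norm for the action of \<open>M\<^sub>n(A)\<close> on the Hilbert
  module \<open>A\<^sup>n\<close>.  It restricts to the C*-norm of \<open>M\<^sub>n(S)\<close> for every C*-subalgebra \<open>S\<close>.\<close>

definition column_norm :: "nat \<Rightarrow> (nat \<Rightarrow> 'a::cstar_algebra) \<Rightarrow> real" where
  "column_norm n \<xi> = sqrt (norm (\<Sum>i<n. star (\<xi> i) * \<xi> i))"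

definition matrix_norm :: "nat \<Rightarrow> 'a::cstar_algebra imat \<Rightarrow> real" where
  "matrix_norm n x = Sup {column_norm n (\<lambda>i. \<Sum>j<n. x i j * \<xi> j) |\<xi>. column_norm n \<xi> \<le> 1}"

definition truncate :: "nat \<Rightarrow> 'a::cstar_algebra imat \<Rightarrow> 'a imat" where
  "truncate n x = (\<lambda>i j. if i < n \<and> j < n then x i j else 0)"

text \<open>\<open>A \<otimes> K\<close> is the completion of the union of the \<open>M\<^sub>n(A)\<close>.  An element \<open>x\<close> of the completion
  is determined by its matrix entries, and its truncations converge to it; conversely an infinite
  matrix comes from the completion iff its truncations form a Cauchy sequence.\<close>

definition stabilization :: "'a::cstar_algebra set \<Rightarrow> 'a imat set" where
  "stabilization S = {x. (\<forall>i j. x i j \<in> S) \<and>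
     (\<forall>\<epsilon>>0. \<exists>N. \<forall>n\<ge>N. \<forall>m\<ge>n.
        matrix_norm m (\<lambda>i j. truncate m x i j - truncate n x i j) < \<epsilon>)}"


section \<open>Projections, Murray--von Neumann equivalence and finiteness\<close>

text \<open>Here \<open>M\<close> is one of the matrix algebras or the stabilization of some C*-algebra.\<close>

definition projections :: "'a::cstar_algebra imat set \<Rightarrow> 'a imat set" where
  "projections M = {p \<in> M. imat_star p = p \<and> imat_mult p p = p}"

definition mvn_rel :: "'a::cstar_algebra imat set \<Rightarrow> ('a imat \<times> 'a imat) set" where
  "mvn_rel M = {(p, q). p \<in> projections M \<and> q \<in> projections M \<and>
     (\<exists>v\<in>M. imat_mult (imat_star v) v = p \<and> imat_mult v (imat_star v) = q)}"

definition subprojection :: "'a::cstar_algebra imat \<Rightarrow> 'a imat \<Rightarrow> bool" where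
  "subprojection p q \<longleftrightarrow> imat_mult p q = p"

definition mvn_subequivalent :: "'a::cstar_algebra imat set \<Rightarrow> 'a imat \<Rightarrow> 'a imat \<Rightarrow> bool" where
  "mvn_subequivalent M p q \<longleftrightarrow> (\<exists>q'\<in>projections M. subprojection q' q \<and> (p, q') \<in> mvn_rel M)"

definition finite_projection :: "'a::cstar_algebra imat set \<Rightarrow> 'a imat \<Rightarrow> bool" where
  "finite_projection M p \<longleftrightarrow> p \<in> projections M \<and>
     \<not> (\<exists>q\<in>projections M. subprojection q p \<and> q \<noteq> p \<and> (p, q) \<in> mvn_rel M)"

definition finite_algebra :: "'a::cstar_algebra imat set \<Rightarrow> bool" where
  "finite_algebra M \<longleftrightarrow>
     (\<exists>u\<in>M. (\<forall>x\<in>M. imat_mult u x = x \<and> imat_mult x u = x) \<and> finite_projection M u)"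

definition unital_algebra :: "'a::cstar_algebra set \<Rightarrow> bool" where
  "unital_algebra S \<longleftrightarrow> (\<exists>u\<in>S. \<forall>a\<in>S. u * a = a \<and> a * u = a)"

definition stably_finite :: "'a::cstar_algebra set \<Rightarrow> bool" where
  "stably_finite S \<longleftrightarrow>
     (if unital_algebra S then \<forall>n. finite_algebra (matrix_algebra n S)
      else \<forall>n. finite_algebra (matrix_algebra n (unitize S)))"


section \<open>The ordered semigroup V\<close>

text \<open>Ordered abelian semigroups and groups are written multiplicatively, to reuse HOL-Algebra:
  \<open>mult\<close> and \<open>one\<close> are the addition and the zero of \<open>V(A)\<close> and \<open>K\<^sub>0(A)\<close>, and \<open>finprod\<close> is
  the finite sum.\<close>

record 'a ordered_monoid = "'a monoid" +
  ole :: "'a \<Rightarrow> 'a \<Rightarrow> bool"  (infix \<open>\<preceq>\<index>\<close> 50)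

definition ordered_hom ::
    "('a, 'm) ordered_monoid_scheme \<Rightarrow> ('b, 'n) ordered_monoid_scheme \<Rightarrow> ('a \<Rightarrow> 'b) set" where
  "ordered_hom M N = {f \<in> hom M N.
     \<forall>s\<in>carrier M. \<forall>s'\<in>carrier M. s \<preceq>\<^bsub>M\<^esub> s' \<longrightarrow> f s \<preceq>\<^bsub>N\<^esub> f s'}"

definition order_embedding ::
    "('a, 'm) ordered_monoid_scheme \<Rightarrow> ('b, 'n) ordered_monoid_scheme \<Rightarrow> ('a \<Rightarrow> 'b) \<Rightarrow> bool" where
  "order_embedding M N f \<longleftrightarrow> f \<in> ordered_hom M N \<and>
     (\<forall>s\<in>carrier M. \<forall>s'\<in>carrier M. f s \<preceq>\<^bsub>N\<^esub> f s' \<longrightarrow> s \<preceq>\<^bsub>M\<^esub> s')"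

text \<open>The sum of two classes is the class of \<open>p + q\<close> for orthogonal representatives \<open>p\<close>, \<open>q\<close>.
  The sums of this form are closed under equivalence, so they make up a whole class.\<close>

definition V :: "'a::cstar_algebra set \<Rightarrow> 'a imat set ordered_monoid" where
  "V S = \<lparr>carrier = projections (stabilization S) // mvn_rel (stabilization S),
     mult = (\<lambda>X Y. {imat_add p q |p q. p \<in> X \<and> q \<in> Y \<and> imat_mult p q = (\<lambda>_ _. 0)}),
     one = mvn_rel (stabilization S) `` {\<lambda>_ _. 0},
     ole = (\<lambda>X Y. \<exists>p\<in>X. \<exists>q\<in>Y. mvn_subequivalent (stabilization S) p q)\<rparr>"

text \<open>\<open>V_map T f\<close> is \<open>V(f) : V(S) \<rightarrow> V(T)\<close> for a *-homomorphism \<open>f : S \<rightarrow> T\<close>.\<close>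

definition V_map ::
    "'b::cstar_algebra set \<Rightarrow> ('a::cstar_algebra \<Rightarrow> 'b) \<Rightarrow> 'a imat set \<Rightarrow> 'b imat set" where
  "V_map T f X = mvn_rel (stabilization T) `` (imat_map f ` X)"


section \<open>The ordered group K0\<close>

definition groth_rel :: "('a, 'm) monoid_scheme \<Rightarrow> (('a \<times> 'a) \<times> ('a \<times> 'a)) set" where
  "groth_rel M = {((x, y), (x', y')).
     x \<in> carrier M \<and> y \<in> carrier M \<and> x' \<in> carrier M \<and> y' \<in> carrier M \<and>
     (\<exists>z\<in>carrier M. x \<otimes>\<^bsub>M\<^esub> y' \<otimes>\<^bsub>M\<^esub> z = x' \<otimes>\<^bsub>M\<^esub> y \<otimes>\<^bsub>M\<^esub> z)}"

definition groth_class :: "('a, 'm) monoid_scheme \<Rightarrow> 'a \<Rightarrow> 'a \<Rightarrow> ('a \<times> 'a) set" where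
  "groth_class M x y = groth_rel M `` {(x, y)}"

definition grothendieck :: "('a, 'm) monoid_scheme \<Rightarrow> ('a \<times> 'a) set monoid" where
  "grothendieck M = \<lparr>carrier = (carrier M \<times> carrier M) // groth_rel M,
     mult = (\<lambda>X Y. \<Union>(x, y)\<in>X. \<Union>(x', y')\<in>Y. groth_class M (x \<otimes>\<^bsub>M\<^esub> x') (y \<otimes>\<^bsub>M\<^esub> y')),
     one = groth_class M \<one>\<^bsub>M\<^esub> \<one>\<^bsub>M\<^esub>\<rparr>"

definition grothendieck_map ::
    "('b, 'n) monoid_scheme \<Rightarrow> ('a \<Rightarrow> 'b) \<Rightarrow> ('a \<times> 'a) set \<Rightarrow> ('b \<times> 'b) set" where
  "grothendieck_map N f X = (\<Union>(x, y)\<in>X. groth_class N (f x) (f y))"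

text \<open>\<open>V(A) \<rightarrow> K\<^sub>0(A)\<close>, \<open>[p] \<mapsto> [p] - [0]\<close>.\<close>

definition V_to_K0 :: "'a::cstar_algebra set \<Rightarrow>
    'a imat set \<Rightarrow> ('a unitization imat set \<times> 'a unitization imat set) set" where
  "V_to_K0 S X = groth_class (V (unitize S)) (V_map (unitize S) (\<lambda>a. Adjoin a 0) X) \<one>\<^bsub>V (unitize S)\<^esub>"

text \<open>\<open>K\<^sub>0(A)\<close> is the kernel of the map from the Grothendieck group of \<open>V\<close> of the unitization to
  that of \<open>V(\<complex>)\<close> induced by the scalar part, whether or not \<open>A\<close> is unital.  The order is given by
  \<open>X \<le> Y\<close> iff \<open>Y - X\<close> lies in the image of \<open>V(A)\<close>.\<close>

definition K0 :: "'a::cstar_algebra set \<Rightarrow>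
    ('a unitization imat set \<times> 'a unitization imat set) set ordered_monoid" where
  "K0 S = \<lparr>carrier = {X \<in> carrier (grothendieck (V (unitize S))).
       grothendieck_map (V (UNIV :: complex set)) (V_map UNIV scalar_part) X =
         \<one>\<^bsub>grothendieck (V (UNIV :: complex set))\<^esub>},
     mult = mult (grothendieck (V (unitize S))),
     one = one (grothendieck (V (unitize S))),
     ole = (\<lambda>X Y. \<exists>Z \<in> V_to_K0 S ` carrier (V S). Y = X \<otimes>\<^bsub>grothendieck (V (unitize S))\<^esub> Z)\<rparr>"

definition K0_map :: "'b::cstar_algebra set \<Rightarrow> ('a::cstar_algebra \<Rightarrow> 'b) \<Rightarrow>
    ('a unitization imat set \<times> 'a unitization imat set) set \<Rightarrow>
    ('b unitization imat set \<times> 'b unitization imat set) set" where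
  "K0_map T f = grothendieck_map (V (unitize T)) (V_map (unitize T) (unitize_map f))"

end

theory Submission
  imports Defs
begin

text \<open>The Rokhlin elements \<open>r\<^sub>g\<close> asymptotically commute with \<open>A\<close>, are orthogonal, are permuted by the action
  and add up to a unit.  Therefore \<open>(a\<^sub>g)\<^sub>g \<mapsto> \<Sum>\<^sub>g r\<^sub>g a\<^sub>g\<close> is an asymptotic morphism from the \<open>A\<close>-valued functions on
  \<open>G\<close> to \<open>A\<close> that sends a constant function to its value.  On the functions \<open>g \<mapsto> \<alpha>\<^sub>g (a)\<close> it is close to the average
  \<open>\<Sum>\<^sub>g \<alpha>\<^sub>g (r\<^sub>1 a)\<close>, which is fixed by the action.  So there is an asymptotic morphism \<open>A \<rightarrow> A\<^sup>\<alpha>\<close> that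
  restricts to the identity of \<open>A\<^sup>\<alpha>\<close>, asymptotically (\<open>rokhlin_average_asymptotic_morphism\<close>,
  \<open>rokhlin_average_on_fixed\<close>).

  An asymptotic morphism sends a projection in a matrix algebra to an element close to a projection, and
  equivalent projections to equivalent ones, eventually (\<open>induced_V_map_exists\<close>).  The induced maps on \<open>V\<close> are
  additive and monotone on any given finite set of classes, eventually.  Three arguments give the
  assertions on \<open>V\<close>.  The maps \<open>V(A) \<rightarrow> V(A\<^sup>\<alpha>)\<close> are eventually left inverse to \<open>V(i)\<close>, so \<open>V(i)\<close> reflects the order
  (\<open>inclusion_reflects_le\<close>).  If \<open>v\<^sub>g\<close> implements \<open>p \<sim> \<alpha>\<^sub>g (p)\<close>, then \<open>\<Sum>\<^sub>g r\<^sub>g v\<^sub>g\<close> implements the equivalence of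
  \<open>p\<close> with the average of \<open>p\<close>, so fixed classes come from \<open>A\<^sup>\<alpha>\<close> (\<open>inclusion_of_induced_on_fixed\<close>).  If
  \<open>p\<close> itself is fixed, then the \<open>r\<^sub>g p\<close> are nearly orthogonal projections with sum \<open>p\<close>, translates of \<open>r\<^sub>1 p\<close>, so
  \<open>[p]\<close> is an orbit sum (\<open>inclusion_is_orbit_sum\<close>).

  For \<open>K\<^sub>0\<close>, an approximate identity of projections \<open>u\<close> makes the compression \<open>b \<mapsto> u b u\<close> an asymptotic morphism
  from the unitization to \<open>A\<close>.  It shows that \<open>K\<^sub>0(A)\<close> is the Grothendieck group of \<open>V(A)\<close> itself (\<open>carrier_K0\<close>,
  \<open>K0_diff_eq_iff\<close>).  Averages of the projections \<open>u\<close> are close to projections that form an approximate identity of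
  \<open>A\<^sup>\<alpha>\<close> (\<open>fixed_approximate_projection\<close>), so the same holds for \<open>A\<^sup>\<alpha>\<close>.  What remains is arithmetic in
  \<open>V\<close>: an equation in \<open>K\<^sub>0(A)\<close> is an equation in \<open>V(A)\<close> up to a common summand \<open>z\<close>, and \<open>z\<close> can be enlarged to its
  orbit sum, which lies in the image of \<open>V(i)\<close>.

  The C*-algebraic groundwork uses neither spectra nor a functional calculus: square roots are limits of explicit
  iterations, which stay in every closed subalgebra, and \<open>A \<otimes> K\<close> is made an instance of the class of C*-algebras.\<close>


section \<open>Algebra and norm in C*-algebras\<close>

lemma star_zero [simp]: "star 0 = (0::'a::cstar_algebra)"
  using star_add[of 0 "0::'a"] by simp

lemma star_minus: "star (- x) = - star (x::'a::cstar_algebra)"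
  using star_add[of x "- x"] by (simp add: eq_neg_iff_add_eq_0 add.commute)

lemma star_diff: "star (x - y) = star x - star (y::'a::cstar_algebra)"
  using star_add[of x "- y"] by (simp add: star_minus)

lemma star_scaleR: "star (r *\<^sub>R x) = r *\<^sub>R star (x::'a::cstar_algebra)"
  using star_cscale[of "complex_of_real r" x] by (simp add: cscale_of_real)

lemma star_sum: "star (sum f I) = (\<Sum>i\<in>I. star (f i :: 'a::cstar_algebra))"
  by (induction I rule: infinite_finite_induct) (simp_all add: star_add)

lemma bounded_linear_star: "bounded_linear (star :: 'a::cstar_algebra \<Rightarrow> 'a)"
  by (rule bounded_linear_intro[where K = 1]) (simp_all add: star_add star_scaleR)

lemmas star_simps = star_add star_diff star_minus star_mult star_scaleR star_star

lemma cstar_eq_0I: "star x * x = 0 \<Longrightarrow> (x::'a::cstar_algebra) = 0"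
  using cstar_identity[of x] by simp

lemma cscale_diff_right: "cscale c (x - y) = cscale c x - cscale c (y::'a::cstar_algebra)"
  using cscale_add_right[of c x "- y"] by (simp add: cscale_minus_right)

lemma norm_mult_self_adjoint: "star x = x \<Longrightarrow> norm (x * x) = (norm (x::'a::cstar_algebra))\<^sup>2"
  using cstar_identity[of x] by simp

lemma norm_projection_le_1:
  assumes "projection (p::'a::cstar_algebra)" shows "norm p \<le> 1"
proof -
  have "norm p = norm p * norm p"
    using assms norm_mult_self_adjoint[of p] by (simp add: projection_def power2_eq_square)
  then show ?thesis by auto
qed

text \<open>Closedness makes the limits of the iterations below, such as square roots, stay in the subalgebra.\<close>

definition cstar_subalgebra :: "'a::cstar_algebra set \<Rightarrow> bool" where
  "cstar_subalgebra M \<longleftrightarrow> closed M \<and> 0 \<in> M \<and> (\<forall>x\<in>M. \<forall>y\<in>M. x + y \<in> M \<and> x * y \<in> M) \<and>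
     (\<forall>x\<in>M. star x \<in> M \<and> (\<forall>c. cscale c x \<in> M))"

context
  fixes M :: "'a::cstar_algebra set"
  assumes M: "cstar_subalgebra M"
begin

lemma subalgebra_closed: "closed M" and subalgebra_zero: "0 \<in> M"
  and subalgebra_add: "x \<in> M \<Longrightarrow> y \<in> M \<Longrightarrow> x + y \<in> M"
  and subalgebra_mult: "x \<in> M \<Longrightarrow> y \<in> M \<Longrightarrow> x * y \<in> M"
  and subalgebra_star: "x \<in> M \<Longrightarrow> star x \<in> M"
  and subalgebra_cscale: "x \<in> M \<Longrightarrow> cscale c x \<in> M"
  using M by (auto simp: cstar_subalgebra_def)

lemma subalgebra_scaleR: "x \<in> M \<Longrightarrow> r *\<^sub>R x \<in> M"
  using subalgebra_cscale[of x "complex_of_real r"] by (simp add: cscale_of_real)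

lemma subalgebra_minus: "x \<in> M \<Longrightarrow> - x \<in> M"
  using subalgebra_scaleR[of x "-1"] by simp

lemma subalgebra_diff: "x \<in> M \<Longrightarrow> y \<in> M \<Longrightarrow> x - y \<in> M"
  using subalgebra_add[of x "- y"] subalgebra_minus by simp

lemma subalgebra_sum: "(\<And>i. i \<in> I \<Longrightarrow> f i \<in> M) \<Longrightarrow> sum f I \<in> M"
  by (induction I rule: infinite_finite_induct) (simp_all add: subalgebra_zero subalgebra_add)

lemmas subalgebra_intros = subalgebra_zero subalgebra_add subalgebra_mult subalgebra_star
  subalgebra_scaleR subalgebra_minus subalgebra_diff subalgebra_sum

end

lemma cstar_subalgebra_UNIV: "cstar_subalgebra UNIV"
  by (simp add: cstar_subalgebra_def)


section \<open>Positivity without spectra\<close>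

text \<open>The iteration \<open>y \<mapsto> (z + y\<^sup>2)/2\<close>, started at \<open>0\<close>, converges to \<open>y = 1 - (1 - z)\<^sup>1\<^sup>/\<^sup>2\<close>
  whenever \<open>norm z \<le> 1\<close>: its increments are dominated by those of the same iteration for the number
  \<open>z = 1\<close>, which increases and is bounded by \<open>1\<close>.  No unit is needed to state or to run it, so it
  stays in every closed subalgebra that contains \<open>z\<close>.\<close>

lemma one_minus_sqrt_exists:
  fixes z :: "'a::cstar_algebra"
  assumes M: "cstar_subalgebra M" "z \<in> M" and sa: "star z = z" and z: "norm z \<le> 1"
  obtains y where "y \<in> M" "star y = y" "2 *\<^sub>R y = z + y * y" "norm y \<le> 1"
    "\<And>x. x * z = z * x \<Longrightarrow> x * y = y * x"
proof -
  define Y where "Y = rec_nat 0 (\<lambda>_ y. (1/2) *\<^sub>R (z + y * y))"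
  define t :: "nat \<Rightarrow> real" where "t = rec_nat 0 (\<lambda>_ y. (1 + y * y) / 2)"
  have Y0: "Y 0 = 0" and YS: "\<And>n. Y (Suc n) = (1/2) *\<^sub>R (z + Y n * Y n)" by (simp_all add: Y_def)
  have t0: "t 0 = 0" and tS: "\<And>n. t (Suc n) = (1 + t n * t n) / 2" by (simp_all add: t_def)
  have t01: "0 \<le> t n \<and> t n \<le> 1" for n
  proof (induction n)
    case (Suc n)
    then have "t n * t n \<le> 1" by (simp add: mult_le_one)
    then show ?case by (simp add: tS)
  qed (simp add: t0)
  have Yt: "norm (Y n) \<le> t n" for n
  proof (induction n)
    case (Suc n)
    have "norm (Y n * Y n) \<le> t n * t n"
      by (rule order_trans[OF norm_mult_ineq]) (use Suc t01[of n] in \<open>simp add: mult_mono\<close>)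
    then show ?case
      using norm_triangle_ineq[of z "Y n * Y n"] z by (simp add: YS tS)
  qed (simp add: Y0 t0)
  have commZ: "x * Y n = Y n * x" if "x * z = z * x" for x n
  proof (induction n)
    case (Suc n)
    have "x * (Y n * Y n) = Y n * Y n * x" by (metis Suc mult.assoc)
    then show ?case using that by (simp add: YS algebra_simps)
  qed (simp add: Y0)
  have comm: "Y m * Y n = Y n * Y m" for m n
    by (rule commZ) (rule commZ[symmetric], simp)
  have dom: "norm (Y (Suc n) - Y n) \<le> t (Suc n) - t n" for n
  proof (induction n)
    case 0
    show ?case using Yt[of 1] by (simp add: Y0 t0)
  next
    case (Suc n)
    have "Y (Suc (Suc n)) - Y (Suc n) = (1/2) *\<^sub>R ((Y (Suc n) - Y n) * (Y (Suc n) + Y n))"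
      using comm[of n "Suc n"] unfolding YS[of "Suc n"] YS[of n]
      by (simp add: algebra_simps)
    also have "norm \<dots> \<le> (1/2) * ((t (Suc n) - t n) * (t (Suc n) + t n))"
    proof -
      have "norm (Y (Suc n) + Y n) \<le> t (Suc n) + t n"
        by (rule norm_triangle_le) (use Yt[of n] Yt[of "Suc n"] in linarith)
      then have "norm ((Y (Suc n) - Y n) * (Y (Suc n) + Y n)) \<le> (t (Suc n) - t n) * (t (Suc n) + t n)"
        by (intro order_trans[OF norm_mult_ineq] mult_mono Suc order_trans[OF norm_ge_zero Suc]) auto
      then show ?thesis by simp
    qed
    also have "\<dots> = t (Suc (Suc n)) - t (Suc n)"
      unfolding tS[of "Suc n"] tS[of n] by (simp add: field_simps)
    finally show ?case .
  qed
  have "incseq t"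
    by (rule incseq_SucI) (use dom in \<open>metis norm_ge_zero order_trans diff_ge_0_iff_ge\<close>)
  then have "convergent t"
    using t01 by (intro Bseq_monoseq_convergent BseqI'[where K = 1]) (auto simp: monoseq_def incseq_def)
  then have "summable (\<lambda>n. t (Suc n) - t n)"
    by (auto simp: convergent_def intro: telescope_summable)
  then have "summable (\<lambda>n. Y (Suc n) - Y n)"
    by (rule summable_norm_cancel[OF summable_comparison_test']) (simp add: dom)
  then have "convergent (\<lambda>n. \<Sum>k<n. Y (Suc k) - Y k)"
    by (simp add: summable_iff_convergent)
  then have "convergent Y" by (simp add: sum_lessThan_telescope Y0)
  then obtain y where y: "Y \<longlonglongrightarrow> y" by (auto simp: convergent_def)
  have inM: "Y n \<in> M" for n
    by (induction n) (use M in \<open>simp_all add: Y0 YS subalgebra_intros\<close>)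
  have saY: "star (Y n) = Y n" for n
    by (induction n) (use sa in \<open>simp_all add: Y0 YS star_simps\<close>)
  show thesis
  proof (rule that)
    show "y \<in> M"
      using subalgebra_closed[OF M(1)] inM y closed_sequentially by blast
    have "(\<lambda>n. star (Y n)) \<longlonglongrightarrow> star y"
      by (rule bounded_linear.tendsto[OF bounded_linear_star y])
    then show "star y = y" using y by (simp add: saY LIMSEQ_unique)
    have "(\<lambda>n. Y (Suc n)) \<longlonglongrightarrow> (1/2) *\<^sub>R (z + y * y)"
      unfolding YS by (intro tendsto_intros y)
    then have "y = (1/2) *\<^sub>R (z + y * y)" using y LIMSEQ_Suc LIMSEQ_unique by blast
    then have "2 *\<^sub>R y = 2 *\<^sub>R ((1/2) *\<^sub>R (z + y * y))" by (rule arg_cong)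
    then show "2 *\<^sub>R y = z + y * y" by simp
    show "norm y \<le> 1"
      by (rule Lim_bounded[OF tendsto_norm[OF y], of 0]) (use Yt t01 order_trans in blast)
    show "x * y = y * x" if "x * z = z * x" for x
    proof -
      have "(\<lambda>n. x * Y n) \<longlonglongrightarrow> x * y" "(\<lambda>n. Y n * x) \<longlonglongrightarrow> y * x"
        by (intro tendsto_intros y)+
      then show ?thesis by (simp add: commZ[OF that] LIMSEQ_unique)
    qed
  qed
qed

text \<open>In a unital C*-algebra, positivity is encoded by the norm: \<open>a \<ge> 0\<close> iff \<open>norm (t - a) \<le> t\<close> for
  some \<open>t \<ge> 0\<close>.  In this form positive elements obviously form a cone; the work lies in recognizing
  the elements \<open>star x * x\<close>.\<close>

definition norm_positive :: "'a::{cstar_algebra,real_normed_algebra_1} \<Rightarrow> bool" where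
  "norm_positive a \<longleftrightarrow> star a = a \<and> (\<exists>t\<ge>0. norm (t *\<^sub>R 1 - a) \<le> t)"

lemma star_one [simp]: "star 1 = (1::'a::{cstar_algebra,real_normed_algebra_1})"
  by (metis mult.right_neutral star_mult star_star)

text \<open>If \<open>h\<^sup>2 + s\<^sup>2 = 1\<close>, then \<open>h + is\<close> is a unitary with real part \<open>h\<close>.\<close>

lemma norm_le_1_if_sum_squares:
  fixes h s :: "'a::{cstar_algebra,real_normed_algebra_1}"
  assumes h: "star h = h" and s: "star s = s" and hs: "h * s = s * h" and 1: "h * h + s * s = 1"
  shows "norm h \<le> 1"
proof -
  define u where "u = h + cscale \<i> s"
  have su: "star u = h - cscale \<i> s"
    by (simp add: u_def star_add star_cscale h s cscale_minus_left)
  have "star u * u = 1"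
    by (simp add: su) (simp add: u_def algebra_simps cscale_mult_left cscale_mult_right cscale_cscale hs
        cscale_minus_left cscale_diff_right 1)
  then have "(norm u)\<^sup>2 = 1" using cstar_identity[of u] by simp
  then have "norm u = 1" by (simp add: power2_eq_1_iff) (use norm_ge_zero[of u] in linarith)
  moreover have "2 *\<^sub>R h = u + star u" by (simp add: su) (simp add: u_def scaleR_2)
  then have "2 * norm h \<le> norm u + norm (star u)"
    by (metis norm_scaleR abs_numeral norm_triangle_ineq)
  ultimately show ?thesis by simp
qed

text \<open>If \<open>norm (t - a) \<le> t\<close>, then \<open>a / t = 1 - z\<close> with \<open>norm z \<le> 1\<close>, and the iteration applies to \<open>z\<close>.\<close>

lemma norm_positive_sqrt:
  fixes a :: "'a::{cstar_algebra,real_normed_algebra_1}"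
  assumes "norm_positive a"
  obtains d where "norm_positive d" "d * d = a" "\<And>x. x * a = a * x \<Longrightarrow> x * d = d * x"
proof -
  obtain t where t: "t \<ge> 0" "norm (t *\<^sub>R 1 - a) \<le> t" and sa: "star a = a"
    using assms by (auto simp: norm_positive_def)
  show thesis
  proof (cases "t = 0")
    case True
    then have "a = 0" using t by simp
    show thesis by (rule that[of 0]) (auto simp: \<open>a = 0\<close> norm_positive_def intro: exI[of _ 0])
  next
    case False
    then have "t > 0" using t by simp
    define z where "z = 1 - (1/t) *\<^sub>R a"
    have "norm z = norm ((1/t) *\<^sub>R (t *\<^sub>R 1 - a))"
      using \<open>t > 0\<close> by (simp add: z_def scaleR_right_diff_distrib)
    also have "\<dots> \<le> 1" using t \<open>t > 0\<close> by (simp del: norm_scaleR add: norm_scaleR)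
    finally have nz: "norm z \<le> 1" .
    have sz: "star z = z" by (simp add: z_def star_simps sa)
    obtain y where y: "star y = y" "2 *\<^sub>R y = z + y * y" "norm y \<le> 1"
      "\<And>x. x * z = z * x \<Longrightarrow> x * y = y * x"
      using one_minus_sqrt_exists[OF cstar_subalgebra_UNIV _ sz nz] by blast
    define d where "d = sqrt t *\<^sub>R (1 - y)"
    have "(1 - y) * (1 - y) = 1 + y * y - 2 *\<^sub>R y" by (simp add: algebra_simps scaleR_2)
    also have "\<dots> = (1/t) *\<^sub>R a" by (simp add: y(2)) (simp add: z_def)
    finally have 1: "d * d = a" using \<open>t > 0\<close> by (simp add: d_def)
    have 2: "norm_positive d"
      unfolding norm_positive_def
    proof (intro conjI exI[of _ "sqrt t"])
      show "norm (sqrt t *\<^sub>R 1 - d) \<le> sqrt t"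
        using y(3) t by (simp add: d_def algebra_simps mult_left_le)
    qed (use t(1) y(1) in \<open>simp_all add: d_def star_simps\<close>)
    have 3: "x * d = d * x" if "x * a = a * x" for x
    proof -
      have "x * z = z * x" by (simp add: z_def algebra_simps that)
      from y(4)[OF this] show ?thesis by (simp add: d_def algebra_simps)
    qed
    show thesis by (rule that[OF 2 1 3])
  qed
qed

text \<open>The element \<open>s = (1 - h\<^sup>2)\<^sup>1\<^sup>/\<^sup>2\<close> completes \<open>h\<close> to a sum of two squares equal to \<open>1\<close>.\<close>

lemma norm_positive_square_1:
  fixes h :: "'a::{cstar_algebra,real_normed_algebra_1}"
  assumes h: "star h = h" and "norm h \<le> 1"
  shows "norm (1 - h * h) \<le> 1"
proof -
  have "norm (h * h) \<le> 1" using assms by (simp add: norm_mult_self_adjoint power_le_one)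
  moreover have "star (h * h) = h * h" by (simp add: star_mult h)
  ultimately obtain y where y: "star y = y" "2 *\<^sub>R y = h * h + y * y" "norm y \<le> 1"
      "\<And>x. x * (h * h) = (h * h) * x \<Longrightarrow> x * y = y * x"
    using one_minus_sqrt_exists[OF cstar_subalgebra_UNIV _, of "h * h"] by blast
  have "y * y = 2 *\<^sub>R y - h * h" using y(2) by simp
  moreover have "(1 - y) * (1 - y) = 1 - 2 *\<^sub>R y + y * y" by (simp add: algebra_simps scaleR_2)
  ultimately have eq: "(1 - y) * (1 - y) = 1 - h * h" by simp
  have "h * y = y * h" by (rule y(4)) (simp add: mult.assoc)
  then have "norm (1 - y) \<le> 1"
    by (intro norm_le_1_if_sum_squares[of _ h]) (simp_all add: star_simps y(1) h eq, simp_all add: algebra_simps)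
  then have "norm ((1 - y) * (1 - y)) \<le> 1"
    by (subst norm_mult_self_adjoint) (simp_all add: star_simps y(1) power_le_one)
  then show ?thesis by (simp add: eq)
qed

text \<open>Scaling by \<open>r = norm h + 1\<close>, which is nonzero, reduces this to contractions.\<close>

lemma norm_positive_square:
  fixes h :: "'a::{cstar_algebra,real_normed_algebra_1}"
  assumes h: "star h = h"
  shows "norm_positive (h * h)"
  unfolding norm_positive_def
proof (intro conjI exI[of _ "(norm h + 1)\<^sup>2"])
  define r where "r = norm h + 1"
  have r: "r > 0" by (simp add: r_def add_nonneg_pos)
  have "norm ((1/r) *\<^sub>R h) \<le> 1" using r by (simp add: r_def)
  then have "norm (1 - (1/r) *\<^sub>R h * (1/r) *\<^sub>R h) \<le> 1"
    by (intro norm_positive_square_1) (simp_all add: star_simps h)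
  then have "r\<^sup>2 * norm (1 - (1/r) *\<^sub>R h * (1/r) *\<^sub>R h) \<le> r\<^sup>2" by (simp add: mult_left_le)
  moreover have "r\<^sup>2 *\<^sub>R (1 - (1/r) *\<^sub>R h * (1/r) *\<^sub>R h) = r\<^sup>2 *\<^sub>R 1 - h * h"
    using r by (simp add: algebra_simps power2_eq_square)
  ultimately show "norm ((norm h + 1)\<^sup>2 *\<^sub>R 1 - h * h) \<le> (norm h + 1)\<^sup>2"
    unfolding r_def[symmetric] by (metis norm_scaleR abs_power2)
qed (simp_all add: star_mult h)

lemma norm_positive_add:
  fixes a b :: "'a::{cstar_algebra,real_normed_algebra_1}"
  assumes "norm_positive a" "norm_positive b" shows "norm_positive (a + b)"
proof -
  obtain s t where st: "s \<ge> 0" "norm (s *\<^sub>R 1 - a) \<le> s" "t \<ge> 0" "norm (t *\<^sub>R 1 - b) \<le> t"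
    and sa: "star a = a" "star b = b" using assms by (auto simp: norm_positive_def)
  have eq: "(s + t) *\<^sub>R 1 - (a + b) = (s *\<^sub>R 1 - a) + (t *\<^sub>R 1 - b)" by (simp add: algebra_simps)
  have "norm ((s + t) *\<^sub>R 1 - (a + b)) \<le> s + t"
    unfolding eq using norm_triangle_ineq[of "s *\<^sub>R 1 - a" "t *\<^sub>R 1 - b"] st by linarith
  then show ?thesis using st sa unfolding norm_positive_def by (auto simp: star_add intro!: exI[of _ "s + t"])
qed

lemma norm_positive_scaleR:
  fixes a :: "'a::{cstar_algebra,real_normed_algebra_1}"
  assumes "norm_positive a" "r \<ge> 0" shows "norm_positive (r *\<^sub>R a)"
proof -
  obtain s where st: "s \<ge> 0" "norm (s *\<^sub>R 1 - a) \<le> s"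
    and sa: "star a = a" using assms by (auto simp: norm_positive_def)
  have "(r * s) *\<^sub>R 1 - r *\<^sub>R a = r *\<^sub>R (s *\<^sub>R 1 - a)" by (simp add: algebra_simps)
  then have "norm ((r * s) *\<^sub>R 1 - r *\<^sub>R a) \<le> r * s"
    using st assms by (simp add: mult_left_mono)
  then show ?thesis using st sa assms unfolding norm_positive_def
    by (auto simp: star_scaleR intro!: exI[of _ "r * s"])
qed

lemma norm_positive_complement:
  fixes a :: "'a::{cstar_algebra,real_normed_algebra_1}"
  assumes "star a = a" "norm a \<le> t" shows "norm_positive (t *\<^sub>R 1 - a)"
  unfolding norm_positive_def
  by (intro conjI exI[of _ t]) (use assms order_trans[OF norm_ge_zero assms(2)] in \<open>auto simp: star_simps\<close>)

text \<open>Two commuting square roots turn \<open>a + (1 - a) = 1\<close> into a sum of squares.\<close>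

lemma norm_le_if_complement_positive:
  fixes a :: "'a::{cstar_algebra,real_normed_algebra_1}"
  assumes a: "norm_positive a" and b: "norm_positive (t *\<^sub>R 1 - a)" and t: "t > 0"
  shows "norm a \<le> t"
proof -
  define a' where "a' = (1/t) *\<^sub>R a"
  have 1: "norm_positive a'" unfolding a'_def using a t by (simp add: norm_positive_scaleR)
  have "norm_positive ((1/t) *\<^sub>R (t *\<^sub>R 1 - a))" using b t by (simp add: norm_positive_scaleR)
  moreover have "(1/t) *\<^sub>R (t *\<^sub>R 1 - a) = 1 - a'" using t by (simp add: a'_def algebra_simps)
  ultimately have 2: "norm_positive (1 - a')" by simp
  obtain n where n: "norm_positive n" "n * n = a'" "\<And>x. x * a' = a' * x \<Longrightarrow> x * n = n * x"
    by (rule norm_positive_sqrt[OF 1]) blast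
  obtain m where m: "norm_positive m" "m * m = 1 - a'" "\<And>x. x * (1 - a') = (1 - a') * x \<Longrightarrow> x * m = m * x"
    by (rule norm_positive_sqrt[OF 2]) blast
  have "n * (1 - a') = (1 - a') * n" by (simp add: n(2)[symmetric] algebra_simps)
  then have "n * m = m * n" by (rule m(3))
  then have "norm n \<le> 1"
    using n(1,2) m(1,2) by (intro norm_le_1_if_sum_squares[of n m]) (auto simp: norm_positive_def)
  then have "norm a' \<le> 1"
    using n(1,2) norm_mult_self_adjoint[of n] by (auto simp: norm_positive_def power_le_one)
  then show ?thesis using t by (simp add: a'_def)
qed

text \<open>For \<open>t = norm (a + b) + e\<close>, the element \<open>t - a = (t - (a + b)) + b\<close> is a sum of positive ones.\<close>

lemma norm_le_norm_add_positive:
  fixes a b :: "'a::{cstar_algebra,real_normed_algebra_1}"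
  assumes a: "norm_positive a" and b: "norm_positive b"
  shows "norm a \<le> norm (a + b)"
proof (rule field_le_epsilon)
  fix e :: real assume e: "e > 0"
  let ?t = "norm (a + b) + e"
  have "norm_positive (?t *\<^sub>R 1 - (a + b))"
    using norm_positive_add[OF a b] e by (intro norm_positive_complement) (auto simp: norm_positive_def)
  then have "norm_positive ((?t *\<^sub>R 1 - (a + b)) + b)" by (rule norm_positive_add[OF _ b])
  then show "norm a \<le> ?t"
    using e by (intro norm_le_if_complement_positive[OF a]) (simp_all add: add_nonneg_pos add_pos_nonneg algebra_simps)
qed

text \<open>If \<open>norm y = 1\<close>, then \<open>y y\<^sup>*\<close> is a positive contraction and the compression of \<open>1 - y y\<^sup>*\<close> by \<open>y\<close> is
  \<open>- (k + k\<^sup>2)\<close> with \<open>k = - y\<^sup>* y\<close>.  So \<open>k \<ge> 0\<close> would satisfy both \<open>norm k = 1\<close> and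
  \<open>norm (k + k\<^sup>2) \<le> 1\<close>; completing the square, the latter forces \<open>norm k \<le> (5/4)\<^sup>1\<^sup>/\<^sup>2 - 1/2 < 1\<close>.\<close>

lemma neg_star_mult_self_positive_imp_zero:
  fixes y :: "'a::{cstar_algebra,real_normed_algebra_1}"
  assumes neg: "norm_positive (- (star y * y))"
  shows "y = 0"
proof (rule ccontr)
  assume "y \<noteq> 0"
  define x where "x = (1 / norm y) *\<^sub>R y"
  define k where "k = - (star x * x)"
  define B where "B = x * star x"
  have nx: "norm x = 1" using \<open>y \<noteq> 0\<close> by (simp add: x_def)
  have "k = (1 / norm y)\<^sup>2 *\<^sub>R (- (star y * y))"
    by (simp add: k_def x_def star_simps power2_eq_square)
  then have k: "norm_positive k" by (simp add: norm_positive_scaleR[OF neg] del: scaleR_minus_right)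
  have nk: "norm k = 1" by (simp add: k_def cstar_identity nx)
  have nB: "norm B = 1" using cstar_identity[of "star x"] by (simp add: B_def star_star nx)
  \<comment> \<open>\<open>x\<^sup>* x + x x\<^sup>*\<close> is half the sum of the squares of \<open>x + x\<^sup>*\<close> and \<open>i (x - x\<^sup>*)\<close>.\<close>
  define X where "X = (x + star x) * (x + star x) + cscale \<i> (x - star x) * cscale \<i> (x - star x)"
  have "X = 2 *\<^sub>R (B - k)"
    by (simp add: X_def B_def k_def algebra_simps scaleR_2 cscale_mult_left cscale_mult_right cscale_cscale
        cscale_minus_left cscale_diff_right)
  then have "B = (1/2) *\<^sub>R X + k" by simp
  moreover have "star (cscale \<i> (x - star x)) = cscale \<i> (x - star x)"
    by (simp add: star_cscale star_simps cscale_minus_left cscale_diff_right)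
  then have "norm_positive X"
    unfolding X_def by (intro norm_positive_add norm_positive_square) (simp_all add: star_simps add.commute)
  ultimately have B: "norm_positive B"
    using k by (simp add: norm_positive_add norm_positive_scaleR)
  have B1: "norm (1 - B) \<le> 1"
  proof -
    obtain d where d: "norm_positive d" "d * d = B" by (rule norm_positive_sqrt[OF B]) blast
    then have "(norm d)\<^sup>2 = 1" using norm_mult_self_adjoint[of d] nB by (auto simp: norm_positive_def)
    then have "norm d \<le> 1" by (simp add: power2_eq_1_iff) (use norm_ge_zero[of d] in linarith)
    then show ?thesis using norm_positive_square_1[of d] d by (auto simp: norm_positive_def)
  qed
  have "norm (star x * (1 - B) * x) \<le> norm (star x) * norm (1 - B) * norm x"
    by (metis norm_mult_ineq mult_right_mono norm_ge_zero order_trans)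
  also have "\<dots> \<le> 1" using B1 nx by simp
  also have "star x * (1 - B) * x = - (k + k * k)"
    by (simp add: B_def k_def algebra_simps)
  finally have kk: "norm (k + k * k) \<le> 1" by (metis norm_minus_cancel)
  define m where "m = k + (1/2) *\<^sub>R 1"
  have sk: "star k = k" using k by (simp add: norm_positive_def)
  then have sm: "star m = m" by (simp add: m_def star_simps)
  have "m * m = (k + k * k) + (1/4) *\<^sub>R 1"
    by (simp add: m_def algebra_simps scaleR_add_left[symmetric])
  then have "norm (m * m) \<le> 5/4"
    using kk norm_triangle_ineq[of "k + k * k" "(1/4) *\<^sub>R 1"] by simp
  then have "norm m \<le> sqrt (5/4)"
    using norm_mult_self_adjoint[OF sm] by (simp add: real_le_rsqrt)
  then have "norm_positive (sqrt (5/4) *\<^sub>R 1 - m)"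
    by (intro norm_positive_complement sm)
  moreover have "sqrt (5/4) *\<^sub>R 1 - m = (sqrt (5/4) - 1/2) *\<^sub>R 1 - k"
    by (simp add: m_def algebra_simps)
  moreover have "sqrt (5/4) < 3/2" by (rule real_less_lsqrt) (simp_all add: power2_eq_square)
  moreover have "sqrt (5/4) > 1/2" by (rule real_less_rsqrt) (simp_all add: power2_eq_square)
  ultimately have "norm k \<le> sqrt (5/4) - 1/2"
    by (intro norm_le_if_complement_positive[OF k]) simp_all
  with nk \<open>sqrt (5/4) < 3/2\<close> show False by simp
qed

text \<open>Put \<open>a = x\<^sup>* x\<close> and \<open>c = (a\<^sup>2)\<^sup>1\<^sup>/\<^sup>2\<close>, the absolute value of \<open>a\<close>.  The element \<open>y = x (c - a)\<close> picks out
  the negative part of \<open>a\<close>: \<open>- y\<^sup>* y = c (c - a)\<^sup>2 \<ge> 0\<close>.  So \<open>y = 0\<close>, and \<open>c - a\<close> is nilpotent.\<close>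

lemma norm_positive_star_mult_self: "norm_positive (star x * (x::'a::{cstar_algebra,real_normed_algebra_1}))"
proof -
  define a where "a = star x * x"
  have sa: "star a = a" by (simp add: a_def star_simps)
  obtain c where c: "norm_positive c" "c * c = a * a" "\<And>w. w * (a * a) = (a * a) * w \<Longrightarrow> w * c = c * w"
    by (rule norm_positive_sqrt[OF norm_positive_square[OF sa]]) blast
  obtain e where e: "norm_positive e" "e * e = c" "\<And>w. w * c = c * w \<Longrightarrow> w * e = e * w"
    by (rule norm_positive_sqrt[OF c(1)]) blast
  have ac: "a * c = c * a" by (rule c(3)) (simp add: mult.assoc)
  have sc: "star c = c" and se: "star e = e" using c(1) e(1) by (auto simp: norm_positive_def)
  define w where "w = c - a"
  have sw: "star w = w" by (simp add: w_def star_simps sa sc)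
  have cw: "w * c = c * w" by (simp add: w_def algebra_simps ac)
  have ew: "w * e = e * w" by (rule e(3)[OF cw])
  have ww: "w * w = 2 *\<^sub>R (c * w)"
    by (simp add: w_def algebra_simps c(2)[symmetric] ac scaleR_2)
  have aw: "a * w = - (c * w)" by (simp add: w_def algebra_simps c(2) ac)
  define y where "y = x * w"
  have "star y * y = w * a * w" by (simp add: y_def a_def star_simps sw mult.assoc)
  also have "\<dots> = - (c * w * w)" by (simp add: mult.assoc aw) (metis cw mult.assoc)
  finally have yy: "- (star y * y) = c * w * w" by simp
  also have "\<dots> = (e * w) * (e * w)" by (metis e(2) ew mult.assoc)
  finally have "norm_positive (- (star y * y))"
    using norm_positive_square[of "e * w"] by (simp add: star_simps sw se ew)
  then have "y = 0" by (rule neg_star_mult_self_positive_imp_zero)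
  then have "c * w * w = 0" using yy by simp
  then have "w * w * w = 0" by (simp add: ww)
  then have "star (w * w) * (w * w) = 0" by (simp add: star_simps sw mult.assoc[symmetric])
  then have "w * w = 0" by (rule cstar_eq_0I)
  then have "w = 0" using cstar_eq_0I[of w] by (simp add: sw)
  then show ?thesis using c(1) by (simp add: w_def a_def[symmetric])
qed


section \<open>Positive elements and Hilbert modules\<close>

instantiation unitization :: (cstar_algebra) real_normed_algebra_1
begin

definition "1 = Adjoin (0::'a) 1"

instance
proof
  fix x :: "'a unitization"
  show "1 * x = x" "x * 1 = x" "(0::'a unitization) \<noteq> 1"
    by (simp_all add: one_unitization_def times_unitization_def zero_unitization_def)
  have "norm (1::'a unitization) \<ge> 1" "norm (1::'a unitization) \<le> 1"
    using norm_unitization_lower(2)[of "1::'a unitization"] norm_unitization_upper[of "1::'a unitization"]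
    by (simp_all add: one_unitization_def)
  then show "norm (1::'a unitization) = 1" by simp
qed

end

lemma norm_Adjoin_0 [simp]: "norm (Adjoin a 0) = norm (a::'a::cstar_algebra)"
proof (rule antisym)
  show "norm (Adjoin a 0) \<le> norm a" using norm_unitization_upper[of "Adjoin a 0"] by simp
  show "norm a \<le> norm (Adjoin a 0)"
    using norm_alg_part_le[of "Adjoin a 0"] by (simp add: norm_unitization_def)
qed

lemma Adjoin_0_simps:
  "Adjoin a 0 + Adjoin b 0 = Adjoin (a + b) (0::complex)" "Adjoin a 0 * Adjoin b 0 = Adjoin (a * b) (0::complex)"
  "star (Adjoin a 0) = Adjoin (star (a::'a::cstar_algebra)) 0"
  by (simp_all add: plus_unitization_def times_unitization_def star_unitization_def)

text \<open>A positive square root of \<open>a\<close> in the unitization has scalar part \<open>0\<close>, as its square has.\<close>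

lemma positive_iff_norm_positive: "positive a \<longleftrightarrow> norm_positive (Adjoin (a::'a::cstar_algebra) 0)"
proof
  assume "positive a"
  then obtain b where "a = star b * b" by (auto simp: positive_def)
  then have "Adjoin a 0 = star (Adjoin b 0) * Adjoin b 0" by (simp add: Adjoin_0_simps)
  then show "norm_positive (Adjoin a 0)" using norm_positive_star_mult_self by metis
next
  assume "norm_positive (Adjoin a 0)"
  then obtain d where d: "norm_positive d" "d * d = Adjoin a 0"
    using norm_positive_sqrt[of "Adjoin a 0"] by metis
  have "scalar_part d = 0" using arg_cong[OF d(2), of scalar_part] by (simp add: times_unitization_def)
  then have "d = Adjoin (alg_part d) 0" by (cases d) simp
  moreover have "star d = d" using d by (simp add: norm_positive_def)
  ultimately have "a = star (alg_part d) * alg_part d"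
    by (metis Adjoin_0_simps(2,3) d(2) unitization.inject)
  then show "positive a" by (auto simp: positive_def)
qed

lemma positive_star_mult_self: "positive (star b * b)"
  by (auto simp: positive_def)

lemma positive_zero: "positive (0::'a::cstar_algebra)"
  using positive_star_mult_self[of "0::'a"] by simp

lemma positive_add: "positive a \<Longrightarrow> positive b \<Longrightarrow> positive (a + b :: 'a::cstar_algebra)"
  using norm_positive_add[of "Adjoin a 0" "Adjoin b 0"]
  by (simp add: positive_iff_norm_positive Adjoin_0_simps)

lemma positive_sum: "(\<And>i. i \<in> I \<Longrightarrow> positive (f i)) \<Longrightarrow> positive (sum f I :: 'a::cstar_algebra)"
  by (induction I rule: infinite_finite_induct) (simp_all add: positive_zero positive_add)

lemma norm_le_add_positive:
  "positive a \<Longrightarrow> positive b \<Longrightarrow> norm a \<le> norm (a + b :: 'a::cstar_algebra)"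
  using norm_le_norm_add_positive[of "Adjoin a 0" "Adjoin b 0"]
  by (simp add: positive_iff_norm_positive Adjoin_0_simps)

text \<open>With \<open>1 - k = (1 - y)\<^sup>2\<close> the element is \<open>(b - y b)\<^sup>* (b - y b)\<close>.\<close>

lemma positive_conjugate_complement:
  fixes k b :: "'a::cstar_algebra"
  assumes "star k = k" "norm k \<le> 1"
  shows "positive (star b * b - star b * k * b)"
proof -
  obtain y where y: "star y = y" "2 *\<^sub>R y = k + y * y"
    using one_minus_sqrt_exists[OF cstar_subalgebra_UNIV _ assms] by blast
  have "star (b - y * b) * (b - y * b) = star b * b - star b * (2 *\<^sub>R y - y * y) * b"
    by (simp add: star_simps y algebra_simps scaleR_2)
  also have "\<dots> = star b * b - star b * k * b" by (simp add: y(2))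
  finally show ?thesis by (metis positive_star_mult_self)
qed

lemma norm_sum_star_mult_self_mono:
  fixes f :: "'i \<Rightarrow> 'a::cstar_algebra"
  assumes "finite J" "I \<subseteq> J"
  shows "norm (\<Sum>i\<in>I. star (f i) * f i) \<le> norm (\<Sum>i\<in>J. star (f i) * f i)"
proof -
  have eq: "(\<Sum>i\<in>J. star (f i) * f i) = (\<Sum>i\<in>I. star (f i) * f i) + (\<Sum>i\<in>J - I. star (f i) * f i)"
    using assms by (metis add.commute sum.subset_diff)
  show ?thesis
    unfolding eq by (intro norm_le_add_positive positive_sum positive_star_mult_self)
qed

text \<open>The Cauchy--Schwarz inequality of the Hilbert module: if \<open>norm \<langle>f, f\<rangle> \<le> 1\<close> and \<open>b = \<langle>f, g\<rangle>\<close>, then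
  \<open>\<langle>g, g\<rangle> = \<langle>g - f b, g - f b\<rangle> + b\<^sup>* b + (b\<^sup>* b - b\<^sup>* \<langle>f, f\<rangle> b)\<close> with positive summands.\<close>

lemma Cauchy_Schwarz_unit:
  fixes f g :: "'i \<Rightarrow> 'a::cstar_algebra"
  assumes 1: "norm (\<Sum>i\<in>I. star (f i) * f i) \<le> 1"
  shows "(norm (\<Sum>i\<in>I. star (f i) * g i))\<^sup>2 \<le> norm (\<Sum>i\<in>I. star (g i) * g i)"
proof -
  define k where "k = (\<Sum>i\<in>I. star (f i) * f i)"
  define b where "b = (\<Sum>i\<in>I. star (f i) * g i)"
  have sk: "star k = k" by (simp add: k_def star_sum star_simps)
  have sb: "star b = (\<Sum>i\<in>I. star (g i) * f i)" by (simp add: b_def star_sum star_simps)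
  have "(\<Sum>i\<in>I. star (g i - f i * b) * (g i - f i * b)) =
     (\<Sum>i\<in>I. star (g i) * g i - star (g i) * f i * b - star b * (star (f i) * g i) + star b * (star (f i) * f i) * b)"
    by (intro sum.cong refl) (simp add: star_simps algebra_simps)
  also have "\<dots> = (\<Sum>i\<in>I. star (g i) * g i) - star b * b - star b * b + star b * k * b"
  proof -
    have "(\<Sum>i\<in>I. star (g i) * f i * b) = star b * b" by (simp add: sb sum_distrib_right)
    moreover have "(\<Sum>i\<in>I. star b * (star (f i) * g i)) = star b * b" by (simp add: b_def sum_distrib_left)
    moreover have "(\<Sum>i\<in>I. star b * (star (f i) * f i) * b) = star b * k * b"
      by (simp only: k_def sum_distrib_left sum_distrib_right)
    ultimately show ?thesis by (simp only: sum.distrib sum_subtractf)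
  qed
  finally have eq: "(\<Sum>i\<in>I. star (g i) * g i) = star b * b +
      ((\<Sum>i\<in>I. star (g i - f i * b) * (g i - f i * b)) + (star b * b - star b * k * b))"
    by simp
  have "norm (star b * b) \<le> norm (\<Sum>i\<in>I. star (g i) * g i)"
    unfolding eq using 1 sk
    by (intro norm_le_add_positive positive_add positive_sum positive_star_mult_self
        positive_conjugate_complement) (simp_all add: k_def)
  then show ?thesis by (simp add: cstar_identity b_def)
qed

text \<open>Dividing \<open>f\<close> by \<open>t\<^sup>1\<^sup>/\<^sup>2\<close> for \<open>t\<close> decreasing to \<open>norm \<langle>f, f\<rangle>\<close>, which may be \<open>0\<close>, reduces to the case above.\<close>

lemma Cauchy_Schwarz_module:
  fixes f g :: "'i \<Rightarrow> 'a::cstar_algebra"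
  shows "(norm (\<Sum>i\<in>I. star (f i) * g i))\<^sup>2
    \<le> norm (\<Sum>i\<in>I. star (f i) * f i) * norm (\<Sum>i\<in>I. star (g i) * g i)"
proof (rule field_le_mult_one_interval)
  fix z :: real assume z: "0 < z" "z < 1"
  show "z * (norm (\<Sum>i\<in>I. star (f i) * g i))\<^sup>2
    \<le> norm (\<Sum>i\<in>I. star (f i) * f i) * norm (\<Sum>i\<in>I. star (g i) * g i)"
  proof -
    have *: "(norm (\<Sum>i\<in>I. star (f i) * g i))\<^sup>2 \<le> t * norm (\<Sum>i\<in>I. star (g i) * g i)"
      if t: "t > 0" "norm (\<Sum>i\<in>I. star (f i) * f i) \<le> t" for t
    proof -
      let ?f = "\<lambda>i. (1 / sqrt t) *\<^sub>R f i"
      have "(\<Sum>i\<in>I. star (?f i) * ?f i) = (1 / t) *\<^sub>R (\<Sum>i\<in>I. star (f i) * f i)"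
        using t by (simp add: star_simps scaleR_sum_right)
      then have "norm (\<Sum>i\<in>I. star (?f i) * ?f i) \<le> 1" using t by simp
      from Cauchy_Schwarz_unit[OF this, of g]
      have "(norm ((1 / sqrt t) *\<^sub>R (\<Sum>i\<in>I. star (f i) * g i)))\<^sup>2 \<le> norm (\<Sum>i\<in>I. star (g i) * g i)"
        by (simp add: star_simps scaleR_sum_right)
      then show ?thesis using t by (simp add: power_divide field_simps)
    qed
    show ?thesis
    proof (cases "norm (\<Sum>i\<in>I. star (f i) * f i) = 0")
      case False
      then have "(norm (\<Sum>i\<in>I. star (f i) * g i))\<^sup>2
        \<le> norm (\<Sum>i\<in>I. star (f i) * f i) * norm (\<Sum>i\<in>I. star (g i) * g i)"
        by (intro *) simp_all
      then show ?thesis using z by (smt (verit) mult_left_le_one_le zero_le_power2)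
    next
      case True
      have "(norm (\<Sum>i\<in>I. star (f i) * g i))\<^sup>2 \<le> 0"
      proof (rule field_le_epsilon)
        fix e :: real assume "e > 0"
        let ?n = "norm (\<Sum>i\<in>I. star (g i) * g i)"
        have "(norm (\<Sum>i\<in>I. star (f i) * g i))\<^sup>2 \<le> e / (?n + 1) * ?n"
          using True \<open>e > 0\<close> by (intro *) (simp_all add: add_nonneg_pos)
        also have "\<dots> = e * (?n / (?n + 1))" by simp
        also have "\<dots> \<le> e" using \<open>e > 0\<close>
          by (intro mult_left_le) (smt (verit) divide_le_eq_1 norm_ge_zero, simp)
        finally show "(norm (\<Sum>i\<in>I. star (f i) * g i))\<^sup>2 \<le> 0 + e" by simp
      qed
      then show ?thesis using True by simp
    qed
  qed
qed

definition star_homomorphism_on :: "'a::cstar_algebra set \<Rightarrow> ('a \<Rightarrow> 'b::cstar_algebra) \<Rightarrow> bool" where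
  "star_homomorphism_on M f \<longleftrightarrow> (\<forall>x\<in>M. \<forall>y\<in>M. f (x + y) = f x + f y \<and> f (x * y) = f x * f y) \<and>
     (\<forall>x\<in>M. f (star x) = star (f x) \<and> (\<forall>r. f (r *\<^sub>R x) = r *\<^sub>R f x))"

text \<open>For \<open>norm a \<le> 1\<close> the relation \<open>1 - a\<^sup>* a = (1 - y)\<^sup>2\<close> is preserved by \<open>f\<close>; it implies
  \<open>h\<^sup>3 \<le> h\<^sup>2\<close>, hence \<open>norm h \<le> 1\<close>, for \<open>h = f (a\<^sup>* a)\<close>.\<close>

lemma star_homomorphism_on_norm_le:
  assumes M: "cstar_subalgebra M" and f: "star_homomorphism_on M f" and a: "a \<in> M"
  shows "norm (f a) \<le> norm a"
proof -
  have fadd: "f (x + y) = f x + f y" and fmult: "f (x * y) = f x * f y" if "x \<in> M" "y \<in> M" for x y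
    using f that by (auto simp: star_homomorphism_on_def)
  have fstar: "f (star x) = star (f x)" and fscale: "f (r *\<^sub>R x) = r *\<^sub>R f x" if "x \<in> M" for x r
    using f that by (auto simp: star_homomorphism_on_def)
  have unit: "norm (f a) \<le> 1" if a: "a \<in> M" and na: "norm a \<le> 1" for a
  proof -
    define h where "h = f (star a * a)"
    have h: "h = star (f a) * f a" using a by (simp add: h_def fmult fstar subalgebra_star[OF M])
    have sh: "star h = h" by (simp add: h star_simps)
    have inM: "star a * a \<in> M" using a M by (simp add: subalgebra_intros)
    have "star (star a * a) = star a * a" "norm (star a * a) \<le> 1"
      using na by (simp_all add: star_simps cstar_identity power_le_one)
    then obtain y where y: "y \<in> M" "star y = y" "2 *\<^sub>R y = star a * a + y * y"
      using one_minus_sqrt_exists[OF M inM] by blast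
    have fy: "2 *\<^sub>R f y = h + f y * f y"
      using arg_cong[OF y(3), of f] inM y(1) M by (simp add: fadd fmult fscale h_def subalgebra_mult)
    have sfy: "star (f y) = f y" using fstar[OF y(1)] y(2) by simp
    have "star (h - f y * h) * (h - f y * h) = h * h - h * (2 *\<^sub>R f y - f y * f y) * h"
      by (simp add: star_simps sfy sh algebra_simps scaleR_2)
    also have "\<dots> = h * h - h * h * h" by (simp add: fy)
    finally have 1: "positive (h * h - h * h * h)" by (metis positive_star_mult_self)
    have "h * h * h = star (f a * h) * (f a * h)" by (simp add: h star_simps mult.assoc)
    then have 2: "positive (h * h * h)" by (metis positive_star_mult_self)
    have 3: "norm (h * h * h) \<le> norm (h * h)" using norm_le_add_positive[OF 2 1] by simp
    have "(norm h)\<^sup>2 * (norm h)\<^sup>2 = norm ((h * h) * (h * h))"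
      using norm_mult_self_adjoint[OF sh] norm_mult_self_adjoint[of "h * h"] sh
      by (simp add: star_mult power2_eq_square)
    also have "\<dots> \<le> norm (h * h * h) * norm h" by (metis norm_mult_ineq mult.assoc)
    also have "\<dots> \<le> (norm h)\<^sup>2 * norm h" using 3 by (simp add: norm_mult_self_adjoint[OF sh] mult_right_mono)
    finally have "norm h \<le> 1"
      by (cases "norm h = 0") (auto simp: power2_eq_square)
    then have "(norm (f a))\<^sup>2 \<le> 1" by (simp add: h cstar_identity)
    then show ?thesis using power2_le_imp_le[of "norm (f a)" 1] by simp
  qed
  show ?thesis
  proof (cases "a = 0")
    case True
    then show ?thesis using fscale[OF a, of 0] by simp
  next
    case False
    have "norm (f ((1 / norm a) *\<^sub>R a)) \<le> 1"
      by (rule unit) (use False a M in \<open>simp_all add: subalgebra_scaleR\<close>)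
    then show ?thesis using False by (simp add: fscale[OF a] divide_simps)
  qed
qed


text \<open>From here on, \<open>truncate\<close> is the truncation of matrices, not the operation of that name on records.\<close>

hide_const (open) ordered_monoid.truncate
hide_fact (open) ordered_monoid.truncate_def

section \<open>The C*-norm of matrix algebras\<close>

definition matvec :: "nat \<Rightarrow> 'a::cstar_algebra imat \<Rightarrow> (nat \<Rightarrow> 'a) \<Rightarrow> nat \<Rightarrow> 'a" where
  "matvec n x \<xi> = (\<lambda>i. \<Sum>j<n. x i j * \<xi> j)"

definition matprod :: "nat \<Rightarrow> 'a::cstar_algebra imat \<Rightarrow> 'a imat \<Rightarrow> 'a imat" where
  "matprod n x y = (\<lambda>i j. \<Sum>k<n. x i k * y k j)"

lemma cscale_sum: "cscale c (sum f I) = (\<Sum>i\<in>I. cscale c (f i :: 'a::cstar_algebra))"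
  by (induction I rule: infinite_finite_induct) (simp_all add: cscale_add_right)

lemma column_norm_nonneg [simp]: "0 \<le> column_norm n \<xi>"
  by (simp add: column_norm_def)

lemma column_norm_power2: "(column_norm n \<xi>)\<^sup>2 = norm (\<Sum>i<n. star (\<xi> i) * \<xi> i)"
  by (simp add: column_norm_def)

lemma column_norm_cong: "(\<And>i. i < n \<Longrightarrow> \<xi> i = \<eta> i) \<Longrightarrow> column_norm n \<xi> = column_norm n \<eta>"
  by (simp add: column_norm_def)

lemma column_Cauchy_Schwarz:
  "norm (\<Sum>i<n. star (\<xi> i) * \<eta> i) \<le> column_norm n \<xi> * column_norm n \<eta>"
proof (rule power2_le_imp_le)
  show "(norm (\<Sum>i<n. star (\<xi> i) * \<eta> i))\<^sup>2 \<le> (column_norm n \<xi> * column_norm n \<eta>)\<^sup>2"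
    unfolding power_mult_distrib column_norm_power2 by (rule Cauchy_Schwarz_module)
qed simp

lemma column_norm_triangle: "column_norm n (\<lambda>i. \<xi> i + \<eta> i) \<le> column_norm n \<xi> + column_norm n \<eta>"
proof (rule power2_le_imp_le)
  let ?ip = "\<lambda>\<xi> \<eta>. \<Sum>i<n. star (\<xi> i) * \<eta> i"
  have "?ip (\<lambda>i. \<xi> i + \<eta> i) (\<lambda>i. \<xi> i + \<eta> i) = ?ip \<xi> \<xi> + ?ip \<xi> \<eta> + ?ip \<eta> \<xi> + ?ip \<eta> \<eta>"
    by (simp add: star_simps algebra_simps sum.distrib)
  then have "(column_norm n (\<lambda>i. \<xi> i + \<eta> i))\<^sup>2 \<le> norm (?ip \<xi> \<xi>) + norm (?ip \<xi> \<eta>) + norm (?ip \<eta> \<xi>) + norm (?ip \<eta> \<eta>)"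
    unfolding column_norm_power2 by (simp only:) (intro norm_triangle_le add_mono order_refl)
  also have "\<dots> \<le> (column_norm n \<xi>)\<^sup>2 + column_norm n \<xi> * column_norm n \<eta> +
      column_norm n \<eta> * column_norm n \<xi> + (column_norm n \<eta>)\<^sup>2"
    unfolding column_norm_power2 by (intro add_mono column_Cauchy_Schwarz order_refl)
  also have "\<dots> = (column_norm n \<xi> + column_norm n \<eta>)\<^sup>2" by (simp add: power2_eq_square algebra_simps)
  finally show "(column_norm n (\<lambda>i. \<xi> i + \<eta> i))\<^sup>2 \<le> (column_norm n \<xi> + column_norm n \<eta>)\<^sup>2" .
qed simp

lemma column_norm_scaleR: "column_norm n (\<lambda>i. r *\<^sub>R \<xi> i) = \<bar>r\<bar> * column_norm n \<xi>"
proof -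
  have "(\<Sum>i<n. star (r *\<^sub>R \<xi> i) * (r *\<^sub>R \<xi> i)) = r\<^sup>2 *\<^sub>R (\<Sum>i<n. star (\<xi> i) * \<xi> i)"
    by (simp add: star_simps scaleR_sum_right power2_eq_square)
  then show ?thesis by (simp add: column_norm_def real_sqrt_mult)
qed

lemma column_norm_cscale: "column_norm n (\<lambda>i. cscale c (\<xi> i)) = cmod c * column_norm n \<xi>"
proof -
  have "(\<Sum>i<n. star (cscale c (\<xi> i)) * cscale c (\<xi> i)) = cscale (c * cnj c) (\<Sum>i<n. star (\<xi> i) * \<xi> i)"
    by (simp add: star_cscale cscale_mult_left cscale_mult_right cscale_cscale cscale_sum)
  then show ?thesis by (simp add: column_norm_def real_sqrt_mult norm_cscale norm_mult)
qed

lemma column_norm_le_sum: "column_norm n \<xi> \<le> (\<Sum>i<n. norm (\<xi> i))"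
proof -
  have "norm (\<Sum>i<n. star (\<xi> i) * \<xi> i) \<le> (\<Sum>i<n. (norm (\<xi> i))\<^sup>2)"
    by (rule order_trans[OF norm_sum]) (simp add: cstar_identity)
  then have "column_norm n \<xi> \<le> L2_set (\<lambda>i. norm (\<xi> i)) {..<n}"
    by (simp add: column_norm_def L2_set_def)
  also have "\<dots> \<le> (\<Sum>i<n. norm (\<xi> i))" by (rule L2_set_le_sum) simp
  finally show ?thesis .
qed

lemma column_norm_mono: "n \<le> m \<Longrightarrow> column_norm n \<xi> \<le> column_norm m \<xi>"
  unfolding column_norm_def by (intro real_sqrt_le_mono norm_sum_star_mult_self_mono) auto

lemma norm_entry_le_column_norm: "i < n \<Longrightarrow> norm (\<xi> i) \<le> column_norm n \<xi>"
proof -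
  assume "i < n"
  then have "norm (\<Sum>i\<in>{i}. star (\<xi> i) * \<xi> i) \<le> norm (\<Sum>i<n. star (\<xi> i) * \<xi> i)"
    by (intro norm_sum_star_mult_self_mono) auto
  then have "(norm (\<xi> i))\<^sup>2 \<le> (column_norm n \<xi>)\<^sup>2" by (simp add: column_norm_power2 cstar_identity)
  then show ?thesis by (rule power2_le_imp_le) simp
qed

lemma column_norm_matvec_le_sum:
  "column_norm n (matvec n x \<xi>) \<le> (\<Sum>i<n. \<Sum>j<n. norm (x i j)) * column_norm n \<xi>"
proof -
  have "norm (matvec n x \<xi> i) \<le> (\<Sum>j<n. norm (x i j)) * column_norm n \<xi>" for i
    unfolding matvec_def sum_distrib_right
    by (rule order_trans[OF norm_sum])
      (auto intro!: sum_mono order_trans[OF norm_mult_ineq] mult_left_mono norm_entry_le_column_norm)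
  then show ?thesis
    unfolding sum_distrib_right[of _ _ "column_norm n \<xi>"]
    by (intro order_trans[OF column_norm_le_sum] sum_mono) (simp add: sum_distrib_right)
qed

lemma matrix_norm_bdd: "bdd_above {column_norm n (\<lambda>i. \<Sum>j<n. x i j * \<xi> j) |\<xi>. column_norm n \<xi> \<le> 1}"
proof (rule bdd_aboveI[of _ "\<Sum>i<n. \<Sum>j<n. norm (x i j)"])
  fix c assume "c \<in> {column_norm n (\<lambda>i. \<Sum>j<n. x i j * \<xi> j) |\<xi>. column_norm n \<xi> \<le> 1}"
  then obtain \<xi> where \<xi>: "c = column_norm n (matvec n x \<xi>)" "column_norm n \<xi> \<le> 1"
    by (auto simp: matvec_def)
  have "c \<le> (\<Sum>i<n. \<Sum>j<n. norm (x i j)) * column_norm n \<xi>"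
    unfolding \<xi> by (rule column_norm_matvec_le_sum)
  also have "\<dots> \<le> (\<Sum>i<n. \<Sum>j<n. norm (x i j))"
    using \<xi>(2) by (intro mult_left_le) (simp_all add: sum_nonneg)
  finally show "c \<le> (\<Sum>i<n. \<Sum>j<n. norm (x i j))" .
qed

lemma column_norm_zero [simp]: "column_norm n (\<lambda>_. 0) = 0"
  by (simp add: column_norm_def)

lemma matrix_norm_nonneg [simp]: "0 \<le> matrix_norm n x"
proof -
  have "column_norm n (\<lambda>i. \<Sum>j<n. x i j * (\<lambda>_. 0) j) \<le> matrix_norm n x"
    unfolding matrix_norm_def by (rule cSup_upper[OF _ matrix_norm_bdd], rule CollectI) (intro exI[of _ "\<lambda>_. 0"], simp)
  then show ?thesis by simp
qed

lemma column_norm_matvec_le: "column_norm n (matvec n x \<xi>) \<le> matrix_norm n x * column_norm n \<xi>"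
proof (cases "column_norm n \<xi> = 0")
  case True
  then have "\<xi> i = 0" if "i < n" for i using norm_entry_le_column_norm[OF that, of \<xi>] by simp
  then have "matvec n x \<xi> = (\<lambda>_. 0)" by (auto simp: matvec_def)
  then show ?thesis by (simp add: True)
next
  case False
  let ?c = "column_norm n \<xi>"
  have c: "?c > 0" using False by (simp add: order_less_le)
  let ?\<xi> = "\<lambda>i. (1 / ?c) *\<^sub>R \<xi> i"
  have "column_norm n ?\<xi> \<le> 1" using c unfolding column_norm_scaleR by simp
  then have "column_norm n (matvec n x ?\<xi>) \<le> matrix_norm n x"
    unfolding matrix_norm_def
    by (intro cSup_upper[OF _ matrix_norm_bdd] CollectI exI[of _ ?\<xi>]) (simp add: matvec_def)
  moreover have "matvec n x ?\<xi> = (\<lambda>i. (1 / ?c) *\<^sub>R matvec n x \<xi> i)"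
    by (simp add: matvec_def scaleR_sum_right)
  ultimately show ?thesis using c by (simp add: column_norm_scaleR field_simps)
qed

lemma matrix_norm_leI:
  assumes "0 \<le> K" "\<And>\<xi>. column_norm n (matvec n x \<xi>) \<le> K * column_norm n \<xi>"
  shows "matrix_norm n x \<le> K"
  unfolding matrix_norm_def
proof (rule cSup_least)
  have "column_norm n (\<lambda>_. 0 :: 'a) \<le> 1" by simp
  then show "{column_norm n (\<lambda>i. \<Sum>j<n. x i j * \<xi> j) |\<xi>. column_norm n \<xi> \<le> 1} \<noteq> {}" by blast
  fix c assume "c \<in> {column_norm n (\<lambda>i. \<Sum>j<n. x i j * \<xi> j) |\<xi>. column_norm n \<xi> \<le> 1}"
  then obtain \<xi> where \<xi>: "c = column_norm n (matvec n x \<xi>)" "column_norm n \<xi> \<le> 1"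
    by (auto simp: matvec_def)
  then show "c \<le> K" using assms(2)[of \<xi>] mult_left_le[OF \<xi>(2) assms(1)] by simp
qed

lemma matrix_norm_cong:
  "(\<And>i j. i < n \<Longrightarrow> j < n \<Longrightarrow> x i j = y i j) \<Longrightarrow> matrix_norm n x = matrix_norm n y"
  unfolding matrix_norm_def by (intro arg_cong[where f = Sup] Collect_cong ex_cong1)
    (auto intro!: column_norm_cong sum.cong simp: column_norm_def)

lemma matrix_norm_le_sum: "matrix_norm n x \<le> (\<Sum>i<n. \<Sum>j<n. norm (x i j))"
  by (rule matrix_norm_leI) (simp_all add: sum_nonneg column_norm_matvec_le_sum)

text \<open>The test column whose only nonzero entry is \<open>(x\<^sub>i\<^sub>j)\<^sup>*\<close>, in row \<open>j\<close>, is mapped to one with entry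
  \<open>x\<^sub>i\<^sub>j (x\<^sub>i\<^sub>j)\<^sup>*\<close> in row \<open>i\<close>.\<close>

lemma norm_entry_le_matrix_norm:
  assumes "i < n" "j < n" shows "norm (x i j) \<le> matrix_norm n x"
proof -
  define \<xi> where "\<xi> k = (if k = j then star (x i j) else 0)" for k
  have "(\<Sum>k<n. star (\<xi> k) * \<xi> k) = (\<Sum>k<n. if k = j then x i j * star (x i j) else 0)"
    by (rule sum.cong) (auto simp: \<xi>_def star_star)
  then have 1: "column_norm n \<xi> = norm (x i j)"
    using assms cstar_identity[of "star (x i j)"] by (simp add: column_norm_def star_star)
  have "matvec n x \<xi> i = (\<Sum>k<n. if k = j then x i j * star (x i j) else 0)"
    unfolding matvec_def by (rule sum.cong) (auto simp: \<xi>_def)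
  then have "matvec n x \<xi> i = x i j * star (x i j)" using assms by simp
  then have "norm (x i j) * norm (x i j) \<le> matrix_norm n x * norm (x i j)"
    using norm_entry_le_column_norm[OF assms(1), of "matvec n x \<xi>"] column_norm_matvec_le[of n x \<xi>]
      cstar_identity[of "star (x i j)"] by (simp add: 1 star_star power2_eq_square)
  then show ?thesis by (cases "x i j = 0") simp_all
qed

lemma matrix_norm_triangle: "matrix_norm n (\<lambda>i j. x i j + y i j) \<le> matrix_norm n x + matrix_norm n y"
proof (rule matrix_norm_leI)
  fix \<xi>
  have "matvec n (\<lambda>i j. x i j + y i j) \<xi> = (\<lambda>i. matvec n x \<xi> i + matvec n y \<xi> i)"
    by (simp add: matvec_def algebra_simps sum.distrib)
  then show "column_norm n (matvec n (\<lambda>i j. x i j + y i j) \<xi>) \<le> (matrix_norm n x + matrix_norm n y) * column_norm n \<xi>"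
    using column_norm_triangle[of n "matvec n x \<xi>" "matvec n y \<xi>"] column_norm_matvec_le[of n x \<xi>]
      column_norm_matvec_le[of n y \<xi>] by (simp add: algebra_simps)
qed simp

lemma matrix_norm_cscale: "matrix_norm n (\<lambda>i j. cscale c (x i j)) = cmod c * matrix_norm n x"
proof -
  have le: "matrix_norm n (\<lambda>i j. cscale c (x i j)) \<le> cmod c * matrix_norm n x" for c and x :: "'a imat"
  proof (rule matrix_norm_leI)
    fix \<xi>
    have "matvec n (\<lambda>i j. cscale c (x i j)) \<xi> = (\<lambda>i. cscale c (matvec n x \<xi> i))"
      by (simp add: matvec_def cscale_mult_left cscale_sum)
    then show "column_norm n (matvec n (\<lambda>i j. cscale c (x i j)) \<xi>) \<le> cmod c * matrix_norm n x * column_norm n \<xi>"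
      using column_norm_matvec_le[of n x \<xi>] by (simp add: column_norm_cscale mult.assoc mult_left_mono)
  qed simp
  show ?thesis
  proof (cases "c = 0")
    case True
    then show ?thesis using le[of 0 x] by (auto intro!: order_antisym)
  next
    case False
    have "matrix_norm n x \<le> inverse (cmod c) * matrix_norm n (\<lambda>i j. cscale c (x i j))"
      using le[of "inverse c" "\<lambda>i j. cscale c (x i j)"] False by (simp add: cscale_cscale norm_inverse)
    then have "cmod c * matrix_norm n x \<le> matrix_norm n (\<lambda>i j. cscale c (x i j))"
      using False by (simp add: field_simps)
    then show ?thesis using le[of c x] by simp
  qed
qed

lemma matrix_norm_scaleR: "matrix_norm n (\<lambda>i j. r *\<^sub>R x i j) = \<bar>r\<bar> * matrix_norm n x"
  using matrix_norm_cscale[of n "complex_of_real r" x] by (simp add: cscale_of_real)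

lemma matvec_matprod: "matvec n (matprod n x y) \<xi> = matvec n x (matvec n y \<xi>)"
proof
  fix i
  have "matvec n (matprod n x y) \<xi> i = (\<Sum>j<n. \<Sum>k<n. x i k * (y k j * \<xi> j))"
    by (simp add: matvec_def matprod_def sum_distrib_right mult.assoc)
  also have "\<dots> = matvec n x (matvec n y \<xi>) i"
    by (subst sum.swap) (simp add: matvec_def sum_distrib_left)
  finally show "matvec n (matprod n x y) \<xi> i = matvec n x (matvec n y \<xi>) i" .
qed

lemma matrix_norm_matprod: "matrix_norm n (matprod n x y) \<le> matrix_norm n x * matrix_norm n y"
proof (rule matrix_norm_leI)
  fix \<xi>
  have "column_norm n (matvec n (matprod n x y) \<xi>) \<le> matrix_norm n x * column_norm n (matvec n y \<xi>)"
    unfolding matvec_matprod by (rule column_norm_matvec_le)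
  also have "\<dots> \<le> matrix_norm n x * (matrix_norm n y * column_norm n \<xi>)"
    by (intro mult_left_mono column_norm_matvec_le) simp
  finally show "column_norm n (matvec n (matprod n x y) \<xi>) \<le> matrix_norm n x * matrix_norm n y * column_norm n \<xi>"
    by (simp add: mult.assoc)
qed simp

lemma inner_matvec: "(\<Sum>i<n. star (matvec n x \<xi> i) * \<eta> i) = (\<Sum>i<n. star (\<xi> i) * matvec n (imat_star x) \<eta> i)"
proof -
  have "(\<Sum>i<n. star (matvec n x \<xi> i) * \<eta> i) = (\<Sum>i<n. \<Sum>j<n. star (\<xi> j) * (star (x i j) * \<eta> i))"
    by (simp add: matvec_def star_sum star_mult sum_distrib_right mult.assoc)
  also have "\<dots> = (\<Sum>i<n. star (\<xi> i) * matvec n (imat_star x) \<eta> i)"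
    by (subst sum.swap) (simp add: matvec_def imat_star_def sum_distrib_left)
  finally show ?thesis .
qed

text \<open>The matrix \<open>x\<^sup>*\<close> is adjoint to \<open>x\<close> for the inner product of columns, so this is Cauchy--Schwarz, as for
  operators on a Hilbert space.\<close>

lemma matrix_norm_power2_le: "(matrix_norm n x)\<^sup>2 \<le> matrix_norm n (matprod n (imat_star x) x)"
proof -
  let ?K = "matrix_norm n (matprod n (imat_star x) x)"
  have "matrix_norm n x \<le> sqrt ?K"
  proof (rule matrix_norm_leI)
    fix \<xi>
    have "(column_norm n (matvec n x \<xi>))\<^sup>2 = norm (\<Sum>i<n. star (\<xi> i) * matvec n (matprod n (imat_star x) x) \<xi> i)"
      by (simp add: column_norm_power2 inner_matvec matvec_matprod)
    also have "\<dots> \<le> column_norm n \<xi> * (?K * column_norm n \<xi>)"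
      by (intro order_trans[OF column_Cauchy_Schwarz] mult_left_mono column_norm_matvec_le) simp
    also have "\<dots> = (sqrt ?K * column_norm n \<xi>)\<^sup>2" by (simp add: power2_eq_square)
    finally show "column_norm n (matvec n x \<xi>) \<le> sqrt ?K * column_norm n \<xi>"
      by (rule power2_le_imp_le) simp
  qed simp
  then show ?thesis by (metis matrix_norm_nonneg power_mono real_sqrt_pow2)
qed

lemma imat_star_imat_star [simp]: "imat_star (imat_star x) = x"
  by (simp add: imat_star_def star_star)

lemma matrix_norm_star: "matrix_norm n (imat_star x) = matrix_norm n x"
proof -
  have le: "matrix_norm n x \<le> matrix_norm n (imat_star x)" for x :: "'a imat"
  proof (cases "matrix_norm n x = 0")
    case False
    have "matrix_norm n x * matrix_norm n x \<le> matrix_norm n (imat_star x) * matrix_norm n x"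
      using matrix_norm_power2_le[of n x] matrix_norm_matprod[of n "imat_star x" x] by (simp add: power2_eq_square)
    with False show ?thesis by (simp add: order_less_le)
  qed simp
  show ?thesis using le[of x] le[of "imat_star x"] by simp
qed

lemma matrix_norm_cstar_identity: "matrix_norm n (matprod n (imat_star x) x) = (matrix_norm n x)\<^sup>2"
  using matrix_norm_power2_le[of n x] matrix_norm_matprod[of n "imat_star x" x]
  by (simp add: matrix_norm_star power2_eq_square)

lemma matrix_norm_mono: assumes "n \<le> m" shows "matrix_norm n x \<le> matrix_norm m x"
proof (rule matrix_norm_leI)
  fix \<xi> :: "nat \<Rightarrow> 'a"
  define \<eta> where "\<eta> i = (if i < n then \<xi> i else 0)" for i
  have "(\<Sum>i<m. star (\<eta> i) * \<eta> i) = (\<Sum>i<n. star (\<xi> i) * \<xi> i)"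
    using assms by (intro sum.mono_neutral_cong_right) (auto simp: \<eta>_def)
  then have 1: "column_norm m \<eta> = column_norm n \<xi>" by (simp add: column_norm_def)
  have "matvec m x \<eta> = matvec n x \<xi>"
    unfolding matvec_def using assms
    by (intro ext sum.mono_neutral_cong_right) (auto simp: \<eta>_def)
  then show "column_norm n (matvec n x \<xi>) \<le> matrix_norm m x * column_norm n \<xi>"
    using column_norm_matvec_le[of m x \<eta>] column_norm_mono[OF assms, of "matvec n x \<xi>"] by (simp add: 1)
qed simp

lemma matrix_norm_truncate: "n \<le> m \<Longrightarrow> matrix_norm n (truncate m x) = matrix_norm n x"
  by (rule matrix_norm_cong) (simp add: truncate_def)

lemma matrix_norm_truncate_le: assumes "n \<le> m" shows "matrix_norm m (truncate n x) \<le> matrix_norm n x"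
proof (rule matrix_norm_leI)
  fix \<xi> :: "nat \<Rightarrow> 'a"
  have eq: "matvec m (truncate n x) \<xi> i = (if i < n then matvec n x \<xi> i else 0)" for i
    unfolding matvec_def truncate_def using assms
    by (auto intro!: sum.mono_neutral_cong_right sum.neutral split: if_splits)
  have "(\<Sum>i<m. star (matvec m (truncate n x) \<xi> i) * matvec m (truncate n x) \<xi> i)
      = (\<Sum>i<n. star (matvec n x \<xi> i) * matvec n x \<xi> i)"
    unfolding eq using assms by (intro sum.mono_neutral_cong_right) auto
  then have "column_norm m (matvec m (truncate n x) \<xi>) = column_norm n (matvec n x \<xi>)"
    by (simp add: column_norm_def)
  also have "\<dots> \<le> matrix_norm n x * column_norm m \<xi>"
    by (intro order_trans[OF column_norm_matvec_le] mult_left_mono column_norm_mono assms) simp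
  finally show "column_norm m (matvec m (truncate n x) \<xi>) \<le> matrix_norm n x * column_norm m \<xi>" .
qed simp


section \<open>The stabilization as a C*-algebra\<close>

definition tail :: "nat \<Rightarrow> 'a::cstar_algebra imat \<Rightarrow> 'a imat" where
  "tail n x = (\<lambda>i j. x i j - truncate n x i j)"

lemma tail_add: "tail n (\<lambda>i j. x i j + y i j) = (\<lambda>i j. tail n x i j + tail n y i j)"
  and tail_cscale: "tail n (\<lambda>i j. cscale c (x i j)) = (\<lambda>i j. cscale c (tail n x i j))"
  and tail_star: "tail n (imat_star x) = imat_star (tail n x)"
  by (auto simp: tail_def truncate_def fun_eq_iff imat_star_def)

text \<open>Norms of submatrices increase with the size, so the truncation to size \<open>m\<close> can be dropped from the Cauchy
  condition.  The tails that are left depend additively on \<open>x\<close>.\<close>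

lemma stabilization_iff_tail:
  "x \<in> stabilization S \<longleftrightarrow> (\<forall>i j. x i j \<in> S) \<and> (\<forall>\<epsilon>>0. \<exists>N. \<forall>n\<ge>N. \<forall>m. matrix_norm m (tail n x) < \<epsilon>)"
proof -
  have eq: "matrix_norm m (\<lambda>i j. truncate m x i j - truncate n x i j) = matrix_norm m (tail n x)" for m n
    by (rule matrix_norm_cong) (simp add: tail_def truncate_def)
  have "(\<forall>m\<ge>n. matrix_norm m (tail n x) < \<epsilon>) \<longleftrightarrow> (\<forall>m. matrix_norm m (tail n x) < \<epsilon>)" for n \<epsilon>
    by (meson le_less_trans matrix_norm_mono nle_le)
  then show ?thesis by (simp only: stabilization_def mem_Collect_eq eq)
qed

lemma matrix_algebra_subset_stabilization: "matrix_algebra n S \<subseteq> stabilization S"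
proof
  fix x assume x: "x \<in> matrix_algebra n S"
  have "tail k x = (\<lambda>i j. 0)" if "k \<ge> n" for k
    using x that by (auto simp: tail_def truncate_def matrix_algebra_def fun_eq_iff)
  moreover have "matrix_norm m (\<lambda>i j. 0 :: 'a) = 0" for m
    using matrix_norm_cscale[of m 0 "\<lambda>i j. 0 :: 'a"] by simp
  ultimately show "x \<in> stabilization S"
    using x by (auto simp: stabilization_iff_tail matrix_algebra_def intro!: exI[of _ n])
qed

lemma zero_in_matrix_algebra: "0 \<in> S \<Longrightarrow> (\<lambda>i j. 0) \<in> matrix_algebra n S"
  by (simp add: matrix_algebra_def)

text \<open>As a type, \<open>A \<otimes> K\<close> becomes an instance of the class of C*-algebras, and everything proved for
  projections in C*-algebras applies to it.\<close>

typedef (overloaded) ('a::cstar_algebra) stab = "stabilization (UNIV :: 'a set)"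
  morphisms entry Stab
  using matrix_algebra_subset_stabilization[of 0 UNIV] zero_in_matrix_algebra[of UNIV 0] by blast

lemma stab_eqI: "(\<And>i j. entry x i j = entry y i j) \<Longrightarrow> x = y"
  by (metis entry_inject ext)

lemma entry_Stab: "x \<in> stabilization UNIV \<Longrightarrow> entry (Stab x) i j = x i j"
  by (simp add: Stab_inverse)

lemma stabilization_add:
  assumes "x \<in> stabilization UNIV" "y \<in> stabilization UNIV"
  shows "(\<lambda>i j. x i j + y i j) \<in> stabilization UNIV"
  unfolding stabilization_iff_tail
proof (intro conjI allI impI)
  fix \<epsilon> :: real assume "\<epsilon> > 0"
  then have "\<epsilon> / 2 > 0" by simp
  then obtain N M where N: "\<And>n m. n \<ge> N \<Longrightarrow> matrix_norm m (tail n x) < \<epsilon> / 2"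
    and M: "\<And>n m. n \<ge> M \<Longrightarrow> matrix_norm m (tail n y) < \<epsilon> / 2"
    using assms unfolding stabilization_iff_tail by meson
  have "matrix_norm m (tail n (\<lambda>i j. x i j + y i j)) < \<epsilon>" if "n \<ge> max N M" for n m
    using matrix_norm_triangle[of m "tail n x" "tail n y"] N[of n m] M[of n m] that by (simp add: tail_add)
  then show "\<exists>N. \<forall>n\<ge>N. \<forall>m. matrix_norm m (tail n (\<lambda>i j. x i j + y i j)) < \<epsilon>" by blast
qed simp

lemma stabilization_cscale:
  assumes "x \<in> stabilization UNIV"
  shows "(\<lambda>i j. cscale c (x i j)) \<in> stabilization UNIV"
  unfolding stabilization_iff_tail
proof (intro conjI allI impI)
  fix \<epsilon> :: real assume "\<epsilon> > 0"
  then have "\<epsilon> / (cmod c + 1) > 0" by (simp add: add_nonneg_pos)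
  then obtain N where N: "\<And>n m. n \<ge> N \<Longrightarrow> matrix_norm m (tail n x) < \<epsilon> / (cmod c + 1)"
    using assms unfolding stabilization_iff_tail by meson
  have "matrix_norm m (tail n (\<lambda>i j. cscale c (x i j))) < \<epsilon>" if "n \<ge> N" for n m
  proof -
    have "cmod c * matrix_norm m (tail n x) \<le> (cmod c + 1) * matrix_norm m (tail n x)"
      by (simp add: mult_right_mono)
    also have "\<dots> < \<epsilon>"
      using N[OF that, of m] add_nonneg_pos[OF norm_ge_zero[of c] zero_less_one]
      by (simp only: pos_less_divide_eq) (simp add: mult.commute)
    finally show ?thesis by (simp add: tail_cscale matrix_norm_cscale)
  qed
  then show "\<exists>N. \<forall>n\<ge>N. \<forall>m. matrix_norm m (tail n (\<lambda>i j. cscale c (x i j))) < \<epsilon>" by blast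
qed simp

lemma stabilization_star: "x \<in> stabilization UNIV \<Longrightarrow> imat_star x \<in> stabilization UNIV"
  by (simp add: stabilization_iff_tail tail_star matrix_norm_star)

lemma bdd_above_matrix_norm:
  assumes "x \<in> stabilization UNIV" shows "bdd_above (range (\<lambda>m. matrix_norm m x))"
proof -
  obtain N where N: "\<And>m. matrix_norm m (tail N x) < 1"
    using assms unfolding stabilization_iff_tail by (meson order_refl zero_less_one)
  have "matrix_norm m x \<le> 1 + matrix_norm N x" for m
  proof (cases "m \<le> N")
    case True
    then show ?thesis using matrix_norm_mono[OF True, of x] by simp
  next
    case False
    have "x = (\<lambda>i j. tail N x i j + truncate N x i j)" by (simp add: tail_def)
    then have "matrix_norm m x \<le> matrix_norm m (tail N x) + matrix_norm m (truncate N x)"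
      using matrix_norm_triangle by metis
    then show ?thesis using N[of m] matrix_norm_truncate_le[of N m x] False by simp
  qed
  then show ?thesis by (auto intro!: bdd_aboveI2)
qed

instantiation stab :: (cstar_algebra) real_normed_vector
begin

definition "0 = Stab (\<lambda>i j. 0 :: 'a)"
definition "x + y = Stab (\<lambda>i j. entry x i j + entry y i j :: 'a)"
definition "- x = Stab (\<lambda>i j. - entry x i j :: 'a)"
definition "x - y = Stab (\<lambda>i j. entry x i j - entry y i j :: 'a)"
definition "r *\<^sub>R x = Stab (\<lambda>i j. r *\<^sub>R entry x i j :: 'a)"
definition "norm (x :: 'a stab) = (SUP m. matrix_norm m (entry x))"
definition "sgn (x :: 'a stab) = inverse (norm x) *\<^sub>R x"
definition "dist (x :: 'a stab) y = norm (x - y)"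
definition "(uniformity :: ('a stab \<times> 'a stab) filter) =
  (INF e\<in>{0<..}. principal {(x, y). dist x y < e})"
definition "open (U :: 'a stab set) \<longleftrightarrow>
  (\<forall>x\<in>U. eventually (\<lambda>(x', y). x' = x \<longrightarrow> y \<in> U) uniformity)"

lemma entry_zero [simp]: "entry (0 :: 'a stab) i j = 0"
  using matrix_algebra_subset_stabilization[of 0 UNIV] zero_in_matrix_algebra[of UNIV 0]
  unfolding zero_stab_def by (subst entry_Stab) auto

lemma entry_add [simp]: "entry (x + y :: 'a stab) i j = entry x i j + entry y i j"
  unfolding plus_stab_def by (rule entry_Stab[OF stabilization_add[OF entry entry]])

lemma entry_minus [simp]: "entry (- x :: 'a stab) i j = - entry x i j"
  using stabilization_cscale[OF entry[of x], of "-1"]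
  unfolding uminus_stab_def by (subst entry_Stab) (simp_all add: cscale_minus_left)

lemma entry_diff [simp]: "entry (x - y :: 'a stab) i j = entry x i j - entry y i j"
  using stabilization_add[OF entry[of x] entry[of "- y"]]
  unfolding minus_stab_def by (subst entry_Stab) simp_all

lemma entry_scaleR [simp]: "entry (r *\<^sub>R x :: 'a stab) i j = r *\<^sub>R entry x i j"
  using stabilization_cscale[OF entry[of x], of "complex_of_real r"]
  unfolding scaleR_stab_def by (subst entry_Stab) (simp_all add: cscale_of_real)

lemma matrix_norm_le_norm: "matrix_norm m (entry x) \<le> norm (x :: 'a stab)"
  unfolding norm_stab_def by (rule cSUP_upper[OF UNIV_I bdd_above_matrix_norm[OF entry]])

lemma norm_stab_leI: "(\<And>m. matrix_norm m (entry x) \<le> K) \<Longrightarrow> norm (x :: 'a stab) \<le> K"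
  unfolding norm_stab_def by (rule cSUP_least) auto

lemma norm_entry_le: "norm (entry x i j) \<le> norm (x :: 'a stab)"
  by (rule order_trans[OF norm_entry_le_matrix_norm[of i "Suc (max i j)"] matrix_norm_le_norm]) auto

instance
proof
  fix x y z :: "'a stab" and r s :: real
  show "x + y + z = x + (y + z)" "x + y = y + x" "0 + x = x" "- x + x = 0" "x - y = x + - y"
    by (rule stab_eqI; simp)+
  show "r *\<^sub>R (x + y) = r *\<^sub>R x + r *\<^sub>R y" "(r + s) *\<^sub>R x = r *\<^sub>R x + s *\<^sub>R x"
    "r *\<^sub>R s *\<^sub>R x = (r * s) *\<^sub>R x" "1 *\<^sub>R x = x"
    by (rule stab_eqI; simp add: algebra_simps)+
  show "sgn x = inverse (norm x) *\<^sub>R x" "dist x y = norm (x - y)"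
    by (simp_all add: sgn_stab_def dist_stab_def)
  show "uniformity = (INF e\<in>{0<..}. principal {(x, y). dist x (y :: 'a stab) < e})"
    by (fact uniformity_stab_def)
  show "open U \<longleftrightarrow> (\<forall>x\<in>U. eventually (\<lambda>(x', y). x' = x \<longrightarrow> y \<in> U) uniformity)"
    for U :: "'a stab set" by (fact open_stab_def)
  show "norm x = 0 \<longleftrightarrow> x = 0"
  proof
    assume "norm x = 0"
    then have "entry x i j = 0" for i j using norm_entry_le[of x i j] by simp
    then show "x = 0" by (intro stab_eqI) simp
  next
    assume "x = 0"
    then have "matrix_norm m (entry x) \<le> 0" for m
      using matrix_norm_le_sum[of m "entry x"] by simp
    then have "norm x \<le> 0" by (rule norm_stab_leI)
    moreover have "norm x \<ge> 0" using matrix_norm_le_norm[of 0 x] matrix_norm_nonneg order_trans by blast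
    ultimately show "norm x = 0" by simp
  qed
  show "norm (x + y) \<le> norm x + norm y"
  proof (rule norm_stab_leI)
    fix m
    have "entry (x + y) = (\<lambda>i j. entry x i j + entry y i j)" by (simp add: fun_eq_iff)
    then show "matrix_norm m (entry (x + y)) \<le> norm x + norm y"
      using matrix_norm_triangle[of m "entry x" "entry y"] matrix_norm_le_norm[of m x] matrix_norm_le_norm[of m y] by simp
  qed
  have le: "norm (r *\<^sub>R x) \<le> \<bar>r\<bar> * norm x" for r and x :: "'a stab"
  proof (rule norm_stab_leI)
    fix m
    have "entry (r *\<^sub>R x) = (\<lambda>i j. r *\<^sub>R entry x i j)" by (simp add: fun_eq_iff)
    then show "matrix_norm m (entry (r *\<^sub>R x)) \<le> \<bar>r\<bar> * norm x"
      by (simp add: matrix_norm_scaleR mult_left_mono matrix_norm_le_norm)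
  qed
  show "norm (r *\<^sub>R x) = \<bar>r\<bar> * norm x"
  proof (cases "r = 0")
    case True
    have "norm (r *\<^sub>R x) \<ge> 0" using matrix_norm_le_norm[of 0 "r *\<^sub>R x"] matrix_norm_nonneg order_trans by blast
    then show ?thesis using le[of r x] True by simp
  next
    case False
    have "inverse r *\<^sub>R r *\<^sub>R x = x" using False by (intro stab_eqI) simp
    then have "norm x \<le> \<bar>inverse r\<bar> * norm (r *\<^sub>R x)" using le[of "inverse r" "r *\<^sub>R x"] by simp
    then show ?thesis using le[of r x] False by (simp add: field_simps)
  qed
qed

end

lemma norm_stab_le_iff: "norm (x :: 'a::cstar_algebra stab) \<le> K \<longleftrightarrow> (\<forall>m. matrix_norm m (entry x) \<le> K)"
  using matrix_norm_le_norm norm_stab_leI order_trans by metis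

lemma entry_sum: "entry (sum f I) i j = (\<Sum>k\<in>I. entry (f k :: 'a::cstar_algebra stab) i j)"
  by (induction I rule: infinite_finite_induct) simp_all

lemma bounded_linear_entry: "bounded_linear (\<lambda>x :: 'a::cstar_algebra stab. entry x i j)"
  by (rule bounded_linear_intro[where K = 1]) (simp_all add: norm_entry_le)

lemmas tendsto_entry = bounded_linear.tendsto[OF bounded_linear_entry]

definition stab_finite :: "nat \<Rightarrow> 'a::cstar_algebra stab \<Rightarrow> bool" where
  "stab_finite n x \<longleftrightarrow> entry x \<in> matrix_algebra n UNIV"

lemma stab_finite_iff: "stab_finite n x \<longleftrightarrow> (\<forall>i j. \<not> (i < n \<and> j < n) \<longrightarrow> entry x i j = 0)"
  by (simp add: stab_finite_def matrix_algebra_def)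

lemma stab_finite_entry_0: "stab_finite n x \<Longrightarrow> i \<ge> n \<or> j \<ge> n \<Longrightarrow> entry x i j = 0"
  by (auto simp: stab_finite_iff)

lemma stab_finite_mono: "stab_finite n x \<Longrightarrow> n \<le> m \<Longrightarrow> stab_finite m x"
  by (auto simp: stab_finite_iff)

lemma entry_Stab_finite: "x \<in> matrix_algebra n UNIV \<Longrightarrow> entry (Stab x) = x"
  using matrix_algebra_subset_stabilization by (intro Stab_inverse) blast

lemma norm_stab_finite: assumes "stab_finite n x" shows "norm x = matrix_norm n (entry x)"
proof (rule antisym[OF norm_stab_leI matrix_norm_le_norm])
  fix m
  have x: "entry x = truncate n (entry x)"
    using assms by (auto simp: fun_eq_iff truncate_def stab_finite_entry_0)
  show "matrix_norm m (entry x) \<le> matrix_norm n (entry x)"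
  proof (cases "m \<le> n")
    case False
    then show ?thesis using matrix_norm_truncate_le[of n m "entry x"] x by simp
  qed (rule matrix_norm_mono)
qed

lemma norm_stab_finite_le_sum: "stab_finite n x \<Longrightarrow> norm x \<le> (\<Sum>i<n. \<Sum>j<n. norm (entry x i j))"
  by (simp add: norm_stab_finite matrix_norm_le_sum)

definition stab_trunc :: "nat \<Rightarrow> 'a::cstar_algebra stab \<Rightarrow> 'a stab" where
  "stab_trunc n x = Stab (truncate n (entry x))"

lemma entry_stab_trunc: "entry (stab_trunc n x) = truncate n (entry x)"
  unfolding stab_trunc_def
  by (rule entry_Stab_finite[of _ n]) (auto simp: matrix_algebra_def truncate_def)

lemma stab_finite_trunc [simp]: "stab_finite n (stab_trunc n x)"
  by (auto simp: stab_finite_iff entry_stab_trunc truncate_def)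

lemma norm_stab_trunc_le: "norm (stab_trunc n x) \<le> norm x"
  by (simp add: norm_stab_finite[OF stab_finite_trunc] entry_stab_trunc matrix_norm_truncate matrix_norm_le_norm)

lemma entry_minus_trunc: "entry (x - stab_trunc n x) = tail n (entry x)"
  by (simp add: fun_eq_iff tail_def entry_stab_trunc)

lemma stab_trunc_tendsto: "(\<lambda>n. stab_trunc n x) \<longlonglongrightarrow> x"
proof (rule LIMSEQ_I)
  fix r :: real assume "r > 0"
  then have "r / 2 > 0" by simp
  then obtain N where N: "\<And>n m. n \<ge> N \<Longrightarrow> matrix_norm m (tail n (entry x)) < r / 2"
    using entry[of x] unfolding stabilization_iff_tail by meson
  have "norm (stab_trunc n x - x) < r" if "n \<ge> N" for n
  proof -
    have "norm (x - stab_trunc n x) \<le> r / 2"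
      unfolding norm_stab_le_iff entry_minus_trunc using N[OF that] less_imp_le by blast
    then show ?thesis using \<open>r > 0\<close> by (simp add: norm_minus_commute)
  qed
  then show "\<exists>N. \<forall>n\<ge>N. norm (stab_trunc n x - x) < r" by blast
qed

text \<open>Entries converge, and the matrix \<open>L\<close> of the limits is uniformly close to a member \<open>X\<^sub>K\<close> of the sequence; so the
  tails of \<open>L\<close> are small because those of \<open>X\<^sub>K\<close> are.\<close>

instance stab :: (cstar_algebra) banach
proof
  fix X :: "nat \<Rightarrow> 'a stab"
  assume C: "Cauchy X"
  have "Cauchy (\<lambda>k. entry (X k) i j)" for i j
    by (rule bounded_linear.Cauchy[OF bounded_linear_entry C])
  then have "\<forall>i j. \<exists>l. (\<lambda>k. entry (X k) i j) \<longlonglongrightarrow> l"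
    using Cauchy_convergent_iff convergent_def by blast
  then obtain L where L: "\<And>i j. (\<lambda>k. entry (X k) i j) \<longlonglongrightarrow> L i j" by metis
  have lim: "(\<lambda>k. matrix_norm m (\<lambda>i j. entry (X k) i j - L i j)) \<longlonglongrightarrow> 0" for m
  proof (rule tendsto_sandwich[OF _ _ tendsto_const])
    have "(\<lambda>k. \<Sum>i<m. \<Sum>j<m. norm (entry (X k) i j - L i j)) \<longlonglongrightarrow> (\<Sum>i<m. \<Sum>j<m. 0)"
      by (intro tendsto_sum tendsto_norm_zero) (simp add: LIM_zero_iff L)
    then show "(\<lambda>k. \<Sum>i<m. \<Sum>j<m. norm (entry (X k) i j - L i j)) \<longlonglongrightarrow> 0" by simp
  qed (auto intro!: always_eventually matrix_norm_le_sum)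
  have close: "\<exists>K. \<forall>k\<ge>K. \<forall>m. matrix_norm m (\<lambda>i j. entry (X k) i j - L i j) \<le> e" if "e > 0" for e
  proof -
    obtain K where K: "\<And>k l. k \<ge> K \<Longrightarrow> l \<ge> K \<Longrightarrow> norm (X k - X l) < e"
      using CauchyD[OF C \<open>e > 0\<close>] by blast
    have "matrix_norm m (\<lambda>i j. entry (X k) i j - L i j) \<le> e" if "k \<ge> K" for k m
    proof (rule Lim_bounded2)
      show "(\<lambda>l. e + matrix_norm m (\<lambda>i j. entry (X l) i j - L i j)) \<longlonglongrightarrow> e"
        using tendsto_add[OF tendsto_const lim[of m], of e] by simp
      have "matrix_norm m (\<lambda>i j. entry (X k) i j - L i j) \<le> e + matrix_norm m (\<lambda>i j. entry (X l) i j - L i j)"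
        if "l \<ge> K" for l
      proof -
        have "(\<lambda>i j. entry (X k) i j - L i j) = (\<lambda>i j. entry (X k - X l) i j + (entry (X l) i j - L i j))"
          by (simp add: fun_eq_iff)
        then have "matrix_norm m (\<lambda>i j. entry (X k) i j - L i j) \<le> matrix_norm m (entry (X k - X l)) +
            matrix_norm m (\<lambda>i j. entry (X l) i j - L i j)"
          using matrix_norm_triangle[of m "entry (X k - X l)" "\<lambda>i j. entry (X l) i j - L i j"] by simp
        then show ?thesis using matrix_norm_le_norm[of m "X k - X l"] K[OF \<open>k \<ge> K\<close> that] by linarith
      qed
      then show "\<forall>l\<ge>K. matrix_norm m (\<lambda>i j. entry (X k) i j - L i j) \<le> e + matrix_norm m (\<lambda>i j. entry (X l) i j - L i j)"
        by blast
    qed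
    then show ?thesis by blast
  qed
  have "L \<in> stabilization UNIV"
    unfolding stabilization_iff_tail
  proof (intro conjI allI impI)
    fix \<epsilon> :: real assume "\<epsilon> > 0"
    then have "\<epsilon> / 4 > 0" by simp
    then obtain K where K: "\<And>m. matrix_norm m (\<lambda>i j. entry (X K) i j - L i j) \<le> \<epsilon> / 4"
      using close by blast
    obtain N where N: "\<And>n m. n \<ge> N \<Longrightarrow> matrix_norm m (tail n (entry (X K))) < \<epsilon> / 4"
      using entry[of "X K"] \<open>\<epsilon> / 4 > 0\<close> unfolding stabilization_iff_tail by meson
    define D where "D = (\<lambda>i j. L i j - entry (X K) i j)"
    have "D = (\<lambda>i j. (-1) *\<^sub>R (entry (X K) i j - L i j))" by (simp add: D_def)
    then have D: "matrix_norm m D \<le> \<epsilon> / 4" for m using matrix_norm_scaleR[of m "-1" "\<lambda>i j. entry (X K) i j - L i j"] K[of m] by simp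
    have TD: "matrix_norm m (truncate n D) \<le> \<epsilon> / 4" for m n
    proof (cases "n \<le> m")
      case True
      then show ?thesis using matrix_norm_truncate_le[OF True, of D] D[of n] by simp
    next
      case False
      then show ?thesis using matrix_norm_truncate[of m n D] D[of m] by simp
    qed
    have "matrix_norm m (tail n L) < \<epsilon>" if "n \<ge> N" for n m
    proof -
      let ?S = "\<lambda>i j. tail n (entry (X K)) i j + D i j"
      have "tail n L = (\<lambda>i j. ?S i j + (-1) *\<^sub>R truncate n D i j)"
        by (auto simp: fun_eq_iff tail_def truncate_def D_def)
      then have "matrix_norm m (tail n L) \<le> matrix_norm m ?S + matrix_norm m (truncate n D)"
        using matrix_norm_triangle[of m ?S "\<lambda>i j. (-1) *\<^sub>R truncate n D i j"]
          matrix_norm_scaleR[of m "-1" "truncate n D"] by simp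
      also have "\<dots> \<le> matrix_norm m (tail n (entry (X K))) + matrix_norm m D + matrix_norm m (truncate n D)"
        using matrix_norm_triangle[of m "tail n (entry (X K))" D] by simp
      finally show ?thesis using N[OF that, of m] D[of m] TD[of m n] \<open>\<epsilon> > 0\<close> by linarith
    qed
    then show "\<exists>N. \<forall>n\<ge>N. \<forall>m. matrix_norm m (tail n L) < \<epsilon>" by blast
  qed simp
  then have L_eq: "entry (Stab L) = L" by (rule Stab_inverse)
  have "X \<longlonglongrightarrow> Stab L"
  proof (rule LIMSEQ_I)
    fix r :: real assume "r > 0"
    then obtain K where K: "\<And>k m. k \<ge> K \<Longrightarrow> matrix_norm m (\<lambda>i j. entry (X k) i j - L i j) \<le> r / 2"
      using close[of "r / 2"] by auto
    have "norm (X k - Stab L) < r" if "k \<ge> K" for k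
    proof -
      have "entry (X k - Stab L) = (\<lambda>i j. entry (X k) i j - L i j)" by (simp add: fun_eq_iff L_eq)
      then have "norm (X k - Stab L) \<le> r / 2" unfolding norm_stab_le_iff using K[OF that] by simp
      then show ?thesis using \<open>r > 0\<close> by simp
    qed
    then show "\<exists>N. \<forall>n\<ge>N. norm (X n - Stab L) < r" by blast
  qed
  then show "convergent X" by (auto simp: convergent_def)
qed

text \<open>The product is the limit of the products of the truncations; in each entry this says that the
  defining series converges.\<close>

definition trunc_prod :: "nat \<Rightarrow> 'a::cstar_algebra stab \<Rightarrow> 'a stab \<Rightarrow> 'a stab" where
  "trunc_prod n x y = Stab (matprod n (truncate n (entry x)) (truncate n (entry y)))"

lemma entry_trunc_prod: "entry (trunc_prod n x y) = matprod n (truncate n (entry x)) (truncate n (entry y))"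
  unfolding trunc_prod_def
  by (rule entry_Stab_finite[of _ n]) (auto simp: matrix_algebra_def truncate_def matprod_def)

lemma stab_finite_trunc_prod: "stab_finite n (trunc_prod n x y)"
  by (auto simp: stab_finite_iff entry_trunc_prod matprod_def truncate_def)

lemma norm_trunc_prod_le: "norm (trunc_prod n x y) \<le> norm x * norm y"
proof -
  have "norm (trunc_prod n x y) \<le> matrix_norm n (entry x) * matrix_norm n (entry y)"
    unfolding norm_stab_finite[OF stab_finite_trunc_prod] entry_trunc_prod
    using matrix_norm_matprod[of n "truncate n (entry x)" "truncate n (entry y)"]
    by (simp add: matrix_norm_truncate)
  also have "\<dots> \<le> norm x * norm y" by (intro mult_mono matrix_norm_le_norm) simp_all
  finally show ?thesis .
qed

lemma trunc_prod_add_left: "trunc_prod n (x + x') y = trunc_prod n x y + trunc_prod n x' y"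
  and trunc_prod_add_right: "trunc_prod n x (y + y') = trunc_prod n x y + trunc_prod n x y'"
  and trunc_prod_scaleR_left: "trunc_prod n (r *\<^sub>R x) y = r *\<^sub>R trunc_prod n x y"
  and trunc_prod_scaleR_right: "trunc_prod n x (r *\<^sub>R y) = r *\<^sub>R trunc_prod n x y"
  by (rule stab_eqI; auto simp: entry_trunc_prod matprod_def truncate_def algebra_simps sum.distrib
      scaleR_sum_right intro!: sum.cong simp flip: sum.distrib)+

lemma trunc_prod_trunc: "n \<le> m \<Longrightarrow> trunc_prod m (stab_trunc n x) (stab_trunc n y) = trunc_prod n x y"
  by (rule stab_eqI)
    (auto simp: entry_trunc_prod entry_stab_trunc matprod_def truncate_def
      intro!: sum.mono_neutral_cong_right sum.neutral split: if_splits)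

text \<open>On the first \<open>n\<close> rows and columns the two products agree; each of the two remaining terms contains the tail of
  one factor.\<close>

lemma trunc_prod_diff_le:
  assumes "n \<le> m"
  shows "norm (trunc_prod m x y - trunc_prod n x y)
    \<le> norm (x - stab_trunc n x) * norm y + norm x * norm (y - stab_trunc n y)"
proof -
  let ?x = "stab_trunc n x" and ?y = "stab_trunc n y"
  have "trunc_prod m x y = trunc_prod m (x - ?x) y + trunc_prod m ?x y"
    unfolding trunc_prod_add_left[symmetric] by simp
  also have "trunc_prod m ?x y = trunc_prod m ?x (y - ?y) + trunc_prod m ?x ?y"
    unfolding trunc_prod_add_right[symmetric] by simp
  finally have "trunc_prod m x y - trunc_prod n x y = trunc_prod m (x - ?x) y + trunc_prod m ?x (y - ?y)"
    using assms by (simp add: trunc_prod_trunc)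
  also have "norm \<dots> \<le> norm (x - ?x) * norm y + norm ?x * norm (y - ?y)"
    by (intro norm_triangle_le add_mono norm_trunc_prod_le)
  also have "\<dots> \<le> norm (x - ?x) * norm y + norm x * norm (y - ?y)"
    by (simp add: mult_right_mono norm_stab_trunc_le)
  finally show ?thesis .
qed

lemma trunc_prod_convergent: "convergent (\<lambda>n. trunc_prod n x y)"
proof -
  have "(\<lambda>n. norm (x - stab_trunc n x) * norm y + norm x * norm (y - stab_trunc n y))
     \<longlonglongrightarrow> norm (x - x) * norm y + norm x * norm (y - y)"
    by (intro tendsto_intros stab_trunc_tendsto)
  then have lim: "(\<lambda>n. norm (x - stab_trunc n x) * norm y + norm x * norm (y - stab_trunc n y)) \<longlonglongrightarrow> 0" by simp
  have "Cauchy (\<lambda>n. trunc_prod n x y)"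
  proof (rule CauchyI')
    fix e :: real assume "e > 0"
    then obtain N where N: "\<And>n. n \<ge> N \<Longrightarrow>
        norm (x - stab_trunc n x) * norm y + norm x * norm (y - stab_trunc n y) < e"
      using LIMSEQ_D[OF lim] by fastforce
    have "norm (trunc_prod m x y - trunc_prod n x y) < e" if "m \<ge> N" "n > m" for m n
      using trunc_prod_diff_le[of m n x y] N[OF that(1)] that(2) by (simp add: norm_minus_commute)
    then show "\<exists>M. \<forall>m\<ge>M. \<forall>n>m. dist (trunc_prod m x y) (trunc_prod n x y) < e"
      unfolding dist_norm by blast
  qed
  then show ?thesis by (simp add: Cauchy_convergent_iff)
qed

lemma imat_mult_in_stabilization:
  obtains z where "entry z = imat_mult (entry x) (entry y)" "(\<lambda>n. trunc_prod n x y) \<longlonglongrightarrow> z"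
    "\<And>i j. (\<lambda>k. entry x i k * entry y k j) sums entry z i j"
proof -
  obtain z where z: "(\<lambda>n. trunc_prod n x y) \<longlonglongrightarrow> z"
    using trunc_prod_convergent by (auto simp: convergent_def)
  have sums: "(\<lambda>k. entry x i k * entry y k j) sums entry z i j" for i j
    unfolding sums_def
  proof (rule Lim_transform_eventually[OF tendsto_entry[OF z]])
    show "\<forall>\<^sub>F n in sequentially. entry (trunc_prod n x y) i j = (\<Sum>k<n. entry x i k * entry y k j)"
      using eventually_gt_at_top[of "max i j"]
      by eventually_elim (auto simp: entry_trunc_prod matprod_def truncate_def)
  qed
  then have "entry z = imat_mult (entry x) (entry y)"
    by (auto simp: fun_eq_iff imat_mult_def sums_iff)
  then show thesis using that z sums by blast
qed

instantiation stab :: (cstar_algebra) real_normed_algebra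
begin

definition "x * y = Stab (imat_mult (entry x) (entry y :: 'a imat))"

lemma entry_mult: "entry (x * y) = imat_mult (entry x) (entry y :: 'a imat)"
  using imat_mult_in_stabilization[of x y] unfolding times_stab_def by (metis entry_inverse)

lemma trunc_prod_tendsto: "(\<lambda>n. trunc_prod n x y) \<longlonglongrightarrow> x * (y :: 'a stab)"
  using imat_mult_in_stabilization[of x y] unfolding times_stab_def by (metis entry_inverse)

lemma entry_mult_sums: "(\<lambda>k. entry x i k * entry y k j) sums entry (x * y :: 'a stab) i j"
  using imat_mult_in_stabilization[of x y] unfolding times_stab_def by (metis entry_inverse)

lemma entry_mult_finite:
  assumes "stab_finite n x \<or> stab_finite n y"
  shows "entry (x * y) i j = (\<Sum>k<n. entry x i k * entry y k j :: 'a)"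
  unfolding entry_mult imat_mult_def
  by (rule suminf_finite) (use assms in \<open>auto simp: stab_finite_entry_0\<close>)

instance
proof -
  have add: "(x + x') * y = x * y + x' * y" "y * (x + x') = y * x + y * x'" for x x' y :: "'a stab"
    using tendsto_add[OF trunc_prod_tendsto[of x y] trunc_prod_tendsto[of x' y]] trunc_prod_tendsto[of "x + x'" y]
      tendsto_add[OF trunc_prod_tendsto[of y x] trunc_prod_tendsto[of y x']] trunc_prod_tendsto[of y "x + x'"]
    by (simp_all add: trunc_prod_add_left trunc_prod_add_right LIMSEQ_unique)
  have scale: "r *\<^sub>R x * y = r *\<^sub>R (x * y)" "x * r *\<^sub>R y = r *\<^sub>R (x * y)" for x y :: "'a stab" and r
    using tendsto_scaleR[OF tendsto_const trunc_prod_tendsto[of x y], of r] trunc_prod_tendsto[of "r *\<^sub>R x" y]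
      trunc_prod_tendsto[of x "r *\<^sub>R y"]
    by (simp_all add: trunc_prod_scaleR_left trunc_prod_scaleR_right LIMSEQ_unique)
  have norm: "norm (x * y) \<le> norm x * norm y" for x y :: "'a stab"
    by (rule Lim_bounded[OF tendsto_norm[OF trunc_prod_tendsto], of 0]) (simp add: norm_trunc_prod_le)
  interpret bounded_bilinear "(*) :: 'a stab \<Rightarrow> 'a stab \<Rightarrow> 'a stab"
    by (rule bounded_bilinear.intro) (use add scale norm in \<open>auto intro!: exI[of _ 1]\<close>)
  have assoc_fin: "a * b * c = a * (b * c)" if "stab_finite n a" "stab_finite n b" "stab_finite n c" for n and a b c :: "'a stab"
  proof (rule stab_eqI)
    fix i j
    have "entry (a * b * c) i j = (\<Sum>k<n. \<Sum>l<n. entry a i l * (entry b l k * entry c k j))"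
      using that by (simp add: entry_mult_finite[of n] sum_distrib_right mult.assoc)
    also have "\<dots> = entry (a * (b * c)) i j"
      using that by (subst sum.swap) (simp add: entry_mult_finite[of n] sum_distrib_left)
    finally show "entry (a * b * c) i j = entry (a * (b * c)) i j" .
  qed
  have assoc: "x * y * z = x * (y * z)" for x y z :: "'a stab"
  proof (rule LIMSEQ_unique)
    show "(\<lambda>n. stab_trunc n x * stab_trunc n y * stab_trunc n z) \<longlonglongrightarrow> x * y * z"
      by (intro tendsto stab_trunc_tendsto)
    show "(\<lambda>n. stab_trunc n x * stab_trunc n y * stab_trunc n z) \<longlonglongrightarrow> x * (y * z)"
      unfolding assoc_fin[OF stab_finite_trunc stab_finite_trunc stab_finite_trunc]
      by (intro tendsto stab_trunc_tendsto)
  qed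
  show "OFCLASS('a stab, real_normed_algebra_class)"
    by standard (use add scale norm assoc in auto)
qed

end

instantiation stab :: (cstar_algebra) cstar_algebra
begin

definition "cscale c x = Stab (\<lambda>i j. cscale c (entry x i j :: 'a))"
definition "star x = Stab (imat_star (entry x :: 'a imat))"

lemma entry_cscale [simp]: "entry (cscale c x) i j = cscale c (entry x i j :: 'a)"
  unfolding cscale_stab_def by (rule entry_Stab[OF stabilization_cscale[OF entry]])

lemma entry_star_eq: "entry (star x) = imat_star (entry x :: 'a imat)"
  unfolding star_stab_def by (rule Stab_inverse[OF stabilization_star[OF entry]])

lemma entry_star [simp]: "entry (star x) i j = star (entry x j i :: 'a)"
  by (simp add: entry_star_eq imat_star_def)

instance
proof -
  have norm_cscale_le: "norm (cscale c x) \<le> cmod c * norm x" for c and x :: "'a stab"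
  proof (rule norm_stab_leI)
    fix m
    have "entry (cscale c x) = (\<lambda>i j. cscale c (entry x i j))" by (simp add: fun_eq_iff)
    then show "matrix_norm m (entry (cscale c x)) \<le> cmod c * norm x"
      by (simp add: matrix_norm_cscale mult_left_mono matrix_norm_le_norm)
  qed
  have norm_cscale: "norm (cscale c x) = cmod c * norm x" for c and x :: "'a stab"
  proof (cases "c = 0")
    case True
    have "cscale 0 x = 0" by (rule stab_eqI) simp
    then show ?thesis using True by simp
  next
    case False
    have "cscale (inverse c) (cscale c x) = x"
      using False by (intro stab_eqI) (simp add: cscale_cscale)
    then have "norm x \<le> inverse (cmod c) * norm (cscale c x)"
      using norm_cscale_le[of "inverse c" "cscale c x"] by (simp add: norm_inverse)
    then show ?thesis using norm_cscale_le[of c x] False by (simp add: field_simps)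
  qed
  have norm_star: "norm (star x) = norm x" for x :: "'a stab"
    by (simp add: norm_stab_def entry_star_eq matrix_norm_star)
  have star_add: "star (x + y) = star x + star y" for x y :: "'a stab"
    by (rule stab_eqI) (simp add: star_add)
  have star_lim: "(\<lambda>n. star (stab_trunc n x)) \<longlonglongrightarrow> star x" for x :: "'a stab"
  proof (rule bounded_linear.tendsto[OF _ stab_trunc_tendsto])
    show "bounded_linear (star :: 'a stab \<Rightarrow> 'a stab)"
      by (rule bounded_linear_intro[where K = 1])
        (auto intro!: stab_eqI simp: norm_star star_add star_scaleR)
  qed
  have star_mult: "star (x * y) = star y * star x" for x y :: "'a stab"
  proof (rule stab_eqI)
    fix i j
    have "(\<lambda>k. star (entry y k i) * star (entry x j k)) sums star (entry (x * y) j i)"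
      using bounded_linear.sums[OF bounded_linear_star entry_mult_sums[of x j y i]] by (simp add: star_mult)
    moreover have "(\<lambda>k. star (entry y k i) * star (entry x j k)) sums entry (star y * star x) i j"
      using entry_mult_sums[of "star y" i "star x" j] by simp
    ultimately show "entry (star (x * y)) i j = entry (star y * star x) i j"
      by (simp add: sums_unique2)
  qed
  have cstar: "norm (star x * x) = (norm x)\<^sup>2" for x :: "'a stab"
  proof (rule LIMSEQ_unique)
    show "(\<lambda>n. norm (star (stab_trunc n x) * stab_trunc n x)) \<longlonglongrightarrow> norm (star x * x)"
      by (intro tendsto_intros star_lim stab_trunc_tendsto)
    have "norm (star (stab_trunc n x) * stab_trunc n x) = (norm (stab_trunc n x))\<^sup>2" for n
    proof -
      let ?t = "stab_trunc n x"
      have "entry (star ?t * ?t) = matprod n (imat_star (entry ?t)) (entry ?t)"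
        by (simp add: fun_eq_iff entry_mult_finite[of n] matprod_def imat_star_def)
      moreover have "stab_finite n (star ?t * ?t)"
        by (auto simp: stab_finite_iff entry_mult_finite[of n] entry_stab_trunc truncate_def)
      ultimately show ?thesis
        by (simp add: norm_stab_finite[of n] matrix_norm_cstar_identity)
    qed
    then show "(\<lambda>n. norm (star (stab_trunc n x) * stab_trunc n x)) \<longlonglongrightarrow> (norm x)\<^sup>2"
      by (simp only:) (intro tendsto_intros stab_trunc_tendsto)
  qed
  have mult: "cscale c x * y = cscale c (x * y)" "x * cscale c y = cscale c (x * y)" for c and x y :: "'a stab"
  proof -
    have 1: "(\<lambda>k. cscale c (entry x i k * entry y k j)) sums cscale c (entry (x * y) i j)" for i j
      by (rule bounded_linear.sums[OF bounded_linear_cscale entry_mult_sums])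
    have 2: "(\<lambda>k. cscale c (entry x i k * entry y k j)) sums entry (cscale c x * y) i j" for i j
      using entry_mult_sums[of "cscale c x" i y j] by (simp add: cscale_mult_left)
    have 3: "(\<lambda>k. cscale c (entry x i k * entry y k j)) sums entry (x * cscale c y) i j" for i j
      using entry_mult_sums[of x i "cscale c y" j] by (simp add: cscale_mult_right)
    show "cscale c x * y = cscale c (x * y)" "x * cscale c y = cscale c (x * y)"
      by (rule stab_eqI; simp add: sums_unique2[OF 2 1] sums_unique2[OF 3 1])+
  qed
  show "OFCLASS('a stab, cstar_algebra_class)"
    by standard (use norm_cscale star_add star_mult cstar mult in
      \<open>auto intro!: stab_eqI simp: cscale_add_right cscale_add_left cscale_cscale cscale_of_real star_cscale star_star\<close>)
qed

end


section \<open>Asymptotic equality\<close>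

text \<open>All approximations are phrased with bounded families indexed along a filter, up to families that
  tend to \<open>0\<close>.  Boundedness is part of the relation, which makes it a congruence for products.\<close>

definition asym_eq :: "('i \<Rightarrow> 'a::real_normed_vector) \<Rightarrow> 'i filter \<Rightarrow> ('i \<Rightarrow> 'a) \<Rightarrow> bool"
    (\<open>(_/ \<simeq>[_] _)\<close> [51, 10, 51] 50) where
  "f \<simeq>[F] g \<longleftrightarrow> Bfun g F \<and> Zfun (\<lambda>i. f i - g i) F"

lemma Bfun_add: assumes "Bfun f F" "Bfun g F" shows "Bfun (\<lambda>i. f i + g i :: 'a::real_normed_vector) F"
proof -
  obtain K L where "eventually (\<lambda>i. norm (f i) \<le> K) F" "eventually (\<lambda>i. norm (g i) \<le> L) F"
    using assms by (metis BfunE)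
  then have "eventually (\<lambda>i. norm (f i + g i) \<le> K + L) F"
    by eventually_elim (rule norm_triangle_le, linarith)
  then show ?thesis by (rule BfunI)
qed

lemma Bfun_bounded_linear: assumes "bounded_linear T" "Bfun f F" shows "Bfun (\<lambda>i. T (f i)) F"
proof -
  obtain K where K: "eventually (\<lambda>i. norm (f i) \<le> K) F" using assms(2) by (rule BfunE)
  obtain C where C: "C > 0" "\<And>x. norm (T x) \<le> norm x * C"
    using bounded_linear.pos_bounded[OF assms(1)] by blast
  from K have "eventually (\<lambda>i. norm (T (f i)) \<le> K * C) F"
    by eventually_elim (use C in \<open>meson mult_right_mono less_imp_le order_trans\<close>)
  then show ?thesis by (rule BfunI)
qed

lemma Bfun_mult:
  assumes "Bfun f F" "Bfun g F" shows "Bfun (\<lambda>i. f i * g i :: 'a::real_normed_algebra) F"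
proof -
  obtain K where K: "K > 0" "eventually (\<lambda>i. norm (f i) \<le> K) F" using assms(1) by (rule BfunE)
  obtain L where L: "eventually (\<lambda>i. norm (g i) \<le> L) F" using assms(2) by (rule BfunE)
  from K(2) L have "eventually (\<lambda>i. norm (f i * g i) \<le> K * L) F"
    by eventually_elim (rule order_trans[OF norm_mult_ineq], use K(1) in \<open>intro mult_mono; simp\<close>)
  then show ?thesis by (rule BfunI)
qed

lemma Zfun_imp_Bfun: "Zfun f F \<Longrightarrow> Bfun f F"
  using ZfunD[of f F 1] by (intro BfunI[of _ 1]) (auto elim: eventually_mono)

lemma asym_eq_Bfun_right: "f \<simeq>[F] g \<Longrightarrow> Bfun g F"
  by (simp add: asym_eq_def)

lemma asym_eq_Bfun_left: "f \<simeq>[F] g \<Longrightarrow> Bfun f F"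
  unfolding asym_eq_def using Bfun_add[OF Zfun_imp_Bfun, of "\<lambda>i. f i - g i" F g] by simp

lemma asym_eq_refl: "Bfun f F \<Longrightarrow> f \<simeq>[F] f"
  by (simp add: asym_eq_def Zfun_zero)

lemma asym_eq_sym: "f \<simeq>[F] g \<Longrightarrow> g \<simeq>[F] f"
  using asym_eq_Bfun_left[of f F g] Zfun_minus[of "\<lambda>i. f i - g i" F] by (simp add: asym_eq_def)

lemma asym_eq_trans [trans]: "f \<simeq>[F] g \<Longrightarrow> g \<simeq>[F] h \<Longrightarrow> f \<simeq>[F] h"
  using Zfun_add[of "\<lambda>i. f i - g i" F "\<lambda>i. g i - h i"] by (simp add: asym_eq_def)

lemma asym_eq_trans_eq [trans]:
  "f = g \<Longrightarrow> g \<simeq>[F] h \<Longrightarrow> f \<simeq>[F] h" "f \<simeq>[F] g \<Longrightarrow> g = h \<Longrightarrow> f \<simeq>[F] h"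
  by simp_all

lemma asym_eq_const: "(\<lambda>_. c) \<simeq>[F] (\<lambda>_. c)"
  by (rule asym_eq_refl) simp

lemma asym_eq_add: "f \<simeq>[F] f' \<Longrightarrow> g \<simeq>[F] g' \<Longrightarrow> (\<lambda>i. f i + g i) \<simeq>[F] (\<lambda>i. f' i + g' i)"
  using Zfun_add[of "\<lambda>i. f i - f' i" F "\<lambda>i. g i - g' i"] Bfun_add[of f' F g']
  by (simp add: asym_eq_def algebra_simps)

lemma asym_eq_bounded_linear:
  assumes T: "bounded_linear T" and fg: "f \<simeq>[F] g" shows "(\<lambda>i. T (f i)) \<simeq>[F] (\<lambda>i. T (g i))"
proof -
  interpret bounded_linear T by (rule T)
  show ?thesis using fg Zfun[of "\<lambda>i. f i - g i" F] Bfun_bounded_linear[OF T, of g F]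
    by (simp add: asym_eq_def diff)
qed

lemma asym_eq_minus: "f \<simeq>[F] f' \<Longrightarrow> (\<lambda>i. - f i) \<simeq>[F] (\<lambda>i. - f' i)"
  by (rule asym_eq_bounded_linear[OF bounded_linear_minus[OF bounded_linear_ident]])

lemma asym_eq_diff: "f \<simeq>[F] f' \<Longrightarrow> g \<simeq>[F] g' \<Longrightarrow> (\<lambda>i. f i - g i) \<simeq>[F] (\<lambda>i. f' i - g' i)"
  using asym_eq_add[OF _ asym_eq_minus, of f F f' g g'] by simp

lemma asym_eq_scaleR: "f \<simeq>[F] f' \<Longrightarrow> (\<lambda>i. r *\<^sub>R f i) \<simeq>[F] (\<lambda>i. r *\<^sub>R f' i)"
  by (rule asym_eq_bounded_linear[OF bounded_linear_scaleR_right])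

lemma asym_eq_star: "f \<simeq>[F] f' \<Longrightarrow> (\<lambda>i. star (f i)) \<simeq>[F] (\<lambda>i. star (f' i))"
  by (rule asym_eq_bounded_linear[OF bounded_linear_star])

lemma asym_eq_mult:
  fixes f f' g g' :: "'i \<Rightarrow> 'a::real_normed_algebra"
  assumes f: "f \<simeq>[F] f'" and g: "g \<simeq>[F] g'"
  shows "(\<lambda>i. f i * g i) \<simeq>[F] (\<lambda>i. f' i * g' i)"
proof -
  have "Zfun (\<lambda>i. (f i - f' i) * g i + f' i * (g i - g' i)) F"
    using f g asym_eq_Bfun_left[OF g] unfolding asym_eq_def
    by (intro Zfun_add bounded_bilinear.Zfun_prod_Bfun[OF bounded_bilinear_mult]
        bounded_bilinear.Bfun_prod_Zfun[OF bounded_bilinear_mult]) auto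
  then show ?thesis using f g by (simp add: asym_eq_def Bfun_mult algebra_simps)
qed

lemma asym_eq_sum:
  "(\<And>k. k \<in> K \<Longrightarrow> f k \<simeq>[F] g k) \<Longrightarrow> (\<lambda>i. \<Sum>k\<in>K. f k i) \<simeq>[F] (\<lambda>i. \<Sum>k\<in>K. g k i)"
  by (induction K rule: infinite_finite_induct) (auto intro: asym_eq_const asym_eq_add)

lemma asym_eq_cong_left: "eventually (\<lambda>i. f i = f' i) F \<Longrightarrow> f' \<simeq>[F] g \<Longrightarrow> f \<simeq>[F] g"
  unfolding asym_eq_def using Zfun_ssubst[of "\<lambda>i. f i - g i" "\<lambda>i. f' i - g i" F]
  by (auto elim: eventually_mono)

lemma asym_eq_0_iff: "f \<simeq>[F] (\<lambda>_. 0) \<longleftrightarrow> Zfun f F"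
  by (simp add: asym_eq_def)

lemma asym_eq_eventually: "f \<simeq>[F] g \<Longrightarrow> e > 0 \<Longrightarrow> eventually (\<lambda>i. norm (f i - g i) < e) F"
  by (simp add: asym_eq_def ZfunD)

lemma Bfun_if_Bfun_star_mult:
  assumes "Bfun (\<lambda>i. star (v i) * v i :: 'a::cstar_algebra) F" shows "Bfun v F"
proof -
  obtain K where "eventually (\<lambda>i. norm (star (v i) * v i) \<le> K) F" using assms by (rule BfunE)
  then have "eventually (\<lambda>i. norm (v i) \<le> sqrt K) F"
    by eventually_elim (simp add: cstar_identity real_le_rsqrt)
  then show ?thesis by (rule BfunI)
qed


section \<open>Projections and Murray--von Neumann equivalence\<close>

definition projs :: "'a::cstar_algebra set \<Rightarrow> 'a set" where
  "projs M = {p \<in> M. projection p}"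

definition mvn_equiv :: "'a::cstar_algebra set \<Rightarrow> 'a \<Rightarrow> 'a \<Rightarrow> bool" where
  "mvn_equiv M p q \<longleftrightarrow> p \<in> projs M \<and> q \<in> projs M \<and> (\<exists>v\<in>M. star v * v = p \<and> v * star v = q)"

lemma projsD: "p \<in> projs M \<Longrightarrow> p \<in> M" "p \<in> projs M \<Longrightarrow> star p = p" "p \<in> projs M \<Longrightarrow> p * p = p"
  by (auto simp: projs_def projection_def)

lemma projs_norm_le_1: "p \<in> projs M \<Longrightarrow> norm p \<le> 1"
  by (simp add: projs_def norm_projection_le_1)

lemma zero_in_projs: "cstar_subalgebra M \<Longrightarrow> 0 \<in> projs M"
  by (simp add: projs_def projection_def subalgebra_zero)

lemma Bfun_projs: assumes "\<And>i. p i \<in> projs (M i)" shows "Bfun p F"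
  by (rule BfunI[of _ 1], rule always_eventually, rule allI, rule projs_norm_le_1[OF assms])

lemma projection_mult_commute_0:
  "projection p \<Longrightarrow> projection q \<Longrightarrow> p * q = 0 \<Longrightarrow> q * p = 0"
  by (metis projection_def star_mult star_zero)

lemma projs_add:
  assumes "cstar_subalgebra M" "p \<in> projs M" "q \<in> projs M" "p * q = 0" shows "p + q \<in> projs M"
proof -
  have "q * p = 0" using assms(2-4) projection_mult_commute_0[of p q] by (simp add: projs_def)
  then have "(p + q) * (p + q) = p + q"
    using assms(4) projsD(3)[OF assms(2)] projsD(3)[OF assms(3)] by (simp add: ring_distribs)
  moreover have "star (p + q) = p + q"
    using projsD(2)[OF assms(2)] projsD(2)[OF assms(3)] by (simp add: star_add)
  ultimately show ?thesis
    using subalgebra_add[OF assms(1)] projsD(1)[OF assms(2)] projsD(1)[OF assms(3)]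
    by (simp add: projs_def projection_def)
qed

text \<open>For \<open>p = v\<^sup>* v\<close> the C*-identity, applied to \<open>v - v p\<close>, shows \<open>v p = v\<close>.\<close>

lemma partial_isometry_right:
  assumes "projection (star v * v)" shows "v * (star v * v) = v"
proof -
  define p where "p = star v * v"
  have sp: "star p = p" and pp: "p * p = p" using assms by (auto simp: p_def[symmetric] projection_def)
  have "star (v - v * p) * (v - v * p) = p - p * p - p * p + p * p * p"
    by (simp add: star_simps sp algebra_simps) (simp add: p_def mult.assoc)
  also have "\<dots> = 0" by (simp add: pp)
  finally have "v - v * p = 0" by (rule cstar_eq_0I)
  then show ?thesis by (simp add: p_def)
qed

lemma partial_isometry_left:
  assumes "projection (star v * v)" shows "v * star v * v = v"
  using partial_isometry_right[OF assms] by (simp add: mult.assoc)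

lemma projection_range:
  assumes "projection (star v * v)" shows "projection (v * star v)"
  using partial_isometry_left[OF assms] unfolding projection_def
  by (simp add: star_simps) (metis mult.assoc)

lemma mvn_equivI:
  assumes M: "cstar_subalgebra M" and v: "v \<in> M" "star v * v = p" and p: "projection p"
  shows "mvn_equiv M p (v * star v)"
  using assms projection_range[of v]
  by (auto simp: mvn_equiv_def projs_def intro!: subalgebra_mult subalgebra_star)

lemma mvn_equivE:
  assumes "mvn_equiv M p q"
  obtains v where "v \<in> M" "star v * v = p" "v * star v = q" "v * p = v" "q * v = v"
    "p * star v = star v" "star v * q = star v"
proof -
  obtain v where v: "v \<in> M" "star v * v = p" "v * star v = q" and p: "p \<in> projs M" and q: "q \<in> projs M"
    using assms by (auto simp: mvn_equiv_def)
  have vp: "v * p = v" "q * v = v"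
    using p partial_isometry_right[of v] partial_isometry_left[of v] v by (auto simp: projs_def)
  have "p * star v = star v" "star v * q = star v"
    using arg_cong[OF vp(1), of star] arg_cong[OF vp(2), of star] projsD(2)[OF p] projsD(2)[OF q]
    by (simp_all add: star_mult)
  then show thesis using that v vp by blast
qed

lemma mvn_equiv_refl: "p \<in> projs M \<Longrightarrow> mvn_equiv M p p"
  by (auto simp: mvn_equiv_def projs_def projection_def intro!: bexI[of _ p])

lemma mvn_equiv_sym: assumes M: "cstar_subalgebra M" and "mvn_equiv M p q" shows "mvn_equiv M q p"
proof -
  obtain v where v: "v \<in> M" "star v * v = p" "v * star v = q" using mvn_equivE[OF assms(2)] by metis
  then have "star (star v) * star v = q" "star v * star (star v) = p" by (simp_all add: star_star)
  then show ?thesis using assms(2) subalgebra_star[OF M v(1)] unfolding mvn_equiv_def by blast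
qed

lemma mvn_equiv_trans:
  assumes M: "cstar_subalgebra M" and pq: "mvn_equiv M p q" and qr: "mvn_equiv M q r"
  shows "mvn_equiv M p r"
proof -
  obtain v where v: "v \<in> M" "star v * v = p" "v * star v = q" "q * v = v"
    using mvn_equivE[OF pq] by metis
  obtain w where w: "w \<in> M" "star w * w = q" "w * star w = r" "w * q = w"
    using mvn_equivE[OF qr] by metis
  have "star (w * v) * (w * v) = star v * (star w * w) * v" by (simp add: star_mult mult.assoc)
  also have "\<dots> = p" by (simp add: w(2) v(2,4) mult.assoc)
  finally have 1: "star (w * v) * (w * v) = p" .
  have "(w * v) * star (w * v) = w * (v * star v) * star w" by (simp add: star_mult mult.assoc)
  also have "\<dots> = r" by (simp add: v(3) w(3,4))
  finally show ?thesis using 1 pq qr subalgebra_mult[OF M w(1) v(1)]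
    unfolding mvn_equiv_def by blast
qed

lemma mvn_equiv_add:
  assumes M: "cstar_subalgebra M" and p: "mvn_equiv M p q" and p': "mvn_equiv M p' q'"
    and 0: "p * p' = 0" "q * q' = 0"
  shows "mvn_equiv M (p + p') (q + q')"
proof -
  have proj: "projection p" "projection q" "projection p'" "projection q'"
    "p \<in> projs M" "q \<in> projs M" "p' \<in> projs M" "q' \<in> projs M"
    using p p' by (auto simp: mvn_equiv_def projs_def)
  obtain v where v: "v \<in> M" "star v * v = p" "v * star v = q" "v * p = v" "q * v = v"
    "p * star v = star v" "star v * q = star v"
    using mvn_equivE[OF p] by metis
  obtain w where w: "w \<in> M" "star w * w = p'" "w * star w = q'" "w * p' = w" "q' * w = w"
    "p' * star w = star w" "star w * q' = star w"
    using mvn_equivE[OF p'] by metis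
  have zero: "p' * p = 0" "q' * q = 0" using 0 proj projection_mult_commute_0 by blast+
  have "star v * w = star v * (q * q') * w" by (metis v(7) w(5) mult.assoc)
  moreover have "star w * v = star w * (q' * q) * v" by (metis w(7) v(5) mult.assoc)
  moreover have "v * star w = v * (p * p') * star w" by (metis v(4) w(6) mult.assoc)
  moreover have "w * star v = w * (p' * p) * star v" by (metis w(4) v(6) mult.assoc)
  ultimately have z: "star v * w = 0" "star w * v = 0" "v * star w = 0" "w * star v = 0"
    using 0 zero by simp_all
  have "star (v + w) * (v + w) = p + p'" "(v + w) * star (v + w) = q + q'"
    by (simp_all add: star_add algebra_simps z v(2,3) w(2,3))
  then show ?thesis
    unfolding mvn_equiv_def
    using projs_add[OF M proj(5,7) 0(1)] projs_add[OF M proj(6,8) 0(2)] subalgebra_add[OF M v(1) w(1)]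
    by blast
qed

text \<open>The solution \<open>s = (1 - z)\<^sup>-\<^sup>1\<^sup>/\<^sup>2 - 1\<close> of \<open>(1 + s)\<^sup>2 (1 - z) = 1\<close>, for small \<open>z\<close>, is the fixed point
  of a contraction.  As above, this takes place in any closed subalgebra containing \<open>z\<close>.\<close>

lemma inverse_sqrt_exists:
  fixes z :: "'a::cstar_algebra"
  assumes M: "cstar_subalgebra M" "z \<in> M" and sa: "star z = z" and z: "norm z \<le> 1/16"
  obtains s where "s \<in> M" "star s = s" "norm s \<le> 2 * norm z" "\<And>x. x * z = z * x \<Longrightarrow> x * s = s * x"
    "2 *\<^sub>R s + s * s = z + 2 *\<^sub>R (s * z) + s * s * z"
proof -
  define r where "r = 2 * norm z"
  have r: "0 \<le> r" "r \<le> 1/8" using z by (simp_all add: r_def)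
  define S where "S = {s \<in> M. star s = s \<and> norm s \<le> r \<and> (\<forall>x. x * z = z * x \<longrightarrow> x * s = s * x)}"
  define f where "f s = (1/2) *\<^sub>R (z + 2 *\<^sub>R (s * z) + s * s * z - s * s)" for s
  have S_eq: "S = M \<inter> {s. star s = s} \<inter> {s. norm s \<le> r} \<inter> (\<Inter>x\<in>{x. x * z = z * x}. {s. x * s = s * x})"
    by (auto simp: S_def)
  have "closed S"
    unfolding S_eq
    by (intro closed_Int closed_INT ballI subalgebra_closed[OF M(1)] closed_Collect_eq closed_Collect_le
        continuous_intros bounded_linear.continuous_on[OF bounded_linear_star])
  then have 1: "complete S" by (simp add: complete_eq_closed)
  have 2: "S \<noteq> {}" using r subalgebra_zero[OF M(1)] by (auto simp: S_def intro!: exI[of _ 0])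
  have norm_f: "norm (f s) \<le> r" if "norm s \<le> r" for s
  proof -
    have nz: "norm z = r / 2" by (simp add: r_def)
    have ss: "norm (s * s) \<le> r * r"
      by (rule order_trans[OF norm_mult_ineq mult_mono]) (use that r in simp_all)
    have sz: "norm (s * z) \<le> r * (r / 2)"
      by (rule order_trans[OF norm_mult_ineq mult_mono]) (use that r nz in simp_all)
    have ssz: "norm (s * s * z) \<le> r * r * (r / 2)"
      by (rule order_trans[OF norm_mult_ineq mult_mono]) (use ss r nz in simp_all)
    have "norm (z + 2 *\<^sub>R (s * z) + s * s * z - s * s) \<le> norm z + 2 * norm (s * z) + norm (s * s * z) + norm (s * s)"
      by (intro norm_triangle_le norm_triangle_le_diff add_mono order_refl) simp_all
    also have "\<dots> \<le> r / 2 + 2 * (r * (r / 2)) + r * r * (r / 2) + r * r"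
      using ss sz ssz nz by linarith
    also have "\<dots> = r * (1 / 2 + r + r * (r / 2) + r)" by (simp add: algebra_simps)
    also have "\<dots> \<le> r * 2"
    proof (rule mult_left_mono)
      have "r * (r / 2) \<le> 1 * (1/8)" using r by (intro mult_mono) auto
      then show "1 / 2 + r + r * (r / 2) + r \<le> 2" using r by linarith
    qed (use r in simp)
    finally show ?thesis by (simp add: f_def)
  qed
  have 3: "f ` S \<subseteq> S"
  proof
    fix t assume "t \<in> f ` S"
    then obtain s where t: "t = f s" and s: "s \<in> M" "star s = s" "norm s \<le> r"
      and comm: "\<And>x. x * z = z * x \<Longrightarrow> x * s = s * x" by (auto simp: S_def)
    have zs: "z * s = s * z" using comm[of z] by simp
    then have "star (f s) = f s" by (simp add: f_def star_simps sa s(2) mult.assoc)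
    moreover have "x * f s = f s * x" if x: "x * z = z * x" for x
    proof -
      have xs: "x * s = s * x" by (rule comm[OF x])
      have "x * (s * z) = s * z * x" by (metis xs x mult.assoc)
      moreover have "x * (s * s) = s * s * x" by (metis xs mult.assoc)
      moreover have "x * (s * s * z) = s * s * z * x" by (metis xs x mult.assoc)
      ultimately show ?thesis using x by (simp add: f_def algebra_simps)
    qed
    moreover have "f s \<in> M" using s M by (simp add: f_def subalgebra_intros)
    ultimately show "t \<in> S" using norm_f[OF s(3)] by (simp add: S_def t)
  qed
  have 4: "dist (f s) (f t) \<le> 1/2 * dist s t" if "s \<in> S" "t \<in> S" for s t
  proof -
    have st: "norm s \<le> 1/8" "norm t \<le> 1/8" using that r by (auto simp: S_def)
    define D where "D = s * (s - t) + (s - t) * t"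
    have "norm D \<le> norm s * norm (s - t) + norm (s - t) * norm t"
      unfolding D_def by (intro norm_triangle_le add_mono norm_mult_ineq)
    also have "\<dots> \<le> 1/8 * norm (s - t) + norm (s - t) * (1/8)"
      using st by (intro add_mono mult_mono) auto
    finally have D: "norm D \<le> 1/4 * norm (s - t)" by simp
    have Dz: "norm (D * z) \<le> 1/4 * norm (s - t) * 1"
      by (rule order_trans[OF norm_mult_ineq]) (use D z in \<open>intro mult_mono; simp\<close>)
    have sz: "norm ((s - t) * z) \<le> norm (s - t) * (1/16)"
      by (rule order_trans[OF norm_mult_ineq mult_left_mono[OF z norm_ge_zero]])
    have "f s - f t = (1/2) *\<^sub>R (2 *\<^sub>R ((s - t) * z) + D * z - D)"
      by (simp add: f_def D_def algebra_simps scaleR_2)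
    also have "norm \<dots> \<le> 1/2 * (2 * norm ((s - t) * z) + norm (D * z) + norm D)"
    proof -
      have "norm (2 *\<^sub>R ((s - t) * z) + D * z - D) \<le> 2 * norm ((s - t) * z) + norm (D * z) + norm D"
        by (intro norm_triangle_le norm_triangle_le_diff add_mono order_refl) simp_all
      then show ?thesis by simp
    qed
    also have "\<dots> \<le> 1/2 * (2 * (norm (s - t) * (1/16)) + 1/4 * norm (s - t) * 1 + 1/4 * norm (s - t))"
      by (intro mult_left_mono add_mono D Dz sz) simp_all
    also have "\<dots> \<le> 1/2 * norm (s - t)" by simp
    finally show ?thesis by (simp add: dist_norm)
  qed
  obtain s where s: "s \<in> S" "f s = s"
    using Banach_fix[OF 1 2 _ _ 3 4] by auto
  have "2 *\<^sub>R s = z + 2 *\<^sub>R (s * z) + s * s * z - s * s"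
    using arg_cong[OF s(2), of "\<lambda>x. 2 *\<^sub>R x"] by (simp add: f_def)
  then have eq: "2 *\<^sub>R s + s * s = z + 2 *\<^sub>R (s * z) + s * s * z" by simp
  have "s \<in> M" "star s = s" "norm s \<le> 2 * norm z" using s(1) by (simp_all add: S_def r_def)
  moreover have "x * s = s * x" if "x * z = z * x" for x using s(1) that by (simp add: S_def)
  ultimately show thesis by (rule that[OF _ _ _ _ eq])
qed

text \<open>With \<open>z = 4 (x - x\<^sup>2) = 1 - (2 x - 1)\<^sup>2\<close>, the symmetry \<open>(2 x - 1) (1 - z)\<^sup>-\<^sup>1\<^sup>/\<^sup>2\<close> has the projection
  \<open>x + x s - s/2\<close> as its positive part; written like this it needs no unit.\<close>

lemma projection_near_almost_idempotent:
  fixes x :: "'a::cstar_algebra"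
  assumes M: "cstar_subalgebra M" "x \<in> M" and sa: "star x = x" and small: "norm (x * x - x) \<le> 1/64"
  obtains p where "p \<in> projs M" "norm (p - x) \<le> 16 * norm (x * x - x)"
proof -
  define z where "z = 4 *\<^sub>R (x - x * x)"
  have nz: "norm z = 4 * norm (x * x - x)" by (simp add: z_def norm_minus_commute)
  have zM: "z \<in> M" using M by (simp add: z_def subalgebra_intros)
  have sz: "star z = z" by (simp add: z_def star_simps sa)
  have "norm z \<le> 1/16" using small by (simp add: nz)
  then obtain s where s: "s \<in> M" "star s = s" "norm s \<le> 2 * norm z"
    and comm: "\<And>y. y * z = z * y \<Longrightarrow> y * s = s * y"
    and eq: "2 *\<^sub>R s + s * s = z + 2 *\<^sub>R (s * z) + s * s * z"
    using inverse_sqrt_exists[OF M(1) zM sz] by metis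
  have xs: "s * x = x * s" by (rule comm[symmetric]) (simp add: z_def algebra_simps)
  have xs': "s * (x * y) = x * (s * y)" for y by (metis xs mult.assoc)
  define p where "p = x + x * s - (1/2) *\<^sub>R s"
  have four: "4 *\<^sub>R y = y + y + y + y" for y :: 'a
  proof -
    have "4 *\<^sub>R y = (1 + 1 + 1 + 1) *\<^sub>R y" by simp
    then show ?thesis by (simp only: scaleR_add_left scaleR_one)
  qed
  have eight: "8 *\<^sub>R y = 4 *\<^sub>R y + 4 *\<^sub>R y" for y :: 'a by (simp flip: scaleR_add_left)
  have "4 *\<^sub>R (p * p - p) = (2 *\<^sub>R s + s * s) - (z + 2 *\<^sub>R (s * z) + s * s * z)"
    by (simp add: p_def z_def algebra_simps xs xs' scaleR_2) (simp add: four eight)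
  then have "p * p = p" using eq by simp
  moreover have "star p = p" by (simp add: p_def star_simps sa s(2) xs)
  moreover have "p \<in> M" using M s by (simp add: p_def subalgebra_intros)
  ultimately have "p \<in> projs M" by (simp add: projs_def projection_def)
  moreover have "norm (p - x) \<le> 16 * norm (x * x - x)"
  proof -
    have "(norm x)\<^sup>2 = norm (x + (x * x - x))" using norm_mult_self_adjoint[OF sa] by simp
    also have "\<dots> \<le> norm x + 1/64" by (rule norm_triangle_le) (use small in simp)
    finally have "norm x * norm x \<le> norm x + 1/64" by (simp add: power2_eq_square)
    then have nx: "norm x \<le> 3/2"
    proof (rule contrapos_pp)
      assume "\<not> norm x \<le> 3/2"
      then have "3/2 * norm x \<le> norm x * norm x" by (intro mult_right_mono) auto
      with \<open>\<not> norm x \<le> 3/2\<close> show "\<not> norm x * norm x \<le> norm x + 1/64" by linarith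
    qed
    have "p - x = x * s - (1/2) *\<^sub>R s" by (simp add: p_def)
    also have "norm \<dots> \<le> norm x * norm s + 1/2 * norm s"
      by (intro norm_triangle_le_diff add_mono norm_mult_ineq) simp
    also have "\<dots> \<le> 3/2 * norm s + 1/2 * norm s" using nx by (intro add_mono mult_right_mono) auto
    also have "\<dots> \<le> 16 * norm (x * x - x)" using s(3) by (simp add: nz)
    finally show ?thesis .
  qed
  ultimately show thesis by (rule that)
qed

text \<open>Polar decomposition of an element that is almost a partial isometry with source \<open>p\<close>:
  \<open>u = w p (p w\<^sup>* w p)\<^sup>-\<^sup>1\<^sup>/\<^sup>2\<close>, the inverse being taken in the corner of \<open>p\<close>.\<close>

lemma partial_isometry_near:
  fixes w :: "'a::cstar_algebra"
  assumes M: "cstar_subalgebra M" and p: "p \<in> projs M" and w: "w \<in> M"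
    and small: "norm (star w * w - p) \<le> 1/16"
  obtains u where "u \<in> M" "star u * u = p" "norm (u - w * p) \<le> 4 * norm (star w * w - p)"
    "\<And>q. q * w = w \<Longrightarrow> q * u = u"
proof -
  note pD = projsD[OF p]
  define z where "z = p * (p - star w * w) * p"
  have "norm z \<le> norm p * norm (p - star w * w) * norm p"
    unfolding z_def by (rule order_trans[OF norm_mult_ineq mult_right_mono[OF norm_mult_ineq norm_ge_zero]])
  also have "\<dots> \<le> 1 * norm (p - star w * w) * 1"
    using projs_norm_le_1[OF p] by (intro mult_mono) auto
  finally have nz: "norm z \<le> norm (star w * w - p)" by (simp add: norm_minus_commute)
  have zM: "z \<in> M" using M pD w by (simp add: z_def subalgebra_intros)
  have sz: "star z = z" by (simp add: z_def star_simps pD mult.assoc)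
  have zp: "z * p = z" and pz: "p * z = z" using pD(3) by (simp_all add: z_def mult.assoc) (simp_all add: mult.assoc[symmetric])
  have "norm z \<le> 1/16" using nz small by simp
  then obtain s where s: "s \<in> M" "star s = s" "norm s \<le> 2 * norm z"
    and comm: "\<And>y. y * z = z * y \<Longrightarrow> y * s = s * y"
    and eq: "2 *\<^sub>R s + s * s = z + 2 *\<^sub>R (s * z) + s * s * z"
    using inverse_sqrt_exists[OF M zM sz] by metis
  have ps: "s * p = p * s" by (rule comm[symmetric]) (simp add: zp pz)
  have zs: "z * s = s * z" by (rule comm) simp
  define c where "c = p + p * s"
  have sc: "star c = c" by (simp add: c_def star_simps pD s(2) ps)
  have psp: "p * s * p = p * s" "p * (p * s) = p * s" using pD(3) ps by (metis mult.assoc)+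
  have cp: "c * p = c" and pc: "p * c = c" by (simp_all add: c_def ring_distribs pD(3) psp)
  have pww: "p * (star w * w) * p = p - z" by (simp add: z_def ring_distribs pD(3))
  define u where "u = w * c"
  have "star u * u = c * (star w * w) * c" by (simp add: u_def star_mult sc mult.assoc)
  also have "\<dots> = c * (p * (star w * w) * p) * c" by (metis cp pc mult.assoc)
  also have "\<dots> = c * c - c * z * c" by (simp add: pww ring_distribs cp)
  also have "c * c = p + p * (2 *\<^sub>R s + s * s)"
  proof -
    have "p * s * (p * s) = p * (s * s)" using psp by (metis mult.assoc)
    then show ?thesis by (simp add: c_def ring_distribs pD(3) psp scaleR_2 add.assoc)
  qed
  also have "c * z * c = z + 2 *\<^sub>R (s * z) + s * s * z"
  proof -
    have "p * s * z = s * z" using ps pz by (metis mult.assoc)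
    then have cz: "c * z = z + s * z" by (simp add: c_def ring_distribs pz)
    have "z * (p * s) = z * s" "s * z * p = s * z" "s * z * (p * s) = s * (z * s)"
      using zp by (metis mult.assoc)+
    then have "(z + s * z) * (p + p * s) = z + s * z + (z * s + s * (z * s))"
      by (simp add: ring_distribs zp)
    then show ?thesis by (simp add: cz) (simp add: c_def zs scaleR_2 algebra_simps)
  qed
  also have "p * (2 *\<^sub>R s + s * s) = z + 2 *\<^sub>R (s * z) + s * s * z"
  proof -
    have "p * (s * z) = s * z" "p * (s * s * z) = s * s * z" using ps pz by (metis mult.assoc)+
    then show ?thesis by (simp add: eq ring_distribs pz)
  qed
  finally have uu: "star u * u = p" by simp
  have uM: "u \<in> M" using M w pD s by (simp add: u_def c_def subalgebra_intros)
  have un: "norm (u - w * p) \<le> 4 * norm (star w * w - p)"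
  proof -
    have "(norm w)\<^sup>2 = norm (p + (star w * w - p))" using cstar_identity[of w] by simp
    also have "\<dots> \<le> 1 + 1/16" by (rule norm_triangle_le) (use small projs_norm_le_1[OF p] in linarith)
    also have "\<dots> \<le> 2\<^sup>2" by simp
    finally have nw: "norm w \<le> 2" by (rule power2_le_imp_le) simp
    have "u - w * p = w * (p * s)" by (simp add: u_def c_def algebra_simps)
    also have "norm \<dots> \<le> norm w * (norm p * norm s)"
      by (rule order_trans[OF norm_mult_ineq mult_left_mono[OF norm_mult_ineq norm_ge_zero]])
    also have "\<dots> \<le> 2 * (1 * (2 * norm (star w * w - p)))"
      using nw projs_norm_le_1[OF p] s(3) nz by (intro mult_mono) auto
    finally show ?thesis by simp
  qed
  have qu: "q * u = u" if "q * w = w" for q using that by (simp add: u_def mult.assoc[symmetric])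
  show thesis by (rule that[OF uM uu un qu])
qed

text \<open>Eventually the real part of \<open>x\<^sub>i\<close> satisfies the hypothesis of \<open>projection_near_almost_idempotent\<close>; at the
  other indices any projection will do, such as \<open>0\<close>.\<close>

lemma projection_near_asym:
  fixes x :: "'i \<Rightarrow> 'a::cstar_algebra"
  assumes M: "\<And>i. cstar_subalgebra (M i)" "\<And>i. x i \<in> M i"
    and sa: "(\<lambda>i. star (x i)) \<simeq>[F] x" and idem: "(\<lambda>i. x i * x i) \<simeq>[F] x"
  obtains p where "\<And>i. p i \<in> projs (M i)" "p \<simeq>[F] x"
proof -
  define y where "y i = (1/2) *\<^sub>R (star (x i) + x i)" for i
  have yx: "y \<simeq>[F] x"
  proof -
    have "y \<simeq>[F] (\<lambda>i. (1/2) *\<^sub>R (x i + x i))"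
      unfolding y_def by (intro asym_eq_scaleR asym_eq_add sa asym_eq_refl asym_eq_Bfun_right[OF sa])
    then show ?thesis by (simp add: scaleR_2[symmetric])
  qed
  have "(\<lambda>i. y i * y i) \<simeq>[F] (\<lambda>i. x i * x i)" by (intro asym_eq_mult yx)
  also note idem
  also note asym_eq_sym[OF yx]
  finally have yy: "(\<lambda>i. y i * y i) \<simeq>[F] y" .
  have "\<exists>p. p \<in> projs (M i) \<and> (norm (y i * y i - y i) \<le> 1/64 \<longrightarrow> norm (p - y i) \<le> 16 * norm (y i * y i - y i))" for i
  proof (cases "norm (y i * y i - y i) \<le> 1/64")
    case True
    have "y i \<in> M i" "star (y i) = y i" using M by (simp_all add: y_def subalgebra_intros star_simps add.commute)
    then obtain q where "q \<in> projs (M i)" "norm (q - y i) \<le> 16 * norm (y i * y i - y i)"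
      by (rule projection_near_almost_idempotent[OF M(1) _ _ True])
    then show ?thesis by blast
  next
    case False
    then show ?thesis using zero_in_projs[OF M(1)] by blast
  qed
  then obtain p where p: "\<And>i. p i \<in> projs (M i)"
    "\<And>i. norm (y i * y i - y i) \<le> 1/64 \<Longrightarrow> norm (p i - y i) \<le> 16 * norm (y i * y i - y i)" by metis
  have "eventually (\<lambda>i. norm (y i * y i - y i) < 1/64) F" by (rule asym_eq_eventually[OF yy]) simp
  then have "eventually (\<lambda>i. norm (p i - y i) \<le> norm (y i * y i - y i) * 16) F"
    by eventually_elim (use p(2) in \<open>simp add: mult.commute\<close>)
  then have "Zfun (\<lambda>i. p i - y i) F" using yy Zfun_imp_Zfun by (auto simp: asym_eq_def)
  then have py: "p \<simeq>[F] y" using yy by (simp add: asym_eq_def)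
  show thesis by (rule that[OF p(1) asym_eq_trans[OF py yx]])
qed

text \<open>The distance of \<open>w\<^sub>i\<close> from \<open>w\<^sub>i p\<^sub>i\<close> is controlled by the C*-identity.\<close>

lemma partial_isometry_near_asym:
  fixes w :: "'i \<Rightarrow> 'a::cstar_algebra"
  assumes M: "\<And>i. cstar_subalgebra (M i)" and p: "\<And>i. p i \<in> projs (M i)" and w: "\<And>i. w i \<in> M i"
    and wp: "(\<lambda>i. star (w i) * w i) \<simeq>[F] p"
  obtains u where "\<And>i. u i \<in> M i" "\<forall>\<^sub>F i in F. star (u i) * u i = p i" "u \<simeq>[F] w"
    "\<And>i q. q * w i = w i \<Longrightarrow> q * u i = u i"
proof -
  have "\<exists>u. u \<in> M i \<and> (\<forall>q. q * w i = w i \<longrightarrow> q * u = u) \<and> (norm (star (w i) * w i - p i) \<le> 1/16 \<longrightarrow>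
      star u * u = p i \<and> norm (u - w i * p i) \<le> 4 * norm (star (w i) * w i - p i))" for i
  proof (cases "norm (star (w i) * w i - p i) \<le> 1/16")
    case True
    obtain u where u: "u \<in> M i" "star u * u = p i" "norm (u - w i * p i) \<le> 4 * norm (star (w i) * w i - p i)"
      "\<And>q. q * w i = w i \<Longrightarrow> q * u = u"
      by (rule partial_isometry_near[OF M[of i] p[of i] w[of i] True]) blast
    then show ?thesis by (intro exI[of _ u] conjI allI impI)
  next
    case False
    then show ?thesis using w by blast
  qed
  then obtain u where u: "\<And>i. u i \<in> M i" "\<And>i q. q * w i = w i \<Longrightarrow> q * u i = u i"
    "\<And>i. norm (star (w i) * w i - p i) \<le> 1/16 \<Longrightarrow>
      star (u i) * u i = p i \<and> norm (u i - w i * p i) \<le> 4 * norm (star (w i) * w i - p i)" by metis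
  have Bw: "Bfun w F" by (rule Bfun_if_Bfun_star_mult[OF asym_eq_Bfun_left[OF wp]])
  have Bp: "Bfun p F" by (rule Bfun_projs[OF p])
  have ev: "\<forall>\<^sub>F i in F. norm (star (w i) * w i - p i) < 1/16" by (rule asym_eq_eventually[OF wp]) simp
  then have 1: "\<forall>\<^sub>F i in F. star (u i) * u i = p i" by eventually_elim (use u(3) in simp)
  from ev have "\<forall>\<^sub>F i in F. norm (u i - w i * p i) \<le> norm (star (w i) * w i - p i) * 4"
    by eventually_elim (use u(3) in \<open>simp add: mult.commute\<close>)
  then have "Zfun (\<lambda>i. u i - w i * p i) F" using wp Zfun_imp_Zfun by (auto simp: asym_eq_def)
  then have "u \<simeq>[F] (\<lambda>i. w i * p i)" by (simp add: asym_eq_def Bfun_mult Bw Bp)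
  also have "(\<lambda>i. w i * p i) \<simeq>[F] w"
  proof -
    have "(\<lambda>i. star (w i - w i * p i) * (w i - w i * p i)) \<simeq>[F]
       (\<lambda>i. p i - p i * p i - (p i * p i - p i * p i * p i))"
    proof -
      have "(\<lambda>i. star (w i - w i * p i) * (w i - w i * p i)) =
        (\<lambda>i. star (w i) * w i - (star (w i) * w i) * p i - (p i * (star (w i) * w i) - p i * (star (w i) * w i) * p i))"
        using projsD(2)[OF p] by (simp add: star_simps algebra_simps fun_eq_iff)
      then show ?thesis
        by (simp only:) (intro asym_eq_diff asym_eq_mult wp asym_eq_refl Bp)
    qed
    also have "(\<lambda>i. p i - p i * p i - (p i * p i - p i * p i * p i)) = (\<lambda>_. 0)"
      using projsD(3)[OF p] by simp
    finally have "Zfun (\<lambda>i. star (w i - w i * p i) * (w i - w i * p i)) F" by (simp add: asym_eq_0_iff)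
    then have Z: "Zfun (\<lambda>i. (norm (w i - w i * p i))\<^sup>2) F"
      using Zfun_norm_iff[of "\<lambda>i. star (w i - w i * p i) * (w i - w i * p i)" F] by (simp add: cstar_identity)
    have "Zfun (\<lambda>i. w i - w i * p i) F"
    proof (rule ZfunI)
      fix r :: real assume r: "r > 0"
      then have "\<forall>\<^sub>F i in F. norm ((norm (w i - w i * p i))\<^sup>2) < r\<^sup>2" using ZfunD[OF Z, of "r\<^sup>2"] by simp
      then show "\<forall>\<^sub>F i in F. norm (w i - w i * p i) < r"
        by eventually_elim (rule power2_less_imp_less, use r in simp_all)
    qed
    then have "w \<simeq>[F] (\<lambda>i. w i * p i)" by (simp add: asym_eq_def Bfun_mult Bw Bp)
    then show ?thesis by (rule asym_eq_sym)
  qed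
  finally have uw: "u \<simeq>[F] w" .
  show thesis by (rule that[OF u(1) 1 uw u(2)])
qed

text \<open>Cutting an asymptotic equivalence down to the target and correcting it by polar decomposition gives
  \<open>u\<^sub>i\<close> with \<open>u\<^sub>i u\<^sub>i\<^sup>* \<le> q\<^sub>i\<close>; two comparable projections at distance less than \<open>1\<close> are equal.\<close>

lemma mvn_equiv_if_asym:
  fixes v :: "'i \<Rightarrow> 'a::cstar_algebra"
  assumes M: "\<And>i. cstar_subalgebra (M i)" and p: "\<And>i. p i \<in> projs (M i)" and q: "\<And>i. q i \<in> projs (M i)"
    and v: "\<And>i. v i \<in> M i"
    and vp: "(\<lambda>i. star (v i) * v i) \<simeq>[F] p" and vq: "(\<lambda>i. v i * star (v i)) \<simeq>[F] q"
  shows "\<forall>\<^sub>F i in F. mvn_equiv (M i) (p i) (q i)"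
proof -
  have Bv: "Bfun v F" by (rule Bfun_if_Bfun_star_mult[OF asym_eq_Bfun_left[OF vp]])
  have Bsv: "Bfun (\<lambda>i. star (v i)) F" by (rule Bfun_bounded_linear[OF bounded_linear_star Bv])
  have Bp: "Bfun p F" and Bq: "Bfun q F" by (rule Bfun_projs[OF p], rule Bfun_projs[OF q])
  define w where "w i = q i * v i" for i
  have wM: "w i \<in> M i" for i using M projsD(1)[OF q] v by (simp add: w_def subalgebra_mult)
  have qw: "q i * w i = w i" for i using projsD(3)[OF q] by (simp add: w_def mult.assoc[symmetric])
  have "(\<lambda>i. star (w i) * w i) = (\<lambda>i. star (v i) * q i * v i)"
    using projsD(2,3)[OF q] by (simp add: w_def star_mult fun_eq_iff) (metis mult.assoc)
  also have "\<dots> \<simeq>[F] (\<lambda>i. star (v i) * (v i * star (v i)) * v i)"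
    by (intro asym_eq_mult asym_eq_refl Bv Bsv asym_eq_sym[OF vq])
  also have "\<dots> = (\<lambda>i. (star (v i) * v i) * (star (v i) * v i))" by (simp add: mult.assoc)
  also have "\<dots> \<simeq>[F] (\<lambda>i. p i * p i)" by (intro asym_eq_mult vp)
  also have "\<dots> = p" using projsD(3)[OF p] by simp
  finally have wp: "(\<lambda>i. star (w i) * w i) \<simeq>[F] p" .
  obtain u where u: "\<And>i. u i \<in> M i" "\<forall>\<^sub>F i in F. star (u i) * u i = p i" "u \<simeq>[F] w"
    "\<And>i q. q * w i = w i \<Longrightarrow> q * u i = u i"
    by (rule partial_isometry_near_asym[where M = M, OF M p wM wp]) blast
  have "(\<lambda>i. u i * star (u i)) \<simeq>[F] (\<lambda>i. w i * star (w i))" by (intro asym_eq_mult asym_eq_star u)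
  also have "\<dots> = (\<lambda>i. q i * (v i * star (v i)) * q i)"
    using projsD(2)[OF q] by (simp add: w_def star_mult mult.assoc)
  also have "\<dots> \<simeq>[F] (\<lambda>i. q i * q i * q i)" by (intro asym_eq_mult asym_eq_refl Bq vq)
  also have "\<dots> = q" using projsD(3)[OF q] by simp
  finally have uq: "(\<lambda>i. u i * star (u i)) \<simeq>[F] q" .
  have "\<forall>\<^sub>F i in F. norm (u i * star (u i) - q i) < 1" by (rule asym_eq_eventually[OF uq]) simp
  with u(2) show ?thesis
  proof eventually_elim
    case (elim i)
    have pi: "projection (star (u i) * u i)" using p[of i] elim by (simp add: projs_def)
    define e where "e = u i * star (u i)"
    have e: "projection e" using projection_range[OF pi] by (simp add: e_def)
    have qe: "q i * e = e" using u(4)[OF qw] by (simp add: e_def mult.assoc[symmetric])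
    have eq: "e * q i = e" using arg_cong[OF qe, of star] e projsD(2)[OF q] by (simp add: star_mult projection_def)
    have "star (q i - e) = q i - e" "(q i - e) * (q i - e) = q i - e"
      using e projsD(2,3)[OF q, of i] by (simp_all add: projection_def star_simps algebra_simps qe eq)
    then have "norm (q i - e) = norm (q i - e) * norm (q i - e)"
      using norm_mult_self_adjoint[of "q i - e"] by (simp add: power2_eq_square)
    then have "q i = e" using elim(2) by (auto simp: e_def[symmetric] norm_minus_commute)
    then show ?case
      using mvn_equivI[OF M u(1)[of i] elim(1)] p[of i] by (simp add: e_def projs_def)
  qed
qed


section \<open>The semigroup V\<close>

definition stab_alg :: "'a::cstar_algebra set \<Rightarrow> 'a stab set" where
  "stab_alg S = {x. \<forall>i j. entry x i j \<in> S}"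

definition matrices :: "nat \<Rightarrow> 'a::cstar_algebra set \<Rightarrow> 'a stab set" where
  "matrices n S = {x \<in> stab_alg S. stab_finite n x}"

lemma cstar_subalgebra_stab_alg: assumes S: "cstar_subalgebra S" shows "cstar_subalgebra (stab_alg S)"
  unfolding cstar_subalgebra_def
proof (intro conjI ballI allI)
  have "stab_alg S = (\<Inter>i j. {x. entry x i j \<in> S})" by (auto simp: stab_alg_def)
  moreover have "closed {x. entry x i j \<in> S}" for i j
    using continuous_closed_vimage[OF subalgebra_closed[OF S] linear_continuous_at[OF bounded_linear_entry[of i j]]]
    by (simp add: vimage_def)
  ultimately show "closed (stab_alg S)" by (simp add: closed_INT)
  fix x y assume xy: "x \<in> stab_alg S" "y \<in> stab_alg S"
  show "x * y \<in> stab_alg S"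
    unfolding stab_alg_def
  proof (intro CollectI allI)
    fix i j
    have lim: "(\<lambda>n. \<Sum>k<n. entry x i k * entry y k j) \<longlonglongrightarrow> entry (x * y) i j"
      using entry_mult_sums by (simp add: sums_def)
    have "(\<Sum>k<n. entry x i k * entry y k j) \<in> S" for n
      using xy by (intro subalgebra_sum[OF S] subalgebra_mult[OF S]) (auto simp: stab_alg_def)
    then show "entry (x * y) i j \<in> S"
      using closed_sequentially[OF subalgebra_closed[OF S] _ lim] by simp
  qed
qed (use S in \<open>auto simp: stab_alg_def subalgebra_intros subalgebra_cscale\<close>)

lemma cstar_subalgebra_matrices: assumes S: "cstar_subalgebra S" shows "cstar_subalgebra (matrices n S)"
  unfolding cstar_subalgebra_def
proof (intro conjI ballI allI)
  note A = cstar_subalgebra_stab_alg[OF S]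
  have "{x :: 'a stab. stab_finite n x} = (\<Inter>i j. {x. \<not> (i < n \<and> j < n) \<longrightarrow> entry x i j = 0})"
    by (auto simp: stab_finite_iff)
  moreover have "closed {x :: 'a stab. \<not> (i < n \<and> j < n) \<longrightarrow> entry x i j = 0}" for i j
    using continuous_closed_vimage[OF closed_singleton[of "0::'a"] linear_continuous_at[OF bounded_linear_entry[of i j]]]
    by (cases "i < n \<and> j < n") (simp_all add: vimage_def)
  ultimately have "closed {x :: 'a stab. stab_finite n x}" by (simp add: closed_INT)
  moreover have "matrices n S = stab_alg S \<inter> {x. stab_finite n x}" by (auto simp: matrices_def)
  ultimately show "closed (matrices n S)" using subalgebra_closed[OF A] by (simp add: closed_Int)
  fix x y assume "x \<in> matrices n S" "y \<in> matrices n S"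
  then show "x * y \<in> matrices n S"
    using A by (auto simp: matrices_def subalgebra_mult stab_finite_iff entry_mult_finite[of n])
qed (use cstar_subalgebra_stab_alg[OF S] in \<open>auto simp: matrices_def subalgebra_intros subalgebra_cscale stab_finite_iff\<close>)

lemma stab_trunc_in_matrices: "cstar_subalgebra S \<Longrightarrow> x \<in> stab_alg S \<Longrightarrow> stab_trunc n x \<in> matrices n S"
  by (auto simp: matrices_def stab_alg_def entry_stab_trunc truncate_def subalgebra_zero)

lemma matrices_subset: "matrices n S \<subseteq> stab_alg S"
  by (auto simp: matrices_def)

lemma matrices_mono: "n \<le> m \<Longrightarrow> matrices n S \<subseteq> matrices m S"
  by (auto simp: matrices_def stab_finite_mono)

lemma projs_mono: "M \<subseteq> N \<Longrightarrow> projs M \<subseteq> projs N"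
  by (auto simp: projs_def)

lemma mvn_equiv_mono: "M \<subseteq> N \<Longrightarrow> mvn_equiv M p q \<Longrightarrow> mvn_equiv N p q"
  unfolding mvn_equiv_def using projs_mono by blast

lemma entry_image_stab_alg: "stabilization S = entry ` stab_alg S"
proof -
  have "stabilization S = {x \<in> stabilization UNIV. \<forall>i j. x i j \<in> S}" by (auto simp: stabilization_iff_tail)
  also have "\<dots> = entry ` stab_alg S"
    by (auto simp: stab_alg_def image_iff entry) (metis Stab_inverse)
  finally show ?thesis .
qed

lemma projections_stabilization: "projections (stabilization S) = entry ` projs (stab_alg S)"
  by (auto simp: projections_def projs_def projection_def entry_image_stab_alg entry_mult[symmetric]
      entry_star_eq[symmetric] entry_inject)

lemma mvn_rel_stabilization:
  "mvn_rel (stabilization S) = {(entry p, entry q) |p q. mvn_equiv (stab_alg S) p q}"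
  unfolding mvn_rel_def projections_stabilization
  by (auto simp: mvn_equiv_def entry_image_stab_alg entry_mult[symmetric] entry_star_eq[symmetric] entry_inject)

lemma mvn_rel_iff: "(entry p, entry q) \<in> mvn_rel (stabilization S) \<longleftrightarrow> mvn_equiv (stab_alg S) p q"
  by (auto simp: mvn_rel_stabilization entry_inject)

definition V_class :: "'a::cstar_algebra set \<Rightarrow> 'a stab \<Rightarrow> 'a imat set" where
  "V_class S p = mvn_rel (stabilization S) `` {entry p}"

lemma V_class_eq: "V_class S p = entry ` {q. mvn_equiv (stab_alg S) p q}"
  by (auto simp: V_class_def mvn_rel_stabilization entry_inject)

lemma entry_in_V_class: "entry q \<in> V_class S p \<longleftrightarrow> mvn_equiv (stab_alg S) p q"
  by (auto simp: V_class_eq entry_inject)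

lemma carrier_V: "carrier (V S) = V_class S ` projs (stab_alg S)"
  by (auto simp: V_def quotient_def projections_stabilization V_class_def)

lemma V_class_in_carrier: "p \<in> projs (stab_alg S) \<Longrightarrow> V_class S p \<in> carrier (V S)"
  by (simp add: carrier_V)

lemma V_class_matrices_in_carrier: "p \<in> projs (matrices n S) \<Longrightarrow> V_class S p \<in> carrier (V S)"
  using projs_mono[OF matrices_subset] by (auto intro: V_class_in_carrier)

lemma one_V: "\<one>\<^bsub>V S\<^esub> = V_class S 0"
proof -
  have "entry (0::'a stab) = (\<lambda>_ _. 0)" by (simp add: fun_eq_iff)
  then show ?thesis by (simp add: V_def V_class_def)
qed

text \<open>Let \<open>v\<close> be \<open>q\<close> with its entries moved down by \<open>k\<close> rows.  Only the rows are moved, which makes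
  \<open>v\<^sup>* v = q\<^sup>* q = q\<close>, and the range projection \<open>v v\<^sup>*\<close> lives in the rows and columns from \<open>k\<close> on.\<close>

lemma orthogonal_copy_matrices:
  assumes S: "cstar_subalgebra S" and p: "p \<in> projs (matrices k S)" and q: "q \<in> projs (matrices n S)"
  obtains q' where "mvn_equiv (matrices (n + k) S) q q'" "p * q' = 0"
proof -
  have qS: "q \<in> stab_alg S" and qf: "stab_finite n q" and pf: "stab_finite k p" using p q by (auto simp: projs_def matrices_def)
  define v where "v = Stab (\<lambda>i j. if k \<le> i then entry q (i - k) j else 0)"
  have ev: "entry v = (\<lambda>i j. if k \<le> i then entry q (i - k) j else 0)"
    unfolding v_def by (rule entry_Stab_finite[of _ "n + k"]) (auto simp: matrix_algebra_def intro!: stab_finite_entry_0[OF qf])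
  have vf: "stab_finite (n + k) v" unfolding stab_finite_iff by (auto simp: ev intro!: stab_finite_entry_0[OF qf])
  have vS: "v \<in> matrices (n + k) S" using qS S vf by (auto simp: matrices_def stab_alg_def ev subalgebra_zero)
  have "star v * v = star q * q"
  proof (rule stab_eqI)
    fix i j
    have "entry (star v * v) i j = (\<Sum>l<n + k. if k \<le> l then star (entry q (l - k) i) * entry q (l - k) j else 0)"
      unfolding entry_mult_finite[OF disjI2[OF vf]] by (rule sum.cong) (auto simp: ev)
    also have "\<dots> = (\<Sum>l\<in>{k..<n + k}. star (entry q (l - k) i) * entry q (l - k) j)"
      by (rule sum.mono_neutral_cong_right) auto
    also have "\<dots> = (\<Sum>l<n. star (entry q l i) * entry q l j)"
      by (rule sum.reindex_bij_witness[of _ "\<lambda>l. l + k" "\<lambda>l. l - k"]) auto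
    also have "\<dots> = entry (star q * q) i j" using qf by (simp add: entry_mult_finite[of n])
    finally show "entry (star v * v) i j = entry (star q * q) i j" .
  qed
  then have 1: "star v * v = q" using projsD[OF q] by simp
  have "p * v = 0"
    by (rule stab_eqI) (auto simp: entry_mult_finite[OF disjI1[OF pf]] ev intro!: sum.neutral)
  then have "p * (v * star v) = 0" by (simp add: mult.assoc[symmetric])
  moreover have "mvn_equiv (matrices (n + k) S) q (v * star v)"
    using mvn_equivI[OF cstar_subalgebra_matrices[OF S] vS 1] q by (simp add: projs_def)
  ultimately show thesis using that by blast
qed

context
  fixes S :: "'a::cstar_algebra set"
  assumes S: "cstar_subalgebra S"
begin

private abbreviation "M \<equiv> stab_alg S"

private lemma M: "cstar_subalgebra M"
  by (rule cstar_subalgebra_stab_alg[OF S])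

text \<open>Truncations of \<open>p\<close> are almost projections, so \<open>p\<close> is close to a projection in a matrix algebra.\<close>

lemma projection_equiv_matrix:
  assumes p: "p \<in> projs M"
  obtains n p' where "p' \<in> projs (matrices n S)" "mvn_equiv M p p'"
proof -
  let ?x = "\<lambda>n. stab_trunc n p"
  have x: "?x \<simeq>[sequentially] (\<lambda>_. p)"
    using stab_trunc_tendsto[of p] by (simp add: asym_eq_def tendsto_Zfun_iff)
  have "(\<lambda>n. star (?x n)) \<simeq>[sequentially] (\<lambda>_. p)"
    using asym_eq_star[OF x] by (simp add: projsD(2)[OF p])
  then have star: "(\<lambda>n. star (?x n)) \<simeq>[sequentially] ?x" by (rule asym_eq_trans[OF _ asym_eq_sym[OF x]])
  have "(\<lambda>n. ?x n * ?x n) \<simeq>[sequentially] (\<lambda>_. p)"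
    using asym_eq_mult[OF x x] by (simp add: projsD(3)[OF p])
  then have idem: "(\<lambda>n. ?x n * ?x n) \<simeq>[sequentially] ?x" by (rule asym_eq_trans[OF _ asym_eq_sym[OF x]])
  obtain q where q: "\<And>n. q n \<in> projs (matrices n S)" "q \<simeq>[sequentially] ?x"
    by (rule projection_near_asym[OF cstar_subalgebra_matrices[OF S] _ star idem])
      (use stab_trunc_in_matrices[OF S projsD(1)[OF p]] in blast)+
  have qM: "q n \<in> projs M" for n using q(1) projs_mono[OF matrices_subset] by blast
  have qp: "q \<simeq>[sequentially] (\<lambda>_. p)" by (rule asym_eq_trans[OF q(2) x])
  have "(\<lambda>n. star p * p) \<simeq>[sequentially] (\<lambda>_. p)" "(\<lambda>n. p * star p) \<simeq>[sequentially] q"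
    using asym_eq_sym[OF qp] by (simp_all add: projsD[OF p] asym_eq_const)
  then have "\<forall>\<^sub>F n in sequentially. mvn_equiv M p (q n)"
    using mvn_equiv_if_asym[of "\<lambda>_. M" "\<lambda>_. p" q "\<lambda>_. p" sequentially] M p qM projsD(1)[OF p] by blast
  then obtain n where "mvn_equiv M p (q n)" by (auto simp: eventually_sequentially)
  with q(1) show thesis using that by blast
qed

lemma orthogonal_copies:
  assumes p: "p \<in> projs M" and q: "q \<in> projs M"
  obtains n p' q' where "p' \<in> projs (matrices n S)" "q' \<in> projs (matrices n S)"
    "mvn_equiv M p p'" "mvn_equiv M q q'" "p' * q' = 0"
proof -
  obtain k p' where p': "p' \<in> projs (matrices k S)" "mvn_equiv M p p'" using projection_equiv_matrix[OF p] by blast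
  obtain n q1 where q1: "q1 \<in> projs (matrices n S)" "mvn_equiv M q q1" using projection_equiv_matrix[OF q] by blast
  obtain q' where q': "mvn_equiv (matrices (n + k) S) q1 q'" "p' * q' = 0"
    using orthogonal_copy_matrices[OF S p'(1) q1(1)] by blast
  have "p' \<in> projs (matrices (n + k) S)" using p'(1) projs_mono[OF matrices_mono[of k "n + k"]] by auto
  moreover have "q' \<in> projs (matrices (n + k) S)" using q'(1) by (simp add: mvn_equiv_def)
  moreover have "mvn_equiv M q q'"
    using mvn_equiv_trans[OF M q1(2) mvn_equiv_mono[OF matrices_subset q'(1)]] .
  ultimately show thesis using that p'(2) q'(2) by blast
qed

lemma V_class_eq_iff:
  assumes "p \<in> projs M" "q \<in> projs M"
  shows "V_class S p = V_class S q \<longleftrightarrow> mvn_equiv M p q"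
proof
  assume "V_class S p = V_class S q"
  then have "entry q \<in> V_class S p" using mvn_equiv_refl[OF assms(2)] by (simp add: entry_in_V_class)
  then show "mvn_equiv M p q" by (simp add: entry_in_V_class)
next
  assume "mvn_equiv M p q"
  then show "V_class S p = V_class S q"
    unfolding V_class_eq using mvn_equiv_trans[OF M] mvn_equiv_sym[OF M] by blast
qed

lemma V_class_cong: "mvn_equiv M p q \<Longrightarrow> V_class S p = V_class S q"
  using V_class_eq_iff by (auto simp: mvn_equiv_def)

lemma V_cases:
  assumes "x \<in> carrier (V S)"
  obtains n p where "p \<in> projs (matrices n S)" "p \<in> projs M" "x = V_class S p"
proof -
  obtain q where q: "q \<in> projs M" "x = V_class S q" using assms by (auto simp: carrier_V)
  obtain n p where p: "p \<in> projs (matrices n S)" "mvn_equiv M q p" using projection_equiv_matrix[OF q(1)] by blast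
  then show thesis using that q V_class_cong by (metis mvn_equiv_def)
qed

lemma V_cases_orthogonal:
  assumes "x \<in> carrier (V S)" "y \<in> carrier (V S)"
  obtains n p q where "p \<in> projs (matrices n S)" "q \<in> projs (matrices n S)"
    "p \<in> projs M" "q \<in> projs M" "p * q = 0" "x = V_class S p" "y = V_class S q"
proof -
  obtain p0 q0 where 0: "p0 \<in> projs M" "x = V_class S p0" "q0 \<in> projs M" "y = V_class S q0"
    using assms by (auto simp: carrier_V)
  obtain n p q where "p \<in> projs (matrices n S)" "q \<in> projs (matrices n S)"
    "mvn_equiv M p0 p" "mvn_equiv M q0 q" "p * q = 0" by (rule orthogonal_copies[OF 0(1,3)])
  then show thesis using that 0 V_class_cong by (metis mvn_equiv_def)
qed

text \<open>The set on the left consists of all sums of orthogonal representatives.  It is the whole class of \<open>p + q\<close>, as a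
  partial isometry with source \<open>p + q\<close> maps \<open>p\<close> and \<open>q\<close> to orthogonal projections.\<close>

lemma V_mult:
  assumes p: "p \<in> projs M" and q: "q \<in> projs M" and pq: "p * q = 0"
  shows "V_class S p \<otimes>\<^bsub>V S\<^esub> V_class S q = V_class S (p + q)"
proof -
  have entry0: "entry x = (\<lambda>_ _. 0) \<longleftrightarrow> x = 0" for x :: "'a stab"
    by (metis entry_inject entry_zero ext)
  have eq: "V_class S p \<otimes>\<^bsub>V S\<^esub> V_class S q =
     {entry (p' + q') |p' q'. mvn_equiv M p p' \<and> mvn_equiv M q q' \<and> p' * q' = 0}"
  proof -
    have add: "imat_add (entry a) (entry b) = entry (a + b)" for a b :: "'a stab"
      by (simp add: imat_add_def fun_eq_iff)
    show ?thesis
    proof (rule equalityI; rule subsetI)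
      fix X assume "X \<in> V_class S p \<otimes>\<^bsub>V S\<^esub> V_class S q"
      then show "X \<in> {entry (p' + q') |p' q'. mvn_equiv M p p' \<and> mvn_equiv M q q' \<and> p' * q' = 0}"
        by (auto simp: V_def V_class_eq entry_mult[symmetric] entry0 add) blast
    next
      fix X assume "X \<in> {entry (p' + q') |p' q'. mvn_equiv M p p' \<and> mvn_equiv M q q' \<and> p' * q' = 0}"
      then obtain p' q' where X: "X = imat_add (entry p') (entry q')" "mvn_equiv M p p'" "mvn_equiv M q q'" "p' * q' = 0"
        by (auto simp: add)
      then have "imat_mult (entry p') (entry q') = (\<lambda>_ _. 0)" by (simp add: entry_mult[symmetric] entry0)
      moreover have "entry p' \<in> V_class S p" "entry q' \<in> V_class S q" using X by (simp_all add: entry_in_V_class)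
      ultimately show "X \<in> V_class S p \<otimes>\<^bsub>V S\<^esub> V_class S q"
        unfolding X(1) by (simp add: V_def) blast
    qed
  qed
  show ?thesis
  proof (rule equalityI; rule subsetI)
    fix X assume "X \<in> V_class S p \<otimes>\<^bsub>V S\<^esub> V_class S q"
    then show "X \<in> V_class S (p + q)"
      unfolding eq using mvn_equiv_add[OF M _ _ pq] by (auto simp: entry_in_V_class)
  next
    fix X assume "X \<in> V_class S (p + q)"
    then obtain r where r: "X = entry r" "mvn_equiv M (p + q) r" by (auto simp: V_class_eq)
    obtain v where v: "v \<in> M" "star v * v = p + q" "v * star v = r" "v * (p + q) = v"
      using mvn_equivE[OF r(2)] by metis
    note pD = projsD[OF p] and qD = projsD[OF q]
    have qp: "q * p = 0" using p q pq projection_mult_commute_0 by (auto simp: projs_def)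
    have vp: "star (v * p) * (v * p) = p"
    proof -
      have "star (v * p) * (v * p) = p * (star v * v) * p" by (simp add: star_mult pD mult.assoc)
      also have "\<dots> = p" by (simp add: v(2) algebra_simps pD(3) qp)
      finally show ?thesis .
    qed
    have vq: "star (v * q) * (v * q) = q"
    proof -
      have "star (v * q) * (v * q) = q * (star v * v) * q" by (simp add: star_mult qD mult.assoc)
      also have "\<dots> = q" by (simp add: v(2) algebra_simps qD(3) pq)
      finally show ?thesis .
    qed
    define p' where "p' = (v * p) * star (v * p)"
    define q' where "q' = (v * q) * star (v * q)"
    have p': "mvn_equiv M p p'" and q': "mvn_equiv M q q'"
      unfolding p'_def q'_def using M v(1) pD(1) qD(1) vp vq p q
      by (auto intro!: mvn_equivI subalgebra_mult simp: projs_def)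
    have "p' * q' = v * p * (p * (star v * v) * q) * q * star v"
      by (simp add: p'_def q'_def star_mult pD(2) qD(2) mult.assoc)
    also have "p * (star v * v) * q = 0" by (simp add: v(2) ring_distribs pD(3) pq)
    finally have "p' * q' = 0" by simp
    moreover have "p' + q' = v * (p * p + q * q) * star v"
      by (simp add: p'_def q'_def star_mult pD(2) qD(2) algebra_simps)
    then have "p' + q' = r" by (simp add: pD(3) qD(3) v(4) v(3))
    ultimately show "X \<in> V_class S p \<otimes>\<^bsub>V S\<^esub> V_class S q" unfolding eq using p' q' r(1) by blast
  qed
qed

lemma V_mult_closed:
  assumes "x \<in> carrier (V S)" "y \<in> carrier (V S)" shows "x \<otimes>\<^bsub>V S\<^esub> y \<in> carrier (V S)"
proof -
  obtain p q where "p \<in> projs M" "q \<in> projs M" "p * q = 0" "x = V_class S p" "y = V_class S q"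
    using V_cases_orthogonal[OF assms] by metis
  then show ?thesis by (simp add: V_mult V_class_in_carrier projs_add[OF M])
qed

lemma V_mult_commute:
  assumes "x \<in> carrier (V S)" "y \<in> carrier (V S)" shows "x \<otimes>\<^bsub>V S\<^esub> y = y \<otimes>\<^bsub>V S\<^esub> x"
proof -
  obtain p q where pq: "p \<in> projs M" "q \<in> projs M" "p * q = 0" "x = V_class S p" "y = V_class S q"
    using V_cases_orthogonal[OF assms] by metis
  then have "q * p = 0" using projection_mult_commute_0 by (auto simp: projs_def)
  then show ?thesis using pq by (simp add: V_mult add.commute)
qed

text \<open>The partial isometry that implements the equivalence maps \<open>p\<close> and \<open>q\<close> to the parts of \<open>r\<close>.\<close>

lemma mvn_equiv_add_split:
  assumes p: "p \<in> projs M" and q: "q \<in> projs M" and pq: "p * q = 0" and r: "mvn_equiv M (p + q) r"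
  obtains p' q' where "mvn_equiv M p p'" "mvn_equiv M q q'" "p' * q' = 0" "p' + q' = r"
proof -
  have "entry r \<in> V_class S p \<otimes>\<^bsub>V S\<^esub> V_class S q"
    using r by (simp add: V_mult[OF p q pq] entry_in_V_class)
  then obtain P Q where PQ: "entry r = imat_add P Q" "P \<in> V_class S p" "Q \<in> V_class S q" "imat_mult P Q = (\<lambda>_ _. 0)"
    by (auto simp: V_def)
  then obtain p' q' where pq': "P = entry p'" "Q = entry q'" "mvn_equiv M p p'" "mvn_equiv M q q'"
    by (auto simp: V_class_eq)
  have "entry (p' * q') = (\<lambda>_ _. 0)" using PQ(4) pq' by (simp add: entry_mult)
  then have "p' * q' = 0" by (intro stab_eqI) simp
  moreover have "p' + q' = r" using PQ(1) pq' by (intro stab_eqI) (simp add: imat_add_def)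
  ultimately show thesis using that pq' by blast
qed

lemma V_mult_assoc:
  assumes x: "x \<in> carrier (V S)" and y: "y \<in> carrier (V S)" and z: "z \<in> carrier (V S)"
  shows "x \<otimes>\<^bsub>V S\<^esub> y \<otimes>\<^bsub>V S\<^esub> z = x \<otimes>\<^bsub>V S\<^esub> (y \<otimes>\<^bsub>V S\<^esub> z)"
proof -
  obtain p q where pq: "p \<in> projs M" "q \<in> projs M" "p * q = 0" "x = V_class S p" "y = V_class S q"
    using V_cases_orthogonal[OF x y] by metis
  obtain t where t: "t \<in> projs M" "z = V_class S t" using z by (auto simp: carrier_V)
  obtain s r where s: "mvn_equiv M (p + q) s" "mvn_equiv M t r" "s * r = 0"
    using orthogonal_copies[OF projs_add[OF M pq(1-3)] t(1)] by blast
  obtain p' q' where p': "mvn_equiv M p p'" "mvn_equiv M q q'" "p' * q' = 0" "p' + q' = s"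
    using mvn_equiv_add_split[OF pq(1-3) s(1)] by blast
  have pr: "p' \<in> projs M" "q' \<in> projs M" "r \<in> projs M" using p' s by (auto simp: mvn_equiv_def)
  have sum: "p' * r + q' * r = 0" using s(3) by (simp add: p'(4)[symmetric] algebra_simps)
  have qp: "q' * p' = 0" using p'(3) pr projection_mult_commute_0 by (auto simp: projs_def)
  have "p' * r = p' * (p' * r + q' * r)"
    by (simp add: ring_distribs mult.assoc[symmetric] projsD(3)[OF pr(1)] p'(3))
  then have a: "p' * r = 0" by (simp add: sum)
  then have b: "q' * r = 0" using sum by simp
  have eqs: "x = V_class S p'" "y = V_class S q'" "z = V_class S r"
    using pq t p' s V_class_cong by auto
  have "x \<otimes>\<^bsub>V S\<^esub> y \<otimes>\<^bsub>V S\<^esub> z = V_class S (p' + q' + r)"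
    using pr a b p'(3) by (simp add: eqs V_mult projs_add[OF M] ring_distribs add.assoc)
  also have "\<dots> = x \<otimes>\<^bsub>V S\<^esub> (y \<otimes>\<^bsub>V S\<^esub> z)"
    using pr a b p'(3) by (simp add: eqs V_mult projs_add[OF M] ring_distribs add.assoc)
  finally show ?thesis .
qed

lemma comm_monoid_V: "comm_monoid (V S)"
proof (rule comm_monoidI)
  show one: "\<one>\<^bsub>V S\<^esub> \<in> carrier (V S)" by (simp add: one_V V_class_in_carrier zero_in_projs[OF M])
  show "\<one>\<^bsub>V S\<^esub> \<otimes>\<^bsub>V S\<^esub> x = x" if x: "x \<in> carrier (V S)" for x
  proof -
    obtain p where "p \<in> projs M" "x = V_class S p" using x by (auto simp: carrier_V)
    then show ?thesis by (simp add: one_V V_mult zero_in_projs[OF M])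
  qed
qed (use V_mult_closed V_mult_assoc V_mult_commute in auto)

lemma V_le_class_iff:
  assumes p: "p \<in> projs M" and q: "q \<in> projs M"
  shows "V_class S p \<preceq>\<^bsub>V S\<^esub> V_class S q \<longleftrightarrow> (\<exists>v\<in>M. star v * v = p \<and> q * v = v)"
proof
  assume "V_class S p \<preceq>\<^bsub>V S\<^esub> V_class S q"
  then obtain P Q where PQ: "P \<in> V_class S p" "Q \<in> V_class S q" "mvn_subequivalent (stabilization S) P Q"
    by (auto simp: V_def)
  obtain p' q' where pq': "P = entry p'" "Q = entry q'" "mvn_equiv M p p'" "mvn_equiv M q q'"
    using PQ by (auto simp: V_class_eq)
  obtain e where e: "e \<in> projs M" "e * q' = e" "mvn_equiv M p' e"
    using PQ(3) unfolding pq' mvn_subequivalent_def projections_stabilization subprojection_def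
    by (auto simp: mvn_rel_iff entry_mult[symmetric] entry_inject)
  obtain a where a: "a \<in> M" "star a * a = p" "p' * a = a" using mvn_equivE[OF pq'(3)] by metis
  obtain b where b: "b \<in> M" "star b * b = p'" "e * b = b" using mvn_equivE[OF e(3)] by metis
  obtain c where c: "c \<in> M" "star c * c = q" "c * star c = q'" "q * star c = star c"
    using mvn_equivE[OF pq'(4)] by metis
  have q'p: "q' \<in> projs M" using pq'(4) by (simp add: mvn_equiv_def)
  have "q' * e = e" using arg_cong[OF e(2), of star] projsD(2)[OF e(1)] projsD(2)[OF q'p] by (simp add: star_mult)
  then have qb: "q' * b = b" by (metis b(3) mult.assoc)
  define v where "v = star c * (b * a)"
  have "star v * v = star a * (star b * ((c * star c) * b)) * a" by (simp add: v_def star_simps mult.assoc)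
  also have "\<dots> = star a * (star b * b) * a" by (simp add: c(3) qb)
  also have "\<dots> = p" by (simp add: b(2) a(2,3) mult.assoc)
  finally have "star v * v = p" .
  moreover have "q * v = v" by (simp add: v_def mult.assoc[symmetric] c(4))
  moreover have "v \<in> M" using M a b c by (simp add: v_def subalgebra_intros)
  ultimately show "\<exists>v\<in>M. star v * v = p \<and> q * v = v" by blast
next
  assume "\<exists>v\<in>M. star v * v = p \<and> q * v = v"
  then obtain v where v: "v \<in> M" "star v * v = p" "q * v = v" by blast
  define e where "e = v * star v"
  have pe: "mvn_equiv M p e" unfolding e_def using M v p by (intro mvn_equivI) (auto simp: projs_def)
  then have e: "e \<in> projs M" by (simp add: mvn_equiv_def)
  have "q * e = e" by (simp add: e_def mult.assoc[symmetric] v(3))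
  moreover have "star (q * e) = e * q" by (simp add: star_mult projsD(2)[OF e] projsD(2)[OF q])
  ultimately have "e * q = e" using projsD(2)[OF e] by simp
  then have "mvn_subequivalent (stabilization S) (entry p) (entry q)"
    unfolding mvn_subequivalent_def projections_stabilization subprojection_def
    using e pe by (auto simp: mvn_rel_iff entry_mult[symmetric] intro!: bexI[of _ e])
  then show "V_class S p \<preceq>\<^bsub>V S\<^esub> V_class S q"
    using mvn_equiv_refl[OF p] mvn_equiv_refl[OF q] by (auto simp: V_def V_class_eq)
qed

text \<open>If \<open>p\<close> is equivalent to a subprojection \<open>e\<close> of \<open>q\<close>, then \<open>[q] = [p] + [q - e]\<close>: the order of \<open>V\<close> is the
  algebraic one, and additive maps are monotone.\<close>

lemma V_le_iff:
  assumes x: "x \<in> carrier (V S)" and y: "y \<in> carrier (V S)"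
  shows "x \<preceq>\<^bsub>V S\<^esub> y \<longleftrightarrow> (\<exists>z\<in>carrier (V S). y = x \<otimes>\<^bsub>V S\<^esub> z)"
proof
  assume le: "x \<preceq>\<^bsub>V S\<^esub> y"
  obtain p q where pq: "p \<in> projs M" "x = V_class S p" "q \<in> projs M" "y = V_class S q"
    using x y by (auto simp: carrier_V)
  obtain v where v: "v \<in> M" "star v * v = p" "q * v = v"
    using le V_le_class_iff[OF pq(1,3)] pq by auto
  define e where "e = v * star v"
  have pe: "mvn_equiv M p e" unfolding e_def using M v pq by (intro mvn_equivI) (auto simp: projs_def)
  then have e: "e \<in> projs M" by (simp add: mvn_equiv_def)
  have qe: "q * e = e" by (simp add: e_def mult.assoc[symmetric] v(3))
  have "star (q * e) = e * q" by (simp add: star_mult projsD(2)[OF e] projsD(2)[OF pq(3)])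
  then have eq: "e * q = e" using projsD(2)[OF e] qe by simp
  have d: "q - e \<in> projs M"
    using M e pq(3) qe eq by (auto simp: projs_def projection_def star_simps algebra_simps subalgebra_intros)
  have "e * (q - e) = 0" by (simp add: algebra_simps eq projsD(3)[OF e])
  from V_mult[OF e d this] have "y = x \<otimes>\<^bsub>V S\<^esub> V_class S (q - e)"
    using V_class_cong[OF pe] by (simp add: pq)
  then show "\<exists>z\<in>carrier (V S). y = x \<otimes>\<^bsub>V S\<^esub> z" using V_class_in_carrier[OF d] by blast
next
  assume "\<exists>z\<in>carrier (V S). y = x \<otimes>\<^bsub>V S\<^esub> z"
  then obtain z where z: "z \<in> carrier (V S)" "y = x \<otimes>\<^bsub>V S\<^esub> z" by blast
  obtain p q where pq: "p \<in> projs M" "q \<in> projs M" "p * q = 0" "x = V_class S p" "z = V_class S q"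
    using V_cases_orthogonal[OF x z(1)] by metis
  have "q * p = 0" using pq projection_mult_commute_0 by (auto simp: projs_def)
  then have "star p * p = p" "(p + q) * p = p" using projsD[OF pq(1)] by (simp_all add: algebra_simps)
  then show "x \<preceq>\<^bsub>V S\<^esub> y"
    using V_le_class_iff[OF pq(1) projs_add[OF M pq(1-3)]] projsD(1)[OF pq(1)]
    by (auto simp: z(2) pq(4,5) V_mult[OF pq(1-3)])
qed

end


section \<open>Functoriality of V\<close>

definition stab_map :: "('a::cstar_algebra \<Rightarrow> 'b::cstar_algebra) \<Rightarrow> 'a stab \<Rightarrow> 'b stab" where
  "stab_map f x = Stab (imat_map f (entry x))"

lemma entry_stab_map_finite:
  assumes "f 0 = 0" "stab_finite n x" shows "entry (stab_map f x) i j = f (entry x i j)"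
proof -
  have "imat_map f (entry x) \<in> matrix_algebra n UNIV"
    using assms by (auto simp: matrix_algebra_def imat_map_def stab_finite_iff)
  then show ?thesis by (simp add: stab_map_def entry_Stab_finite imat_map_def)
qed

lemma stab_finite_stab_map: "f 0 = 0 \<Longrightarrow> stab_finite n x \<Longrightarrow> stab_finite n (stab_map f x)"
  by (simp add: stab_finite_iff[of n "stab_map f x"] entry_stab_map_finite stab_finite_entry_0)
    (auto simp: stab_finite_iff)

context
  fixes f :: "'a::cstar_algebra \<Rightarrow> 'b::cstar_algebra"
  assumes f: "star_homomorphism f"
begin

lemma star_hom_add: "f (x + y) = f x + f y" and star_hom_cscale: "f (cscale c x) = cscale c (f x)"
  and star_hom_mult: "f (x * y) = f x * f y" and star_hom_star: "f (star x) = star (f x)"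
  using f by (auto simp: star_homomorphism_def)

lemma star_hom_scaleR: "f (r *\<^sub>R x) = r *\<^sub>R f x"
  using star_hom_cscale[of "complex_of_real r" x] by (simp add: cscale_of_real)

lemma star_hom_zero: "f 0 = 0"
  using star_hom_scaleR[of 0 0] by simp

lemma star_hom_sum: "f (sum h I) = (\<Sum>i\<in>I. f (h i))"
  by (induction I rule: infinite_finite_induct) (simp_all add: star_hom_zero star_hom_add)

lemma star_hom_norm_le: "norm (f x) \<le> norm x"
  by (rule star_homomorphism_on_norm_le[OF cstar_subalgebra_UNIV _ UNIV_I])
    (simp add: star_homomorphism_on_def star_hom_add star_hom_mult star_hom_star star_hom_scaleR)

lemma star_hom_bounded_linear: "bounded_linear f"
  by (rule bounded_linear_intro[where K = 1]) (simp_all add: star_hom_add star_hom_scaleR star_hom_norm_le)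

text \<open>On \<open>n \<times> n\<close> matrices, entrywise application of \<open>f\<close> is a *-homomorphism of C*-algebras, hence
  contractive.\<close>

lemma matrix_norm_imat_map_le: "matrix_norm n (imat_map f y) \<le> matrix_norm n y"
proof -
  define x where "x = Stab (truncate n y)"
  have ex: "entry x = truncate n y"
    unfolding x_def by (rule entry_Stab_finite[of _ n]) (auto simp: matrix_algebra_def truncate_def)
  have xf: "stab_finite n x" by (auto simp: stab_finite_iff ex truncate_def)
  note em = entry_stab_map_finite[of f n, OF star_hom_zero]
  have "star_homomorphism_on (matrices n UNIV) (stab_map f)"
    unfolding star_homomorphism_on_def
  proof (intro ballI conjI allI)
    fix x y :: "'a stab" and r
    assume xy: "x \<in> matrices n UNIV" "y \<in> matrices n UNIV"
    then have fin: "stab_finite n x" "stab_finite n y" by (auto simp: matrices_def)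
    have fin2: "stab_finite n (x + y)" "stab_finite n (x * y)" "stab_finite n (star x)" "stab_finite n (r *\<^sub>R x)"
      using fin by (auto simp: stab_finite_iff entry_mult_finite[of n])
    show "stab_map f (x + y) = stab_map f x + stab_map f y"
      using fin fin2 by (intro stab_eqI) (simp add: em star_hom_add)
    show "stab_map f (x * y) = stab_map f x * stab_map f y"
      using fin fin2 stab_finite_stab_map[of f, OF star_hom_zero fin(1)]
      by (intro stab_eqI) (simp add: em entry_mult_finite[of n] star_hom_sum star_hom_mult)
    show "stab_map f (star x) = star (stab_map f x)"
      using fin fin2 by (intro stab_eqI) (simp add: em star_hom_star)
    show "stab_map f (r *\<^sub>R x) = r *\<^sub>R stab_map f x"
      using fin fin2 by (intro stab_eqI) (simp add: em star_hom_scaleR)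
  qed
  moreover have "x \<in> matrices n UNIV" using xf by (simp add: matrices_def stab_alg_def)
  ultimately have "norm (stab_map f x) \<le> norm x"
    using star_homomorphism_on_norm_le[OF cstar_subalgebra_matrices[OF cstar_subalgebra_UNIV]] by blast
  moreover have "norm x = matrix_norm n y" by (simp add: norm_stab_finite[OF xf] ex matrix_norm_truncate)
  moreover have "norm (stab_map f x) = matrix_norm n (imat_map f y)"
    unfolding norm_stab_finite[OF stab_finite_stab_map[of f, OF star_hom_zero xf]]
    by (rule matrix_norm_cong) (simp add: em[OF xf] ex truncate_def imat_map_def)
  ultimately show ?thesis by simp
qed

lemma entry_stab_map: "entry (stab_map f x) i j = f (entry x i j)"
proof -
  have "tail n (imat_map f y) = imat_map f (tail n y)" for n y
    using bounded_linear.linear[OF star_hom_bounded_linear]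
    by (auto simp: tail_def imat_map_def truncate_def fun_eq_iff linear_diff star_hom_zero)
  then have "imat_map f (entry x) \<in> stabilization UNIV"
    using entry[of x] unfolding stabilization_iff_tail
    by (metis UNIV_I le_less_trans matrix_norm_imat_map_le)
  then show ?thesis by (simp add: stab_map_def entry_Stab imat_map_def)
qed

lemma star_homomorphism_stab_map: "star_homomorphism (stab_map f)"
  unfolding star_homomorphism_def
proof (intro conjI allI)
  fix x y :: "'a stab"
  show "stab_map f (x * y) = stab_map f x * stab_map f y"
  proof (rule stab_eqI)
    fix i j
    have 1: "(\<lambda>k. f (entry x i k) * f (entry y k j)) sums f (entry (x * y) i j)"
      using bounded_linear.sums[OF star_hom_bounded_linear entry_mult_sums[of x i y j]] by (simp add: star_hom_mult)
    have 2: "(\<lambda>k. f (entry x i k) * f (entry y k j)) sums entry (stab_map f x * stab_map f y) i j"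
      using entry_mult_sums[of "stab_map f x" i "stab_map f y" j] by (simp add: entry_stab_map)
    show "entry (stab_map f (x * y)) i j = entry (stab_map f x * stab_map f y) i j"
      using sums_unique2[OF 1 2] by (simp add: entry_stab_map)
  qed
qed (auto intro!: stab_eqI simp: entry_stab_map star_hom_add star_hom_cscale star_hom_star)

lemma stab_map_in_stab_alg: "f ` S \<subseteq> T \<Longrightarrow> x \<in> stab_alg S \<Longrightarrow> stab_map f x \<in> stab_alg T"
  by (auto simp: stab_alg_def entry_stab_map)

end

lemma star_hom_mvn_equiv:
  assumes f: "star_homomorphism f" "f ` M \<subseteq> N" and pq: "mvn_equiv M p q"
  shows "mvn_equiv N (f p) (f q)"
proof -
  obtain v where v: "v \<in> M" "star v * v = p" "v * star v = q" using mvn_equivE[OF pq] by metis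
  have "star (f v) * f v = f p" "f v * star (f v) = f q"
    using v by (simp_all flip: star_hom_mult[OF f(1)] star_hom_star[OF f(1)])
  moreover have "f p \<in> projs N" "f q \<in> projs N"
    using pq f(2) by (auto simp: mvn_equiv_def projs_def projection_def simp flip: star_hom_mult[OF f(1)] star_hom_star[OF f(1)])
  ultimately show ?thesis using v(1) f(2) by (auto simp: mvn_equiv_def)
qed

lemma star_hom_projs: "star_homomorphism f \<Longrightarrow> f ` M \<subseteq> N \<Longrightarrow> p \<in> projs M \<Longrightarrow> f p \<in> projs N"
  using star_hom_mvn_equiv[OF _ _ mvn_equiv_refl, of f M N p] by (simp add: mvn_equiv_def)

lemma stab_map_projs:
  "star_homomorphism f \<Longrightarrow> f ` S \<subseteq> T \<Longrightarrow> p \<in> projs (stab_alg S) \<Longrightarrow> stab_map f p \<in> projs (stab_alg T)"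
  by (rule star_hom_projs[OF star_homomorphism_stab_map]) (auto simp: stab_map_in_stab_alg)

lemma V_map_class:
  assumes f: "star_homomorphism f" "f ` S \<subseteq> T" and T: "cstar_subalgebra T" and p: "p \<in> projs (stab_alg S)"
  shows "V_map T f (V_class S p) = V_class T (stab_map f p)"
proof -
  have ent: "imat_map f (entry q) = entry (stab_map f q)" for q
    by (simp add: fun_eq_iff imat_map_def entry_stab_map[OF f(1)])
  have sub: "stab_map f ` stab_alg S \<subseteq> stab_alg T" using stab_map_in_stab_alg[OF f] by auto
  have "V_map T f (V_class S p) = (\<Union>q\<in>{q. mvn_equiv (stab_alg S) p q}. V_class T (stab_map f q))"
    unfolding V_map_def V_class_eq[of S p] image_image ent V_class_def[of T] by blast
  also have "\<dots> = (\<Union>q\<in>{q. mvn_equiv (stab_alg S) p q}. V_class T (stab_map f p))"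
    using V_class_cong[OF T star_hom_mvn_equiv[OF star_homomorphism_stab_map[OF f(1)] sub]] by auto
  also have "\<dots> = V_class T (stab_map f p)" using mvn_equiv_refl[OF p] by auto
  finally show ?thesis .
qed

context
  fixes f :: "'a::cstar_algebra \<Rightarrow> 'b::cstar_algebra" and S T
  assumes f: "star_homomorphism f" "f ` S \<subseteq> T" and S: "cstar_subalgebra S" and T: "cstar_subalgebra T"
begin

lemma V_map_closed: assumes "x \<in> carrier (V S)" shows "V_map T f x \<in> carrier (V T)"
proof -
  obtain p where "p \<in> projs (stab_alg S)" "x = V_class S p" using assms by (auto simp: carrier_V)
  then show ?thesis by (simp add: V_map_class[OF f T] V_class_in_carrier stab_map_projs[OF f])
qed

lemma V_map_mult:
  assumes "x \<in> carrier (V S)" "y \<in> carrier (V S)"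
  shows "V_map T f (x \<otimes>\<^bsub>V S\<^esub> y) = V_map T f x \<otimes>\<^bsub>V T\<^esub> V_map T f y"
proof -
  obtain p q where pq: "p \<in> projs (stab_alg S)" "q \<in> projs (stab_alg S)" "p * q = 0" "x = V_class S p" "y = V_class S q"
    using V_cases_orthogonal[OF S assms] by metis
  note h = star_homomorphism_stab_map[OF f(1)]
  have "stab_map f p * stab_map f q = 0" using pq(3) by (simp add: star_hom_mult[OF h, symmetric] star_hom_zero[OF h])
  then show ?thesis
    using pq f S T by (simp add: V_mult V_map_class projs_add cstar_subalgebra_stab_alg stab_map_projs star_hom_add[OF h])
qed

lemma V_map_one: "V_map T f \<one>\<^bsub>V S\<^esub> = \<one>\<^bsub>V T\<^esub>"
  using f S T by (simp add: one_V V_map_class zero_in_projs cstar_subalgebra_stab_alg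
      star_hom_zero[OF star_homomorphism_stab_map])

lemma V_map_hom: "V_map T f \<in> hom (V S) (V T)"
  by (auto simp: hom_def V_map_closed V_map_mult)

lemma V_map_ordered_hom: "V_map T f \<in> ordered_hom (V S) (V T)"
proof -
  have "V_map T f x \<preceq>\<^bsub>V T\<^esub> V_map T f y" if xy: "x \<in> carrier (V S)" "y \<in> carrier (V S)" "x \<preceq>\<^bsub>V S\<^esub> y" for x y
  proof -
    obtain z where "z \<in> carrier (V S)" "y = x \<otimes>\<^bsub>V S\<^esub> z" using xy V_le_iff[OF S] by blast
    then show ?thesis using xy V_le_iff[OF T] V_map_closed V_map_mult by blast
  qed
  then show ?thesis by (simp add: ordered_hom_def V_map_hom)
qed

end

lemma star_homomorphism_comp: "star_homomorphism f \<Longrightarrow> star_homomorphism g \<Longrightarrow> star_homomorphism (\<lambda>a. g (f a))"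
  by (simp add: star_homomorphism_def)

lemma V_map_comp:
  assumes f: "star_homomorphism f" "f ` S \<subseteq> T" and g: "star_homomorphism g" "g ` T \<subseteq> U"
    and T: "cstar_subalgebra T" and U: "cstar_subalgebra U" and x: "x \<in> carrier (V S)"
  shows "V_map U g (V_map T f x) = V_map U (\<lambda>a. g (f a)) x"
proof -
  obtain p where p: "p \<in> projs (stab_alg S)" "x = V_class S p" using x by (auto simp: carrier_V)
  have "stab_map g (stab_map f p) = stab_map (\<lambda>a. g (f a)) p"
    using f g star_homomorphism_comp[of f g] by (intro stab_eqI) (simp add: entry_stab_map)
  moreover have "(\<lambda>a. g (f a)) ` S \<subseteq> U" using f g by auto
  ultimately show ?thesis
    using p f g T U star_homomorphism_comp[of f g] by (simp add: V_map_class stab_map_projs)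
qed

lemma V_map_cong:
  assumes f: "star_homomorphism f" "f ` S \<subseteq> T" and g: "star_homomorphism g" "\<And>a. a \<in> S \<Longrightarrow> f a = g a"
    and T: "cstar_subalgebra T" and x: "x \<in> carrier (V S)"
  shows "V_map T f x = V_map T g x"
proof -
  obtain p where p: "p \<in> projs (stab_alg S)" "x = V_class S p" using x by (auto simp: carrier_V)
  have "stab_map f p = stab_map g p"
    using p f g by (intro stab_eqI) (simp add: entry_stab_map projs_def stab_alg_def)
  moreover have "g ` S \<subseteq> T" using f g by auto
  ultimately show ?thesis using p f g T by (simp add: V_map_class)
qed

lemma star_homomorphism_ident: "star_homomorphism (\<lambda>a. a)"
  by (simp add: star_homomorphism_def)

lemma V_map_ident: assumes S: "cstar_subalgebra S" and x: "x \<in> carrier (V S)" shows "V_map S (\<lambda>a. a) x = x"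
proof -
  obtain p where p: "p \<in> projs (stab_alg S)" "x = V_class S p" using x by (auto simp: carrier_V)
  have "stab_map (\<lambda>a. a) p = p" by (rule stab_eqI) (simp add: entry_stab_map star_homomorphism_ident)
  then show ?thesis using p S by (simp add: V_map_class star_homomorphism_ident)
qed


section \<open>Sums of asymptotically orthogonal projections\<close>

text \<open>Adding the projections one by one, the sum collected so far is moved by a partial isometry \<open>v\<close> to a copy
  orthogonal to a copy of the next one; conjugation by \<open>v\<close> moves the summands along.\<close>

lemma orthogonal_family_copies:
  assumes S: "cstar_subalgebra S" and I: "finite I" and p: "\<And>k. k \<in> I \<Longrightarrow> p k \<in> projs (stab_alg S)"
  shows "\<exists>q. (\<forall>k\<in>I. mvn_equiv (stab_alg S) (p k) (q k)) \<and> (\<forall>k\<in>I. \<forall>l\<in>I. k \<noteq> l \<longrightarrow> q k * q l = 0) \<and>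
     (\<Sum>k\<in>I. q k) \<in> projs (stab_alg S) \<and>
     (\<Otimes>\<^bsub>V S\<^esub>k\<in>I. V_class S (p k)) = V_class S (\<Sum>k\<in>I. q k)"
  using I p
proof (induction I)
  case empty
  interpret comm_monoid "V S" by (rule comm_monoid_V[OF S])
  show ?case using zero_in_projs[OF cstar_subalgebra_stab_alg[OF S]] by (simp add: one_V)
next
  case (insert j I)
  interpret comm_monoid "V S" by (rule comm_monoid_V[OF S])
  let ?M = "stab_alg S"
  note M = cstar_subalgebra_stab_alg[OF S]
  have "\<exists>q. (\<forall>k\<in>I. mvn_equiv ?M (p k) (q k)) \<and> (\<forall>k\<in>I. \<forall>l\<in>I. k \<noteq> l \<longrightarrow> q k * q l = 0) \<and>
     (\<Sum>k\<in>I. q k) \<in> projs ?M \<and> (\<Otimes>\<^bsub>V S\<^esub>k\<in>I. V_class S (p k)) = V_class S (\<Sum>k\<in>I. q k)"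
    by (rule insert.IH) (simp add: insert.prems)
  then obtain q where IH: "(\<forall>k\<in>I. mvn_equiv ?M (p k) (q k)) \<and> (\<forall>k\<in>I. \<forall>l\<in>I. k \<noteq> l \<longrightarrow> q k * q l = 0) \<and>
     (\<Sum>k\<in>I. q k) \<in> projs ?M \<and> (\<Otimes>\<^bsub>V S\<^esub>k\<in>I. V_class S (p k)) = V_class S (\<Sum>k\<in>I. q k)" ..
  then have q: "\<And>k. k \<in> I \<Longrightarrow> mvn_equiv ?M (p k) (q k)"
    and orth: "\<And>k l. k \<in> I \<Longrightarrow> l \<in> I \<Longrightarrow> k \<noteq> l \<Longrightarrow> q k * q l = 0"
    and Q: "(\<Sum>k\<in>I. q k) \<in> projs ?M" and prod: "(\<Otimes>\<^bsub>V S\<^esub>k\<in>I. V_class S (p k)) = V_class S (\<Sum>k\<in>I. q k)"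
    by simp_all
  define Q where "Q = (\<Sum>k\<in>I. q k)"
  have qp: "q k \<in> projs ?M" if "k \<in> I" for k using q[OF that] by (simp add: mvn_equiv_def)
  have Qq: "Q * q k = q k" if k: "k \<in> I" for k
  proof -
    have "Q * q k = (\<Sum>l\<in>I. if l = k then q k else 0)"
      unfolding Q_def sum_distrib_right
      by (rule sum.cong) (use orth[OF _ k] projsD(3)[OF qp[OF k]] in auto)
    then show ?thesis using k insert.hyps by simp
  qed
  obtain Q' r where Q': "mvn_equiv ?M Q Q'" and r: "mvn_equiv ?M (p j) r" and Qr: "Q' * r = 0"
    using orthogonal_copies[OF S Q[folded Q_def] insert.prems[OF insertI1]] by metis
  obtain v where v: "v \<in> ?M" "star v * v = Q" "v * star v = Q'" "v * Q = v" "star v * Q' = star v"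
    using mvn_equivE[OF Q'] by metis
  define q' where "q' k = (if k = j then r else v * q k * star v)" for k
  have j: "k \<noteq> j" if "k \<in> I" for k using that insert.hyps by auto
  have 1: "mvn_equiv ?M (p k) (q' k)" if k: "k \<in> I" for k
  proof (rule mvn_equiv_trans[OF M q[OF k]])
    have "star (v * q k) * (v * q k) = q k * (Q * q k)"
      by (simp add: star_mult projsD(2)[OF qp[OF k]] v(2)[symmetric] mult.assoc)
    also have "\<dots> = q k" by (simp add: Qq[OF k] projsD(3)[OF qp[OF k]])
    finally have "mvn_equiv ?M (q k) (v * q k * star (v * q k))"
      using M v(1) qp[OF k] by (intro mvn_equivI subalgebra_mult) (auto simp: projs_def)
    moreover have "v * q k * star (v * q k) = q' k"
      using j[OF k] projsD(2,3)[OF qp[OF k]] by (simp add: q'_def star_mult) (metis mult.assoc)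
    ultimately show "mvn_equiv ?M (q k) (q' k)" by simp
  qed
  have 2: "q' k * q' l = 0" if "k \<in> I" "l \<in> I" "k \<noteq> l" for k l
  proof -
    have "q' k * q' l = v * (q k * (Q * q l)) * star v"
      using j that by (simp add: q'_def v(2)[symmetric] mult.assoc)
    then show ?thesis using that by (simp add: Qq orth)
  qed
  have 3: "q' k * q' j = 0" if "k \<in> I" for k
  proof -
    have "q' k * q' j = v * q k * (star v * (Q' * r))"
      using j[OF that] by (simp add: q'_def mult.assoc) (metis v(5) mult.assoc)
    then show ?thesis by (simp add: Qr)
  qed
  have q'p: "q' k \<in> projs ?M" if "k \<in> insert j I" for k
  proof (cases "k = j")
    case True
    then show ?thesis using r by (simp add: q'_def mvn_equiv_def)
  next
    case False
    then show ?thesis using 1[of k] that by (simp add: mvn_equiv_def)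
  qed
  have 4: "q' j * q' k = 0" if "k \<in> I" for k
    using projection_mult_commute_0[OF _ _ 3[OF that]] q'p[of k] q'p[of j] that by (simp add: projs_def)
  have sumI: "(\<Sum>k\<in>I. q' k) = Q'"
  proof -
    have "(\<Sum>k\<in>I. q' k) = (\<Sum>k\<in>I. v * q k * star v)" by (rule sum.cong) (auto simp: q'_def j)
    also have "\<dots> = v * Q * star v" by (simp add: Q_def sum_distrib_left sum_distrib_right)
    finally show ?thesis by (simp add: v(3,4))
  qed
  have Q'p: "Q' \<in> projs ?M" and rp: "r \<in> projs ?M" using Q' r by (auto simp: mvn_equiv_def)
  have rQ: "r * Q' = 0" using Qr Q'p rp projection_mult_commute_0 by (auto simp: projs_def)
  have sum: "(\<Sum>k\<in>insert j I. q' k) = r + Q'" using insert.hyps by (simp add: sumI) (simp add: q'_def)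
  show ?case
  proof (intro exI[of _ q'] conjI ballI impI)
    show "mvn_equiv ?M (p k) (q' k)" if "k \<in> insert j I" for k
      using that 1[of k] r by (cases "k = j") (simp_all add: q'_def)
    show "q' k * q' l = 0" if "k \<in> insert j I" "l \<in> insert j I" "k \<noteq> l" for k l
      using that 2[of k l] 3[of k] 4[of l] by (cases "k = j"; cases "l = j") simp_all
    show "(\<Sum>k\<in>insert j I. q' k) \<in> projs ?M" unfolding sum by (rule projs_add[OF M rp Q'p rQ])
    have "(\<Otimes>\<^bsub>V S\<^esub>k\<in>insert j I. V_class S (p k)) = V_class S (p j) \<otimes>\<^bsub>V S\<^esub> V_class S Q"
      using insert.hyps insert.prems prod by (simp add: finprod_insert V_class_in_carrier Pi_def Q_def)
    also have "\<dots> = V_class S r \<otimes>\<^bsub>V S\<^esub> V_class S Q'"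
      using V_class_cong[OF S r] V_class_cong[OF S Q'] by simp
    finally show "(\<Otimes>\<^bsub>V S\<^esub>k\<in>insert j I. V_class S (p k)) = V_class S (\<Sum>k\<in>insert j I. q' k)"
      by (simp add: sum V_mult[OF S rp Q'p rQ])
  qed
qed

text \<open>With orthogonal copies \<open>q\<^sub>k = u\<^sub>k\<^sup>* u\<^sub>k\<close> of \<open>p\<^sub>k = u\<^sub>k u\<^sub>k\<^sup>*\<close>, the sum of the \<open>u\<^sub>k\<close> has the range
  \<open>\<Sum> p\<^sub>k\<close>, exactly, and the source \<open>\<Sum> q\<^sub>k\<close>, asymptotically.\<close>

lemma V_class_sum_asym:
  assumes S: "cstar_subalgebra S" and I: "finite I"
    and p: "\<And>k i. k \<in> I \<Longrightarrow> p k i \<in> projs (stab_alg S)" and r: "\<And>i. r i \<in> projs (stab_alg S)"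
    and orth: "\<And>k l. k \<in> I \<Longrightarrow> l \<in> I \<Longrightarrow> k \<noteq> l \<Longrightarrow> (\<lambda>i. p k i * p l i) \<simeq>[F] (\<lambda>_. 0)"
    and sum: "(\<lambda>i. \<Sum>k\<in>I. p k i) \<simeq>[F] r"
  shows "\<forall>\<^sub>F i in F. (\<Otimes>\<^bsub>V S\<^esub>k\<in>I. V_class S (p k i)) = V_class S (r i)"
proof -
  let ?M = "stab_alg S"
  note M = cstar_subalgebra_stab_alg[OF S]
  have "\<forall>i. \<exists>q. (\<forall>k\<in>I. mvn_equiv ?M (p k i) (q k)) \<and> (\<forall>k\<in>I. \<forall>l\<in>I. k \<noteq> l \<longrightarrow> q k * q l = 0) \<and>
     (\<Sum>k\<in>I. q k) \<in> projs ?M \<and> (\<Otimes>\<^bsub>V S\<^esub>k\<in>I. V_class S (p k i)) = V_class S (\<Sum>k\<in>I. q k)"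
    by (intro allI orthogonal_family_copies[OF S I] p)
  from choice[OF this] obtain q where copies: "\<forall>i. (\<forall>k\<in>I. mvn_equiv ?M (p k i) (q i k)) \<and>
     (\<forall>k\<in>I. \<forall>l\<in>I. k \<noteq> l \<longrightarrow> q i k * q i l = 0) \<and> (\<Sum>k\<in>I. q i k) \<in> projs ?M \<and>
     (\<Otimes>\<^bsub>V S\<^esub>k\<in>I. V_class S (p k i)) = V_class S (\<Sum>k\<in>I. q i k)" ..
  then have q: "\<And>i k. k \<in> I \<Longrightarrow> mvn_equiv ?M (p k i) (q i k)"
    and qo: "\<And>i k l. k \<in> I \<Longrightarrow> l \<in> I \<Longrightarrow> k \<noteq> l \<Longrightarrow> q i k * q i l = 0"
    and Q: "\<And>i. (\<Sum>k\<in>I. q i k) \<in> projs ?M"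
    and prod: "\<And>i. (\<Otimes>\<^bsub>V S\<^esub>k\<in>I. V_class S (p k i)) = V_class S (\<Sum>k\<in>I. q i k)" by simp_all
  define U where "U k i u \<longleftrightarrow> u \<in> ?M \<and> star u * u = q i k \<and> u * star u = p k i \<and> u * q i k = u \<and>
     star u * p k i = star u \<and> p k i * u = u \<and> q i k * star u = star u" for k i u
  define u where "u k i = (SOME u. U k i u)" for k i
  have uU: "U k i (u k i)" if k: "k \<in> I" for k i
  proof -
    obtain w where "w \<in> ?M" "star w * w = q i k" "w * star w = p k i" "w * q i k = w" "p k i * w = w"
      "q i k * star w = star w" "star w * p k i = star w"
      by (rule mvn_equivE[OF mvn_equiv_sym[OF M q[OF k, of i]]])
    then have "U k i w" by (simp add: U_def)
    then show ?thesis unfolding u_def by (rule someI)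
  qed
  have u: "\<And>k i. k \<in> I \<Longrightarrow> u k i \<in> ?M" "\<And>k i. k \<in> I \<Longrightarrow> star (u k i) * u k i = q i k"
    "\<And>k i. k \<in> I \<Longrightarrow> u k i * star (u k i) = p k i" "\<And>k i. k \<in> I \<Longrightarrow> u k i * q i k = u k i"
    "\<And>k i. k \<in> I \<Longrightarrow> star (u k i) * p k i = star (u k i)" "\<And>k i. k \<in> I \<Longrightarrow> p k i * u k i = u k i"
    "\<And>k i. k \<in> I \<Longrightarrow> q i k * star (u k i) = star (u k i)"
    using uU unfolding U_def by simp_all
  have Bu: "Bfun (u k) F" if "k \<in> I" for k
    by (rule Bfun_if_Bfun_star_mult)
      (use u(2)[OF that] Bfun_projs[of "\<lambda>i. q i k" "\<lambda>_. ?M"] q[OF that] in \<open>simp add: mvn_equiv_def\<close>)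
  define v where "v i = (\<Sum>k\<in>I. u k i)" for i
  have v: "v i \<in> ?M" for i unfolding v_def using u(1) M by (intro subalgebra_sum) auto
  have "v i * star (v i) = (\<Sum>k\<in>I. p k i)" for i
  proof -
    have "v i * star (v i) = (\<Sum>k\<in>I. \<Sum>l\<in>I. u k i * star (u l i))"
      by (simp add: v_def star_sum sum_product)
    also have "\<dots> = (\<Sum>k\<in>I. \<Sum>l\<in>I. if k = l then p k i else 0)"
    proof (intro sum.cong refl)
      fix k l assume kl: "k \<in> I" "l \<in> I"
      have "u k i * star (u l i) = u k i * (q i k * q i l) * star (u l i)"
        by (metis u(4)[OF kl(1)] u(7)[OF kl(2)] mult.assoc)
      then show "u k i * star (u l i) = (if k = l then p k i else 0)"
        using qo[OF kl] u(3)[OF kl(1)] by auto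
    qed
    finally show ?thesis using I by simp
  qed
  then have vr: "(\<lambda>i. v i * star (v i)) \<simeq>[F] r" using sum by simp
  have "(\<lambda>i. star (v i) * v i) = (\<lambda>i. \<Sum>k\<in>I. \<Sum>l\<in>I. star (u k i) * u l i)"
    by (simp add: v_def star_sum sum_product)
  also have "\<dots> \<simeq>[F] (\<lambda>i. \<Sum>k\<in>I. \<Sum>l\<in>I. if k = l then q i k else 0)"
  proof (intro asym_eq_sum)
    fix k l assume kl: "k \<in> I" "l \<in> I"
    show "(\<lambda>i. star (u k i) * u l i) \<simeq>[F] (\<lambda>i. if k = l then q i k else 0)"
    proof (cases "k = l")
      case True
      then show ?thesis using asym_eq_refl[OF Bfun_projs[of "\<lambda>i. q i k" "\<lambda>_. ?M"]] q[OF kl(1)]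
        by (simp add: u(2)[OF kl(2)] mvn_equiv_def)
    next
      case False
      have "(\<lambda>i. star (u k i) * u l i) = (\<lambda>i. star (u k i) * (p k i * p l i) * u l i)"
        by (rule ext) (metis u(5)[OF kl(1)] u(6)[OF kl(2)] mult.assoc)
      also have "\<dots> \<simeq>[F] (\<lambda>i. star (u k i) * 0 * u l i)"
        by (intro asym_eq_mult asym_eq_star asym_eq_refl Bu kl orth False)
      finally show ?thesis using False by simp
    qed
  qed
  also have "\<dots> = (\<lambda>i. \<Sum>k\<in>I. q i k)" using I by simp
  finally have "(\<lambda>i. star (v i) * v i) \<simeq>[F] (\<lambda>i. \<Sum>k\<in>I. q i k)" .
  then have "\<forall>\<^sub>F i in F. mvn_equiv ?M (\<Sum>k\<in>I. q i k) (r i)"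
    using mvn_equiv_if_asym[of "\<lambda>_. ?M" "\<lambda>i. \<Sum>k\<in>I. q i k" r v F] M Q r v vr by blast
  then show ?thesis
    by eventually_elim (simp add: prod V_class_cong[OF S])
qed


section \<open>Asymptotic morphisms\<close>

text \<open>The maps are additive exactly, so that applied to the entries of a matrix they only have to be controlled on
  products and adjoints.  Boundedness along the filter is part of \<open>\<simeq>\<close>.\<close>

definition asymptotic_morphism ::
    "'i filter \<Rightarrow> 'a::cstar_algebra set \<Rightarrow> 'b::cstar_algebra set \<Rightarrow> ('i \<Rightarrow> 'a \<Rightarrow> 'b) \<Rightarrow> bool" where
  "asymptotic_morphism F S T \<theta> \<longleftrightarrow>
     (\<forall>i. \<forall>a\<in>S. \<theta> i a \<in> T) \<and> (\<forall>i a b. \<theta> i (a + b) = \<theta> i a + \<theta> i b) \<and>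
     (\<forall>a\<in>S. \<forall>b\<in>S. (\<lambda>i. \<theta> i (a * b)) \<simeq>[F] (\<lambda>i. \<theta> i a * \<theta> i b)) \<and>
     (\<forall>a\<in>S. (\<lambda>i. \<theta> i (star a)) \<simeq>[F] (\<lambda>i. star (\<theta> i a)))"

lemma Bfun_sum: "(\<And>k. k \<in> K \<Longrightarrow> Bfun (f k) F) \<Longrightarrow> Bfun (\<lambda>i. \<Sum>k\<in>K. f k i :: 'a::real_normed_vector) F"
  using asym_eq_sum[of K f F f] asym_eq_refl asym_eq_Bfun_left by blast

lemma Bfun_matrices:
  assumes x: "\<And>i. stab_finite n (x i)"
    and B: "\<And>a b. a < n \<Longrightarrow> b < n \<Longrightarrow> Bfun (\<lambda>i. entry (x i) a b) F"
  shows "Bfun x F"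
proof -
  have "Bfun (\<lambda>i. \<Sum>a<n. \<Sum>b<n. norm (entry (x i) a b)) F"
  proof (intro Bfun_sum)
    fix a b assume "a \<in> {..<n}" "b \<in> {..<n}"
    then obtain K where "\<forall>\<^sub>F i in F. norm (entry (x i) a b) \<le> K" using B BfunE by (metis lessThan_iff)
    then show "Bfun (\<lambda>i. norm (entry (x i) a b)) F" by (intro BfunI[of _ K]) simp
  qed
  then obtain K where "\<forall>\<^sub>F i in F. norm (\<Sum>a<n. \<Sum>b<n. norm (entry (x i) a b)) \<le> K" by (rule BfunE)
  then have "\<forall>\<^sub>F i in F. norm (x i) \<le> K"
  proof eventually_elim
    case (elim i)
    then show ?case using norm_stab_finite_le_sum[OF x[of i]] by simp
  qed
  then show ?thesis by (rule BfunI)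
qed

lemma Zfun_matrices:
  assumes x: "\<And>i. stab_finite n (x i)"
    and Z: "\<And>a b. a < n \<Longrightarrow> b < n \<Longrightarrow> Zfun (\<lambda>i. entry (x i) a b) F"
  shows "Zfun x F"
proof -
  have "((\<lambda>i. \<Sum>a<n. \<Sum>b<n. norm (entry (x i) a b)) \<longlongrightarrow> (\<Sum>a<n. \<Sum>b<n. 0)) F"
    using Z by (intro tendsto_sum tendsto_norm_zero) (simp add: tendsto_Zfun_iff)
  then have "Zfun (\<lambda>i. \<Sum>a<n. \<Sum>b<n. norm (entry (x i) a b)) F" by (simp add: tendsto_Zfun_iff)
  then show ?thesis
    by (rule Zfun_imp_Zfun[where K = 1]) (intro always_eventually allI, simp add: norm_stab_finite_le_sum[OF x] sum_nonneg)
qed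

lemma asym_eq_matrices:
  assumes x: "\<And>i. stab_finite n (x i)" and y: "\<And>i. stab_finite n (y i)"
    and xy: "\<And>a b. a < n \<Longrightarrow> b < n \<Longrightarrow> (\<lambda>i. entry (x i) a b) \<simeq>[F] (\<lambda>i. entry (y i) a b)"
  shows "x \<simeq>[F] y"
  unfolding asym_eq_def
proof
  show "Bfun y F" using xy asym_eq_Bfun_right by (intro Bfun_matrices[OF y]) blast
  have "stab_finite n (x i - y i)" for i using x[of i] y[of i] by (auto simp: stab_finite_iff)
  then show "Zfun (\<lambda>i. x i - y i) F"
    using xy by (intro Zfun_matrices[of n]) (auto simp: asym_eq_def)
qed

lemma projs_matrices_finite: "p \<in> projs (matrices n S) \<Longrightarrow> stab_finite n p"
  and projs_matrices_entry: "p \<in> projs (matrices n S) \<Longrightarrow> entry p i j \<in> S"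
  by (auto simp: projs_def matrices_def stab_alg_def)

lemma projs_matrices_stab_alg: "p \<in> projs (matrices n S) \<Longrightarrow> p \<in> projs (stab_alg S)"
  using projs_mono[OF matrices_subset] by blast

text \<open>From \<open>v = q v = v p\<close> the entries of \<open>v\<close> vanish where those of \<open>q\<close> and \<open>p\<close> do.\<close>

lemma mvn_equiv_in_matrices:
  assumes p: "p \<in> projs (matrices n S)" and q: "q \<in> projs (matrices n S)" and pq: "mvn_equiv (stab_alg S) p q"
  shows "mvn_equiv (matrices n S) p q"
proof -
  obtain v where v: "v \<in> stab_alg S" "star v * v = p" "v * star v = q" "v * p = v" "q * v = v"
    "p * star v = star v" "star v * q = star v" by (rule mvn_equivE[OF pq])
  have "entry v i j = 0" if "\<not> (i < n \<and> j < n)" for i j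
  proof (cases "i < n")
    case False
    then have "entry (q * v) i j = 0"
      using stab_finite_entry_0[OF projs_matrices_finite[OF q]]
      by (simp add: entry_mult_finite[OF disjI1[OF projs_matrices_finite[OF q]]])
    then show ?thesis by (simp add: v(5))
  next
    case True
    then have "entry (v * p) i j = 0"
      using that stab_finite_entry_0[OF projs_matrices_finite[OF p]]
      by (simp add: entry_mult_finite[OF disjI2[OF projs_matrices_finite[OF p]]])
    then show ?thesis by (simp add: v(4))
  qed
  then have "v \<in> matrices n S" using v(1) by (auto simp: matrices_def stab_finite_iff)
  then show ?thesis using p q v(2,3) unfolding mvn_equiv_def by blast
qed

text \<open>The action on \<open>V\<close>, specified by what it does eventually to every projection in a matrix algebra.\<close>

definition induced_V_map ::
    "'i filter \<Rightarrow> 'a::cstar_algebra set \<Rightarrow> 'b::cstar_algebra set \<Rightarrow> ('i \<Rightarrow> 'a \<Rightarrow> 'b) \<Rightarrow>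
     ('i \<Rightarrow> 'a imat set \<Rightarrow> 'b imat set) \<Rightarrow> bool" where
  "induced_V_map F S T \<theta> f \<longleftrightarrow>
     (\<forall>i. \<forall>x\<in>carrier (V S). f i x \<in> carrier (V T)) \<and>
     (\<forall>n p q. p \<in> projs (matrices n S) \<longrightarrow> (\<forall>i. q i \<in> projs (stab_alg T)) \<longrightarrow>
        q \<simeq>[F] (\<lambda>i. stab_map (\<theta> i) p) \<longrightarrow> (\<forall>\<^sub>F i in F. f i (V_class S p) = V_class T (q i)))"

lemma induced_V_map_closed: "induced_V_map F S T \<theta> f \<Longrightarrow> x \<in> carrier (V S) \<Longrightarrow> f i x \<in> carrier (V T)"
  by (simp add: induced_V_map_def)

lemma induced_V_mapD:
  "induced_V_map F S T \<theta> f \<Longrightarrow> p \<in> projs (matrices n S) \<Longrightarrow> (\<And>i. q i \<in> projs (stab_alg T)) \<Longrightarrow>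
   q \<simeq>[F] (\<lambda>i. stab_map (\<theta> i) p) \<Longrightarrow> \<forall>\<^sub>F i in F. f i (V_class S p) = V_class T (q i)"
  unfolding induced_V_map_def by blast

context
  fixes F :: "'i filter" and S :: "'a::cstar_algebra set" and T :: "'b::cstar_algebra set" and \<theta>
  assumes S: "cstar_subalgebra S" and T: "cstar_subalgebra T" and \<theta>: "asymptotic_morphism F S T \<theta>"
begin

lemma morphism_in: "a \<in> S \<Longrightarrow> \<theta> i a \<in> T"
  and morphism_add: "\<theta> i (a + b) = \<theta> i a + \<theta> i b"
  and morphism_mult: "a \<in> S \<Longrightarrow> b \<in> S \<Longrightarrow> (\<lambda>i. \<theta> i (a * b)) \<simeq>[F] (\<lambda>i. \<theta> i a * \<theta> i b)"
  and morphism_star: "a \<in> S \<Longrightarrow> (\<lambda>i. \<theta> i (star a)) \<simeq>[F] (\<lambda>i. star (\<theta> i a))"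
  using \<theta> by (auto simp: asymptotic_morphism_def)

lemma morphism_zero: "\<theta> i 0 = 0"
  using morphism_add[of i 0 0] by simp

lemma morphism_sum: "\<theta> i (sum h I) = (\<Sum>k\<in>I. \<theta> i (h k))"
  by (induction I rule: infinite_finite_induct) (simp_all add: morphism_zero morphism_add)

lemma morphism_Bfun: "a \<in> S \<Longrightarrow> Bfun (\<lambda>i. \<theta> i a) F"
  using Bfun_bounded_linear[OF bounded_linear_star asym_eq_Bfun_right[OF morphism_star]]
  by (simp add: star_star)

private lemma em: "stab_finite n x \<Longrightarrow> entry (stab_map (\<theta> i) x) a b = \<theta> i (entry x a b)"
  by (rule entry_stab_map_finite[of "\<theta> i", OF morphism_zero])

private lemma fm: "stab_finite n x \<Longrightarrow> stab_finite n (stab_map (\<theta> i) x)"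
  by (rule stab_finite_stab_map[of "\<theta> i", OF morphism_zero])

lemma stab_map_in_matrices: "x \<in> matrices n S \<Longrightarrow> stab_map (\<theta> i) x \<in> matrices n T"
  using fm by (auto simp: matrices_def stab_alg_def em morphism_in)

lemma stab_map_morphism_Bfun: "x \<in> matrices n S \<Longrightarrow> Bfun (\<lambda>i. stab_map (\<theta> i) x) F"
  by (rule Bfun_matrices[of n]) (auto simp: matrices_def stab_alg_def fm em morphism_Bfun)

lemma stab_map_morphism_add:
  assumes "x \<in> matrices n S" "y \<in> matrices n S"
  shows "stab_map (\<theta> i) (x + y) = stab_map (\<theta> i) x + stab_map (\<theta> i) y"
proof -
  have "stab_finite n x" "stab_finite n y" "stab_finite n (x + y)" using assms by (auto simp: matrices_def stab_finite_iff)
  then show ?thesis by (intro stab_eqI) (simp add: em morphism_add)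
qed

lemma stab_map_morphism_mult:
  assumes x: "x \<in> matrices n S" and y: "y \<in> matrices n S"
  shows "(\<lambda>i. stab_map (\<theta> i) (x * y)) \<simeq>[F] (\<lambda>i. stab_map (\<theta> i) x * stab_map (\<theta> i) y)"
proof (rule asym_eq_matrices)
  have fin: "stab_finite n x" "stab_finite n y" using x y by (auto simp: matrices_def)
  have fin2: "stab_finite n (x * y)"
    using subalgebra_mult[OF cstar_subalgebra_matrices[OF S] x y] by (simp add: matrices_def)
  show "stab_finite n (stab_map (\<theta> i) (x * y))" for i by (rule fm[OF fin2])
  show "stab_finite n (stab_map (\<theta> i) x * stab_map (\<theta> i) y)" for i
    using subalgebra_mult[OF cstar_subalgebra_matrices[OF T] stab_map_in_matrices[OF x] stab_map_in_matrices[OF y]]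
    by (simp add: matrices_def)
  fix a b
  have "(\<lambda>i. entry (stab_map (\<theta> i) (x * y)) a b) = (\<lambda>i. \<Sum>k<n. \<theta> i (entry x a k * entry y k b))"
    by (simp add: em[OF fin2] entry_mult_finite[OF disjI1[OF fin(1)]] morphism_sum)
  also have "\<dots> \<simeq>[F] (\<lambda>i. \<Sum>k<n. \<theta> i (entry x a k) * \<theta> i (entry y k b))"
    using x y by (intro asym_eq_sum morphism_mult) (auto simp: matrices_def stab_alg_def)
  also have "\<dots> = (\<lambda>i. entry (stab_map (\<theta> i) x * stab_map (\<theta> i) y) a b)"
    by (simp add: entry_mult_finite[OF disjI1[OF fm[OF fin(1)]]] em[OF fin(1)] em[OF fin(2)])
  finally show "(\<lambda>i. entry (stab_map (\<theta> i) (x * y)) a b) \<simeq>[F]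
      (\<lambda>i. entry (stab_map (\<theta> i) x * stab_map (\<theta> i) y) a b)" .
qed

lemma stab_map_morphism_star:
  assumes x: "x \<in> matrices n S"
  shows "(\<lambda>i. stab_map (\<theta> i) (star x)) \<simeq>[F] (\<lambda>i. star (stab_map (\<theta> i) x))"
proof (rule asym_eq_matrices)
  have fin: "stab_finite n x" using x by (auto simp: matrices_def)
  have fin2: "stab_finite n (star x)" using fin by (auto simp: stab_finite_iff)
  show "stab_finite n (stab_map (\<theta> i) (star x))" for i by (rule fm[OF fin2])
  show "stab_finite n (star (stab_map (\<theta> i) x))" for i using fm[OF fin, of i] by (auto simp: stab_finite_iff)
  fix a b
  have "entry x b a \<in> S" using x by (auto simp: matrices_def stab_alg_def)
  then show "(\<lambda>i. entry (stab_map (\<theta> i) (star x)) a b) \<simeq>[F] (\<lambda>i. entry (star (stab_map (\<theta> i) x)) a b)"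
    using morphism_star by (simp add: em[OF fin2] em[OF fin])
qed

lemma morphism_projection_near:
  assumes p: "p \<in> projs (matrices n S)"
  obtains q where "\<And>i. q i \<in> projs (matrices n T)" "q \<simeq>[F] (\<lambda>i. stab_map (\<theta> i) p)"
proof -
  note pm = projsD(1)[OF p]
  have 1: "(\<lambda>i. star (stab_map (\<theta> i) p)) \<simeq>[F] (\<lambda>i. stab_map (\<theta> i) p)"
    using asym_eq_sym[OF stab_map_morphism_star[OF pm]] by (simp add: projsD(2)[OF p])
  have 2: "(\<lambda>i. stab_map (\<theta> i) p * stab_map (\<theta> i) p) \<simeq>[F] (\<lambda>i. stab_map (\<theta> i) p)"
    using asym_eq_sym[OF stab_map_morphism_mult[OF pm pm]] by (simp add: projsD(3)[OF p])
  show thesis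
    by (rule projection_near_asym[of "\<lambda>_. matrices n T", OF cstar_subalgebra_matrices[OF T] stab_map_in_matrices[OF pm] 1 2])
      (rule that)
qed

lemma morphism_mvn_equiv:
  assumes p: "p \<in> projs (matrices n S)" "p' \<in> projs (matrices n S)" "mvn_equiv (stab_alg S) p p'"
    and q: "\<And>i. q i \<in> projs (stab_alg T)" "q \<simeq>[F] (\<lambda>i. stab_map (\<theta> i) p)"
    and q': "\<And>i. q' i \<in> projs (stab_alg T)" "q' \<simeq>[F] (\<lambda>i. stab_map (\<theta> i) p')"
  shows "\<forall>\<^sub>F i in F. mvn_equiv (stab_alg T) (q i) (q' i)"
proof -
  obtain v where v: "v \<in> matrices n S" "star v * v = p" "v * star v = p'"
    using mvn_equivE[OF mvn_equiv_in_matrices[OF p]] by metis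
  have sv: "star v \<in> matrices n S" by (rule subalgebra_star[OF cstar_subalgebra_matrices[OF S] v(1)])
  let ?w = "\<lambda>i. stab_map (\<theta> i) v"
  have B: "?w \<simeq>[F] ?w" by (rule asym_eq_refl[OF stab_map_morphism_Bfun[OF v(1)]])
  have "(\<lambda>i. star (?w i) * ?w i) \<simeq>[F] (\<lambda>i. stab_map (\<theta> i) (star v) * ?w i)"
    by (intro asym_eq_mult asym_eq_sym[OF stab_map_morphism_star[OF v(1)]] B)
  also have "\<dots> \<simeq>[F] (\<lambda>i. stab_map (\<theta> i) (star v * v))"
    by (rule asym_eq_sym[OF stab_map_morphism_mult[OF sv v(1)]])
  also have "\<dots> \<simeq>[F] q" unfolding v(2) by (rule asym_eq_sym[OF q(2)])
  finally have 1: "(\<lambda>i. star (?w i) * ?w i) \<simeq>[F] q" .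
  have "(\<lambda>i. ?w i * star (?w i)) \<simeq>[F] (\<lambda>i. ?w i * stab_map (\<theta> i) (star v))"
    by (intro asym_eq_mult asym_eq_sym[OF stab_map_morphism_star[OF v(1)]] B)
  also have "\<dots> \<simeq>[F] (\<lambda>i. stab_map (\<theta> i) (v * star v))"
    by (rule asym_eq_sym[OF stab_map_morphism_mult[OF v(1) sv]])
  also have "\<dots> \<simeq>[F] q'" unfolding v(3) by (rule asym_eq_sym[OF q'(2)])
  finally have 2: "(\<lambda>i. ?w i * star (?w i)) \<simeq>[F] q'" .
  have w: "?w i \<in> stab_alg T" for i using stab_map_in_matrices[OF v(1)] matrices_subset by blast
  show ?thesis
    by (rule mvn_equiv_if_asym[of "\<lambda>_. stab_alg T", OF cstar_subalgebra_stab_alg[OF T] q(1) q'(1) w 1 2])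
qed

text \<open>A class is sent to the class of projections near the image of a chosen representative.  The choice does not
  matter eventually, but from which index on depends on the representatives compared.\<close>

lemma induced_V_map_exists: "\<exists>f. induced_V_map F S T \<theta> f"
proof -
  define R where "R x p \<longleftrightarrow> (\<exists>n. p \<in> projs (matrices n S)) \<and> x = V_class S p" for x p
  define rep where "rep x = (SOME p. R x p)" for x
  define Q where "Q p q \<longleftrightarrow> (\<forall>i. q i \<in> projs (stab_alg T)) \<and> q \<simeq>[F] (\<lambda>i. stab_map (\<theta> i) p)" for p q
  define near where "near p = (SOME q. Q p q)" for p
  define f where "f i x = V_class T (near (rep x) i)" for i x
  have rep: "R x (rep x)" if x: "x \<in> carrier (V S)" for x
  proof -
    obtain n p where "p \<in> projs (matrices n S)" "x = V_class S p" using V_cases[OF S x] by metis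
    then have "R x p" by (auto simp: R_def)
    then show ?thesis unfolding rep_def by (rule someI[of "R x"])
  qed
  have near: "Q p (near p)" if p: "p \<in> projs (matrices n S)" for p n
  proof -
    obtain q where q: "\<And>i. q i \<in> projs (matrices n T)" "q \<simeq>[F] (\<lambda>i. stab_map (\<theta> i) p)"
      by (rule morphism_projection_near[OF p]) blast
    then have "Q p q" using projs_matrices_stab_alg by (auto simp: Q_def)
    then show ?thesis unfolding near_def by (rule someI[of "Q p"])
  qed
  have "induced_V_map F S T \<theta> f"
    unfolding induced_V_map_def
  proof (intro conjI allI ballI impI)
    fix i x assume "x \<in> carrier (V S)"
    then obtain n where "rep x \<in> projs (matrices n S)" using rep by (auto simp: R_def)
    then have "near (rep x) i \<in> projs (stab_alg T)" using near by (auto simp: Q_def)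
    then show "f i x \<in> carrier (V T)" by (simp add: f_def V_class_in_carrier)
  next
    fix n p q
    assume p: "p \<in> projs (matrices n S)" and q: "\<forall>i. q i \<in> projs (stab_alg T)" "q \<simeq>[F] (\<lambda>i. stab_map (\<theta> i) p)"
    define p' where "p' = rep (V_class S p)"
    have "R (V_class S p) p'" unfolding p'_def by (rule rep[OF V_class_matrices_in_carrier[OF p]])
    then obtain m where p': "p' \<in> projs (matrices m S)" "V_class S p = V_class S p'" by (auto simp: R_def)
    have eq: "mvn_equiv (stab_alg S) p p'"
      using p'(2) V_class_eq_iff[OF S projs_matrices_stab_alg[OF p] projs_matrices_stab_alg[OF p'(1)]] by simp
    have pN: "p \<in> projs (matrices (max n m) S)" "p' \<in> projs (matrices (max n m) S)"
      using p p'(1) projs_mono[OF matrices_mono[of n "max n m" S]] projs_mono[OF matrices_mono[of m "max n m" S]] by auto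
    have Qp: "Q p' (near p')" by (rule near[OF p'(1)])
    have "\<forall>\<^sub>F i in F. mvn_equiv (stab_alg T) (q i) (near p' i)"
      by (rule morphism_mvn_equiv[OF pN eq]) (use q Qp in \<open>auto simp: Q_def\<close>)
    then show "\<forall>\<^sub>F i in F. f i (V_class S p) = V_class T (q i)"
      by eventually_elim (simp add: f_def p'_def V_class_cong[OF T])
  qed
  then show ?thesis by blast
qed

text \<open>Images of orthogonal projections are only asymptotically orthogonal, which suffices for sums in \<open>V\<close>.\<close>

lemma induced_V_map_add:
  assumes f: "induced_V_map F S T \<theta> f" and x: "x \<in> carrier (V S)" and y: "y \<in> carrier (V S)"
  shows "\<forall>\<^sub>F i in F. f i (x \<otimes>\<^bsub>V S\<^esub> y) = f i x \<otimes>\<^bsub>V T\<^esub> f i y"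
proof -
  interpret VT: comm_monoid "V T" by (rule comm_monoid_V[OF T])
  obtain n p q where pq: "p \<in> projs (matrices n S)" "q \<in> projs (matrices n S)" "p * q = 0"
    "x = V_class S p" "y = V_class S q" using V_cases_orthogonal[OF S x y] by metis
  note pm = projsD(1)[OF pq(1)] and qm = projsD(1)[OF pq(2)]
  have qp: "q * p = 0" using pq projection_mult_commute_0 by (auto simp: projs_def)
  have s: "p + q \<in> projs (matrices n S)" by (rule projs_add[OF cstar_subalgebra_matrices[OF S] pq(1-3)])
  obtain P where P: "\<And>i. P i \<in> projs (matrices n T)" "P \<simeq>[F] (\<lambda>i. stab_map (\<theta> i) p)"
    by (rule morphism_projection_near[OF pq(1)]) blast
  obtain Q where Q: "\<And>i. Q i \<in> projs (matrices n T)" "Q \<simeq>[F] (\<lambda>i. stab_map (\<theta> i) q)"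
    by (rule morphism_projection_near[OF pq(2)]) blast
  obtain R where R: "\<And>i. R i \<in> projs (matrices n T)" "R \<simeq>[F] (\<lambda>i. stab_map (\<theta> i) (p + q))"
    by (rule morphism_projection_near[OF s]) blast
  note P' = projs_matrices_stab_alg[OF P(1)] and Q' = projs_matrices_stab_alg[OF Q(1)]
    and R' = projs_matrices_stab_alg[OF R(1)]
  have zero: "stab_map (\<theta> i) 0 = 0" for i
    by (rule stab_eqI) (simp add: em[of 0] stab_finite_iff morphism_zero)
  have PQ: "(\<lambda>i. P i * Q i) \<simeq>[F] (\<lambda>_. 0)"
    using asym_eq_trans[OF asym_eq_mult[OF P(2) Q(2)] asym_eq_sym[OF stab_map_morphism_mult[OF pm qm]]]
    by (simp add: pq(3) zero)
  have QP: "(\<lambda>i. Q i * P i) \<simeq>[F] (\<lambda>_. 0)"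
    using asym_eq_trans[OF asym_eq_mult[OF Q(2) P(2)] asym_eq_sym[OF stab_map_morphism_mult[OF qm pm]]]
    by (simp add: qp zero)
  have sum: "(\<lambda>i. P i + Q i) \<simeq>[F] R"
    using asym_eq_trans[OF asym_eq_add[OF P(2) Q(2)]] asym_eq_sym[OF R(2)] stab_map_morphism_add[OF pm qm] by simp
  have orth: "(\<lambda>i. (if k then P i else Q i) * (if l then P i else Q i)) \<simeq>[F] (\<lambda>_. 0)" if "k \<noteq> l" for k l
    using that PQ QP by (cases k; cases l) simp_all
  have "\<forall>\<^sub>F i in F. (\<Otimes>\<^bsub>V T\<^esub>k\<in>{True, False}. V_class T (if k then P i else Q i)) = V_class T (R i)"
    by (rule V_class_sum_asym[OF T _ _ R' orth]) (use P' Q' sum in \<open>simp_all\<close>)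
  moreover have "\<forall>\<^sub>F i in F. f i x = V_class T (P i)" unfolding pq(4) by (rule induced_V_mapD[OF f pq(1) P' P(2)])
  moreover have "\<forall>\<^sub>F i in F. f i y = V_class T (Q i)" unfolding pq(5) by (rule induced_V_mapD[OF f pq(2) Q' Q(2)])
  moreover have "\<forall>\<^sub>F i in F. f i (x \<otimes>\<^bsub>V S\<^esub> y) = V_class T (R i)"
    unfolding pq(4,5) V_mult[OF S projs_matrices_stab_alg[OF pq(1)] projs_matrices_stab_alg[OF pq(2)] pq(3)]
    by (rule induced_V_mapD[OF f s R' R(2)])
  ultimately show ?thesis
    by eventually_elim (simp add: V_class_in_carrier[OF P'] V_class_in_carrier[OF Q'])
qed

lemma induced_V_map_mono:
  assumes f: "induced_V_map F S T \<theta> f" and x: "x \<in> carrier (V S)" and y: "y \<in> carrier (V S)"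
    and le: "x \<preceq>\<^bsub>V S\<^esub> y"
  shows "\<forall>\<^sub>F i in F. f i x \<preceq>\<^bsub>V T\<^esub> f i y"
proof -
  obtain z where z: "z \<in> carrier (V S)" "y = x \<otimes>\<^bsub>V S\<^esub> z" using le V_le_iff[OF S x y] by blast
  show ?thesis
    using induced_V_map_add[OF f x z(1)] unfolding z(2)
    by eventually_elim (use induced_V_map_closed[OF f] x z(1) V_le_iff[OF T] V_mult_closed[OF T] in metis)
qed

end

text \<open>The sets of those \<open>x\<close> that satisfy the condition up to \<open>\<epsilon>\<close> on \<open>K\<close> shrink with \<open>\<epsilon>\<close> and as \<open>K\<close> grows, so
  that finitely many of them have a common member, and together they generate a proper filter.\<close>

lemma approximation_filter:
  fixes P :: "real \<Rightarrow> 'k set \<Rightarrow> 'x \<Rightarrow> bool"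
  assumes mono: "\<And>\<epsilon> \<epsilon>' K K' x. P \<epsilon> K x \<Longrightarrow> \<epsilon> \<le> \<epsilon>' \<Longrightarrow> K' \<subseteq> K \<Longrightarrow> P \<epsilon>' K' x"
    and ex: "\<And>\<epsilon> K. \<epsilon> > 0 \<Longrightarrow> finite K \<Longrightarrow> K \<subseteq> S \<Longrightarrow> \<exists>x. P \<epsilon> K x"
  obtains F where "F \<noteq> bot" "\<And>\<epsilon> K. \<epsilon> > 0 \<Longrightarrow> finite K \<Longrightarrow> K \<subseteq> S \<Longrightarrow> eventually (P \<epsilon> K) F"
proof -
  define I where "I = {(\<epsilon> :: real, K). \<epsilon> > 0 \<and> finite K \<and> K \<subseteq> S}"
  define B where "B = (\<lambda>(\<epsilon>, K). {x. P \<epsilon> K x})"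
  define F where "F = (INF i\<in>I. principal (B i))"
  have "F \<noteq> bot"
    unfolding F_def
  proof (rule INF_filter_not_bot)
    fix J assume J: "J \<subseteq> I" "finite J"
    define \<epsilon> where "\<epsilon> = Min (insert 1 (fst ` J))"
    define K where "K = \<Union> (snd ` J)"
    have "\<epsilon> > 0" using J by (auto simp: \<epsilon>_def I_def)
    moreover have "finite K" using J by (auto simp: K_def I_def)
    moreover have "K \<subseteq> S" using J(1) unfolding K_def I_def by fastforce
    ultimately obtain x where x: "P \<epsilon> K x" using ex by blast
    have "x \<in> B i" if i: "i \<in> J" for i
    proof -
      have "\<epsilon> \<le> fst i" using J i by (auto simp: \<epsilon>_def)
      moreover have "snd i \<subseteq> K" using i by (auto simp: K_def)
      ultimately show ?thesis using mono[OF x] by (auto simp: B_def split: prod.splits)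
    qed
    then have "x \<in> \<Inter> (B ` J)" by blast
    then show "(INF i\<in>J. principal (B i)) \<noteq> bot"
      unfolding INF_principal_finite[OF J(2)] principal_eq_bot_iff by blast
  qed
  moreover have "eventually (P \<epsilon> K) F" if "\<epsilon> > 0" "finite K" "K \<subseteq> S" for \<epsilon> K
    unfolding F_def by (rule eventually_INF1[of "(\<epsilon>, K)"]) (use that in \<open>auto simp: I_def B_def eventually_principal\<close>)
  ultimately show thesis by (rule that)
qed


section \<open>Actions with the Rokhlin property\<close>

locale finite_action = group G for G :: "('g, 'm) monoid_scheme" (structure) +
  fixes \<alpha> :: "'g \<Rightarrow> 'a::cstar_algebra \<Rightarrow> 'a"
  assumes finite_carrier: "finite (carrier G)"
    and action: "\<alpha> \<in> hom G cstar_Aut"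
begin

lemma act_hom: "g \<in> carrier G \<Longrightarrow> star_homomorphism (\<alpha> g)"
  and act_bij: "g \<in> carrier G \<Longrightarrow> bij (\<alpha> g)"
  using hom_carrier[OF action] by (auto simp: cstar_Aut_def)

lemma act_mult: "g \<in> carrier G \<Longrightarrow> h \<in> carrier G \<Longrightarrow> \<alpha> (g \<otimes> h) a = \<alpha> g (\<alpha> h a)"
  using hom_mult[OF action, of g h] by (simp add: cstar_Aut_def)

lemma act_one: "\<alpha> \<one> a = a"
proof -
  have "\<alpha> \<one> (\<alpha> \<one> a) = \<alpha> \<one> a" using act_mult[of \<one> \<one> a] by simp
  then show ?thesis using act_bij[OF one_closed] by (simp add: bij_def inj_def)
qed

abbreviation fixed_points :: "'a set" where "fixed_points \<equiv> fixed_point_algebra G \<alpha>"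

lemma fixed_pointsD: "a \<in> fixed_points \<Longrightarrow> g \<in> carrier G \<Longrightarrow> \<alpha> g a = a"
  by (simp add: fixed_point_algebra_def)

lemma cstar_subalgebra_fixed_points: "cstar_subalgebra fixed_points"
proof -
  have "closed {a. \<alpha> g a = a}" if "g \<in> carrier G" for g
    using linear_continuous_on[OF star_hom_bounded_linear[OF act_hom[OF that]]]
    by (intro closed_Collect_eq) auto
  moreover have "fixed_points = (\<Inter>g\<in>carrier G. {a. \<alpha> g a = a})" by (auto simp: fixed_point_algebra_def)
  ultimately have "closed fixed_points" by (simp add: closed_INT)
  then show ?thesis
    by (auto simp: cstar_subalgebra_def fixed_point_algebra_def act_hom star_hom_zero star_hom_add
        star_hom_mult star_hom_star star_hom_cscale)
qed

text \<open>The approximations of the Rokhlin property, for all \<open>\<epsilon>\<close> and finite sets at once: a filter on the families of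
  Rokhlin elements.  Limits along it replace the bookkeeping of \<open>\<epsilon>\<close> and of finite sets.\<close>

definition rokhlin_filter :: "('g \<Rightarrow> 'a) filter \<Rightarrow> bool" where
  "rokhlin_filter F \<longleftrightarrow>
     (\<forall>g\<in>carrier G. (\<forall>\<^sub>F r in F. norm (r g) \<le> 1) \<and> (\<forall>\<^sub>F r in F. star (r g) = r g)) \<and>
     (\<forall>g\<in>carrier G. \<forall>h\<in>carrier G. g \<noteq> h \<longrightarrow> (\<forall>\<^sub>F r in F. r g * r h = 0)) \<and>
     (\<forall>g\<in>carrier G. \<forall>h\<in>carrier G. Zfun (\<lambda>r. \<alpha> g (r h) - r (g \<otimes> h)) F) \<and>
     (\<forall>a. \<forall>g\<in>carrier G. Zfun (\<lambda>r. r g * a - a * r g) F) \<and>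
     (\<forall>a. Zfun (\<lambda>r. (\<Sum>g\<in>carrier G. r g) * a - a) F)"

lemma rokhlin_filter_exists:
  assumes "rokhlin_property G \<alpha>"
  obtains F where "F \<noteq> bot" "rokhlin_filter F"
proof -
  define P where "P \<epsilon> K r \<longleftrightarrow> (\<forall>g\<in>carrier G. positive (r g) \<and> norm (r g) \<le> 1) \<and>
            (\<forall>g\<in>carrier G. \<forall>h\<in>carrier G. g \<noteq> h \<longrightarrow> r g * r h = 0) \<and>
            (\<forall>g\<in>carrier G. \<forall>h\<in>carrier G. norm (\<alpha> g (r h) - r (g \<otimes> h)) < \<epsilon>) \<and>
            (\<forall>a\<in>K. \<forall>g\<in>carrier G. norm (r g * a - a * r g) < \<epsilon>) \<and>
            (\<forall>a\<in>K. norm ((\<Sum>g\<in>carrier G. r g) * a - a) < \<epsilon>)" for \<epsilon> K and r :: "'g \<Rightarrow> 'a"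
  have ex: "\<exists>r. P \<epsilon> K r" if "\<epsilon> > 0" "finite K" "K \<subseteq> UNIV" for \<epsilon> and K :: "'a set"
    using assms that unfolding rokhlin_property_def P_def by blast
  have mono: "P \<epsilon>' K' r" if "P \<epsilon> K r" "\<epsilon> \<le> \<epsilon>'" "K' \<subseteq> K" for \<epsilon> \<epsilon>' K K' r
    using that unfolding P_def by (meson order_less_le_trans subsetD)
  obtain F where F: "F \<noteq> bot" "\<And>\<epsilon> K. \<epsilon> > 0 \<Longrightarrow> finite K \<Longrightarrow> K \<subseteq> UNIV \<Longrightarrow> eventually (P \<epsilon> K) F"
  proof (rule approximation_filter[of P UNIV])
    show "P \<epsilon>' K' r" if "P \<epsilon> K r" "\<epsilon> \<le> \<epsilon>'" "K' \<subseteq> K" for \<epsilon> \<epsilon>' K K' r by (rule mono[OF that])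
    show "\<exists>r. P \<epsilon> K r" if "\<epsilon> > 0" "finite K" "K \<subseteq> UNIV" for \<epsilon> K by (rule ex[OF that])
  qed (rule that, assumption, blast)
  have "star b = b" if "positive b" for b :: 'a
    using that by (auto simp: positive_def star_simps)
  then have 1: "\<forall>\<^sub>F r in F. norm (r g) \<le> 1" "\<forall>\<^sub>F r in F. star (r g) = r g" if "g \<in> carrier G" for g
    using F(2)[of 1 "{}"] that by (auto elim!: eventually_mono simp: P_def)
  have 2: "\<forall>\<^sub>F r in F. r g * r h = 0" if "g \<in> carrier G" "h \<in> carrier G" "g \<noteq> h" for g h
    using F(2)[of 1 "{}"] that by (auto elim!: eventually_mono simp: P_def)
  have 3: "Zfun (\<lambda>r. \<alpha> g (r h) - r (g \<otimes> h)) F" if "g \<in> carrier G" "h \<in> carrier G" for g h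
  proof (rule ZfunI)
    fix e :: real assume "e > 0"
    then show "\<forall>\<^sub>F r in F. norm (\<alpha> g (r h) - r (g \<otimes> h)) < e"
      using F(2)[of e "{}"] that by (auto elim!: eventually_mono simp: P_def)
  qed
  have 4: "Zfun (\<lambda>r. r g * a - a * r g) F" if "g \<in> carrier G" for g a
  proof (rule ZfunI)
    fix e :: real assume "e > 0"
    then show "\<forall>\<^sub>F r in F. norm (r g * a - a * r g) < e"
      using F(2)[of e "{a}"] that by (auto elim!: eventually_mono simp: P_def)
  qed
  have 5: "Zfun (\<lambda>r. (\<Sum>g\<in>carrier G. r g) * a - a) F" for a
  proof (rule ZfunI)
    fix e :: real assume "e > 0"
    then show "\<forall>\<^sub>F r in F. norm ((\<Sum>g\<in>carrier G. r g) * a - a) < e"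
      using F(2)[of e "{a}"] by (auto elim!: eventually_mono simp: P_def)
  qed
  have "rokhlin_filter F" by (simp add: rokhlin_filter_def 1 2 3 4 5)
  then show thesis by (rule that[OF F(1)])
qed

text \<open>The average is fixed by the action exactly, while \<open>\<Sum>\<^sub>g r\<^sub>g \<alpha>\<^sub>g (a)\<close>, to which it is close because \<open>\<alpha>\<^sub>g (r\<^sub>1)\<close> is
  close to \<open>r\<^sub>g\<close>, is only nearly so.\<close>

definition rokhlin_average :: "('g \<Rightarrow> 'a) \<Rightarrow> 'a \<Rightarrow> 'a" where
  "rokhlin_average r a = (\<Sum>g\<in>carrier G. \<alpha> g (r \<one> * a))"

definition rokhlin_sum :: "('g \<Rightarrow> 'a) \<Rightarrow> ('g \<Rightarrow> 'a stab) \<Rightarrow> 'a stab" where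
  "rokhlin_sum r v = Stab (\<lambda>i j. \<Sum>g\<in>carrier G. r g * entry (v g) i j)"

lemma rokhlin_average_fixed: "rokhlin_average r a \<in> fixed_points"
  unfolding fixed_point_algebra_def
proof (intro CollectI ballI)
  fix h assume h: "h \<in> carrier G"
  have "\<alpha> h (rokhlin_average r a) = (\<Sum>g\<in>carrier G. \<alpha> (h \<otimes> g) (r \<one> * a))"
    unfolding rokhlin_average_def by (simp add: star_hom_sum[OF act_hom[OF h]] act_mult h)
  also have "\<dots> = rokhlin_average r a"
    unfolding rokhlin_average_def
    by (rule sum.reindex_bij_witness[of _ "\<lambda>g. inv h \<otimes> g" "\<lambda>g. h \<otimes> g"])
      (use h in \<open>simp_all add: m_assoc[symmetric]\<close>)
  finally show "\<alpha> h (rokhlin_average r a) = rokhlin_average r a" .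
qed

lemma entry_rokhlin_sum:
  assumes "\<And>g. g \<in> carrier G \<Longrightarrow> stab_finite n (v g)"
  shows "entry (rokhlin_sum r v) i j = (\<Sum>g\<in>carrier G. r g * entry (v g) i j)"
proof -
  have "(\<lambda>i j. \<Sum>g\<in>carrier G. r g * entry (v g) i j) \<in> matrix_algebra n UNIV"
    using assms by (auto simp: matrix_algebra_def stab_finite_iff intro!: sum.neutral)
  then show ?thesis by (simp add: rokhlin_sum_def entry_Stab_finite)
qed

lemma stab_finite_rokhlin_sum:
  assumes "\<And>g. g \<in> carrier G \<Longrightarrow> stab_finite n (v g)" shows "stab_finite n (rokhlin_sum r v)"
proof -
  have "r g * entry (v g) i j = 0" if "\<not> (i < n \<and> j < n)" "g \<in> carrier G" for g i j
    using assms[OF that(2)] that(1) by (simp add: stab_finite_iff)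
  then have "entry (rokhlin_sum r v) i j = 0" if "\<not> (i < n \<and> j < n)" for i j
    using that by (simp add: entry_rokhlin_sum[of n v, OF assms])
  then show ?thesis by (simp add: stab_finite_iff)
qed

context
  fixes F :: "('g \<Rightarrow> 'a) filter"
  assumes F: "rokhlin_filter F"
begin

lemma rokhlin_Bfun: "g \<in> carrier G \<Longrightarrow> Bfun (\<lambda>r. r g) F"
  using F by (auto simp: rokhlin_filter_def intro!: BfunI[of _ 1])

private lemma B: "g \<in> carrier G \<Longrightarrow> (\<lambda>r. r g) \<simeq>[F] (\<lambda>r. r g)"
  by (rule asym_eq_refl[OF rokhlin_Bfun])

lemma rokhlin_star: "g \<in> carrier G \<Longrightarrow> (\<lambda>r. star (r g)) \<simeq>[F] (\<lambda>r. r g)"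
  using F by (intro asym_eq_cong_left[OF _ B]) (auto simp: rokhlin_filter_def)

lemma rokhlin_orthogonal:
  "g \<in> carrier G \<Longrightarrow> h \<in> carrier G \<Longrightarrow> g \<noteq> h \<Longrightarrow> (\<lambda>r. r g * r h) \<simeq>[F] (\<lambda>_. 0)"
  using F by (intro asym_eq_cong_left[OF _ asym_eq_const]) (auto simp: rokhlin_filter_def)

lemma rokhlin_translate:
  "g \<in> carrier G \<Longrightarrow> h \<in> carrier G \<Longrightarrow> (\<lambda>r. \<alpha> g (r h)) \<simeq>[F] (\<lambda>r. r (g \<otimes> h))"
  using F rokhlin_Bfun[of "g \<otimes> h"] by (simp add: asym_eq_def rokhlin_filter_def)

lemma rokhlin_central: "g \<in> carrier G \<Longrightarrow> (\<lambda>r. r g * a) \<simeq>[F] (\<lambda>r. a * r g)"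
  using F Bfun_mult[OF Bfun_const rokhlin_Bfun] by (simp add: asym_eq_def rokhlin_filter_def)

lemma rokhlin_unit: "(\<lambda>r. \<Sum>g\<in>carrier G. r g * a) \<simeq>[F] (\<lambda>_. a)"
  using F by (simp add: asym_eq_def rokhlin_filter_def sum_distrib_right)

text \<open>On \<open>A\<close>, each \<open>r\<^sub>g\<close> acts asymptotically as a projection, as \<open>r\<^sub>g = r\<^sub>g \<Sum>\<^sub>h r\<^sub>h = r\<^sub>g\<^sup>2\<close> there.\<close>

lemma rokhlin_idempotent:
  assumes g: "g \<in> carrier G" shows "(\<lambda>r. r g * r g * a) \<simeq>[F] (\<lambda>r. r g * a)"
proof -
  have "(\<lambda>r. r g * (\<Sum>h\<in>carrier G. r h * a)) \<simeq>[F] (\<lambda>r. r g * a)"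
    by (rule asym_eq_mult[OF B[OF g] rokhlin_unit])
  moreover have "(\<lambda>r. r g * (\<Sum>h\<in>carrier G. r h * a)) \<simeq>[F] (\<lambda>r. \<Sum>h\<in>carrier G. if h = g then r g * r g * a else 0)"
    unfolding sum_distrib_left
  proof (rule asym_eq_sum)
    fix h assume h: "h \<in> carrier G"
    show "(\<lambda>r. r g * (r h * a)) \<simeq>[F] (\<lambda>r. if h = g then r g * r g * a else 0)"
    proof (cases "h = g")
      case True
      then show ?thesis using asym_eq_mult[OF asym_eq_mult[OF B[OF g] B[OF g]] asym_eq_const[of a]]
        by (simp add: mult.assoc)
    next
      case False
      have "(\<lambda>r. r g * r h * a) \<simeq>[F] (\<lambda>r. 0 * a)"
        by (intro asym_eq_mult rokhlin_orthogonal asym_eq_const) (use g h False in auto)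
      then show ?thesis using False by (simp add: mult.assoc)
    qed
  qed
  ultimately show ?thesis
    using g finite_carrier asym_eq_trans[OF asym_eq_sym] by (simp add: sum.delta)
qed

text \<open>So \<open>(a\<^sub>g)\<^sub>g \<mapsto> \<Sum>\<^sub>g r\<^sub>g a\<^sub>g\<close> is an asymptotic morphism from the functions on \<open>G\<close>, with pointwise
  operations, to \<open>A\<close>, which reproduces the constant functions.\<close>

lemma rokhlin_sum_mult_entry:
  "(\<lambda>r. (\<Sum>g\<in>carrier G. r g * a g) * (\<Sum>g\<in>carrier G. r g * b g)) \<simeq>[F] (\<lambda>r. \<Sum>g\<in>carrier G. r g * (a g * b g))"
proof -
  have "(\<lambda>r. \<Sum>g\<in>carrier G. \<Sum>h\<in>carrier G. (r g * a g) * (r h * b h)) \<simeq>[F]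
     (\<lambda>r. \<Sum>g\<in>carrier G. \<Sum>h\<in>carrier G. if h = g then r g * (a g * b g) else 0)"
  proof (intro asym_eq_sum)
    fix g h assume gh: "g \<in> carrier G" "h \<in> carrier G"
    have "(\<lambda>r. (r g * a g) * (r h * b h)) = (\<lambda>r. r g * (a g * r h) * b h)" by (simp add: mult.assoc)
    also have "\<dots> \<simeq>[F] (\<lambda>r. r g * (r h * a g) * b h)"
      by (intro asym_eq_mult B gh asym_eq_sym[OF rokhlin_central] asym_eq_const)
    also have "\<dots> = (\<lambda>r. r g * r h * (a g * b h))" by (simp add: mult.assoc)
    also have "\<dots> \<simeq>[F] (\<lambda>r. if h = g then r g * (a g * b g) else 0)"
    proof (cases "h = g")
      case True
      then show ?thesis using rokhlin_idempotent[OF gh(1)] by simp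
    next
      case False
      have "(\<lambda>r. r g * r h * (a g * b h)) \<simeq>[F] (\<lambda>r. 0 * (a g * b h))"
        by (intro asym_eq_mult rokhlin_orthogonal asym_eq_const) (use gh False in auto)
      then show ?thesis using False by simp
    qed
    finally show "(\<lambda>r. (r g * a g) * (r h * b h)) \<simeq>[F] (\<lambda>r. if h = g then r g * (a g * b g) else 0)" .
  qed
  then show ?thesis using finite_carrier by (simp add: sum_product sum.delta)
qed

lemma rokhlin_sum_star_entry:
  "(\<lambda>r. star (\<Sum>g\<in>carrier G. r g * a g)) \<simeq>[F] (\<lambda>r. \<Sum>g\<in>carrier G. r g * star (a g))"
  unfolding star_sum star_mult
proof (rule asym_eq_sum)
  fix g assume g: "g \<in> carrier G"
  have "(\<lambda>r. star (a g) * star (r g)) \<simeq>[F] (\<lambda>r. star (a g) * r g)"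
    by (intro asym_eq_mult asym_eq_const rokhlin_star g)
  also have "\<dots> \<simeq>[F] (\<lambda>r. r g * star (a g))" by (rule asym_eq_sym[OF rokhlin_central[OF g]])
  finally show "(\<lambda>r. star (a g) * star (r g)) \<simeq>[F] (\<lambda>r. r g * star (a g))" .
qed

lemma rokhlin_sum_Bfun_entry: "Bfun (\<lambda>r. \<Sum>g\<in>carrier G. r g * a g) F"
  by (intro Bfun_sum Bfun_mult rokhlin_Bfun Bfun_const)

lemma rokhlin_sum_mult:
  assumes v: "\<And>g. g \<in> carrier G \<Longrightarrow> stab_finite n (v g)" and w: "\<And>g. g \<in> carrier G \<Longrightarrow> stab_finite n (w g)"
  shows "(\<lambda>r. rokhlin_sum r v * rokhlin_sum r w) \<simeq>[F] (\<lambda>r. rokhlin_sum r (\<lambda>g. v g * w g))"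
proof (rule asym_eq_matrices[of n])
  note vf = stab_finite_rokhlin_sum[of n v, OF v] and wf = stab_finite_rokhlin_sum[of n w, OF w]
  have vw: "stab_finite n (v g * w g)" if "g \<in> carrier G" for g
    using v[OF that] w[OF that] by (auto simp: stab_finite_iff entry_mult_finite[of n])
  show "stab_finite n (rokhlin_sum r v * rokhlin_sum r w)" for r
    using vf[of r] wf[of r] by (auto simp: stab_finite_iff entry_mult_finite[of n])
  show "stab_finite n (rokhlin_sum r (\<lambda>g. v g * w g))" for r by (rule stab_finite_rokhlin_sum[OF vw])
  fix i j
  have "(\<lambda>r. entry (rokhlin_sum r v * rokhlin_sum r w) i j) =
    (\<lambda>r. \<Sum>k<n. (\<Sum>g\<in>carrier G. r g * entry (v g) i k) * (\<Sum>g\<in>carrier G. r g * entry (w g) k j))"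
    by (simp add: entry_mult_finite[OF disjI1[OF vf]] entry_rokhlin_sum[OF v] entry_rokhlin_sum[OF w])
  also have "\<dots> \<simeq>[F] (\<lambda>r. \<Sum>k<n. \<Sum>g\<in>carrier G. r g * (entry (v g) i k * entry (w g) k j))"
    by (intro asym_eq_sum rokhlin_sum_mult_entry)
  also have "\<dots> = (\<lambda>r. \<Sum>g\<in>carrier G. r g * (\<Sum>k<n. entry (v g) i k * entry (w g) k j))"
    by (subst sum.swap) (simp add: sum_distrib_left)
  also have "\<dots> = (\<lambda>r. entry (rokhlin_sum r (\<lambda>g. v g * w g)) i j)"
    by (simp add: entry_rokhlin_sum[OF vw] entry_mult_finite[OF disjI1[OF v]])
  finally show "(\<lambda>r. entry (rokhlin_sum r v * rokhlin_sum r w) i j) \<simeq>[F]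
    (\<lambda>r. entry (rokhlin_sum r (\<lambda>g. v g * w g)) i j)" .
qed

lemma rokhlin_sum_star:
  assumes v: "\<And>g. g \<in> carrier G \<Longrightarrow> stab_finite n (v g)"
  shows "(\<lambda>r. star (rokhlin_sum r v)) \<simeq>[F] (\<lambda>r. rokhlin_sum r (\<lambda>g. star (v g)))"
proof (rule asym_eq_matrices[of n])
  have sv: "stab_finite n (star (v g))" if "g \<in> carrier G" for g using v[OF that] by (auto simp: stab_finite_iff)
  show "stab_finite n (star (rokhlin_sum r v))" for r
    using stab_finite_rokhlin_sum[of n v, OF v] by (auto simp: stab_finite_iff)
  show "stab_finite n (rokhlin_sum r (\<lambda>g. star (v g)))" for r by (rule stab_finite_rokhlin_sum[OF sv])
  fix i j
  show "(\<lambda>r. entry (star (rokhlin_sum r v)) i j) \<simeq>[F] (\<lambda>r. entry (rokhlin_sum r (\<lambda>g. star (v g))) i j)"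
    using rokhlin_sum_star_entry[of "\<lambda>g. entry (v g) j i"]
    by (simp add: entry_rokhlin_sum[OF sv] entry_rokhlin_sum[OF v])
qed

lemma rokhlin_sum_const:
  assumes p: "stab_finite n p" shows "(\<lambda>r. rokhlin_sum r (\<lambda>_. p)) \<simeq>[F] (\<lambda>_. p)"
  by (rule asym_eq_matrices[of n])
    (use p rokhlin_unit in \<open>simp_all add: stab_finite_rokhlin_sum entry_rokhlin_sum[of n]\<close>)

lemma rokhlin_sum_Bfun:
  assumes v: "\<And>g. g \<in> carrier G \<Longrightarrow> stab_finite n (v g)" shows "Bfun (\<lambda>r. rokhlin_sum r v) F"
  by (rule Bfun_matrices[of n])
    (simp_all add: stab_finite_rokhlin_sum[OF v] entry_rokhlin_sum[OF v] rokhlin_sum_Bfun_entry)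

lemma rokhlin_average_asym: "(\<lambda>r. rokhlin_average r a) \<simeq>[F] (\<lambda>r. \<Sum>g\<in>carrier G. r g * \<alpha> g a)"
  unfolding rokhlin_average_def
proof (rule asym_eq_sum)
  fix g assume g: "g \<in> carrier G"
  show "(\<lambda>r. \<alpha> g (r \<one> * a)) \<simeq>[F] (\<lambda>r. r g * \<alpha> g a)"
    using asym_eq_mult[OF rokhlin_translate[OF g one_closed] asym_eq_const[of "\<alpha> g a"]] g
    by (simp add: star_hom_mult[OF act_hom[OF g]])
qed

lemma rokhlin_average_on_fixed:
  assumes "a \<in> fixed_points" shows "(\<lambda>r. rokhlin_average r a) \<simeq>[F] (\<lambda>_. a)"
proof -
  have "(\<lambda>r. \<Sum>g\<in>carrier G. r g * \<alpha> g a) = (\<lambda>r. \<Sum>g\<in>carrier G. r g * a)"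
    using fixed_pointsD[OF assms] by (intro ext sum.cong) auto
  with rokhlin_average_asym[of a] have "(\<lambda>r. rokhlin_average r a) \<simeq>[F] (\<lambda>r. \<Sum>g\<in>carrier G. r g * a)" by simp
  then show ?thesis by (rule asym_eq_trans[OF _ rokhlin_unit])
qed

lemma rokhlin_average_asymptotic_morphism: "asymptotic_morphism F UNIV fixed_points rokhlin_average"
  unfolding asymptotic_morphism_def
proof (intro conjI allI ballI)
  fix r a show "rokhlin_average r a \<in> fixed_points" by (rule rokhlin_average_fixed)
next
  fix r a b show "rokhlin_average r (a + b) = rokhlin_average r a + rokhlin_average r b"
    unfolding rokhlin_average_def sum.distrib[symmetric]
    by (rule sum.cong) (simp_all add: distrib_left star_hom_add[OF act_hom])
next
  fix a b
  have "(\<lambda>r. rokhlin_average r (a * b)) \<simeq>[F] (\<lambda>r. \<Sum>g\<in>carrier G. r g * \<alpha> g (a * b))"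
    by (rule rokhlin_average_asym)
  also have "\<dots> = (\<lambda>r. \<Sum>g\<in>carrier G. r g * (\<alpha> g a * \<alpha> g b))"
    by (intro ext sum.cong refl) (simp add: star_hom_mult[OF act_hom])
  also have "\<dots> \<simeq>[F] (\<lambda>r. (\<Sum>g\<in>carrier G. r g * \<alpha> g a) * (\<Sum>g\<in>carrier G. r g * \<alpha> g b))"
    by (rule asym_eq_sym[OF rokhlin_sum_mult_entry])
  also have "\<dots> \<simeq>[F] (\<lambda>r. rokhlin_average r a * rokhlin_average r b)"
    by (intro asym_eq_mult asym_eq_sym[OF rokhlin_average_asym])
  finally show "(\<lambda>r. rokhlin_average r (a * b)) \<simeq>[F] (\<lambda>r. rokhlin_average r a * rokhlin_average r b)" .
next
  fix a
  have "(\<lambda>r. rokhlin_average r (star a)) \<simeq>[F] (\<lambda>r. \<Sum>g\<in>carrier G. r g * \<alpha> g (star a))"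
    by (rule rokhlin_average_asym)
  also have "\<dots> = (\<lambda>r. \<Sum>g\<in>carrier G. r g * star (\<alpha> g a))"
    by (intro ext sum.cong refl) (simp add: star_hom_star[OF act_hom])
  also have "\<dots> \<simeq>[F] (\<lambda>r. star (\<Sum>g\<in>carrier G. r g * \<alpha> g a))" by (rule asym_eq_sym[OF rokhlin_sum_star_entry])
  also have "\<dots> \<simeq>[F] (\<lambda>r. star (rokhlin_average r a))"
    by (intro asym_eq_star asym_eq_sym[OF rokhlin_average_asym])
  finally show "(\<lambda>r. rokhlin_average r (star a)) \<simeq>[F] (\<lambda>r. star (rokhlin_average r a))" .
qed

private lemma fixed_algebra: "cstar_subalgebra fixed_points"
  by (rule cstar_subalgebra_fixed_points)

private lemma whole_algebra: "cstar_subalgebra (UNIV :: 'a set)"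
  by (rule cstar_subalgebra_UNIV)

private lemma average_zero: "rokhlin_average r 0 = 0"
  by (simp add: rokhlin_average_def star_hom_zero[OF act_hom])

lemma inclusion_V_class:
  assumes p: "p \<in> projs (stab_alg fixed_points)"
  shows "p \<in> projs (stab_alg UNIV)" "V_map UNIV (\<lambda>a. a) (V_class fixed_points p) = V_class UNIV p"
proof -
  show "p \<in> projs (stab_alg UNIV)" using p by (auto simp: projs_def stab_alg_def)
  have "stab_map (\<lambda>a. a) p = p" by (rule stab_eqI) (simp add: entry_stab_map[OF star_homomorphism_ident])
  then show "V_map UNIV (\<lambda>a. a) (V_class fixed_points p) = V_class UNIV p"
    using V_map_class[OF star_homomorphism_ident _ whole_algebra p] by simp
qed

text \<open>The average is asymptotically the identity on matrices over the fixed point algebra.\<close>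

lemma induced_on_image:
  assumes f: "induced_V_map F UNIV fixed_points rokhlin_average f" and x: "x \<in> carrier (V fixed_points)"
  shows "\<forall>\<^sub>F r in F. f r (V_map UNIV (\<lambda>a. a) x) = x"
proof -
  obtain n p where p: "p \<in> projs (matrices n fixed_points)" "p \<in> projs (stab_alg fixed_points)" "x = V_class fixed_points p"
    using V_cases[OF fixed_algebra x] by metis
  note fin = projs_matrices_finite[OF p(1)]
  have pU: "p \<in> projs (matrices n UNIV)" using p(1) by (auto simp: projs_def matrices_def stab_alg_def)
  have "(\<lambda>r. stab_map (rokhlin_average r) p) \<simeq>[F] (\<lambda>_. p)"
    by (rule asym_eq_matrices[of n])
      (simp_all add: fin stab_finite_stab_map[of "rokhlin_average _", OF average_zero]
        entry_stab_map_finite[of "rokhlin_average _" n, OF average_zero]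
        rokhlin_average_on_fixed[OF projs_matrices_entry[OF p(1)]])
  then have "\<forall>\<^sub>F r in F. f r (V_class UNIV p) = V_class fixed_points p"
    by (intro induced_V_mapD[OF f pU, of "\<lambda>_. p"] p(2)) (rule asym_eq_sym)
  then show ?thesis unfolding p(3) inclusion_V_class(2)[OF p(2)] .
qed

text \<open>If \<open>v\<^sub>g\<close> implements \<open>p \<sim> \<alpha>\<^sub>g (p)\<close>, then \<open>\<Sum>\<^sub>g r\<^sub>g v\<^sub>g\<close> implements, asymptotically, the equivalence
  of \<open>p = \<Sum>\<^sub>g r\<^sub>g p\<close> with \<open>\<Sum>\<^sub>g r\<^sub>g \<alpha>\<^sub>g (p)\<close>.\<close>

lemma inclusion_of_induced_on_fixed:
  assumes f: "induced_V_map F UNIV fixed_points rokhlin_average f" and x: "x \<in> carrier (V UNIV)"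
    and fixed: "\<And>g. g \<in> carrier G \<Longrightarrow> V_map UNIV (\<alpha> g) x = x"
  shows "\<forall>\<^sub>F r in F. V_map UNIV (\<lambda>a. a) (f r x) = x"
proof -
  obtain n p where p: "p \<in> projs (matrices n UNIV)" "p \<in> projs (stab_alg UNIV)" "x = V_class UNIV p"
    using V_cases[OF whole_algebra x] by metis
  note fin = projs_matrices_finite[OF p(1)]
  define P where "P g = stab_map (\<alpha> g) p" for g
  have Pfin: "stab_finite n (P g)" if "g \<in> carrier G" for g
    unfolding P_def by (rule stab_finite_stab_map[of "\<alpha> g", OF star_hom_zero[OF act_hom[OF that]] fin])
  have "\<exists>v. stab_finite n v \<and> star v * v = p \<and> v * star v = P g" if g: "g \<in> carrier G" for g
  proof -
    have Pg: "P g \<in> projs (stab_alg UNIV)" unfolding P_def by (rule stab_map_projs[OF act_hom[OF g] _ p(2)]) simp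
    then have PgM: "P g \<in> projs (matrices n UNIV)" using Pfin[OF g] by (auto simp: projs_def matrices_def)
    have "V_class UNIV p = V_class UNIV (P g)"
      using fixed[OF g] V_map_class[OF act_hom[OF g] _ whole_algebra p(2)] by (simp add: p(3) P_def)
    then have "mvn_equiv (stab_alg UNIV) p (P g)" using V_class_eq_iff[OF whole_algebra p(2) Pg] by simp
    from mvn_equiv_in_matrices[OF p(1) PgM this] show ?thesis
      by (auto simp: mvn_equiv_def matrices_def)
  qed
  then obtain v where v: "\<And>g. g \<in> carrier G \<Longrightarrow> stab_finite n (v g)"
    "\<And>g. g \<in> carrier G \<Longrightarrow> star (v g) * v g = p" "\<And>g. g \<in> carrier G \<Longrightarrow> v g * star (v g) = P g" by metis
  have sv: "stab_finite n (star (v g))" if "g \<in> carrier G" for g using v(1)[OF that] by (auto simp: stab_finite_iff)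
  obtain q where q: "\<And>r. q r \<in> projs (matrices n fixed_points)" "q \<simeq>[F] (\<lambda>r. stab_map (rokhlin_average r) p)"
    by (rule morphism_projection_near[OF whole_algebra fixed_algebra rokhlin_average_asymptotic_morphism p(1)]) blast
  note qS = projs_matrices_stab_alg[OF q(1)]
  have cong: "rokhlin_sum r u = rokhlin_sum r u'" if "\<And>g. g \<in> carrier G \<Longrightarrow> u g = u' g" for r u u'
    using that by (simp add: rokhlin_sum_def cong: sum.cong)
  let ?w = "\<lambda>r. rokhlin_sum r v"
  have Bw: "?w \<simeq>[F] ?w" by (rule asym_eq_refl[OF rokhlin_sum_Bfun[OF v(1)]])
  have "(\<lambda>r. star (?w r) * ?w r) \<simeq>[F] (\<lambda>r. rokhlin_sum r (\<lambda>g. star (v g)) * ?w r)"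
    by (intro asym_eq_mult rokhlin_sum_star[OF v(1)] Bw)
  also have "\<dots> \<simeq>[F] (\<lambda>r. rokhlin_sum r (\<lambda>g. star (v g) * v g))" by (rule rokhlin_sum_mult[OF sv v(1)])
  also have "\<dots> = (\<lambda>r. rokhlin_sum r (\<lambda>_. p))" by (intro ext cong v(2))
  also have "\<dots> \<simeq>[F] (\<lambda>_. p)" by (rule rokhlin_sum_const[OF fin])
  finally have 1: "(\<lambda>r. star (?w r) * ?w r) \<simeq>[F] (\<lambda>_. p)" .
  have "(\<lambda>r. ?w r * star (?w r)) \<simeq>[F] (\<lambda>r. ?w r * rokhlin_sum r (\<lambda>g. star (v g)))"
    by (intro asym_eq_mult rokhlin_sum_star[OF v(1)] Bw)
  also have "\<dots> \<simeq>[F] (\<lambda>r. rokhlin_sum r (\<lambda>g. v g * star (v g)))" by (rule rokhlin_sum_mult[OF v(1) sv])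
  also have "\<dots> = (\<lambda>r. rokhlin_sum r P)" by (intro ext cong v(3))
  also have "\<dots> \<simeq>[F] (\<lambda>r. stab_map (rokhlin_average r) p)"
  proof (rule asym_eq_sym, rule asym_eq_matrices[of n])
    show "stab_finite n (stab_map (rokhlin_average r) p)" for r
      by (rule stab_finite_stab_map[of "rokhlin_average r", OF average_zero fin])
    show "stab_finite n (rokhlin_sum r P)" for r by (rule stab_finite_rokhlin_sum[OF Pfin])
    fix i j
    have "(\<Sum>g\<in>carrier G. r g * entry (P g) i j) = (\<Sum>g\<in>carrier G. r g * \<alpha> g (entry p i j))" for r
      by (rule sum.cong) (simp_all add: P_def entry_stab_map[OF act_hom])
    then show "(\<lambda>r. entry (stab_map (rokhlin_average r) p) i j) \<simeq>[F] (\<lambda>r. entry (rokhlin_sum r P) i j)"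
      using rokhlin_average_asym[of "entry p i j"]
      by (simp add: entry_stab_map_finite[of "rokhlin_average _" n, OF average_zero fin] entry_rokhlin_sum[OF Pfin])
  qed
  also have "\<dots> \<simeq>[F] q" by (rule asym_eq_sym[OF q(2)])
  finally have 2: "(\<lambda>r. ?w r * star (?w r)) \<simeq>[F] q" .
  have "\<forall>\<^sub>F r in F. mvn_equiv (stab_alg UNIV) p (q r)"
    by (rule mvn_equiv_if_asym[of "\<lambda>_. stab_alg UNIV" "\<lambda>_. p", OF cstar_subalgebra_stab_alg[OF whole_algebra] p(2) inclusion_V_class(1)[OF qS] _ 1 2])
      (simp add: stab_alg_def)
  moreover have "\<forall>\<^sub>F r in F. f r x = V_class fixed_points (q r)"
    unfolding p(3) by (rule induced_V_mapD[OF f p(1) qS q(2)])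
  ultimately show ?thesis
    by eventually_elim (simp add: inclusion_V_class(2)[OF qS] p(3) V_class_cong[OF whole_algebra])
qed

text \<open>A fixed projection \<open>p\<close> is, asymptotically, the orthogonal sum of the translates \<open>r\<^sub>g p\<close> of \<open>r\<^sub>1 p\<close>.\<close>

lemma inclusion_is_orbit_sum:
  assumes x: "x \<in> carrier (V fixed_points)" and F0: "F \<noteq> bot"
  shows "\<exists>y\<in>carrier (V UNIV). V_map UNIV (\<lambda>a. a) x = (\<Otimes>\<^bsub>V UNIV\<^esub>g\<in>carrier G. V_map UNIV (\<alpha> g) y)"
proof -
  obtain n p where p: "p \<in> projs (matrices n fixed_points)" "p \<in> projs (stab_alg fixed_points)" "x = V_class fixed_points p"
    using V_cases[OF fixed_algebra x] by metis
  note fin = projs_matrices_finite[OF p(1)] and pD = projsD[OF p(1)]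
  define d where "d h g = (if g = h then p else 0)" for h g :: 'g
  define P where "P h = (\<lambda>r. rokhlin_sum r (d h))" for h
  have dfin: "stab_finite n (d h g)" for h g using fin by (simp add: d_def stab_finite_iff)
  have PB: "P h \<simeq>[F] P h" for h unfolding P_def by (rule asym_eq_refl[OF rokhlin_sum_Bfun[OF dfin]])
  have Pstar: "(\<lambda>r. star (P h r)) \<simeq>[F] P h" for h
  proof -
    have "(\<lambda>g. star (d h g)) = d h" by (auto simp: d_def pD)
    then show ?thesis using rokhlin_sum_star[of n "d h", OF dfin] unfolding P_def by simp
  qed
  have PP: "(\<lambda>r. P h r * P k r) \<simeq>[F] (if h = k then P h else (\<lambda>_. 0))" for h k
  proof -
    have "(\<lambda>r. P h r * P k r) \<simeq>[F] (\<lambda>r. rokhlin_sum r (\<lambda>g. d h g * d k g))"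
      unfolding P_def by (rule rokhlin_sum_mult[OF dfin dfin])
    moreover have "(\<lambda>g. d h g * d k g) = (if h = k then d h else (\<lambda>_. 0))" by (auto simp: d_def pD)
    moreover have "rokhlin_sum r (\<lambda>_. 0) = 0" for r
      by (rule stab_eqI) (simp add: entry_rokhlin_sum[of 0] stab_finite_iff)
    ultimately show ?thesis by (auto simp: P_def)
  qed
  have Psum: "(\<lambda>r. \<Sum>h\<in>carrier G. P h r) \<simeq>[F] (\<lambda>_. p)"
  proof -
    have "(\<Sum>h\<in>carrier G. P h r) = rokhlin_sum r (\<lambda>_. p)" for r
    proof (rule stab_eqI)
      fix i j
      have "entry (\<Sum>h\<in>carrier G. P h r) i j = (\<Sum>h\<in>carrier G. \<Sum>g\<in>carrier G. if g = h then r g * entry p i j else 0)"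
        unfolding entry_sum P_def entry_rokhlin_sum[of n "d _", OF dfin]
        by (intro sum.cong refl) (simp add: d_def)
      then show "entry (\<Sum>h\<in>carrier G. P h r) i j = entry (rokhlin_sum r (\<lambda>_. p)) i j"
        using finite_carrier fin by (simp add: entry_rokhlin_sum[of n])
    qed
    then show ?thesis using rokhlin_sum_const[OF fin] by simp
  qed
  have PM: "P \<one> r \<in> matrices n UNIV" for r
    unfolding P_def using stab_finite_rokhlin_sum[of n "d \<one>", OF dfin] by (simp add: matrices_def stab_alg_def)
  obtain q where q: "\<And>r. q r \<in> projs (matrices n UNIV)" "q \<simeq>[F] P \<one>"
    by (rule projection_near_asym[of "\<lambda>_. matrices n UNIV" "P \<one>", OF cstar_subalgebra_matrices[OF whole_algebra] PM Pstar])
      (use PP[of \<one> \<one>] in auto)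
  note qU = projs_matrices_stab_alg[OF q(1)]
  have translate: "(\<lambda>r. stab_map (\<alpha> h) (q r)) \<simeq>[F] P h" if h: "h \<in> carrier G" for h
  proof -
    note ah = star_homomorphism_stab_map[OF act_hom[OF h]]
    have "(\<lambda>r. stab_map (\<alpha> h) (q r)) \<simeq>[F] (\<lambda>r. stab_map (\<alpha> h) (P \<one> r))"
      by (rule asym_eq_bounded_linear[OF star_hom_bounded_linear[OF ah] q(2)])
    also have "\<dots> \<simeq>[F] P h"
    proof (rule asym_eq_matrices[of n])
      show "stab_finite n (stab_map (\<alpha> h) (P \<one> r))" for r
        by (rule stab_finite_stab_map[of "\<alpha> h", OF star_hom_zero[OF act_hom[OF h]]]) (use PM[of r] in \<open>simp add: matrices_def\<close>)
      show "stab_finite n (P h r)" for r unfolding P_def by (rule stab_finite_rokhlin_sum[OF dfin])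
      fix i j
      have ent: "entry (P k r) i j = r k * entry p i j" if "k \<in> carrier G" for k r
      proof -
        have "entry (P k r) i j = (\<Sum>g\<in>carrier G. if g = k then r k * entry p i j else 0)"
          unfolding P_def entry_rokhlin_sum[of n "d k", OF dfin] by (rule sum.cong) (auto simp: d_def)
        then show ?thesis using that finite_carrier by simp
      qed
      have "\<alpha> h (entry p i j) = entry p i j" by (rule fixed_pointsD[OF projs_matrices_entry[OF p(1)] h])
      then have "(\<lambda>r. entry (stab_map (\<alpha> h) (P \<one> r)) i j) = (\<lambda>r. \<alpha> h (r \<one>) * entry p i j)"
        by (simp add: entry_stab_map[OF act_hom[OF h]] ent star_hom_mult[OF act_hom[OF h]])
      also have "\<dots> \<simeq>[F] (\<lambda>r. r h * entry p i j)"
        using asym_eq_mult[OF rokhlin_translate[OF h one_closed] asym_eq_const] h by simp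
      finally show "(\<lambda>r. entry (stab_map (\<alpha> h) (P \<one> r)) i j) \<simeq>[F] (\<lambda>r. entry (P h r) i j)"
        by (simp add: ent[OF h])
    qed
    finally show ?thesis .
  qed
  have "\<forall>\<^sub>F r in F. (\<Otimes>\<^bsub>V UNIV\<^esub>g\<in>carrier G. V_class UNIV (stab_map (\<alpha> g) (q r))) = V_class UNIV p"
  proof (rule V_class_sum_asym[OF whole_algebra finite_carrier])
    show "stab_map (\<alpha> g) (q r) \<in> projs (stab_alg UNIV)" if "g \<in> carrier G" for g r
      by (rule stab_map_projs[OF act_hom[OF that] _ qU]) simp
    show "p \<in> projs (stab_alg UNIV)" by (rule inclusion_V_class(1)[OF p(2)])
    show "(\<lambda>r. stab_map (\<alpha> g) (q r) * stab_map (\<alpha> h) (q r)) \<simeq>[F] (\<lambda>_. 0)"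
      if "g \<in> carrier G" "h \<in> carrier G" "g \<noteq> h" for g h
      using asym_eq_trans[OF asym_eq_mult[OF translate[OF that(1)] translate[OF that(2)]]] PP[of g h] that(3) by simp
    show "(\<lambda>r. \<Sum>g\<in>carrier G. stab_map (\<alpha> g) (q r)) \<simeq>[F] (\<lambda>_. p)"
      by (rule asym_eq_trans[OF asym_eq_sum[OF translate] Psum])
  qed
  then obtain r where r: "(\<Otimes>\<^bsub>V UNIV\<^esub>g\<in>carrier G. V_class UNIV (stab_map (\<alpha> g) (q r))) = V_class UNIV p"
    using F0 eventually_happens' by blast
  have "(\<Otimes>\<^bsub>V UNIV\<^esub>g\<in>carrier G. V_map UNIV (\<alpha> g) (V_class UNIV (q r))) =
     (\<Otimes>\<^bsub>V UNIV\<^esub>g\<in>carrier G. V_class UNIV (stab_map (\<alpha> g) (q r)))"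
  proof -
    interpret VU: comm_monoid "V (UNIV :: 'a set)" by (rule comm_monoid_V[OF whole_algebra])
    show ?thesis
      by (rule VU.finprod_cong')
        (auto simp: V_map_class[OF act_hom _ whole_algebra qU] intro!: V_class_in_carrier stab_map_projs[OF act_hom _ qU])
  qed
  then show ?thesis
    using r V_class_in_carrier[OF qU] by (auto simp: p(3) inclusion_V_class(2)[OF p(2)] intro!: bexI[of _ "V_class UNIV (q r)"])
qed

end

end


section \<open>The Grothendieck group\<close>

lemma UN_pairs_constant: "(x, y) \<in> A \<Longrightarrow> (\<And>a b. (a, b) \<in> A \<Longrightarrow> f a b = k) \<Longrightarrow> (\<Union>(a, b)\<in>A. f a b) = k"
  by (rule UN_constant_eq[of "(x, y)"]) auto

context comm_monoid
begin

lemma groth_rel_equiv: "equiv (carrier G \<times> carrier G) (groth_rel G)"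
proof (rule equivI)
  show "groth_rel G \<subseteq> (carrier G \<times> carrier G) \<times> (carrier G \<times> carrier G)" by (auto simp: groth_rel_def)
  show "refl_on (carrier G \<times> carrier G) (groth_rel G)"
    by (auto simp: refl_on_def groth_rel_def)
  show "sym (groth_rel G)"
    by (rule symI) (auto simp: groth_rel_def, metis)
  show "trans (groth_rel G)"
  proof (rule transI)
    fix X Y Z assume "(X, Y) \<in> groth_rel G" "(Y, Z) \<in> groth_rel G"
    then obtain x y x' y' x'' y'' z w where c: "X = (x, y)" "Y = (x', y')" "Z = (x'', y'')"
      "x \<in> carrier G" "y \<in> carrier G" "x' \<in> carrier G" "y' \<in> carrier G" "x'' \<in> carrier G" "y'' \<in> carrier G"
      "z \<in> carrier G" "w \<in> carrier G"
      and z: "x \<otimes> y' \<otimes> z = x' \<otimes> y \<otimes> z" and w: "x' \<otimes> y'' \<otimes> w = x'' \<otimes> y' \<otimes> w"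
      by (auto simp: groth_rel_def)
    have "x \<otimes> y'' \<otimes> (y' \<otimes> z \<otimes> w) = (x \<otimes> y' \<otimes> z) \<otimes> (y'' \<otimes> w)" using c by (simp add: m_ac)
    also have "\<dots> = (x' \<otimes> y'' \<otimes> w) \<otimes> (y \<otimes> z)" using c by (simp add: z) (simp add: m_ac)
    also have "\<dots> = x'' \<otimes> y \<otimes> (y' \<otimes> z \<otimes> w)" using c by (simp add: w) (simp add: m_ac)
    finally have "x \<otimes> y'' \<otimes> (y' \<otimes> z \<otimes> w) = x'' \<otimes> y \<otimes> (y' \<otimes> z \<otimes> w)" .
    moreover have "y' \<otimes> z \<otimes> w \<in> carrier G" using c by simp
    ultimately show "(X, Z) \<in> groth_rel G" using c unfolding groth_rel_def by blast
  qed
qed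

lemma groth_class_eq_iff:
  assumes "x \<in> carrier G" "y \<in> carrier G" "x' \<in> carrier G" "y' \<in> carrier G"
  shows "groth_class G x y = groth_class G x' y' \<longleftrightarrow> (\<exists>z\<in>carrier G. x \<otimes> y' \<otimes> z = x' \<otimes> y \<otimes> z)"
  using assms eq_equiv_class_iff[OF groth_rel_equiv, of "(x, y)" "(x', y')"]
  by (simp add: groth_class_def groth_rel_def)

lemma groth_class_absorb:
  assumes "x \<in> carrier G" "y \<in> carrier G" "z \<in> carrier G"
  shows "groth_class G (x \<otimes> z) (y \<otimes> z) = groth_class G x y"
  using assms by (subst groth_class_eq_iff) (auto simp: m_ac intro!: bexI[of _ \<one>])

lemma carrier_grothendieck: "carrier (grothendieck G) = {groth_class G x y |x y. x \<in> carrier G \<and> y \<in> carrier G}"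
  by (auto simp: grothendieck_def quotient_def groth_class_def)

lemma groth_class_pairs:
  assumes "x \<in> carrier G" "y \<in> carrier G"
  shows "(a, b) \<in> groth_class G x y \<longleftrightarrow> a \<in> carrier G \<and> b \<in> carrier G \<and> groth_class G a b = groth_class G x y"
  using assms groth_class_eq_iff[of x y a b] by (auto simp: groth_class_def groth_rel_def)

lemma groth_class_self: "x \<in> carrier G \<Longrightarrow> y \<in> carrier G \<Longrightarrow> (x, y) \<in> groth_class G x y"
  by (simp add: groth_class_pairs)

lemma groth_class_cong_mult:
  assumes c: "x \<in> carrier G" "y \<in> carrier G" "a \<in> carrier G" "b \<in> carrier G"
    "x' \<in> carrier G" "y' \<in> carrier G" "a' \<in> carrier G" "b' \<in> carrier G"
    and ab: "groth_class G a b = groth_class G x y" and ab': "groth_class G a' b' = groth_class G x' y'"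
  shows "groth_class G (a \<otimes> a') (b \<otimes> b') = groth_class G (x \<otimes> x') (y \<otimes> y')"
proof -
  obtain z where z: "z \<in> carrier G" "a \<otimes> y \<otimes> z = x \<otimes> b \<otimes> z" using ab c by (auto simp: groth_class_eq_iff)
  obtain w where w: "w \<in> carrier G" "a' \<otimes> y' \<otimes> w = x' \<otimes> b' \<otimes> w" using ab' c by (auto simp: groth_class_eq_iff)
  have "a \<otimes> a' \<otimes> (y \<otimes> y') \<otimes> (z \<otimes> w) = (a \<otimes> y \<otimes> z) \<otimes> (a' \<otimes> y' \<otimes> w)" using c z(1) w(1) by (simp add: m_ac)
  also have "\<dots> = x \<otimes> x' \<otimes> (b \<otimes> b') \<otimes> (z \<otimes> w)" unfolding z(2) w(2) using c z(1) w(1) by (simp add: m_ac)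
  finally show ?thesis using c z(1) w(1) by (subst groth_class_eq_iff) (auto intro!: bexI[of _ "z \<otimes> w"])
qed

lemma groth_mult:
  assumes c: "x \<in> carrier G" "y \<in> carrier G" "x' \<in> carrier G" "y' \<in> carrier G"
  shows "groth_class G x y \<otimes>\<^bsub>grothendieck G\<^esub> groth_class G x' y' = groth_class G (x \<otimes> x') (y \<otimes> y')"
proof -
  have pair: "groth_class G (a \<otimes> a') (b \<otimes> b') = groth_class G (x \<otimes> x') (y \<otimes> y')"
    if "(a, b) \<in> groth_class G x y" "(a', b') \<in> groth_class G x' y'" for a b a' b'
    using that by (intro groth_class_cong_mult) (simp_all add: groth_class_pairs c)
  show ?thesis
    unfolding grothendieck_def monoid.simps
    by (intro UN_pairs_constant[OF groth_class_self[OF c(1,2)]] UN_pairs_constant[OF groth_class_self[OF c(3,4)]] pair)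
qed

lemma one_grothendieck: "\<one>\<^bsub>grothendieck G\<^esub> = groth_class G \<one> \<one>"
  by (simp add: grothendieck_def)

end

text \<open>A homomorphism maps a witness \<open>z\<close> of the equality of two classes to a witness.\<close>

lemma groth_class_hom:
  assumes M: "comm_monoid M" and N: "comm_monoid N" and f: "f \<in> hom M N"
    and c: "x \<in> carrier M" "y \<in> carrier M" "a \<in> carrier M" "b \<in> carrier M"
    and eq: "groth_class M a b = groth_class M x y"
  shows "groth_class N (f a) (f b) = groth_class N (f x) (f y)"
proof -
  interpret M: comm_monoid M by (rule M)
  interpret N: comm_monoid N by (rule N)
  obtain z where z: "z \<in> carrier M" "a \<otimes>\<^bsub>M\<^esub> y \<otimes>\<^bsub>M\<^esub> z = x \<otimes>\<^bsub>M\<^esub> b \<otimes>\<^bsub>M\<^esub> z"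
    using eq c by (auto simp: M.groth_class_eq_iff)
  have "f (a \<otimes>\<^bsub>M\<^esub> y \<otimes>\<^bsub>M\<^esub> z) = f (x \<otimes>\<^bsub>M\<^esub> b \<otimes>\<^bsub>M\<^esub> z)" by (simp only: z(2))
  then have "f a \<otimes>\<^bsub>N\<^esub> f y \<otimes>\<^bsub>N\<^esub> f z = f x \<otimes>\<^bsub>N\<^esub> f b \<otimes>\<^bsub>N\<^esub> f z" using c z(1) by (simp add: hom_mult[OF f])
  then show ?thesis using c z(1) hom_in_carrier[OF f] by (auto simp: N.groth_class_eq_iff)
qed

lemma grothendieck_map_class:
  assumes M: "comm_monoid M" and N: "comm_monoid N" and f: "f \<in> hom M N"
    and c: "x \<in> carrier M" "y \<in> carrier M"
  shows "grothendieck_map N f (groth_class M x y) = groth_class N (f x) (f y)"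
proof -
  interpret M: comm_monoid M by (rule M)
  show ?thesis
    unfolding grothendieck_map_def
    by (rule UN_pairs_constant[OF M.groth_class_self[OF c]], rule groth_class_hom[OF M N f c])
      (simp_all add: M.groth_class_pairs c)
qed


section \<open>K0 in the presence of an approximate identity of projections\<close>

lemma cstar_subalgebra_unitize: assumes S: "cstar_subalgebra S" shows "cstar_subalgebra (unitize S)"
proof -
  have "bounded_linear (alg_part :: 'a unitization \<Rightarrow> 'a)"
    by (rule bounded_linear_intro[where K = 2])
      (use norm_unitization_lower(1) in \<open>auto simp: plus_unitization_def scaleR_unitization_def mult.commute\<close>)
  then have "closed (alg_part -` S)"
    by (intro continuous_closed_vimage[OF subalgebra_closed[OF S]] linear_continuous_at)
  then show ?thesis
    using S by (auto simp: cstar_subalgebra_def unitize_def vimage_def zero_unitization_def plus_unitization_def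
        times_unitization_def star_unitization_def cscale_unitization_def)
qed

lemma star_homomorphism_Adjoin_0: "star_homomorphism (\<lambda>a::'a::cstar_algebra. Adjoin a 0)"
  by (simp add: star_homomorphism_def unitization_defs star_unitization_def cscale_unitization_def)

lemma star_homomorphism_scalar_part: "star_homomorphism (scalar_part :: 'a::cstar_algebra unitization \<Rightarrow> complex)"
  by (simp add: star_homomorphism_def unitization_defs star_unitization_def cscale_unitization_def
      star_complex_def cscale_complex_def)

lemma star_homomorphism_unitize_map: "star_homomorphism f \<Longrightarrow> star_homomorphism (unitize_map f)"
  by (simp add: star_homomorphism_def unitize_map_def unitization_defs star_unitization_def cscale_unitization_def)

lemma unitize_map_image: "f ` S \<subseteq> T \<Longrightarrow> unitize_map f ` unitize S \<subseteq> unitize T"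
  by (auto simp: unitize_map_def unitize_def)

text \<open>For a projection \<open>u\<close> of \<open>A\<close>, the complement \<open>1 - u\<close> in the unitization spans a copy of \<open>\<complex>\<close>.\<close>

definition complement_hom :: "'a::cstar_algebra \<Rightarrow> complex \<Rightarrow> 'a unitization" where
  "complement_hom u c = Adjoin (- cscale c u) c"

lemma star_homomorphism_complement:
  assumes "projection u" shows "star_homomorphism (complement_hom u)"
  using assms unfolding star_homomorphism_def complement_hom_def projection_def
  by (simp add: unitization_defs star_unitization_def cscale_unitization_def star_complex_def cscale_complex_def
      cscale_add_left cscale_cscale star_cscale star_minus cscale_mult_left cscale_mult_right
      cscale_minus_right mult.commute)

text \<open>An approximate identity of projections, as a family indexed along a filter.  All its members are projections in
  \<open>S\<close>, and by taking adjoints it is a right approximate identity as well.\<close>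

definition projection_unit :: "'i filter \<Rightarrow> 'a::cstar_algebra set \<Rightarrow> ('i \<Rightarrow> 'a) \<Rightarrow> bool" where
  "projection_unit F S u \<longleftrightarrow> F \<noteq> bot \<and> (\<forall>i. u i \<in> projs S) \<and> (\<forall>a\<in>S. (\<lambda>i. u i * a) \<simeq>[F] (\<lambda>_. a))"

text \<open>Differences \<open>[p] - [q]\<close> of projections over \<open>A\<close> itself; without an approximate identity of projections they
  need not exhaust \<open>K\<^sub>0(A)\<close>.\<close>

definition K0_diff :: "'a::cstar_algebra set \<Rightarrow> 'a imat set \<Rightarrow> 'a imat set \<Rightarrow>
    ('a unitization imat set \<times> 'a unitization imat set) set" where
  "K0_diff S x y = groth_class (V (unitize S)) (V_map (unitize S) (\<lambda>a. Adjoin a 0) x)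
     (V_map (unitize S) (\<lambda>a. Adjoin a 0) y)"

context
  fixes S :: "'a::cstar_algebra set" and F :: "'i filter" and u :: "'i \<Rightarrow> 'a"
  assumes S: "cstar_subalgebra S" and u: "projection_unit F S u"
begin

private abbreviation "S1 \<equiv> unitize S"
private abbreviation "j \<equiv> V_map S1 (\<lambda>a. Adjoin a 0)"

private lemma S1: "cstar_subalgebra S1"
  by (rule cstar_subalgebra_unitize[OF S])

private lemma C: "cstar_subalgebra (UNIV :: complex set)"
  by (rule cstar_subalgebra_UNIV)

private lemma incl: "(\<lambda>a. Adjoin a 0) ` S \<subseteq> S1"
  by (auto simp: unitize_def)

private lemma uS: "u i \<in> projs S" and F0: "F \<noteq> bot" and uu: "a \<in> S \<Longrightarrow> (\<lambda>i. u i * a) \<simeq>[F] (\<lambda>_. a)"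
  using u by (auto simp: projection_unit_def)

private lemma uproj: "star (u i) = u i" "u i * u i = u i" "u i \<in> S"
  using projsD[OF uS] by auto

private lemma Bu: "u \<simeq>[F] u"
  by (rule asym_eq_refl[OF Bfun_projs[of u "\<lambda>_. S", OF uS]])

private lemma uu': assumes a: "a \<in> S" shows "(\<lambda>i. a * u i) \<simeq>[F] (\<lambda>_. a)"
  using asym_eq_star[OF uu[OF subalgebra_star[OF S a]]] by (simp add: star_simps uproj)

text \<open>The element \<open>u b u\<close> for \<open>b = a + c 1\<close>, written as an element of \<open>A\<close>.\<close>

definition compression :: "'i \<Rightarrow> 'a unitization \<Rightarrow> 'a" where
  "compression i b = u i * alg_part b * u i + cscale (scalar_part b) (u i)"

private lemma j_hom: "j \<in> hom (V S) (V S1)"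
  by (rule V_map_hom[OF star_homomorphism_Adjoin_0 incl S S1])

private lemma j_closed: "x \<in> carrier (V S) \<Longrightarrow> j x \<in> carrier (V S1)"
  by (rule hom_in_carrier[OF j_hom])

private lemma j_mult: "x \<in> carrier (V S) \<Longrightarrow> y \<in> carrier (V S) \<Longrightarrow> j (x \<otimes>\<^bsub>V S\<^esub> y) = j x \<otimes>\<^bsub>V S1\<^esub> j y"
  by (rule hom_mult[OF j_hom])

private lemma j_one: "j \<one>\<^bsub>V S\<^esub> = \<one>\<^bsub>V S1\<^esub>"
  by (rule V_map_one[OF star_homomorphism_Adjoin_0 incl S S1])

text \<open>On the unitization, \<open>b \<mapsto> u b u\<close> is asymptotically multiplicative, since \<open>u a (1 - u) \<rightarrow> 0\<close> for
  \<open>a \<in> A\<close> and \<open>u\<close> commutes with the scalars.\<close>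

lemma compression_asymptotic_morphism: "asymptotic_morphism F S1 S compression"
  unfolding asymptotic_morphism_def
proof (intro conjI allI ballI)
  fix i b assume "b \<in> S1"
  then show "compression i b \<in> S"
    using uproj S by (simp add: compression_def unitize_def subalgebra_intros subalgebra_cscale)
next
  fix i a b show "compression i (a + b) = compression i a + compression i b"
    by (simp add: compression_def plus_unitization_def algebra_simps cscale_add_left)
next
  fix a b assume ab: "a \<in> S1" "b \<in> S1"
  define x y c d where "x = alg_part a" "y = alg_part b" "c = scalar_part a" "d = scalar_part b"
  note defs = this
  have x: "x \<in> S" using ab by (simp add: defs unitize_def)
  have uuy: "u i * (u i * z) = u i * z" for i z by (simp add: mult.assoc[symmetric] uproj)
  have eq1: "compression i a * compression i b = u i * (x * u i) * y * u i + cscale c (u i * y * u i) +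
      cscale d (u i * x * u i) + cscale (c * d) (u i)" for i
    by (simp add: compression_def defs ring_distribs mult.assoc uuy uproj cscale_mult_left cscale_mult_right
        cscale_cscale cscale_add_right add_ac mult.commute)
  have eq2: "compression i (a * b) = u i * x * y * u i + cscale c (u i * y * u i) +
      cscale d (u i * x * u i) + cscale (c * d) (u i)" for i
    by (simp add: compression_def defs times_unitization_def ring_distribs cscale_mult_left cscale_mult_right mult.assoc)
  have Bc: "Bfun (\<lambda>i. cscale c (u i * y * u i) + cscale d (u i * x * u i) + cscale (c * d) (u i)) F"
    by (intro Bfun_add Bfun_bounded_linear[OF bounded_linear_cscale] Bfun_mult Bfun_const Bfun_projs[of u "\<lambda>_. S", OF uS])
  have "(\<lambda>i. u i * x * y * u i) \<simeq>[F] (\<lambda>i. u i * (x * u i) * y * u i)"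
    by (intro asym_eq_mult Bu asym_eq_const asym_eq_sym[OF uu'[OF x]])
  from asym_eq_add[OF this asym_eq_refl[OF Bc]]
  show "(\<lambda>i. compression i (a * b)) \<simeq>[F] (\<lambda>i. compression i a * compression i b)"
    unfolding eq1 eq2 by (simp add: add.assoc)
next
  fix a
  have "compression i (star a) = star (compression i a)" for i
    by (simp add: compression_def star_unitization_def star_simps star_cscale uproj mult.assoc)
  moreover have "Bfun (\<lambda>i. compression i (star a)) F"
    unfolding compression_def
    by (intro Bfun_add Bfun_bounded_linear[OF bounded_linear_cscale] Bfun_mult Bfun_const Bfun_projs[of u "\<lambda>_. S", OF uS])
  ultimately show "(\<lambda>i. compression i (star a)) \<simeq>[F] (\<lambda>i. star (compression i a))"
    using asym_eq_refl by simp
qed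

private lemma compression_zero: "compression i 0 = 0"
  by (simp add: compression_def zero_unitization_def)

lemma compression_on_ideal:
  assumes f: "induced_V_map F S1 S compression f" and x: "x \<in> carrier (V S)"
  shows "\<forall>\<^sub>F i in F. f i (j x) = x"
proof -
  obtain n p where p: "p \<in> projs (matrices n S)" "p \<in> projs (stab_alg S)" "x = V_class S p"
    using V_cases[OF S x] by metis
  note fin = projs_matrices_finite[OF p(1)]
  define P where "P = stab_map (\<lambda>a. Adjoin a 0) p"
  have entP: "entry P a b = Adjoin (entry p a b) 0" for a b
    by (simp add: P_def entry_stab_map[OF star_homomorphism_Adjoin_0])
  have Pfin: "stab_finite n P" using fin by (auto simp: stab_finite_iff entP zero_unitization_def)
  have "P \<in> projs (stab_alg S1)" unfolding P_def by (rule stab_map_projs[OF star_homomorphism_Adjoin_0 incl p(2)])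
  then have P: "P \<in> projs (matrices n S1)" using Pfin by (auto simp: projs_def matrices_def)
  have "(\<lambda>i. stab_map (compression i) P) \<simeq>[F] (\<lambda>_. p)"
  proof (rule asym_eq_matrices[of n])
    show "stab_finite n (stab_map (compression i) P)" for i
      by (rule stab_finite_stab_map[of "compression i", OF compression_zero Pfin])
    fix a b
    note e = projs_matrices_entry[OF p(1), of a b]
    have "(\<lambda>i. u i * entry p a b * u i) \<simeq>[F] (\<lambda>i. entry p a b * u i)" by (intro asym_eq_mult uu e Bu)
    also have "\<dots> \<simeq>[F] (\<lambda>_. entry p a b)" by (rule uu'[OF e])
    finally show "(\<lambda>i. entry (stab_map (compression i) P) a b) \<simeq>[F] (\<lambda>i. entry p a b)"
      by (simp add: entry_stab_map_finite[of "compression _" n, OF compression_zero Pfin] entP compression_def)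
  qed (rule fin)
  then have "\<forall>\<^sub>F i in F. f i (V_class S1 P) = V_class S p"
    by (intro induced_V_mapD[OF f P, of "\<lambda>_. p"] p(2)) (rule asym_eq_sym)
  moreover have "j x = V_class S1 P"
    unfolding p(3) P_def by (rule V_map_class[OF star_homomorphism_Adjoin_0 incl S1 p(2)])
  ultimately show ?thesis by (simp add: p(3))
qed

text \<open>A projection over the unitization splits, asymptotically, into its compression by \<open>u\<close> and the
  complement \<open>1 - u\<close> times its scalar part.\<close>

lemma unitization_class_split:
  assumes f: "induced_V_map F S1 S compression f" and x: "x \<in> carrier (V S1)"
  shows "\<forall>\<^sub>F i in F. x = j (f i x) \<otimes>\<^bsub>V S1\<^esub> V_map S1 (complement_hom (u i)) (V_map UNIV scalar_part x)"
proof -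
  interpret V1: comm_monoid "V S1" by (rule comm_monoid_V[OF S1])
  obtain n p where p: "p \<in> projs (matrices n S1)" "p \<in> projs (stab_alg S1)" "x = V_class S1 p"
    using V_cases[OF S1 x] by metis
  note fin = projs_matrices_finite[OF p(1)]
  note sc = star_homomorphism_scalar_part
  have \<kappa>: "star_homomorphism (complement_hom (u i))" for i
    by (rule star_homomorphism_complement) (simp add: projection_def uproj)
  have \<kappa>S: "complement_hom (u i) ` UNIV \<subseteq> S1" for i
    using S uproj by (auto simp: complement_hom_def unitize_def subalgebra_minus subalgebra_cscale)
  define s where "s = stab_map scalar_part p"
  have s: "s \<in> projs (stab_alg UNIV)" unfolding s_def by (rule stab_map_projs[OF sc _ p(2)]) simp
  have sfin: "stab_finite n s" unfolding s_def by (rule stab_finite_stab_map[of scalar_part, OF star_hom_zero[OF sc] fin])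
  obtain q where q: "\<And>i. q i \<in> projs (matrices n S)" "q \<simeq>[F] (\<lambda>i. stab_map (compression i) p)"
    by (rule morphism_projection_near[OF S1 S compression_asymptotic_morphism p(1)]) blast
  note qS = projs_matrices_stab_alg[OF q(1)]
  note J = star_homomorphism_Adjoin_0
  define Q where "Q i = stab_map (\<lambda>a. Adjoin a 0) (q i)" for i
  define R where "R i = stab_map (complement_hom (u i)) s" for i
  define C where "C i = stab_map (\<lambda>a. Adjoin a 0) (stab_map (compression i) p)" for i
  have Qp: "Q i \<in> projs (stab_alg S1)" for i unfolding Q_def by (rule stab_map_projs[OF J incl qS])
  have Rp: "R i \<in> projs (stab_alg S1)" for i unfolding R_def by (rule stab_map_projs[OF \<kappa> \<kappa>S s])
  have Cfin: "stab_finite n (C i)" for i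
    unfolding C_def by (intro stab_finite_stab_map[of "\<lambda>a. Adjoin a 0", OF star_hom_zero[OF J]] stab_finite_stab_map[of "compression i", OF compression_zero fin])
  have Rfin: "stab_finite n (R i)" for i
    unfolding R_def by (rule stab_finite_stab_map[of "complement_hom (u i)", OF star_hom_zero[OF \<kappa>] sfin])
  have entC: "entry (C i) a b = Adjoin (compression i (entry p a b)) 0" for i a b
    by (simp add: C_def entry_stab_map[OF J] entry_stab_map_finite[of "compression i" n, OF compression_zero fin])
  have entR: "entry (R i) a b = complement_hom (u i) (scalar_part (entry p a b))" for i a b
    by (simp add: R_def s_def entry_stab_map[OF \<kappa>] entry_stab_map[OF sc])
  have QC: "Q \<simeq>[F] C"
    unfolding Q_def C_def by (rule asym_eq_bounded_linear[OF star_hom_bounded_linear[OF star_homomorphism_stab_map[OF J]] q(2)])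
  have BR: "R \<simeq>[F] R" by (rule asym_eq_refl[OF Bfun_projs[of R "\<lambda>_. stab_alg S1", OF Rp]])
  have uuy: "u i * (u i * z) = u i * z" for i z by (simp add: mult.assoc[symmetric] uproj)
  have ortho: "Adjoin (compression i b) 0 * complement_hom (u i) c = 0" "complement_hom (u i) c * Adjoin (compression i b) 0 = 0" for i b c
    by (simp_all add: complement_hom_def compression_def times_unitization_def zero_unitization_def ring_distribs
        mult.assoc uuy uproj cscale_mult_left cscale_mult_right cscale_cscale cscale_add_right cscale_minus_right mult.commute)
  have CR: "C i * R i = 0" "R i * C i = 0" for i
    by (rule stab_eqI; simp add: entry_mult_finite[OF disjI1[OF Cfin]] entry_mult_finite[OF disjI2[OF Cfin]] entC entR ortho)+
  have QR: "(\<lambda>i. Q i * R i) \<simeq>[F] (\<lambda>_. 0)" "(\<lambda>i. R i * Q i) \<simeq>[F] (\<lambda>_. 0)"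
    using asym_eq_mult[OF QC BR] asym_eq_mult[OF BR QC] by (simp_all add: CR)
  have sum: "(\<lambda>i. Q i + R i) \<simeq>[F] (\<lambda>_. p)"
  proof -
    have "(\<lambda>i. Q i + R i) \<simeq>[F] (\<lambda>i. C i + R i)" by (rule asym_eq_add[OF QC BR])
    also have "\<dots> \<simeq>[F] (\<lambda>_. p)"
    proof (rule asym_eq_matrices[of n])
      show "stab_finite n (C i + R i)" for i using Cfin[of i] Rfin[of i] by (auto simp: stab_finite_iff)
      fix a b
      define c where "c = entry p a b"
      have c: "alg_part c \<in> S" using projs_matrices_entry[OF p(1), of a b] by (simp add: c_def unitize_def)
      have "(\<lambda>i. u i * alg_part c * u i) \<simeq>[F] (\<lambda>i. alg_part c * u i)" by (intro asym_eq_mult uu c Bu)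
      also have "\<dots> \<simeq>[F] (\<lambda>_. alg_part c)" by (rule uu'[OF c])
      finally have lim: "(\<lambda>i. u i * alg_part c * u i) \<simeq>[F] (\<lambda>_. alg_part c)" .
      have "(\<lambda>i. Adjoin (u i * alg_part c * u i) 0) \<simeq>[F] (\<lambda>_. Adjoin (alg_part c) 0)"
        by (rule asym_eq_bounded_linear[OF star_hom_bounded_linear[OF J] lim])
      from asym_eq_add[OF this asym_eq_const[of "Adjoin 0 (scalar_part c)"]]
      show "(\<lambda>i. entry (C i + R i) a b) \<simeq>[F] (\<lambda>i. entry p a b)"
        by (simp add: entC entR c_def[symmetric] compression_def complement_hom_def plus_unitization_def)
    qed (rule fin)
    finally show ?thesis .
  qed
  have orth: "(\<lambda>i. (if k then Q i else R i) * (if l then Q i else R i)) \<simeq>[F] (\<lambda>_. 0)" if "k \<noteq> l" for k l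
    using that QR by (cases k; cases l) simp_all
  have ev1: "\<forall>\<^sub>F i in F. (\<Otimes>\<^bsub>V S1\<^esub>k\<in>{True, False}. V_class S1 (if k then Q i else R i)) = V_class S1 p"
    by (rule V_class_sum_asym[OF S1 _ _ p(2) orth]) (use Qp Rp sum in \<open>simp_all\<close>)
  have ev2: "\<forall>\<^sub>F i in F. f i (V_class S1 p) = V_class S (q i)" by (rule induced_V_mapD[OF f p(1) qS q(2)])
  have eqR: "V_map S1 (complement_hom (u i)) (V_map UNIV scalar_part x) = V_class S1 (R i)" for i
    using V_map_class[OF sc _ C p(2)] V_map_class[OF \<kappa> \<kappa>S S1 s] by (simp add: p(3) s_def R_def)
  have eqQ: "j (V_class S (q i)) = V_class S1 (Q i)" for i
    unfolding Q_def by (rule V_map_class[OF J incl S1 qS])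
  from ev1 ev2 show ?thesis
    unfolding eqR unfolding p(3) by eventually_elim (simp add: eqQ V_class_in_carrier[OF Qp] V_class_in_carrier[OF Rp])
qed

text \<open>Equality in \<open>K\<^sub>0\<close> is witnessed by a summand \<open>z\<close> over the unitization; its compression \<open>f\<^sub>i (z)\<close> is a witness
  over \<open>A\<close>, since the compression fixes the classes that come from \<open>A\<close>.\<close>

lemma K0_diff_eq_iff:
  assumes c: "x \<in> carrier (V S)" "y \<in> carrier (V S)" "x' \<in> carrier (V S)" "y' \<in> carrier (V S)"
  shows "K0_diff S x y = K0_diff S x' y' \<longleftrightarrow>
    (\<exists>z\<in>carrier (V S). x \<otimes>\<^bsub>V S\<^esub> y' \<otimes>\<^bsub>V S\<^esub> z = x' \<otimes>\<^bsub>V S\<^esub> y \<otimes>\<^bsub>V S\<^esub> z)"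
proof -
  interpret V0: comm_monoid "V S" by (rule comm_monoid_V[OF S])
  interpret V1: comm_monoid "V S1" by (rule comm_monoid_V[OF S1])
  have iff: "K0_diff S x y = K0_diff S x' y' \<longleftrightarrow>
    (\<exists>z\<in>carrier (V S1). j (x \<otimes>\<^bsub>V S\<^esub> y') \<otimes>\<^bsub>V S1\<^esub> z = j (x' \<otimes>\<^bsub>V S\<^esub> y) \<otimes>\<^bsub>V S1\<^esub> z)"
    unfolding K0_diff_def using c by (simp add: V1.groth_class_eq_iff j_closed j_mult)
  show ?thesis
  proof
    assume "K0_diff S x y = K0_diff S x' y'"
    then obtain z where z: "z \<in> carrier (V S1)" "j (x \<otimes>\<^bsub>V S\<^esub> y') \<otimes>\<^bsub>V S1\<^esub> z = j (x' \<otimes>\<^bsub>V S\<^esub> y) \<otimes>\<^bsub>V S1\<^esub> z"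
      using iff by blast
    obtain f where f: "induced_V_map F S1 S compression f"
      using induced_V_map_exists[OF S1 S compression_asymptotic_morphism] by blast
    have a: "x \<otimes>\<^bsub>V S\<^esub> y' \<in> carrier (V S)" and b: "x' \<otimes>\<^bsub>V S\<^esub> y \<in> carrier (V S)" using c by simp_all
    note add = induced_V_map_add[OF S1 S compression_asymptotic_morphism f j_closed z(1)]
    have "\<forall>\<^sub>F i in F. x \<otimes>\<^bsub>V S\<^esub> y' \<otimes>\<^bsub>V S\<^esub> f i z = x' \<otimes>\<^bsub>V S\<^esub> y \<otimes>\<^bsub>V S\<^esub> f i z"
      using add[OF a] add[OF b] compression_on_ideal[OF f a] compression_on_ideal[OF f b]
      by eventually_elim (simp add: z(2))
    then obtain i where "x \<otimes>\<^bsub>V S\<^esub> y' \<otimes>\<^bsub>V S\<^esub> f i z = x' \<otimes>\<^bsub>V S\<^esub> y \<otimes>\<^bsub>V S\<^esub> f i z"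
      using F0 eventually_happens' by blast
    then show "\<exists>z\<in>carrier (V S). x \<otimes>\<^bsub>V S\<^esub> y' \<otimes>\<^bsub>V S\<^esub> z = x' \<otimes>\<^bsub>V S\<^esub> y \<otimes>\<^bsub>V S\<^esub> z"
      using induced_V_map_closed[OF f z(1)] by blast
  next
    assume "\<exists>z\<in>carrier (V S). x \<otimes>\<^bsub>V S\<^esub> y' \<otimes>\<^bsub>V S\<^esub> z = x' \<otimes>\<^bsub>V S\<^esub> y \<otimes>\<^bsub>V S\<^esub> z"
    then obtain z where z: "z \<in> carrier (V S)" "x \<otimes>\<^bsub>V S\<^esub> y' \<otimes>\<^bsub>V S\<^esub> z = x' \<otimes>\<^bsub>V S\<^esub> y \<otimes>\<^bsub>V S\<^esub> z" by blast
    have "j (x \<otimes>\<^bsub>V S\<^esub> y' \<otimes>\<^bsub>V S\<^esub> z) = j (x' \<otimes>\<^bsub>V S\<^esub> y \<otimes>\<^bsub>V S\<^esub> z)" by (simp only: z(2))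
    then show "K0_diff S x y = K0_diff S x' y'"
      unfolding iff using c z(1) j_closed[OF z(1)] by (auto simp: j_mult intro!: bexI[of _ "j z"])
  qed
qed

lemma V_map_scalar_part_ideal: "x \<in> carrier (V S) \<Longrightarrow> V_map UNIV scalar_part (j x) = \<one>\<^bsub>V (UNIV :: complex set)\<^esub>"
proof -
  assume x: "x \<in> carrier (V S)"
  obtain p where p: "p \<in> projs (stab_alg S)" "x = V_class S p" using x by (auto simp: carrier_V)
  note J = star_homomorphism_Adjoin_0 and sc = star_homomorphism_scalar_part
  have "stab_map scalar_part (stab_map (\<lambda>a. Adjoin a 0) p) = 0"
    by (rule stab_eqI) (simp add: entry_stab_map[OF J] entry_stab_map[OF sc])
  then show ?thesis
    using V_map_class[OF J incl S1 p(1)] V_map_class[OF sc _ C stab_map_projs[OF J incl p(1)]] by (simp add: p(2) one_V)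
qed

text \<open>Projections over the unitization split, along \<open>u\<close>, into a part over \<open>A\<close> and the tensor product of \<open>1 - u\<close> with
  their scalar part.  If \<open>p\<close> and \<open>q\<close> have equivalent scalar parts, then the latter cancel in \<open>[p] - [q]\<close>.\<close>

lemma carrier_K0: "carrier (K0 S) = {K0_diff S x y |x y. x \<in> carrier (V S) \<and> y \<in> carrier (V S)}"
proof -
  interpret V1: comm_monoid "V S1" by (rule comm_monoid_V[OF S1])
  interpret VC: comm_monoid "V (UNIV :: complex set)" by (rule comm_monoid_V[OF C])
  note sc = star_homomorphism_scalar_part
  have sch: "V_map UNIV scalar_part \<in> hom (V S1) (V (UNIV :: complex set))"
    by (rule V_map_hom[OF sc _ S1 C]) simp
  note gm = grothendieck_map_class[OF comm_monoid_V[OF S1] comm_monoid_V[OF C] sch]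
  show ?thesis
  proof (intro equalityI subsetI)
    fix X assume "X \<in> {K0_diff S x y |x y. x \<in> carrier (V S) \<and> y \<in> carrier (V S)}"
    then obtain x y where xy: "X = K0_diff S x y" "x \<in> carrier (V S)" "y \<in> carrier (V S)" by blast
    then show "X \<in> carrier (K0 S)"
      using j_closed by (auto simp: K0_def K0_diff_def V1.carrier_grothendieck gm V_map_scalar_part_ideal VC.one_grothendieck)
  next
    fix X assume "X \<in> carrier (K0 S)"
    then obtain x y where xy: "x \<in> carrier (V S1)" "y \<in> carrier (V S1)" "X = groth_class (V S1) x y"
      and ker: "grothendieck_map (V (UNIV :: complex set)) (V_map UNIV scalar_part) X = \<one>\<^bsub>grothendieck (V (UNIV :: complex set))\<^esub>"
      by (auto simp: K0_def V1.carrier_grothendieck)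
    let ?sc = "V_map (UNIV :: complex set) scalar_part"
    have scc: "?sc x \<in> carrier (V UNIV)" "?sc y \<in> carrier (V UNIV)" using hom_in_carrier[OF sch] xy by auto
    have "groth_class (V UNIV) (?sc x) (?sc y) = groth_class (V UNIV) \<one>\<^bsub>V UNIV\<^esub> \<one>\<^bsub>V UNIV\<^esub>"
      using ker gm[OF xy(1,2)] by (simp add: xy(3) VC.one_grothendieck)
    then obtain z where z: "z \<in> carrier (V (UNIV :: complex set))"
      "?sc x \<otimes>\<^bsub>V UNIV\<^esub> z = ?sc y \<otimes>\<^bsub>V UNIV\<^esub> z"
      using scc by (auto simp: VC.groth_class_eq_iff)
    have L: "star_homomorphism (\<lambda>c. Adjoin (0::'a) c)"
      by (simp add: star_homomorphism_def unitization_defs star_unitization_def cscale_unitization_def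
          star_complex_def cscale_complex_def)
    have LS: "(\<lambda>c. Adjoin (0::'a) c) ` UNIV \<subseteq> S1" by (auto simp: unitize_def subalgebra_zero[OF S])
    \<comment> \<open>Adding the scalar projection \<open>z\<close> to both sides makes the scalar parts equivalent.\<close>
    define w where "w = V_map S1 (\<lambda>c. Adjoin (0::'a) c) z"
    have w: "w \<in> carrier (V S1)" unfolding w_def by (rule V_map_closed[OF L LS C S1 z(1)])
    have scw: "?sc w = z"
      unfolding w_def using V_map_comp[OF L LS sc _ S1 C z(1)] V_map_ident[OF C z(1)] by simp
    define x' y' where "x' = x \<otimes>\<^bsub>V S1\<^esub> w" and "y' = y \<otimes>\<^bsub>V S1\<^esub> w"
    have x'y': "x' \<in> carrier (V S1)" "y' \<in> carrier (V S1)" using xy w by (simp_all add: x'_def y'_def)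
    have eq: "?sc x' = ?sc y'" using xy w z(2) by (simp add: x'_def y'_def hom_mult[OF sch] scw)
    obtain f where f: "induced_V_map F S1 S compression f"
      using induced_V_map_exists[OF S1 S compression_asymptotic_morphism] by blast
    have "\<forall>\<^sub>F i in F. x' = j (f i x') \<otimes>\<^bsub>V S1\<^esub> V_map S1 (complement_hom (u i)) (?sc x') \<and>
        y' = j (f i y') \<otimes>\<^bsub>V S1\<^esub> V_map S1 (complement_hom (u i)) (?sc x')"
      using unitization_class_split[OF f x'y'(1)] unitization_class_split[OF f x'y'(2)]
      by eventually_elim (simp add: eq)
    then obtain i where i: "x' = j (f i x') \<otimes>\<^bsub>V S1\<^esub> V_map S1 (complement_hom (u i)) (?sc x')"
        "y' = j (f i y') \<otimes>\<^bsub>V S1\<^esub> V_map S1 (complement_hom (u i)) (?sc x')"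
      using F0 eventually_happens' by blast
    have \<kappa>: "star_homomorphism (complement_hom (u i))"
      by (rule star_homomorphism_complement) (simp add: projection_def uproj)
    have \<kappa>S: "complement_hom (u i) ` UNIV \<subseteq> S1"
      using S uproj by (auto simp: complement_hom_def unitize_def subalgebra_minus subalgebra_cscale)
    have k: "V_map S1 (complement_hom (u i)) (?sc x') \<in> carrier (V S1)"
      by (rule V_map_closed[OF \<kappa> \<kappa>S C S1 hom_in_carrier[OF sch x'y'(1)]])
    note fx = induced_V_map_closed[OF f x'y'(1), of i] and fy = induced_V_map_closed[OF f x'y'(2), of i]
    have "X = groth_class (V S1) x' y'"
      unfolding xy(3) x'_def y'_def by (rule V1.groth_class_absorb[OF xy(1,2) w, symmetric])
    also have "\<dots> = K0_diff S (f i x') (f i y')"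
      unfolding K0_diff_def
      using V1.groth_class_absorb[OF j_closed[OF fx] j_closed[OF fy] k] i by simp
    finally show "X \<in> {K0_diff S x y |x y. x \<in> carrier (V S) \<and> y \<in> carrier (V S)}" using fx fy by blast
  qed
qed

lemma K0_mult:
  assumes "x \<in> carrier (V S)" "y \<in> carrier (V S)" "x' \<in> carrier (V S)" "y' \<in> carrier (V S)"
  shows "K0_diff S x y \<otimes>\<^bsub>K0 S\<^esub> K0_diff S x' y' = K0_diff S (x \<otimes>\<^bsub>V S\<^esub> x') (y \<otimes>\<^bsub>V S\<^esub> y')"
proof -
  interpret V1: comm_monoid "V S1" by (rule comm_monoid_V[OF S1])
  show ?thesis using assms by (simp add: K0_def K0_diff_def V1.groth_mult j_closed j_mult)
qed

lemma K0_le_iff: "X \<preceq>\<^bsub>K0 S\<^esub> Y \<longleftrightarrow> (\<exists>z\<in>carrier (V S). Y = X \<otimes>\<^bsub>K0 S\<^esub> K0_diff S z \<one>\<^bsub>V S\<^esub>)"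
  by (simp add: K0_def K0_diff_def V_to_K0_def j_one)

lemma one_K0: "\<one>\<^bsub>K0 S\<^esub> = K0_diff S \<one>\<^bsub>V S\<^esub> \<one>\<^bsub>V S\<^esub>"
  by (simp add: K0_def K0_diff_def j_one grothendieck_def)

lemma comm_monoid_K0: "comm_monoid (K0 S)"
proof -
  interpret V0: comm_monoid "V S" by (rule comm_monoid_V[OF S])
  show ?thesis
  proof (rule comm_monoidI)
    fix X Y Z
    assume "X \<in> carrier (K0 S)" "Y \<in> carrier (K0 S)"
    then obtain x y x' y' where c: "X = K0_diff S x y" "Y = K0_diff S x' y'"
      "x \<in> carrier (V S)" "y \<in> carrier (V S)" "x' \<in> carrier (V S)" "y' \<in> carrier (V S)"
      by (auto simp: carrier_K0)
    show "X \<otimes>\<^bsub>K0 S\<^esub> Y \<in> carrier (K0 S)" using c by (auto simp: K0_mult carrier_K0 intro!: exI)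
    show "X \<otimes>\<^bsub>K0 S\<^esub> Y = Y \<otimes>\<^bsub>K0 S\<^esub> X" using c by (simp add: K0_mult V0.m_comm)
    assume "Z \<in> carrier (K0 S)"
    then obtain x'' y'' where c': "Z = K0_diff S x'' y''" "x'' \<in> carrier (V S)" "y'' \<in> carrier (V S)"
      by (auto simp: carrier_K0)
    show "X \<otimes>\<^bsub>K0 S\<^esub> Y \<otimes>\<^bsub>K0 S\<^esub> Z = X \<otimes>\<^bsub>K0 S\<^esub> (Y \<otimes>\<^bsub>K0 S\<^esub> Z)" using c c' by (simp add: K0_mult V0.m_assoc)
  next
    show "\<one>\<^bsub>K0 S\<^esub> \<in> carrier (K0 S)" by (auto simp: one_K0 carrier_K0)
    fix X assume "X \<in> carrier (K0 S)"
    then obtain x y where "X = K0_diff S x y" "x \<in> carrier (V S)" "y \<in> carrier (V S)" by (auto simp: carrier_K0)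
    then show "\<one>\<^bsub>K0 S\<^esub> \<otimes>\<^bsub>K0 S\<^esub> X = X" by (simp add: one_K0 K0_mult)
  qed
qed

lemma K0_finprod:
  assumes I: "finite I" and c: "\<And>k. k \<in> I \<Longrightarrow> x k \<in> carrier (V S)" "\<And>k. k \<in> I \<Longrightarrow> y k \<in> carrier (V S)"
  shows "(\<Otimes>\<^bsub>K0 S\<^esub>k\<in>I. K0_diff S (x k) (y k)) = K0_diff S (\<Otimes>\<^bsub>V S\<^esub>k\<in>I. x k) (\<Otimes>\<^bsub>V S\<^esub>k\<in>I. y k)"
proof -
  interpret V0: comm_monoid "V S" by (rule comm_monoid_V[OF S])
  interpret K: comm_monoid "K0 S" by (rule comm_monoid_K0)
  show ?thesis using I c
  proof (induction I)
    case empty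
    then show ?case by (simp add: one_K0)
  next
    case (insert k I)
    have "K0_diff S (x l) (y l) \<in> carrier (K0 S)" if "l \<in> insert k I" for l
      using insert.prems that by (auto simp: carrier_K0)
    then show ?case
      using insert by (simp add: K.finprod_insert V0.finprod_insert Pi_def K0_mult V0.finprod_closed)
  qed
qed

end

lemma K0_map_diff:
  assumes f: "star_homomorphism f" "f ` S \<subseteq> T" and S: "cstar_subalgebra S" and T: "cstar_subalgebra T"
    and c: "x \<in> carrier (V S)" "y \<in> carrier (V S)"
  shows "K0_map T f (K0_diff S x y) = K0_diff T (V_map T f x) (V_map T f y)"
proof -
  note J = star_homomorphism_Adjoin_0
  note S1 = cstar_subalgebra_unitize[OF S] and T1 = cstar_subalgebra_unitize[OF T]
  note um = star_homomorphism_unitize_map[OF f(1)] unitize_map_image[OF f(2)]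
  have SJ: "(\<lambda>a. Adjoin a 0) ` S \<subseteq> unitize S" and TJ: "(\<lambda>a. Adjoin a 0) ` T \<subseteq> unitize T"
    by (auto simp: unitize_def)
  have eq: "V_map (unitize T) (unitize_map f) (V_map (unitize S) (\<lambda>a. Adjoin a 0) z) =
      V_map (unitize T) (\<lambda>a. Adjoin a 0) (V_map T f z)" if z: "z \<in> carrier (V S)" for z
    using V_map_comp[OF J SJ um S1 T1 z] V_map_comp[OF f J TJ T T1 z] by (simp add: unitize_map_def)
  show ?thesis
    unfolding K0_map_def K0_diff_def
    using grothendieck_map_class[OF comm_monoid_V[OF S1] comm_monoid_V[OF T1] V_map_hom[OF um S1 T1]
        V_map_closed[OF J SJ S S1 c(1)] V_map_closed[OF J SJ S S1 c(2)]]
    by (simp add: eq c)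
qed


section \<open>The inclusion of the fixed point algebra\<close>

lemma V_map_finprod:
  assumes f: "star_homomorphism f" "f ` S \<subseteq> T" and S: "cstar_subalgebra S" and T: "cstar_subalgebra T"
    and I: "finite I" and x: "\<And>k. k \<in> I \<Longrightarrow> x k \<in> carrier (V S)"
  shows "V_map T f (\<Otimes>\<^bsub>V S\<^esub>k\<in>I. x k) = (\<Otimes>\<^bsub>V T\<^esub>k\<in>I. V_map T f (x k))"
proof -
  interpret VS: comm_monoid "V S" by (rule comm_monoid_V[OF S])
  interpret VT: comm_monoid "V T" by (rule comm_monoid_V[OF T])
  note closed = V_map_closed[OF f S T]
  show ?thesis using I x
  proof (induction I)
    case empty
    then show ?case by (simp add: V_map_one[OF f S T])
  next
    case (insert k I)
    then show ?case
      by (simp add: VS.finprod_insert VT.finprod_insert Pi_def V_map_mult[OF f S T] VS.finprod_closed closed)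
  qed
qed

context finite_action
begin

context
begin

private lemma S: "cstar_subalgebra fixed_points"
  by (rule cstar_subalgebra_fixed_points)

private lemma U: "cstar_subalgebra (UNIV :: 'a set)"
  by (rule cstar_subalgebra_UNIV)

private abbreviation "act g \<equiv> V_map (UNIV :: 'a set) (\<alpha> g)"
private abbreviation "incl \<equiv> V_map (UNIV :: 'a set) (\<lambda>a. a)"
private abbreviation "VS \<equiv> carrier (V fixed_points)"
private abbreviation "VU \<equiv> carrier (V (UNIV :: 'a set))"

private lemma fixed_UNIV: "(\<lambda>a. a) ` fixed_points \<subseteq> UNIV"
  by simp

private lemma incl_closed: "x \<in> VS \<Longrightarrow> incl x \<in> VU"
  by (rule V_map_closed[OF star_homomorphism_ident fixed_UNIV S U])

private lemma incl_mult: "x \<in> VS \<Longrightarrow> y \<in> VS \<Longrightarrow> incl (x \<otimes>\<^bsub>V fixed_points\<^esub> y) = incl x \<otimes>\<^bsub>V UNIV\<^esub> incl y"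
  by (rule V_map_mult[OF star_homomorphism_ident fixed_UNIV S U])

private lemma incl_one: "incl \<one>\<^bsub>V fixed_points\<^esub> = \<one>\<^bsub>V UNIV\<^esub>"
  by (rule V_map_one[OF star_homomorphism_ident fixed_UNIV S U])

private lemma act_closed: "g \<in> carrier G \<Longrightarrow> x \<in> VU \<Longrightarrow> act g x \<in> VU"
  by (rule V_map_closed[OF act_hom subset_UNIV U U])

private lemma act_V_mult: "g \<in> carrier G \<Longrightarrow> x \<in> VU \<Longrightarrow> y \<in> VU \<Longrightarrow>
    act g (x \<otimes>\<^bsub>V UNIV\<^esub> y) = act g x \<otimes>\<^bsub>V UNIV\<^esub> act g y"
  by (rule V_map_mult[OF act_hom subset_UNIV U U])

private lemma act_one_V: "x \<in> VU \<Longrightarrow> act \<one> x = x"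
  using V_map_cong[OF act_hom[OF one_closed] subset_UNIV star_homomorphism_ident act_one U, of x UNIV]
    V_map_ident[OF U, of x] by simp

definition orbit_sum :: "'a imat set \<Rightarrow> 'a imat set" where
  "orbit_sum x = (\<Otimes>\<^bsub>V UNIV\<^esub>g\<in>carrier G. V_map UNIV (\<alpha> g) x)"

lemma orbit_sum_split:
  assumes x: "x \<in> carrier (V UNIV)" and h: "h \<in> carrier G"
  obtains y where "y \<in> carrier (V UNIV)" "orbit_sum x = V_map UNIV (\<alpha> h) x \<otimes>\<^bsub>V UNIV\<^esub> y"
proof -
  interpret VU: comm_monoid "V (UNIV :: 'a set)" by (rule comm_monoid_V[OF U])
  have "orbit_sum x = (\<Otimes>\<^bsub>V UNIV\<^esub>g\<in>insert h (carrier G - {h}). act g x)"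
    using h by (simp add: orbit_sum_def insert_absorb)
  also have "\<dots> = act h x \<otimes>\<^bsub>V UNIV\<^esub> (\<Otimes>\<^bsub>V UNIV\<^esub>g\<in>carrier G - {h}. act g x)"
    using finite_carrier h by (intro VU.finprod_insert) (auto intro: act_closed x)
  finally show thesis by (intro that[OF VU.finprod_closed]) (auto intro: act_closed x)
qed

lemma orbit_sum_closed: "x \<in> carrier (V UNIV) \<Longrightarrow> orbit_sum x \<in> carrier (V UNIV)"
proof -
  assume x: "x \<in> carrier (V UNIV)"
  interpret VU: comm_monoid "V (UNIV :: 'a set)" by (rule comm_monoid_V[OF U])
  show ?thesis unfolding orbit_sum_def by (rule VU.finprod_closed) (auto intro: act_closed x)
qed

lemma act_orbit_sum:
  assumes x: "x \<in> carrier (V UNIV)" and h: "h \<in> carrier G"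
  shows "V_map UNIV (\<alpha> h) (orbit_sum x) = orbit_sum x"
proof -
  interpret VU: comm_monoid "V (UNIV :: 'a set)" by (rule comm_monoid_V[OF U])
  have comp: "act h (act g x) = act (h \<otimes> g) x" if g: "g \<in> carrier G" for g
  proof -
    have "\<alpha> (h \<otimes> g) = (\<lambda>a. \<alpha> h (\<alpha> g a))" by (rule ext) (rule act_mult[OF h g])
    then show ?thesis using V_map_comp[OF act_hom[OF g] subset_UNIV act_hom[OF h] subset_UNIV U U x] by simp
  qed
  have "act h (orbit_sum x) = (\<Otimes>\<^bsub>V UNIV\<^esub>g\<in>carrier G. act h (act g x))"
    unfolding orbit_sum_def
    by (rule V_map_finprod[OF act_hom[OF h] subset_UNIV U U finite_carrier act_closed[OF _ x]])
  also have "\<dots> = (\<Otimes>\<^bsub>V UNIV\<^esub>g\<in>carrier G. act (h \<otimes> g) x)"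
    by (rule VU.finprod_cong') (auto simp: comp h intro!: act_closed x)
  also have "\<dots> = (\<Otimes>\<^bsub>V UNIV\<^esub>g\<in>(\<otimes>) h ` carrier G. act g x)"
    by (rule VU.finprod_reindex[symmetric]) (auto simp: h inj_on_cmult intro!: act_closed x)
  also have "\<dots> = orbit_sum x" using surj_const_mult[OF h] by (simp add: orbit_sum_def)
  finally show ?thesis .
qed

context
  assumes rokhlin: "rokhlin_property G \<alpha>"
begin

text \<open>The maps induced by the averages are monotone on \<open>V(i) (s) \<le> V(i) (s')\<close> and return \<open>s\<close> and \<open>s'\<close>, eventually.\<close>

lemma inclusion_reflects_le:
  assumes s: "s \<in> carrier (V fixed_points)" "s' \<in> carrier (V fixed_points)"
    and le: "V_map UNIV (\<lambda>a. a) s \<preceq>\<^bsub>V UNIV\<^esub> V_map UNIV (\<lambda>a. a) s'"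
  shows "s \<preceq>\<^bsub>V fixed_points\<^esub> s'"
proof -
  obtain F where F: "F \<noteq> bot" "rokhlin_filter F" by (rule rokhlin_filter_exists[OF rokhlin])
  note \<theta> = rokhlin_average_asymptotic_morphism[OF F(2)]
  obtain f where f: "induced_V_map F UNIV fixed_points rokhlin_average f"
    using induced_V_map_exists[OF U S \<theta>] by blast
  have "\<forall>\<^sub>F r in F. s \<preceq>\<^bsub>V fixed_points\<^esub> s'"
    using induced_V_map_mono[OF U S \<theta> f incl_closed[OF s(1)] incl_closed[OF s(2)] le]
      induced_on_image[OF F(2) f s(1)] induced_on_image[OF F(2) f s(2)]
    by eventually_elim simp
  then show ?thesis using F(1) eventually_happens' by blast
qed

lemma fixed_class_in_image:
  assumes x: "x \<in> carrier (V UNIV)" and fixed: "\<And>g. g \<in> carrier G \<Longrightarrow> V_map UNIV (\<alpha> g) x = x"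
  obtains y where "y \<in> carrier (V fixed_points)" "V_map UNIV (\<lambda>a. a) y = x"
proof -
  obtain F where F: "F \<noteq> bot" "rokhlin_filter F" by (rule rokhlin_filter_exists[OF rokhlin])
  obtain f where f: "induced_V_map F UNIV fixed_points rokhlin_average f"
    using induced_V_map_exists[OF U S rokhlin_average_asymptotic_morphism[OF F(2)]] by blast
  obtain r where "V_map UNIV (\<lambda>a. a) (f r x) = x"
    using eventually_happens'[OF F(1) inclusion_of_induced_on_fixed[OF F(2) f x fixed]] by blast
  with induced_V_map_closed[OF f x] show thesis by (rule that)
qed

lemma orbit_sum_in_image:
  assumes x: "x \<in> carrier (V UNIV)"
  obtains y where "y \<in> carrier (V fixed_points)" "V_map UNIV (\<lambda>a. a) y = orbit_sum x"
  by (rule fixed_class_in_image[OF orbit_sum_closed[OF x] act_orbit_sum[OF x]], assumption, rule that)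

lemma image_is_orbit_sum:
  assumes "x \<in> carrier (V fixed_points)"
  obtains y where "y \<in> carrier (V UNIV)" "V_map UNIV (\<lambda>a. a) x = orbit_sum y"
proof -
  obtain F where F: "F \<noteq> bot" "rokhlin_filter F" by (rule rokhlin_filter_exists[OF rokhlin])
  show thesis using inclusion_is_orbit_sum[OF F(2) assms F(1)] that unfolding orbit_sum_def by blast
qed

lemma V_inclusion_order_embedding:
  "order_embedding (V fixed_points) (V UNIV) (V_map UNIV (\<lambda>a. a))"
  unfolding order_embedding_def
  using V_map_ordered_hom[OF star_homomorphism_ident fixed_UNIV S U] inclusion_reflects_le by simp

lemma V_inclusion_image:
  shows "V_map UNIV (\<lambda>a. a) ` carrier (V fixed_points) = orbit_sum ` carrier (V UNIV)"
    and "V_map UNIV (\<lambda>a. a) ` carrier (V fixed_points) =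
      {x \<in> carrier (V UNIV). \<forall>g\<in>carrier G. V_map UNIV (\<alpha> g) x = x}"
proof -
  have 1: "incl ` VS \<subseteq> orbit_sum ` VU"
  proof (rule image_subsetI)
    fix x assume "x \<in> VS"
    then obtain y where "y \<in> VU" "incl x = orbit_sum y" by (rule image_is_orbit_sum)
    then show "incl x \<in> orbit_sum ` VU" by simp
  qed
  have 2: "orbit_sum ` VU \<subseteq> {x \<in> VU. \<forall>g\<in>carrier G. act g x = x}"
    by (simp add: image_subset_iff orbit_sum_closed act_orbit_sum)
  have 3: "{x \<in> VU. \<forall>g\<in>carrier G. act g x = x} \<subseteq> incl ` VS"
  proof (rule subsetI)
    fix x assume "x \<in> {x \<in> VU. \<forall>g\<in>carrier G. act g x = x}"
    then have "x \<in> VU" "\<And>g. g \<in> carrier G \<Longrightarrow> act g x = x" by simp_all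
    then obtain y where "y \<in> VS" "incl y = x" by (rule fixed_class_in_image)
    then show "x \<in> incl ` VS" by (metis imageI)
  qed
  show "incl ` VS = orbit_sum ` VU" using 1 2 3 by (meson order_trans subset_antisym)
  show "incl ` VS = {x \<in> VU. \<forall>g\<in>carrier G. act g x = x}" using 1 2 3 by (meson order_trans subset_antisym)
qed

lemma projection_unit_of_filter:
  assumes F: "F \<noteq> bot" and M: "cstar_subalgebra M" and proj: "\<forall>\<^sub>F e in F. e \<in> projs M"
    and lim: "\<And>a. a \<in> M \<Longrightarrow> ((\<lambda>e. e * a) \<longlongrightarrow> a) F"
  shows "projection_unit F M (\<lambda>e. if e \<in> projs M then e else 0)"
  unfolding projection_unit_def
proof (intro conjI allI ballI)
  show "(if e \<in> projs M then e else 0) \<in> projs M" for e by (simp add: zero_in_projs[OF M])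
  fix a assume "a \<in> M"
  then have "Zfun (\<lambda>e. e * a - a) F" using lim by (simp add: tendsto_Zfun_iff)
  then have "(\<lambda>e. e * a) \<simeq>[F] (\<lambda>_. a)" by (simp add: asym_eq_def)
  then show "(\<lambda>e. (if e \<in> projs M then e else 0) * a) \<simeq>[F] (\<lambda>_. a)"
  proof (rule asym_eq_cong_left[rotated])
    show "\<forall>\<^sub>F e in F. (if e \<in> projs M then e else 0) * a = e * a" using proj by eventually_elim simp
  qed
qed (rule F)

text \<open>If \<open>e a\<close> is close to \<open>a\<close>, then so is \<open>\<theta> (e) a = \<theta> (e a)\<close> for the average \<open>\<theta>\<close> and fixed \<open>a\<close>; and \<open>\<theta> (e)\<close> is close
  to a projection in the fixed point algebra.\<close>

lemma fixed_approximate_projection: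
  fixes E :: "'a filter"
  assumes E: "E \<noteq> bot" "eventually projection E" "\<And>a. ((\<lambda>e. e * a) \<longlongrightarrow> a) E"
    and \<epsilon>: "\<epsilon> > 0" and K: "finite K" "K \<subseteq> fixed_points"
  shows "\<exists>p\<in>projs fixed_points. \<forall>a\<in>K. norm (p * a - a) < \<epsilon>"
proof -
  obtain F where F: "F \<noteq> bot" "rokhlin_filter F" by (rule rokhlin_filter_exists[OF rokhlin])
  note \<theta> = rokhlin_average_asymptotic_morphism[OF F(2)]
  let ?N = "real (card (carrier G))"
  have N: "?N > 0" using finite_carrier one_closed by (auto simp: card_gt_0_iff)
  \<comment> \<open>The average has norm at most \<open>N\<close> times that of its argument.\<close>
  define \<delta> where "\<delta> = \<epsilon> / (2 * ?N)"
  have "\<forall>\<^sub>F e in E. projection e \<and> (\<forall>a\<in>K. norm (e * a - a) < \<delta>)"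
    using E(2,3) \<epsilon> N K(1) by (intro eventually_conj eventually_ball_finite ballI)
      (auto simp: \<delta>_def tendsto_iff dist_norm)
  then obtain e where e: "projection e" "\<And>a. a \<in> K \<Longrightarrow> norm (e * a - a) < \<delta>"
    using eventually_happens'[OF E(1)] by blast
  have average_mult: "rokhlin_average r b * a = rokhlin_average r (b * a)" if "a \<in> fixed_points" for r a b
    unfolding rokhlin_average_def sum_distrib_right
    by (rule sum.cong) (simp_all add: mult.assoc star_hom_mult[OF act_hom] fixed_pointsD[OF that])
  have average_diff: "rokhlin_average r (a - b) = rokhlin_average r a - rokhlin_average r b" for r a b
    unfolding rokhlin_average_def sum_subtractf[symmetric]
    by (rule sum.cong) (simp_all add: right_diff_distrib bounded_linear.linear[OF star_hom_bounded_linear[OF act_hom]] linear_diff)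
  have ee: "star e = e" "e * e = e" using e(1) by (auto simp: projection_def)
  have sa: "(\<lambda>r. star (rokhlin_average r e)) \<simeq>[F] (\<lambda>r. rokhlin_average r e)"
    using asym_eq_sym[OF morphism_star[OF U S \<theta> UNIV_I, of e]] by (simp add: ee)
  have idem: "(\<lambda>r. rokhlin_average r e * rokhlin_average r e) \<simeq>[F] (\<lambda>r. rokhlin_average r e)"
    using asym_eq_sym[OF morphism_mult[OF U S \<theta> UNIV_I UNIV_I, of e e]] by (simp add: ee)
  obtain q where q: "\<And>r. q r \<in> projs fixed_points" "q \<simeq>[F] (\<lambda>r. rokhlin_average r e)"
    by (rule projection_near_asym[of "\<lambda>_. fixed_points" "\<lambda>r. rokhlin_average r e", OF S rokhlin_average_fixed sa idem])
      (rule that)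
  have small: "norm (rokhlin_average r b) \<le> ?N * norm b" if "norm (r \<one>) \<le> 1" for r b
  proof -
    have "norm (rokhlin_average r b) \<le> (\<Sum>g\<in>carrier G. norm b)"
      unfolding rokhlin_average_def
    proof (rule sum_norm_le)
      fix g assume g: "g \<in> carrier G"
      have "norm (\<alpha> g (r \<one> * b)) \<le> norm (r \<one>) * norm b"
        using star_hom_norm_le[OF act_hom[OF g], of "r \<one> * b"] norm_mult_ineq[of "r \<one>" b] by simp
      also have "\<dots> \<le> 1 * norm b" by (intro mult_right_mono that) simp
      finally show "norm (\<alpha> g (r \<one> * b)) \<le> norm b" by simp
    qed
    then show ?thesis by simp
  qed
  have near: "\<forall>\<^sub>F r in F. norm (q r * a - a) < \<epsilon>" if a: "a \<in> K" for a
  proof -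
    have af: "a \<in> fixed_points" using a K(2) by blast
    have "(\<lambda>r. q r * a) \<simeq>[F] (\<lambda>r. rokhlin_average r e * a)" by (intro asym_eq_mult q(2) asym_eq_const)
    then have "(\<lambda>r. q r * a - rokhlin_average r a) \<simeq>[F] (\<lambda>r. rokhlin_average r (e * a) - rokhlin_average r a)"
      unfolding average_mult[OF af]
      by (intro asym_eq_diff asym_eq_refl asym_eq_Bfun_left[OF rokhlin_average_on_fixed[OF F(2) af]])
    from asym_eq_eventually[OF this, of "\<epsilon> / 4"] asym_eq_eventually[OF rokhlin_average_on_fixed[OF F(2) af], of "\<epsilon> / 4"]
    have 1: "\<forall>\<^sub>F r in F. norm (q r * a - rokhlin_average r a - rokhlin_average r (e * a - a)) < \<epsilon> / 4"
      and 2: "\<forall>\<^sub>F r in F. norm (rokhlin_average r a - a) < \<epsilon> / 4"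
      using \<epsilon> by (simp_all add: average_diff)
    have 3: "\<forall>\<^sub>F r in F. norm (r \<one>) \<le> 1" using F(2) by (simp add: rokhlin_filter_def)
    show ?thesis using 1 2 3
    proof eventually_elim
      case (elim r)
      let ?x = "q r * a - rokhlin_average r a - rokhlin_average r (e * a - a)" and ?y = "rokhlin_average r (e * a - a)"
      have "norm ?y \<le> ?N * norm (e * a - a)" by (rule small, rule elim(3))
      also have "\<dots> \<le> ?N * \<delta>" using e(2)[OF a] by (intro mult_left_mono) simp_all
      also have "\<dots> = \<epsilon> / 2" using N by (simp add: \<delta>_def)
      finally have y: "norm ?y \<le> \<epsilon> / 2" .
      have "norm (?x + ?y + (rokhlin_average r a - a)) \<le> norm ?x + norm ?y + norm (rokhlin_average r a - a)"
        by (intro norm_triangle_mono order_refl)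
      then have "norm (q r * a - a) \<le> norm ?x + norm ?y + norm (rokhlin_average r a - a)" by simp
      then show ?case using elim(1,2) y by linarith
    qed
  qed
  have "\<forall>\<^sub>F r in F. \<forall>a\<in>K. norm (q r * a - a) < \<epsilon>" by (rule eventually_ball_finite[OF K(1)], rule ballI, rule near)
  then obtain r where "\<forall>a\<in>K. norm (q r * a - a) < \<epsilon>" using eventually_happens'[OF F(1)] by blast
  then show ?thesis using q(1) by blast
qed

lemma projection_units_exist:
  assumes "has_approximate_identity_of_projections TYPE('a)"
  obtains E u F v where "projection_unit E (UNIV :: 'a set) (u :: 'a \<Rightarrow> 'a)"
    "projection_unit F fixed_points (v :: 'a \<Rightarrow> 'a)"
proof -
  obtain E :: "'a filter" where E: "E \<noteq> bot" "eventually projection E" "\<And>a. ((\<lambda>e. e * a) \<longlongrightarrow> a) E"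
    using assms unfolding has_approximate_identity_of_projections_def by blast
  have projs: "\<forall>\<^sub>F e in E. e \<in> projs UNIV" using E(2) by (simp add: projs_def)
  define P where "P \<epsilon> K p \<longleftrightarrow> p \<in> projs fixed_points \<and> (\<forall>a\<in>K. norm (p * a - a) < \<epsilon>)" for \<epsilon> K p
  obtain F where F: "F \<noteq> bot" "\<And>\<epsilon> K. \<epsilon> > 0 \<Longrightarrow> finite K \<Longrightarrow> K \<subseteq> fixed_points \<Longrightarrow> eventually (P \<epsilon> K) F"
  proof (rule approximation_filter[of P fixed_points])
    show "P \<epsilon>' K' p" if "P \<epsilon> K p" "\<epsilon> \<le> \<epsilon>'" "K' \<subseteq> K" for \<epsilon> \<epsilon>' K K' p
      using that unfolding P_def by (meson order_less_le_trans subsetD)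
    show "\<exists>p. P \<epsilon> K p" if "\<epsilon> > 0" "finite K" "K \<subseteq> fixed_points" for \<epsilon> K
      using fixed_approximate_projection[OF E that] unfolding P_def by blast
  qed (rule that, assumption, blast)
  have "\<forall>\<^sub>F p in F. p \<in> projs fixed_points"
    using F(2)[of 1 "{}"] by (auto elim!: eventually_mono simp: P_def)
  moreover have "((\<lambda>p. p * a) \<longlongrightarrow> a) F" if a: "a \<in> fixed_points" for a
    unfolding tendsto_iff dist_norm
  proof (intro allI impI)
    fix \<epsilon> :: real assume "\<epsilon> > 0"
    then show "\<forall>\<^sub>F p in F. norm (p * a - a) < \<epsilon>"
      using F(2)[of \<epsilon> "{a}"] a by (auto elim!: eventually_mono simp: P_def)
  qed
  ultimately have v: "projection_unit F fixed_points (\<lambda>e. if e \<in> projs fixed_points then e else 0)"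
    by (rule projection_unit_of_filter[OF F(1) S])
  show thesis by (rule that[OF projection_unit_of_filter[OF E(1) U projs E(3)] v])
qed

context
  fixes E F :: "'a filter" and u v :: "'a \<Rightarrow> 'a"
  assumes u: "projection_unit E (UNIV :: 'a set) u" and v: "projection_unit F fixed_points v"
begin

private lemma K0_incl: "x \<in> VS \<Longrightarrow> y \<in> VS \<Longrightarrow>
    K0_map UNIV (\<lambda>a. a) (K0_diff fixed_points x y) = K0_diff UNIV (incl x) (incl y)"
  by (rule K0_map_diff[OF star_homomorphism_ident fixed_UNIV S U])

private lemma K0_act: "g \<in> carrier G \<Longrightarrow> x \<in> VU \<Longrightarrow> y \<in> VU \<Longrightarrow>
    K0_map UNIV (\<alpha> g) (K0_diff UNIV x y) = K0_diff UNIV (act g x) (act g y)"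
  by (rule K0_map_diff[OF act_hom subset_UNIV U U])

private lemma K0_fixed_cases:
  assumes "X \<in> carrier (K0 fixed_points)"
  obtains x y where "x \<in> VS" "y \<in> VS" "X = K0_diff fixed_points x y"
proof -
  have "X \<in> {K0_diff fixed_points x y |x y. x \<in> VS \<and> y \<in> VS}" using assms by (simp only: carrier_K0[OF S v])
  then show thesis using that by blast
qed

private lemma K0_UNIV_cases:
  assumes "X \<in> carrier (K0 (UNIV :: 'a set))"
  obtains x y where "x \<in> VU" "y \<in> VU" "X = K0_diff UNIV x y"
proof -
  have "X \<in> {K0_diff UNIV x y |x y. x \<in> VU \<and> y \<in> VU}" using assms by (simp only: carrier_K0[OF U u])
  then show thesis using that by blast
qed

private lemma K0_incl_closed: "X \<in> carrier (K0 fixed_points) \<Longrightarrow> K0_map UNIV (\<lambda>a. a) X \<in> carrier (K0 UNIV)"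
  unfolding carrier_K0[OF S v] carrier_K0[OF U u] using K0_incl incl_closed by blast

private lemma K0_incl_mult:
  assumes "X \<in> carrier (K0 fixed_points)" "Y \<in> carrier (K0 fixed_points)"
  shows "K0_map UNIV (\<lambda>a. a) (X \<otimes>\<^bsub>K0 fixed_points\<^esub> Y) =
    K0_map UNIV (\<lambda>a. a) X \<otimes>\<^bsub>K0 UNIV\<^esub> K0_map UNIV (\<lambda>a. a) Y"
proof -
  interpret V0: comm_monoid "V fixed_points" by (rule comm_monoid_V[OF S])
  obtain x y where x: "x \<in> VS" "y \<in> VS" "X = K0_diff fixed_points x y" by (rule K0_fixed_cases[OF assms(1)])
  obtain x' y' where x': "x' \<in> VS" "y' \<in> VS" "Y = K0_diff fixed_points x' y'" by (rule K0_fixed_cases[OF assms(2)])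
  note c = x(1,2) x'(1,2) and XY = x(3) x'(3)
  show ?thesis
    using c by (simp add: XY K0_mult[OF S v] K0_mult[OF U u] K0_incl incl_closed incl_mult)
qed

text \<open>If \<open>Y - X = [p]\<close> in \<open>K\<^sub>0(A)\<close>, then the corresponding equation in \<open>V(A)\<close> holds after a summand \<open>z\<close> is added.
  With \<open>z\<close> enlarged to its orbit sum, which is \<open>V(i) (t)\<close> for some \<open>t\<close>, it becomes an inequality between elements
  of the image of \<open>V(i)\<close>, and \<open>V(i)\<close> reflects the order.\<close>

lemma K0_inclusion_reflects_le:
  assumes X: "X \<in> carrier (K0 fixed_points)" and Y: "Y \<in> carrier (K0 fixed_points)"
    and le: "K0_map UNIV (\<lambda>a. a) X \<preceq>\<^bsub>K0 UNIV\<^esub> K0_map UNIV (\<lambda>a. a) Y"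
  shows "X \<preceq>\<^bsub>K0 fixed_points\<^esub> Y"
proof -
  interpret V0: comm_monoid "V fixed_points" by (rule comm_monoid_V[OF S])
  interpret V1: comm_monoid "V (UNIV :: 'a set)" by (rule comm_monoid_V[OF U])
  obtain x y where x: "x \<in> VS" "y \<in> VS" "X = K0_diff fixed_points x y" by (rule K0_fixed_cases[OF X])
  obtain x' y' where x': "x' \<in> VS" "y' \<in> VS" "Y = K0_diff fixed_points x' y'" by (rule K0_fixed_cases[OF Y])
  note c = x(1,2) x'(1,2) and XY = x(3) x'(3)
  note ic = incl_closed[OF c(1)] incl_closed[OF c(2)] incl_closed[OF c(3)] incl_closed[OF c(4)]
  obtain p where p: "p \<in> VU" and
    "K0_diff UNIV (incl x') (incl y') = K0_diff UNIV (incl x) (incl y) \<otimes>\<^bsub>K0 UNIV\<^esub> K0_diff UNIV p \<one>\<^bsub>V UNIV\<^esub>"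
    using le c unfolding XY K0_le_iff[OF U u] by (auto simp: K0_incl)
  then have "K0_diff UNIV (incl x') (incl y') = K0_diff UNIV (incl x \<otimes>\<^bsub>V UNIV\<^esub> p) (incl y)"
    using ic by (simp add: K0_mult[OF U u])
  then obtain z where z: "z \<in> VU" and
    eq: "incl x' \<otimes>\<^bsub>V UNIV\<^esub> incl y \<otimes>\<^bsub>V UNIV\<^esub> z = incl x \<otimes>\<^bsub>V UNIV\<^esub> p \<otimes>\<^bsub>V UNIV\<^esub> incl y' \<otimes>\<^bsub>V UNIV\<^esub> z"
    using ic p by (subst (asm) K0_diff_eq_iff[OF U u]) (auto)
  obtain t where t: "t \<in> VS" "incl t = orbit_sum z" by (rule orbit_sum_in_image[OF z])
  obtain w where w: "w \<in> VU" "orbit_sum z = act \<one> z \<otimes>\<^bsub>V UNIV\<^esub> w" by (rule orbit_sum_split[OF z one_closed])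
  have tz: "incl t = z \<otimes>\<^bsub>V UNIV\<^esub> w" using w(2) by (simp add: t(2) act_one_V z)
  have "incl (x' \<otimes>\<^bsub>V fixed_points\<^esub> y \<otimes>\<^bsub>V fixed_points\<^esub> t) =
      (incl x' \<otimes>\<^bsub>V UNIV\<^esub> incl y \<otimes>\<^bsub>V UNIV\<^esub> z) \<otimes>\<^bsub>V UNIV\<^esub> w"
    using c t(1) ic z w(1) by (simp add: incl_mult tz V1.m_assoc)
  also have "\<dots> = incl (x \<otimes>\<^bsub>V fixed_points\<^esub> y' \<otimes>\<^bsub>V fixed_points\<^esub> t) \<otimes>\<^bsub>V UNIV\<^esub> p"
    unfolding eq using c t(1) ic z w(1) p by (simp add: incl_mult tz V1.m_ac)
  finally have "incl (x \<otimes>\<^bsub>V fixed_points\<^esub> y' \<otimes>\<^bsub>V fixed_points\<^esub> t) \<preceq>\<^bsub>V UNIV\<^esub> incl (x' \<otimes>\<^bsub>V fixed_points\<^esub> y \<otimes>\<^bsub>V fixed_points\<^esub> t)"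
    using p c t(1) by (subst V_le_iff[OF U]) (auto intro!: incl_closed)
  then have "x \<otimes>\<^bsub>V fixed_points\<^esub> y' \<otimes>\<^bsub>V fixed_points\<^esub> t \<preceq>\<^bsub>V fixed_points\<^esub> x' \<otimes>\<^bsub>V fixed_points\<^esub> y \<otimes>\<^bsub>V fixed_points\<^esub> t"
    using c t(1) by (intro inclusion_reflects_le) simp_all
  then obtain p' where p': "p' \<in> VS" "x' \<otimes>\<^bsub>V fixed_points\<^esub> y \<otimes>\<^bsub>V fixed_points\<^esub> t =
      x \<otimes>\<^bsub>V fixed_points\<^esub> y' \<otimes>\<^bsub>V fixed_points\<^esub> t \<otimes>\<^bsub>V fixed_points\<^esub> p'"
    using c t(1) by (subst (asm) V_le_iff[OF S]) auto
  have "Y = K0_diff fixed_points (x \<otimes>\<^bsub>V fixed_points\<^esub> p') y"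
    unfolding XY
  proof (subst K0_diff_eq_iff[OF S v])
    have "x' \<otimes>\<^bsub>V fixed_points\<^esub> y \<otimes>\<^bsub>V fixed_points\<^esub> t = x \<otimes>\<^bsub>V fixed_points\<^esub> p' \<otimes>\<^bsub>V fixed_points\<^esub> y' \<otimes>\<^bsub>V fixed_points\<^esub> t"
      unfolding p'(2) using c t(1) p'(1) by (simp add: V0.m_ac)
    then show "\<exists>z\<in>VS. x' \<otimes>\<^bsub>V fixed_points\<^esub> y \<otimes>\<^bsub>V fixed_points\<^esub> z =
        x \<otimes>\<^bsub>V fixed_points\<^esub> p' \<otimes>\<^bsub>V fixed_points\<^esub> y' \<otimes>\<^bsub>V fixed_points\<^esub> z"
      using t(1) by blast
  qed (use c p'(1) in simp_all)
  also have "\<dots> = X \<otimes>\<^bsub>K0 fixed_points\<^esub> K0_diff fixed_points p' \<one>\<^bsub>V fixed_points\<^esub>"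
    unfolding XY using c p'(1) by (simp add: K0_mult[OF S v])
  finally show ?thesis unfolding K0_le_iff[OF S v] using p'(1) by blast
qed

lemma K0_inclusion_order_embedding:
  "order_embedding (K0 fixed_points) (K0 UNIV) (K0_map UNIV (\<lambda>a. a))"
proof -
  interpret V0: comm_monoid "V fixed_points" by (rule comm_monoid_V[OF S])
  interpret V1: comm_monoid "V (UNIV :: 'a set)" by (rule comm_monoid_V[OF U])
  have "K0_map UNIV (\<lambda>a. a) X \<preceq>\<^bsub>K0 UNIV\<^esub> K0_map UNIV (\<lambda>a. a) Y"
    if X: "X \<in> carrier (K0 fixed_points)" and le: "X \<preceq>\<^bsub>K0 fixed_points\<^esub> Y" for X Y
  proof -
    obtain z where z: "z \<in> VS" "Y = X \<otimes>\<^bsub>K0 fixed_points\<^esub> K0_diff fixed_points z \<one>\<^bsub>V fixed_points\<^esub>"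
      using le unfolding K0_le_iff[OF S v] by blast
    have "K0_diff fixed_points z \<one>\<^bsub>V fixed_points\<^esub> \<in> carrier (K0 fixed_points)"
      unfolding carrier_K0[OF S v] using z(1) by blast
    then have "K0_map UNIV (\<lambda>a. a) Y = K0_map UNIV (\<lambda>a. a) X \<otimes>\<^bsub>K0 UNIV\<^esub> K0_diff UNIV (incl z) \<one>\<^bsub>V UNIV\<^esub>"
      unfolding z(2) by (simp add: K0_incl_mult[OF X] K0_incl z(1) incl_one)
    then show ?thesis unfolding K0_le_iff[OF U u] using incl_closed[OF z(1)] by blast
  qed
  then show ?thesis
    unfolding order_embedding_def ordered_hom_def hom_def
    using K0_incl_closed K0_incl_mult K0_inclusion_reflects_le by simp
qed

text \<open>Each \<open>g\<close> comes with its own summand \<open>z\<^sub>g\<close>; the orbit sum of \<open>\<Sum>\<^sub>g z\<^sub>g\<close> contains all of them and is fixed.\<close>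

lemma fixed_K0_common_summand:
  assumes x: "x \<in> carrier (V UNIV)" and y: "y \<in> carrier (V UNIV)"
    and fixed: "\<And>g. g \<in> carrier G \<Longrightarrow> K0_map UNIV (\<alpha> g) (K0_diff UNIV x y) = K0_diff UNIV x y"
  obtains z where "z \<in> carrier (V UNIV)" "\<forall>g\<in>carrier G. V_map UNIV (\<alpha> g) z = z"
    "\<forall>g\<in>carrier G. V_map UNIV (\<alpha> g) x \<otimes>\<^bsub>V UNIV\<^esub> y \<otimes>\<^bsub>V UNIV\<^esub> z = x \<otimes>\<^bsub>V UNIV\<^esub> V_map UNIV (\<alpha> g) y \<otimes>\<^bsub>V UNIV\<^esub> z"
proof -
  interpret V1: comm_monoid "V (UNIV :: 'a set)" by (rule comm_monoid_V[OF U])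
  have "\<exists>z\<in>VU. act g x \<otimes>\<^bsub>V UNIV\<^esub> y \<otimes>\<^bsub>V UNIV\<^esub> z = x \<otimes>\<^bsub>V UNIV\<^esub> act g y \<otimes>\<^bsub>V UNIV\<^esub> z" if g: "g \<in> carrier G" for g
    using fixed[OF g] K0_act[OF g x y] K0_diff_eq_iff[OF U u act_closed[OF g x] act_closed[OF g y] x y] by simp
  then have "\<exists>z. \<forall>g\<in>carrier G. z g \<in> VU \<and> act g x \<otimes>\<^bsub>V UNIV\<^esub> y \<otimes>\<^bsub>V UNIV\<^esub> z g = x \<otimes>\<^bsub>V UNIV\<^esub> act g y \<otimes>\<^bsub>V UNIV\<^esub> z g"
    by (intro bchoice) blast
  then obtain z where z: "\<And>g. g \<in> carrier G \<Longrightarrow> z g \<in> VU"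
    "\<And>g. g \<in> carrier G \<Longrightarrow> act g x \<otimes>\<^bsub>V UNIV\<^esub> y \<otimes>\<^bsub>V UNIV\<^esub> z g = x \<otimes>\<^bsub>V UNIV\<^esub> act g y \<otimes>\<^bsub>V UNIV\<^esub> z g"
    by blast
  define s where "s = (\<Otimes>\<^bsub>V UNIV\<^esub>g\<in>carrier G. z g)"
  have s: "s \<in> VU" unfolding s_def by (rule V1.finprod_closed) (auto intro: z)
  obtain w where w: "w \<in> VU" "orbit_sum s = act \<one> s \<otimes>\<^bsub>V UNIV\<^esub> w" by (rule orbit_sum_split[OF s one_closed])
  have ow: "orbit_sum s = s \<otimes>\<^bsub>V UNIV\<^esub> w" using w(2) by (simp add: act_one_V s)
  show thesis
  proof (rule that[OF orbit_sum_closed[OF s]]; rule ballI)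
    fix g assume g: "g \<in> carrier G"
    show "act g (orbit_sum s) = orbit_sum s" by (rule act_orbit_sum[OF s g])
  next
    fix g assume g: "g \<in> carrier G"
    define t where "t = (\<Otimes>\<^bsub>V UNIV\<^esub>h\<in>carrier G - {g}. z h)"
    have t: "t \<in> VU" unfolding t_def by (rule V1.finprod_closed) (auto intro: z)
    have "s = (\<Otimes>\<^bsub>V UNIV\<^esub>h\<in>insert g (carrier G - {g}). z h)" using g by (simp add: s_def insert_absorb)
    also have "\<dots> = z g \<otimes>\<^bsub>V UNIV\<^esub> t"
      unfolding t_def using finite_carrier g by (intro V1.finprod_insert) (auto intro: z)
    finally have "s = z g \<otimes>\<^bsub>V UNIV\<^esub> t" .
    then have os: "orbit_sum s = z g \<otimes>\<^bsub>V UNIV\<^esub> t \<otimes>\<^bsub>V UNIV\<^esub> w" unfolding ow by (rule arg_cong)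
    note c = x y w(1) t z(1)[OF g] act_closed[OF g x] act_closed[OF g y]
    have "act g x \<otimes>\<^bsub>V UNIV\<^esub> y \<otimes>\<^bsub>V UNIV\<^esub> orbit_sum s = (act g x \<otimes>\<^bsub>V UNIV\<^esub> y \<otimes>\<^bsub>V UNIV\<^esub> z g) \<otimes>\<^bsub>V UNIV\<^esub> (t \<otimes>\<^bsub>V UNIV\<^esub> w)"
      unfolding os using c by (simp add: V1.m_assoc)
    also have "\<dots> = x \<otimes>\<^bsub>V UNIV\<^esub> act g y \<otimes>\<^bsub>V UNIV\<^esub> orbit_sum s"
      unfolding z(2)[OF g] unfolding os using c by (simp add: V1.m_assoc)
    finally show "act g x \<otimes>\<^bsub>V UNIV\<^esub> y \<otimes>\<^bsub>V UNIV\<^esub> orbit_sum s = x \<otimes>\<^bsub>V UNIV\<^esub> act g y \<otimes>\<^bsub>V UNIV\<^esub> orbit_sum s" .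
  qed
qed

text \<open>The class \<open>x - y\<close> is rewritten as \<open>q - r\<close> with fixed \<open>q\<close> and \<open>r\<close>, by adding the translates of \<open>y\<close> to both terms.\<close>

lemma fixed_K0_in_image:
  assumes X: "X \<in> carrier (K0 UNIV)" and fixed: "\<And>g. g \<in> carrier G \<Longrightarrow> K0_map UNIV (\<alpha> g) X = X"
  shows "X \<in> K0_map UNIV (\<lambda>a. a) ` carrier (K0 fixed_points)"
proof -
  interpret V1: comm_monoid "V (UNIV :: 'a set)" by (rule comm_monoid_V[OF U])
  obtain x y where x: "x \<in> VU" and y: "y \<in> VU" and Xxy: "X = K0_diff UNIV x y"
    by (rule K0_UNIV_cases[OF X])
  obtain z where z: "z \<in> VU" "\<forall>g\<in>carrier G. act g z = z"
    and swap: "\<forall>g\<in>carrier G. act g x \<otimes>\<^bsub>V UNIV\<^esub> y \<otimes>\<^bsub>V UNIV\<^esub> z = x \<otimes>\<^bsub>V UNIV\<^esub> act g y \<otimes>\<^bsub>V UNIV\<^esub> z"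
    by (rule fixed_K0_common_summand[OF x y fixed[unfolded Xxy]])
  let ?n = "orbit_sum y"
  have n: "?n \<in> VU" by (rule orbit_sum_closed[OF y])
  obtain w where w: "w \<in> VU" "?n = y \<otimes>\<^bsub>V UNIV\<^esub> w"
    using orbit_sum_split[OF y one_closed] act_one_V[OF y] by metis
  \<comment> \<open>\<open>x - y = (x + w + z) - (n + z)\<close> for \<open>n = y + w\<close>.  Adding \<open>2n\<close> makes the first term fixed: \<open>2n\<close> contains both
    \<open>y\<close> and \<open>\<alpha>\<^sub>g (y)\<close>, which is what the exchange of \<open>\<alpha>\<^sub>g (x)\<close> for \<open>x\<close> takes.\<close>
  define q where "q = x \<otimes>\<^bsub>V UNIV\<^esub> w \<otimes>\<^bsub>V UNIV\<^esub> z \<otimes>\<^bsub>V UNIV\<^esub> ?n \<otimes>\<^bsub>V UNIV\<^esub> ?n"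
  define r where "r = ?n \<otimes>\<^bsub>V UNIV\<^esub> z \<otimes>\<^bsub>V UNIV\<^esub> ?n \<otimes>\<^bsub>V UNIV\<^esub> ?n"
  have q: "q \<in> VU" and r: "r \<in> VU" using x w(1) z(1) n by (simp_all add: q_def r_def)
  have fixq: "act g q = q" if g: "g \<in> carrier G" for g
  proof -
    obtain t where t: "t \<in> VU" "?n = act g y \<otimes>\<^bsub>V UNIV\<^esub> t" by (rule orbit_sum_split[OF y g])
    note a = act_closed[OF g x] act_closed[OF g y] act_closed[OF g w(1)]
    have nw: "act g y \<otimes>\<^bsub>V UNIV\<^esub> act g w = ?n"
      using act_orbit_sum[OF y g] act_V_mult[OF g y w(1)] by (simp add: w(2))
    have "act g q = act g x \<otimes>\<^bsub>V UNIV\<^esub> act g w \<otimes>\<^bsub>V UNIV\<^esub> z \<otimes>\<^bsub>V UNIV\<^esub> ?n \<otimes>\<^bsub>V UNIV\<^esub> ?n"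
      unfolding q_def using x w(1) z n by (simp add: act_V_mult g act_orbit_sum y)
    also have "\<dots> = act g x \<otimes>\<^bsub>V UNIV\<^esub> act g w \<otimes>\<^bsub>V UNIV\<^esub> z \<otimes>\<^bsub>V UNIV\<^esub> (y \<otimes>\<^bsub>V UNIV\<^esub> w) \<otimes>\<^bsub>V UNIV\<^esub> (act g y \<otimes>\<^bsub>V UNIV\<^esub> t)"
      by (simp only: w(2)[symmetric] t(2)[symmetric])
    also have "\<dots> = (act g x \<otimes>\<^bsub>V UNIV\<^esub> y \<otimes>\<^bsub>V UNIV\<^esub> z) \<otimes>\<^bsub>V UNIV\<^esub> (act g y \<otimes>\<^bsub>V UNIV\<^esub> act g w) \<otimes>\<^bsub>V UNIV\<^esub> (w \<otimes>\<^bsub>V UNIV\<^esub> t)"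
      using a x y w(1) z(1) t(1) by (simp add: V1.m_ac)
    also have "\<dots> = (x \<otimes>\<^bsub>V UNIV\<^esub> act g y \<otimes>\<^bsub>V UNIV\<^esub> z) \<otimes>\<^bsub>V UNIV\<^esub> ?n \<otimes>\<^bsub>V UNIV\<^esub> (w \<otimes>\<^bsub>V UNIV\<^esub> t)"
      by (simp only: bspec[OF swap g] nw)
    also have "\<dots> = x \<otimes>\<^bsub>V UNIV\<^esub> w \<otimes>\<^bsub>V UNIV\<^esub> z \<otimes>\<^bsub>V UNIV\<^esub> ?n \<otimes>\<^bsub>V UNIV\<^esub> (act g y \<otimes>\<^bsub>V UNIV\<^esub> t)"
      using a x y w(1) z(1) t(1) n by (simp add: V1.m_ac)
    also have "\<dots> = q" by (simp only: q_def t(2)[symmetric])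
    finally show ?thesis .
  qed
  have fixr: "act g r = r" if g: "g \<in> carrier G" for g
    unfolding r_def using z n by (simp add: act_V_mult g act_orbit_sum y)
  obtain q' where q': "q' \<in> VS" "incl q' = q" by (rule fixed_class_in_image[OF q fixq])
  obtain r' where r': "r' \<in> VS" "incl r' = r" by (rule fixed_class_in_image[OF r fixr])
  have "X = K0_diff UNIV q r"
    unfolding Xxy
  proof (subst K0_diff_eq_iff[OF U u x y q r], rule bexI)
    have "x \<otimes>\<^bsub>V UNIV\<^esub> (?n \<otimes>\<^bsub>V UNIV\<^esub> z \<otimes>\<^bsub>V UNIV\<^esub> ?n \<otimes>\<^bsub>V UNIV\<^esub> ?n) =
      x \<otimes>\<^bsub>V UNIV\<^esub> ((y \<otimes>\<^bsub>V UNIV\<^esub> w) \<otimes>\<^bsub>V UNIV\<^esub> z \<otimes>\<^bsub>V UNIV\<^esub> ?n \<otimes>\<^bsub>V UNIV\<^esub> ?n)" by (simp only: w(2)[symmetric])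
    also have "\<dots> = q \<otimes>\<^bsub>V UNIV\<^esub> y" unfolding q_def using x y w(1) z(1) n by (simp add: V1.m_ac)
    finally show "x \<otimes>\<^bsub>V UNIV\<^esub> r \<otimes>\<^bsub>V UNIV\<^esub> \<one>\<^bsub>V UNIV\<^esub> = q \<otimes>\<^bsub>V UNIV\<^esub> y \<otimes>\<^bsub>V UNIV\<^esub> \<one>\<^bsub>V UNIV\<^esub>" by (simp only: r_def)
  qed simp
  then have "X = K0_map UNIV (\<lambda>a. a) (K0_diff fixed_points q' r')" by (simp add: K0_incl q' r')
  moreover have "K0_diff fixed_points q' r' \<in> carrier (K0 fixed_points)"
    unfolding carrier_K0[OF S v] using q'(1) r'(1) by blast
  ultimately show ?thesis by (rule image_eqI)
qed

lemma K0_orbit_sum: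
  assumes "x \<in> carrier (V UNIV)" "y \<in> carrier (V UNIV)"
  shows "(\<Otimes>\<^bsub>K0 UNIV\<^esub>g\<in>carrier G. K0_map UNIV (\<alpha> g) (K0_diff UNIV x y)) = K0_diff UNIV (orbit_sum x) (orbit_sum y)"
proof -
  interpret K: comm_monoid "K0 (UNIV :: 'a set)" by (rule comm_monoid_K0[OF U u])
  note a = act_closed[OF _ assms(1)] act_closed[OF _ assms(2)]
  have "(\<Otimes>\<^bsub>K0 UNIV\<^esub>g\<in>carrier G. K0_map UNIV (\<alpha> g) (K0_diff UNIV x y)) =
      (\<Otimes>\<^bsub>K0 UNIV\<^esub>g\<in>carrier G. K0_diff UNIV (act g x) (act g y))"
  proof (rule K.finprod_cong')
    show "(\<lambda>g. K0_diff UNIV (act g x) (act g y)) \<in> carrier G \<rightarrow> carrier (K0 UNIV)"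
      unfolding carrier_K0[OF U u] using a by blast
  qed (simp_all add: K0_act assms)
  also have "\<dots> = K0_diff UNIV (orbit_sum x) (orbit_sum y)"
    unfolding orbit_sum_def by (rule K0_finprod[OF U u finite_carrier a])
  finally show ?thesis .
qed

lemma K0_inclusion_image:
  shows "K0_map UNIV (\<lambda>a. a) ` carrier (K0 fixed_points) =
      (\<lambda>x. \<Otimes>\<^bsub>K0 UNIV\<^esub>g\<in>carrier G. K0_map UNIV (\<alpha> g) x) ` carrier (K0 UNIV)" (is "?im = ?sum ` _")
    and "K0_map UNIV (\<lambda>a. a) ` carrier (K0 fixed_points) =
      {x \<in> carrier (K0 UNIV). \<forall>g\<in>carrier G. K0_map UNIV (\<alpha> g) x = x}" (is "_ = ?fix")
proof -
  have 1: "?im \<subseteq> ?sum ` carrier (K0 UNIV)"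
  proof (rule image_subsetI)
    fix X assume "X \<in> carrier (K0 fixed_points)"
    then obtain x y where x: "x \<in> VS" and y: "y \<in> VS" and X: "X = K0_diff fixed_points x y"
      by (rule K0_fixed_cases)
    obtain x' where x': "x' \<in> VU" "incl x = orbit_sum x'" by (rule image_is_orbit_sum[OF x])
    obtain y' where y': "y' \<in> VU" "incl y = orbit_sum y'" by (rule image_is_orbit_sum[OF y])
    have "K0_map UNIV (\<lambda>a. a) X = ?sum (K0_diff UNIV x' y')"
      unfolding X K0_incl[OF x y] K0_orbit_sum[OF x'(1) y'(1)] x'(2) y'(2) by (rule refl)
    moreover have "K0_diff UNIV x' y' \<in> carrier (K0 UNIV)" unfolding carrier_K0[OF U u] using x'(1) y'(1) by blast
    ultimately show "K0_map UNIV (\<lambda>a. a) X \<in> ?sum ` carrier (K0 UNIV)" by (rule image_eqI)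
  qed
  have 2: "?sum ` carrier (K0 UNIV) \<subseteq> ?fix"
  proof (rule image_subsetI)
    fix X :: "('a unitization imat set \<times> 'a unitization imat set) set" assume "X \<in> carrier (K0 UNIV)"
    then obtain x y where x: "x \<in> VU" and y: "y \<in> VU" and X: "X = K0_diff UNIV x y"
      by (rule K0_UNIV_cases)
    note o = orbit_sum_closed[OF x] orbit_sum_closed[OF y]
    have "K0_diff UNIV (orbit_sum x) (orbit_sum y) \<in> carrier (K0 UNIV)" unfolding carrier_K0[OF U u] using o by blast
    then show "?sum X \<in> ?fix"
      unfolding X K0_orbit_sum[OF x y] by (simp add: K0_act o act_orbit_sum x y)
  qed
  have 3: "?fix \<subseteq> ?im"
  proof (rule subsetI)
    fix X assume "X \<in> ?fix"
    then show "X \<in> ?im" by (intro fixed_K0_in_image) simp_all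
  qed
  show "?im = ?sum ` carrier (K0 UNIV)" by (rule subset_antisym[OF 1 order_trans[OF 2 3]])
  show "?im = ?fix" by (rule subset_antisym[OF order_trans[OF 1 2] 3])
qed

end

end

end

end

theorem theorem4p2:
  fixes G :: "('g, 'm) monoid_scheme"
    and \<alpha> :: "'g \<Rightarrow> 'a::cstar_algebra \<Rightarrow> 'a"
    and A :: "'a set" and A\<^sub>\<alpha> :: "'a set" and \<iota> :: "'a \<Rightarrow> 'a"
  assumes A: "A = UNIV"
    and group: "group G" and fin: "finite (carrier G)"
    and action: "\<alpha> \<in> hom G cstar_Aut"
    and stably_finite: "stably_finite A"
    and rokhlin: "rokhlin_property G \<alpha>"
    and A\<^sub>\<alpha>: "A\<^sub>\<alpha> = fixed_point_algebra G \<alpha>"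
    and \<iota>: "\<iota> = (\<lambda>a. a)"
  shows
    "(order_embedding (V A\<^sub>\<alpha>) (V A) (V_map A \<iota>) \<and>
      V_map A \<iota> ` carrier (V A\<^sub>\<alpha>) =
        (\<lambda>x. \<Otimes>\<^bsub>V A\<^esub>g\<in>carrier G. V_map A (\<alpha> g) x) ` carrier (V A) \<and>
      V_map A \<iota> ` carrier (V A\<^sub>\<alpha>) =
        {x \<in> carrier (V A). \<forall>g\<in>carrier G. V_map A (\<alpha> g) x = x}) \<and>
     (has_approximate_identity_of_projections TYPE('a) \<longrightarrow>
      order_embedding (K0 A\<^sub>\<alpha>) (K0 A) (K0_map A \<iota>) \<and>
      K0_map A \<iota> ` carrier (K0 A\<^sub>\<alpha>) =
        (\<lambda>x. \<Otimes>\<^bsub>K0 A\<^esub>g\<in>carrier G. K0_map A (\<alpha> g) x) ` carrier (K0 A) \<and>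
      K0_map A \<iota> ` carrier (K0 A\<^sub>\<alpha>) =
        {x \<in> carrier (K0 A). \<forall>g\<in>carrier G. K0_map A (\<alpha> g) x = x})"
proof -
  interpret finite_action G \<alpha>
    by (intro finite_action.intro finite_action_axioms.intro group fin action)
  have orbit: "(\<lambda>x. \<Otimes>\<^bsub>V UNIV\<^esub>g\<in>carrier G. V_map UNIV (\<alpha> g) x) = orbit_sum"
    by (rule ext) (simp add: orbit_sum_def)
  show ?thesis
    unfolding A A\<^sub>\<alpha> \<iota> orbit
  proof (intro conjI impI)
    show "order_embedding (V fixed_points) (V UNIV) (V_map UNIV (\<lambda>a. a))"
      by (rule V_inclusion_order_embedding[OF rokhlin])
    show "V_map UNIV (\<lambda>a. a) ` carrier (V fixed_points) = orbit_sum ` carrier (V UNIV)"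
      by (rule V_inclusion_image(1)[OF rokhlin])
    show "V_map UNIV (\<lambda>a. a) ` carrier (V fixed_points) =
        {x \<in> carrier (V UNIV). \<forall>g\<in>carrier G. V_map UNIV (\<alpha> g) x = x}"
      by (rule V_inclusion_image(2)[OF rokhlin])
    assume "has_approximate_identity_of_projections TYPE('a)"
    then obtain E u F v where uv: "projection_unit E (UNIV :: 'a set) (u :: 'a \<Rightarrow> 'a)"
        "projection_unit F fixed_points (v :: 'a \<Rightarrow> 'a)"
      by (rule projection_units_exist[OF rokhlin])
    show "order_embedding (K0 fixed_points) (K0 UNIV) (K0_map UNIV (\<lambda>a. a))"
      by (rule K0_inclusion_order_embedding[OF rokhlin uv])
    show "K0_map UNIV (\<lambda>a. a) ` carrier (K0 fixed_points) =
        (\<lambda>x. \<Otimes>\<^bsub>K0 UNIV\<^esub>g\<in>carrier G. K0_map UNIV (\<alpha> g) x) ` carrier (K0 UNIV)"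
      by (rule K0_inclusion_image(1)[OF rokhlin uv])
    show "K0_map UNIV (\<lambda>a. a) ` carrier (K0 fixed_points) =
        {x \<in> carrier (K0 UNIV). \<forall>g\<in>carrier G. K0_map UNIV (\<alpha> g) x = x}"
      by (rule K0_inclusion_image(2)[OF rokhlin uv])
  qed
qed

end
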